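(* Let $T$ be an interval exchange transformation on an alphabet $\mathcal{A}$ with $d$ letters, with irreducible combinatorial data and without connections, which belongs to the class $DC(\eta,\theta,\sigma)$ for some parameters $\eta\geq 0$, $\theta>0$, $\sigma>0$ with $$\left(4d+\frac{d(d-1)}{\sigma}\right)\eta<\theta .$$ Let $r\geq 1$ be an integer. Then there are bounded linear operators $$L_1(r):C^{r+BV}_{\partial}(\sqcup_{\alpha\in\mathcal{A}} I^t_{\alpha}(T))\to\Gamma_{\partial}(r)/\Gamma_T(r),\qquad L_0(r):C^{r+BV}_{\partial}(\sqcup_{\alpha\in\mathcal{A}} I^t_{\alpha}(T))\to C^{r-1}(\overline{I(T)}),$$ such that $L_1(r)$ extends the canonical projection $\Gamma_{\partial}(r)\to\Gamma_{\partial}(r)/\Gamma_T(r)$ and, for every $\varphi\in C^{r+BV}_{\partial}(\sqcup_{\alpha\in\mathcal{A}} I^t_{\alpha}(T))$, $$\varphi = L_1(r)(\varphi)+ L_0(r)(\varphi)\circ T - L_0(r)(\varphi),$$ meaning that the function $\varphi-\left(L_0(r)(\varphi)\circ T-L_0(r)(\varphi)\right)$ belongs to $\Gamma_\partial(r)$ and its class modulo $\Gamma_T(r)$ is $L_1(r)(\varphi)$.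
   Context: **Interval exchange transformations (i.e.t.).** Let $\mathcal{A}$ be an alphabet with $d\geq 2$ letters. An i.e.t. $T$ on a bounded open interval $I(T)=(u_0(T),u_d(T))$ is given by two partitions (mod finitely many points) $I(T)=\sqcup_\alpha I^t_\alpha(T)=\sqcup_\alpha I^b_\alpha(T)$ into open subintervals with $|I^t_\alpha(T)|=|I^b_\alpha(T)|=:\lambda_\alpha(T)$; $T$ maps each $I^t_\alpha(T)$ onto $I^b_\alpha(T)$ by a translation. The points $u_1(T)<\dots<u_{d-1}(T)$ separating the $I^t_\alpha(T)$ are the singularities of $T$; the points $v_1(T)<\dots<v_{d-1}(T)$ separating the $I^b_\alpha(T)$ are those of $T^{-1}$. The combinatorial data is the pair of bijections $\pi=(\pi_t,\pi_b)$ from $\mathcal{A}$ to $\{1,\dots,d\}$ giving the left-to-right positions of the $I^t_\alpha(T)$ and of the $I^b_\alpha(T)$; it is irreducible if $\pi_t^{-1}(\{1,\dots,k\})\neq\pi_b^{-1}(\{1,\dots,k\})$ for all $0<k<d$. A connection is a triple $(u_k(T),v_l(T),m)$, $0<k,l<d$, $m\geq 0$, with $T^m(v_l(T))=u_k(T)$. **Rauzy–Veech algorithm and matrices $B(m,n)$.** If $u_{d-1}(T)\neq v_{d-1}(T)$, let $\widehat T$ be the first return map of $T$ to $(u_0(T),\max\{u_{d-1}(T),v_{d-1}(T)\})$. Let $\alpha_t,\alpha_b$ be the letters with $\pi_t(\alpha_t)=d=\pi_b(\alpha_b)$. $\widehat T$ is an i.e.t. on $\mathcal{A}$ labelled as follows.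 If $u_{d-1}>v_{d-1}$, then $\widehat\lambda_{\alpha_b}=\lambda_{\alpha_b}-\lambda_{\alpha_t}$, the other lengths and the bottom order are unchanged, and in the top order $\alpha_t$ is moved immediately to the right of $\alpha_b$; the associated matrix is $\mathrm{Id}+E_{\alpha_t\alpha_b}$. If $u_{d-1}<v_{d-1}$, then $\widehat\lambda_{\alpha_t}=\lambda_{\alpha_t}-\lambda_{\alpha_b}$, the other lengths and the top order are unchanged, and in the bottom order $\alpha_b$ is moved immediately to the right of $\alpha_t$; the associated matrix is $\mathrm{Id}+E_{\alpha_b\alpha_t}$. Here $(E_{\alpha\beta})_{ab}=\delta_{\alpha a}\delta_{\beta b}$. For $T=T(0)$ without connections the algorithm can be iterated indefinitely, giving i.e.t.'s $T(n)$ on intervals $I(n)$; $B(m,m+1)$ is the matrix of the step $T(m)\mapsto T(m+1)$, $B(m,m)=\mathrm{Id}$ and $B(m,p)=B(n,p)B(m,n)$ for $m\leq n\leq p$. Put $n_0=0$ and let $n_{k+1}$ be the smallest integer such that all entries of $B(n_k,n_{k+1})$ are positive. $\|\cdot\|$ denotes a fixed norm on matrices/operators, e.g. the sum of absolute values of entries. **Piecewise constant functions.** $\Gamma(T)\simeq\mathbb{R}^{\mathcal{A}}$ is the space of functions constant on each $I^t_\alpha(T)$; $\Gamma_0(T)\subset\Gamma(T)$ is the hyperplane of functions with zero integral over $I(T)$. $B(m,n)$ acts as a linear map $\Gamma(T(m))\to\Gamma(T(n))$. **The class $DC(\eta,\theta,\sigma)$** ($\eta\geq0$, $\theta,\sigma>0$).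 For $p\geq 0$ let $\Gamma_s(T(n_p))$ be the subspace of $\chi\in\Gamma(T(n_p))$ such that $\|B(n_p,n_q)\chi\|=O(\|B(n_p,n_q)\|^{-\sigma})$ for all $q\geq p$. For $k\leq l$, $B(n_k,n_l)$ induces operators $B_s(n_k,n_l):\Gamma_s(T(n_k))\to\Gamma_s(T(n_l))$ and $B_\flat(n_k,n_l):\Gamma(T(n_k))/\Gamma_s(T(n_k))\to\Gamma(T(n_l))/\Gamma_s(T(n_l))$. An i.e.t. $T$ without connections is in $DC(\eta,\theta,\sigma)$ if: (a) for all $\varepsilon>0$, $\|B(n_k,n_{k+1})\|=O_\varepsilon(\|B(0,n_k)\|^{\eta+\varepsilon})$; (b) $\|B(0,n_k)|_{\Gamma_0(T)}\|=O(\|B(0,n_k)\|^{1-\theta})$; (c) for all $\varepsilon>0$, $\|B_s(n_k,n_l)\|=O_\varepsilon(\|B(0,n_l)\|^\varepsilon)$ and $\|B_\flat(n_k,n_l)^{-1}\|=O_\varepsilon(\|B(0,n_l)\|^\varepsilon)$, uniformly in $k\leq l$; (d) if $\mu:=\dim\Gamma_s(T)<g$, then $\limsup_{n\to\infty}\|B(0,n)v\|>0$ for all $v\in\Gamma(T)\setminus\Gamma_s(T)$. Here $2g$ is the rank of the antisymmetric matrix $\Omega$ with $\Omega_{\alpha\beta}=1$ if $\pi_t(\alpha)<\pi_t(\beta)$ and $\pi_b(\alpha)>\pi_b(\beta)$, $\Omega_{\alpha\beta}=-1$ if $\pi_t(\alpha)>\pi_t(\beta)$ and $\pi_b(\alpha)<\pi_b(\beta)$,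 and $\Omega_{\alpha\beta}=0$ otherwise. **Function spaces.** $C^r(\sqcup_\alpha I^t_\alpha(T))=\prod_\alpha C^r(\overline{I^t_\alpha(T)})$, and $C^{r+BV}(\sqcup_\alpha I^t_\alpha(T))$ is the subspace of those $\varphi$ such that $D^r\varphi$ has bounded variation (on each $I^t_\alpha(T)$), with its natural norm (sup norms of derivatives of order $\leq r$ plus the total variation of $D^r\varphi$). **Boundary operator.** Define a permutation $\tau$ of $\mathcal{A}\times\{L,R\}$: $\tau(\alpha,R)=(\beta,L)$ with $\pi_t(\beta)=\pi_t(\alpha)+1$ if $\pi_t(\alpha)\neq d$, and $\tau(\alpha,R)=(\alpha_b,R)$ if $\pi_t(\alpha)=d$, where $\pi_b(\alpha_b)=d$; $\tau(\alpha,L)=(\beta,R)$ with $\pi_b(\beta)=\pi_b(\alpha)-1$ if $\pi_b(\alpha)\neq1$, and $\tau(\alpha,L)=({}_t\alpha,L)$ if $\pi_b(\alpha)=1$, where $\pi_t({}_t\alpha)=1$. Let $\Sigma$ be the set of cycles of $\tau$. For $\varphi\in C^0(\sqcup_\alpha I^t_\alpha(T))$ define $\partial\varphi\in\mathbb{R}^\Sigma$ by $(\partial\varphi)_C=\sum_{c\in C}\varepsilon(c)\varphi(c)$, with $\varepsilon(\alpha,L)=-1$, $\varepsilon(\alpha,R)=1$, and $\varphi(\alpha,L)$ (resp. $\varphi(\alpha,R)$) the limit of $\varphi$ at the left (resp. right) endpoint of $I^t_\alpha(T)$. Set $C^{r+BV}_\partial(\sqcup_\alpha I^t_\alpha(T))=\{\varphi\in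 C^{r+BV}(\sqcup_\alpha I^t_\alpha(T)):\partial D^i\varphi=0,\ 0\leq i<r\}$. **Spaces of piecewise polynomials.** $\Gamma(r)$ is the space of $\chi\in C^\infty(\sqcup_\alpha I^t_\alpha(T))$ whose restriction to each $I^t_\alpha(T)$ is a polynomial of degree $<r$; $\Gamma_\partial(r)=\{\chi\in\Gamma(r):\partial D^i\chi=0,\ 0\leq i<r\}$; $\Gamma_T(r)$ is the subspace of $\chi\in\Gamma(r)$ of the form $\chi=\psi\circ T-\psi$ with $\psi\in C^{r-1}(\overline{I(T)})$. *)

theory Defs
  imports "HOL-Analysis.Analysis" "HOL-Combinatorics.Orbits"
    "HOL-Library.Landau_Symbols" "HOL-Library.Function_Algebras" "HOL-Library.Set_Algebras"
begin

section \<open>Linear maps, quotients and norms on subspaces\<close>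

(* Sums of functions are the pointwise ones of Function_Algebras, and v +o S and C + D are the
   coset and the elementwise sum of Set_Algebras.  The scalings are passed explicitly. *)

definition quot_space :: "'v::plus set \<Rightarrow> 'v set \<Rightarrow> 'v set set" where
  "quot_space V S = (\<lambda>v. v +o S) ` V"

(* adding S makes this correct for c = 0 as well *)
definition quot_scale :: "(real \<Rightarrow> 'v \<Rightarrow> 'v) \<Rightarrow> 'v::plus set \<Rightarrow> real \<Rightarrow> 'v set \<Rightarrow> 'v set" where
  "quot_scale sc S c C = sc c ` C + S"

definition quot_norm :: "('v \<Rightarrow> real) \<Rightarrow> 'v set \<Rightarrow> real" where
  "quot_norm N C = (INF v\<in>C. N v)"

(* induced map on cosets modulo S', for F linear with F ` S \<subseteq> S' *)
definition quot_map :: "'w::plus set \<Rightarrow> ('v \<Rightarrow> 'w) \<Rightarrow> 'v set \<Rightarrow> 'w set" where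
  "quot_map S' F C = F ` C + S'"

definition op_norm :: "'v set \<Rightarrow> ('v \<Rightarrow> real) \<Rightarrow> ('w \<Rightarrow> real) \<Rightarrow> ('v \<Rightarrow> 'w) \<Rightarrow> real" where
  "op_norm V nV nW F = (SUP v\<in>{v \<in> V. nV v \<le> 1}. nW (F v))"

definition bounded_linear_op ::
    "'v::plus set \<Rightarrow> (real \<Rightarrow> 'v \<Rightarrow> 'v) \<Rightarrow> ('v \<Rightarrow> real) \<Rightarrow>
     'w::plus set \<Rightarrow> (real \<Rightarrow> 'w \<Rightarrow> 'w) \<Rightarrow> ('w \<Rightarrow> real) \<Rightarrow> ('v \<Rightarrow> 'w) \<Rightarrow> bool" where
  "bounded_linear_op V sV nV W sW nW F \<longleftrightarrow>
     F \<in> V \<rightarrow> W \<and>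
     (\<forall>v\<in>V. \<forall>w\<in>V. F (v + w) = F v + F w) \<and>
     (\<forall>c. \<forall>v\<in>V. F (sV c v) = sW c (F v)) \<and>
     (\<exists>K. \<forall>v\<in>V. nW (F v) \<le> K * nV v)"


section \<open>Interval exchange transformations\<close>

(* The alphabet is the finite type 'a.  An i.e.t. is determined by the left endpoint u_0 of its
   interval, the positions pi_t, pi_b and the lengths lambda. *)
record 'a iet =
  iet_left :: real
  iet_top :: "'a \<Rightarrow> nat"
  iet_bot :: "'a \<Rightarrow> nat"
  iet_len :: "'a \<Rightarrow> real"

definition is_iet :: "'a::finite iet \<Rightarrow> bool" where
  "is_iet T \<longleftrightarrow>
     bij_betw (iet_top T) UNIV {1..CARD('a)} \<and>
     bij_betw (iet_bot T) UNIV {1..CARD('a)} \<and>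
     (\<forall>a. iet_len T a > 0)"

definition iet_irreducible :: "'a::finite iet \<Rightarrow> bool" where
  "iet_irreducible T \<longleftrightarrow>
     (\<forall>k. 0 < k \<and> k < CARD('a) \<longrightarrow> iet_top T -` {1..k} \<noteq> iet_bot T -` {1..k})"

(* the points u_0 < ... < u_d and v_0 < ... < v_d (u_0 = v_0 and u_d = v_d) *)
definition top_pt :: "'a::finite iet \<Rightarrow> nat \<Rightarrow> real" where
  "top_pt T k = iet_left T + (\<Sum>a | iet_top T a \<le> k. iet_len T a)"

definition bot_pt :: "'a::finite iet \<Rightarrow> nat \<Rightarrow> real" where
  "bot_pt T k = iet_left T + (\<Sum>a | iet_bot T a \<le> k. iet_len T a)"

definition iet_int :: "'a::finite iet \<Rightarrow> real set" where
  "iet_int T = {top_pt T 0 <..< top_pt T CARD('a)}"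

definition top_int :: "'a::finite iet \<Rightarrow> 'a \<Rightarrow> real set" where
  "top_int T a = {top_pt T (iet_top T a - 1) <..< top_pt T (iet_top T a)}"

(* the translation carrying I^t_a onto I^b_a *)
definition iet_shift :: "'a::finite iet \<Rightarrow> 'a \<Rightarrow> real" where
  "iet_shift T a = bot_pt T (iet_bot T a - 1) - top_pt T (iet_top T a - 1)"

(* only meaningful on the union of the open intervals top_int T a *)
definition iet_map :: "'a::finite iet \<Rightarrow> real \<Rightarrow> real" where
  "iet_map T x = x + iet_shift T (THE a. x \<in> top_int T a)"

definition iet_connection :: "'a::finite iet \<Rightarrow> nat \<Rightarrow> nat \<Rightarrow> nat \<Rightarrow> bool" where
  "iet_connection T k l m \<longleftrightarrow>
     0 < k \<and> k < CARD('a) \<and> 0 < l \<and> l < CARD('a) \<and>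
     (\<forall>j<m. (iet_map T ^^ j) (bot_pt T l) \<in> (\<Union>a. top_int T a)) \<and>
     (iet_map T ^^ m) (bot_pt T l) = top_pt T k"

definition no_connections :: "'a::finite iet \<Rightarrow> bool" where
  "no_connections T \<longleftrightarrow> \<not> (\<exists>k l m. iet_connection T k l m)"


section \<open>The Rauzy--Veech algorithm\<close>

definition last_top :: "'a::finite iet \<Rightarrow> 'a" where
  "last_top T = inv (iet_top T) CARD('a)"

definition last_bot :: "'a::finite iet \<Rightarrow> 'a" where
  "last_bot T = inv (iet_bot T) CARD('a)"

(* new positions after moving letter a immediately to the right of letter b,
   when a is the last letter of the order p *)
definition move_last_after :: "'a \<Rightarrow> 'a \<Rightarrow> ('a \<Rightarrow> nat) \<Rightarrow> 'a \<Rightarrow> nat" where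
  "move_last_after a b p c =
     (if c = a then p b + 1 else if p c \<le> p b then p c else p c + 1)"

(* The first return map to (u_0, max u_(d-1) v_(d-1)) with its labelling.  The step is undefined
   if u_(d-1) = v_(d-1), a connection; T and the identity matrix are dummy values there. *)
definition rv_step :: "'a::finite iet \<Rightarrow> 'a iet" where
  "rv_step T =
     (let \<alpha> = last_top T; \<beta> = last_bot T;
          u = top_pt T (CARD('a) - 1); v = bot_pt T (CARD('a) - 1) in
      if u > v then
        T\<lparr>iet_top := move_last_after \<alpha> \<beta> (iet_top T),
          iet_len := (iet_len T)(\<beta> := iet_len T \<beta> - iet_len T \<alpha>)\<rparr>
      else if u < v then
        T\<lparr>iet_bot := move_last_after \<beta> \<alpha> (iet_bot T),
          iet_len := (iet_len T)(\<alpha> := iet_len T \<alpha> - iet_len T \<beta>)\<rparr>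
      else T)"

definition elem_mat :: "'a::finite \<Rightarrow> 'a \<Rightarrow> real^'a^'a" where
  "elem_mat a b = (\<chi> i j. if i = a \<and> j = b then 1 else 0)"

definition rv_mat :: "'a::finite iet \<Rightarrow> real^'a^'a" where
  "rv_mat T =
     (let \<alpha> = last_top T; \<beta> = last_bot T;
          u = top_pt T (CARD('a) - 1); v = bot_pt T (CARD('a) - 1) in
      if u > v then mat 1 + elem_mat \<alpha> \<beta>
      else if u < v then mat 1 + elem_mat \<beta> \<alpha>
      else mat 1)"

definition rv_iter :: "'a::finite iet \<Rightarrow> nat \<Rightarrow> 'a iet" where
  "rv_iter T n = (rv_step ^^ n) T"

(* B(m,n), meaningful for m \<le> n *)
primrec rv_B :: "'a::finite iet \<Rightarrow> nat \<Rightarrow> nat \<Rightarrow> real^'a^'a" where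
  "rv_B T m 0 = mat 1"
| "rv_B T m (Suc n) = (if m \<le> n then rv_mat (rv_iter T n) ** rv_B T m n else mat 1)"

primrec rv_time :: "'a::finite iet \<Rightarrow> nat \<Rightarrow> nat" where
  "rv_time T 0 = 0"
| "rv_time T (Suc k) =
     (LEAST n. rv_time T k \<le> n \<and> (\<forall>a b. rv_B T (rv_time T k) n $ a $ b > 0))"

(* B(n_k, n_l) *)
definition acc_B :: "'a::finite iet \<Rightarrow> nat \<Rightarrow> nat \<Rightarrow> real^'a^'a" where
  "acc_B T k l = rv_B T (rv_time T k) (rv_time T l)"

definition mat_norm :: "real^'n::finite^'m::finite \<Rightarrow> real" where
  "mat_norm A = (\<Sum>i\<in>UNIV. \<Sum>j\<in>UNIV. \<bar>A $ i $ j\<bar>)"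


section \<open>The class \<open>DC\<close>\<close>

(* The space Gamma of piecewise constant functions is identified with real^'a. *)
definition Gamma_zero :: "'a::finite iet \<Rightarrow> (real^'a) set" where
  "Gamma_zero T = {v. (\<Sum>a\<in>UNIV. iet_len T a * v $ a) = 0}"

(* Gamma_s(T(n_p)) *)
definition Gamma_s :: "'a::finite iet \<Rightarrow> real \<Rightarrow> nat \<Rightarrow> (real^'a) set" where
  "Gamma_s T \<sigma> p =
     {v. (\<lambda>q. norm (acc_B T p q *v v)) \<in> O(\<lambda>q. mat_norm (acc_B T p q) powr (-\<sigma>))}"

definition norm_B_s :: "'a::finite iet \<Rightarrow> real \<Rightarrow> nat \<Rightarrow> nat \<Rightarrow> real" where
  "norm_B_s T \<sigma> k l = op_norm (Gamma_s T \<sigma> k) norm norm ((*v) (acc_B T k l))"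

definition B_flat :: "'a::finite iet \<Rightarrow> real \<Rightarrow> nat \<Rightarrow> nat \<Rightarrow> (real^'a) set \<Rightarrow> (real^'a) set" where
  "B_flat T \<sigma> k l = quot_map (Gamma_s T \<sigma> l) ((*v) (acc_B T k l))"

definition norm_B_flat_inv :: "'a::finite iet \<Rightarrow> real \<Rightarrow> nat \<Rightarrow> nat \<Rightarrow> real" where
  "norm_B_flat_inv T \<sigma> k l =
     op_norm (quot_space UNIV (Gamma_s T \<sigma> l)) (quot_norm norm) (quot_norm norm)
       (inv_into (quot_space UNIV (Gamma_s T \<sigma> k)) (B_flat T \<sigma> k l))"

definition iet_Omega :: "'a::finite iet \<Rightarrow> real^'a^'a" where
  "iet_Omega T = (\<chi> a b.
     if iet_top T a < iet_top T b \<and> iet_bot T a > iet_bot T b then 1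
     else if iet_top T a > iet_top T b \<and> iet_bot T a < iet_bot T b then -1
     else 0)"

(* rank of the antisymmetric matrix Omega is even *)
definition iet_genus :: "'a::finite iet \<Rightarrow> nat" where
  "iet_genus T = rank (iet_Omega T) div 2"

definition in_DC :: "real \<Rightarrow> real \<Rightarrow> real \<Rightarrow> 'a::finite iet \<Rightarrow> bool" where
  "in_DC \<eta> \<theta> \<sigma> T \<longleftrightarrow>
     no_connections T \<and>
     (\<forall>\<epsilon>>0. (\<lambda>k. mat_norm (acc_B T k (Suc k)))
              \<in> O(\<lambda>k. mat_norm (acc_B T 0 k) powr (\<eta> + \<epsilon>))) \<and>
     (\<lambda>k. op_norm (Gamma_zero T) norm norm ((*v) (acc_B T 0 k)))
              \<in> O(\<lambda>k. mat_norm (acc_B T 0 k) powr (1 - \<theta>)) \<and>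
     (\<forall>\<epsilon>>0. \<exists>C. \<forall>k l. k \<le> l \<longrightarrow>
         norm_B_s T \<sigma> k l \<le> C * mat_norm (acc_B T 0 l) powr \<epsilon> \<and>
         norm_B_flat_inv T \<sigma> k l \<le> C * mat_norm (acc_B T 0 l) powr \<epsilon>) \<and>
     (dim (Gamma_s T \<sigma> 0) < iet_genus T \<longrightarrow>
         (\<forall>v. v \<notin> Gamma_s T \<sigma> 0 \<longrightarrow>
            limsup (\<lambda>n. ereal (norm (rv_B T 0 n *v v))) > 0))"


section \<open>Function spaces\<close>

(* Functions on a set S \<subseteq> real are represented by functions on the whole line vanishing off S,
   so that equality and the pointwise operations are those of the functions on S. *)

definition deriv_on :: "real set \<Rightarrow> (real \<Rightarrow> real) \<Rightarrow> real \<Rightarrow> real" where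
  "deriv_on S f x = (if x \<in> S then vector_derivative f (at x within S) else 0)"

definition C_on :: "nat \<Rightarrow> real set \<Rightarrow> (real \<Rightarrow> real) set" where
  "C_on k S = {f. (\<forall>x. x \<notin> S \<longrightarrow> f x = 0) \<and>
     (\<forall>i<k. (deriv_on S ^^ i) f differentiable_on S) \<and>
     continuous_on S ((deriv_on S ^^ k) f)}"

definition C_norm :: "nat \<Rightarrow> real set \<Rightarrow> (real \<Rightarrow> real) \<Rightarrow> real" where
  "C_norm k S f = (\<Sum>i\<le>k. SUP x\<in>S. \<bar>(deriv_on S ^^ i) f x\<bar>)"

definition variation_sums :: "(real \<Rightarrow> real) \<Rightarrow> real set \<Rightarrow> real set" where
  "variation_sums f S =
     {\<Sum>i<n. \<bar>f (t (Suc i)) - f (t i)\<bar> | t n. (\<forall>i\<le>n. t i \<in> S) \<and> (\<forall>i<n. t i \<le> t (Suc i))}"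

definition bounded_variation_on :: "(real \<Rightarrow> real) \<Rightarrow> real set \<Rightarrow> bool" where
  "bounded_variation_on f S \<longleftrightarrow> bdd_above (variation_sums f S)"

definition total_variation :: "(real \<Rightarrow> real) \<Rightarrow> real set \<Rightarrow> real" where
  "total_variation f S = Sup (variation_sums f S)"

(* An element of C^r of the disjoint union of the I^t_a is a family, indexed by the letters,
   of C^r functions on the closures of the I^t_a. *)
definition pw_D :: "'a::finite iet \<Rightarrow> ('a \<Rightarrow> real \<Rightarrow> real) \<Rightarrow> 'a \<Rightarrow> real \<Rightarrow> real" where
  "pw_D T \<phi> a = deriv_on (closure (top_int T a)) (\<phi> a)"

definition pw_C :: "'a::finite iet \<Rightarrow> nat \<Rightarrow> ('a \<Rightarrow> real \<Rightarrow> real) set" where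
  "pw_C T r = {\<phi>. \<forall>a. \<phi> a \<in> C_on r (closure (top_int T a))}"

definition pw_CBV :: "'a::finite iet \<Rightarrow> nat \<Rightarrow> ('a \<Rightarrow> real \<Rightarrow> real) set" where
  "pw_CBV T r =
     {\<phi> \<in> pw_C T r. \<forall>a. bounded_variation_on ((pw_D T ^^ r) \<phi> a) (top_int T a)}"

definition pw_CBV_norm :: "'a::finite iet \<Rightarrow> nat \<Rightarrow> ('a \<Rightarrow> real \<Rightarrow> real) \<Rightarrow> real" where
  "pw_CBV_norm T r \<phi> =
     (\<Sum>i\<le>r. SUP (a, x)\<in>(SIGMA a:UNIV. closure (top_int T a)). \<bar>(pw_D T ^^ i) \<phi> a x\<bar>) +
     (\<Sum>a\<in>UNIV. total_variation ((pw_D T ^^ r) \<phi> a) (top_int T a))"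

definition fun_scale :: "real \<Rightarrow> (real \<Rightarrow> real) \<Rightarrow> real \<Rightarrow> real" where
  "fun_scale c f x = c * f x"

definition pw_scale :: "real \<Rightarrow> ('a \<Rightarrow> real \<Rightarrow> real) \<Rightarrow> 'a \<Rightarrow> real \<Rightarrow> real" where
  "pw_scale c \<phi> a x = c * \<phi> a x"

(* psi o T - psi, where T is extended to the closure of each I^t_a as a translation *)
definition coboundary :: "'a::finite iet \<Rightarrow> (real \<Rightarrow> real) \<Rightarrow> 'a \<Rightarrow> real \<Rightarrow> real" where
  "coboundary T \<psi> a x =
     (if x \<in> closure (top_int T a) then \<psi> (x + iet_shift T a) - \<psi> x else 0)"


section \<open>The boundary operator and piecewise polynomials\<close>

datatype side = LeftEnd | RightEnd

definition iet_tau :: "'a::finite iet \<Rightarrow> 'a \<times> side \<Rightarrow> 'a \<times> side" where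
  "iet_tau T c = (case c of
     (a, RightEnd) \<Rightarrow>
       if iet_top T a \<noteq> CARD('a) then (inv (iet_top T) (iet_top T a + 1), LeftEnd)
       else (inv (iet_bot T) CARD('a), RightEnd)
   | (a, LeftEnd) \<Rightarrow>
       if iet_bot T a \<noteq> 1 then (inv (iet_bot T) (iet_bot T a - 1), RightEnd)
       else (inv (iet_top T) 1, LeftEnd))"

definition iet_cycles :: "'a::finite iet \<Rightarrow> ('a \<times> side) set set" where
  "iet_cycles T = range (orbit (iet_tau T))"

(* phi a is continuous on the closure of I^t_a, so its one-sided limit at an endpoint
   is its value there *)
definition signed_end_value :: "'a::finite iet \<Rightarrow> ('a \<Rightarrow> real \<Rightarrow> real) \<Rightarrow> 'a \<times> side \<Rightarrow> real" where
  "signed_end_value T \<phi> c = (case c of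
     (a, LeftEnd) \<Rightarrow> - \<phi> a (top_pt T (iet_top T a - 1))
   | (a, RightEnd) \<Rightarrow> \<phi> a (top_pt T (iet_top T a)))"

definition boundary ::
    "'a::finite iet \<Rightarrow> ('a \<Rightarrow> real \<Rightarrow> real) \<Rightarrow> ('a \<times> side) set \<Rightarrow> real" where
  "boundary T \<phi> C = (\<Sum>c\<in>C. signed_end_value T \<phi> c)"

definition boundary_zero_upto :: "'a::finite iet \<Rightarrow> nat \<Rightarrow> ('a \<Rightarrow> real \<Rightarrow> real) \<Rightarrow> bool" where
  "boundary_zero_upto T r \<phi> \<longleftrightarrow>
     (\<forall>i<r. \<forall>C\<in>iet_cycles T. boundary T ((pw_D T ^^ i) \<phi>) C = 0)"

definition pw_CBV_bd :: "'a::finite iet \<Rightarrow> nat \<Rightarrow> ('a \<Rightarrow> real \<Rightarrow> real) set" where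
  "pw_CBV_bd T r = {\<phi> \<in> pw_CBV T r. boundary_zero_upto T r \<phi>}"

definition Gamma_poly :: "'a::finite iet \<Rightarrow> nat \<Rightarrow> ('a \<Rightarrow> real \<Rightarrow> real) set" where
  "Gamma_poly T r =
     {\<omega>. \<forall>a. (\<forall>x. x \<notin> closure (top_int T a) \<longrightarrow> \<omega> a x = 0) \<and>
        (\<exists>p. (p = 0 \<or> degree p < r) \<and> (\<forall>x\<in>closure (top_int T a). \<omega> a x = poly p x))}"

definition Gamma_bd :: "'a::finite iet \<Rightarrow> nat \<Rightarrow> ('a \<Rightarrow> real \<Rightarrow> real) set" where
  "Gamma_bd T r = {\<omega> \<in> Gamma_poly T r. boundary_zero_upto T r \<omega>}"

definition Gamma_cob :: "'a::finite iet \<Rightarrow> nat \<Rightarrow> ('a \<Rightarrow> real \<Rightarrow> real) set" where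
  "Gamma_cob T r =
     {\<omega> \<in> Gamma_poly T r. \<exists>\<psi>\<in>C_on (r - 1) (closure (iet_int T)). \<omega> = coboundary T \<psi>}"

end

theory Submission
  imports Defs
begin

text \<open>
  Along the times \<open>n_k\<close> the special Birkhoff sums \<open>S_k \<phi>\<close> are functions on the intervals of the
  induced maps \<open>T(n_k)\<close>, and every orbit segment is a concatenation of towers.  Hence, if
  \<open>\<Sum>k. \<parallel>B(n_k, n_(k+1))\<parallel> sup |S_k \<phi>|\<close> converges, the Birkhoff sums of \<open>\<phi>\<close> over growing towers
  converge, and their limit solves \<open>\<psi> \<circ> T - \<psi> = \<phi>\<close>.  The limits from the left and from the right
  agree because a discontinuity would recur in every induced interval, where the limit is small.

  In regularity 1 the condition \<open>\<partial>\<phi> = 0\<close> gives \<open>D\<phi>\<close> zero integral, so (b) and the bounded variation of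
  \<open>D\<phi>\<close> bound its special sums, and the oscillation of \<open>S_k \<phi>\<close> on each interval decays.  The mean
  values of \<open>S_k \<phi>\<close> then satisfy the recursion of \<open>B(n_k, n_(k+1))\<close> up to a summable error; by (c) this
  error can be pulled back modulo the stable spaces, and a single vector in \<open>\<Gamma>(T)\<close> corrects \<open>\<phi>\<close> so that
  the series above converges.  An exchange of two intervals has explicit zero-mean vectors, and there
  the estimates are made for single steps of the algorithm.

  Higher regularity follows by integrating the solution for \<open>D\<phi>\<close>: the boundary operator vanishes on
  coboundaries of continuous functions, so the remaining piecewise polynomial lies in \<open>\<Gamma>_\<partial>\<close>.
\<close>

section \<open>Positions and offsets\<close>

text \<open>The scale of all estimates is \<open>N k\<close>, the sum of the entries of B(0,n_k).
  One accelerated step raises it at most to the power 1 + h, up to a constant, with h slightly above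
  \<eta>. An error made at level j is bounded at level k in two ways: by transport from level j on,
  without decay in k, or from level 0 with the full decay in k, after a pull-back that costs the
  power d - 1 of the norm because det B = 1 (Cramer). Interpolating between the two bounds makes the
  errors summable over j and keeps some decay in k. This happens twice: for zero-mean vectors with
  the exponent \<theta> of (b), and for stable vectors with \<sigma>. The hypothesis says that
  \<theta>/d, roughly the decay left by the first interpolation, exceeds (d-1)\<eta>/\<sigma>,
  roughly the cost of the second, plus 4\<eta> for the passages between consecutive levels. The
  exponents are fitted together for d \<ge> 3, where \<theta> \<le> d/(d-1) gives \<theta>/d \<le>
  1/2. Finally, the correcting vector is determined only up to vectors whose images decay, so that a
  linear choice of it needs an extra argument.\<close>

definition btw :: "bool \<Rightarrow> bool \<Rightarrow> real \<Rightarrow> real \<Rightarrow> real \<Rightarrow> bool" where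
  "btw p q l r x \<longleftrightarrow> (if p then l \<le> x else l < x) \<and> (if q then x \<le> r else x < r)"

definition offs :: "('a::finite \<Rightarrow> nat) \<Rightarrow> ('a \<Rightarrow> real) \<Rightarrow> 'a \<Rightarrow> real" where
  "offs p len a = (\<Sum>c | p c < p a. len c)"

abbreviation positions :: "('a::finite \<Rightarrow> nat) \<Rightarrow> bool" where
  "positions p \<equiv> bij_betw p UNIV {1..CARD('a)}"

lemma positions_inj: "positions p \<Longrightarrow> p a = p b \<longleftrightarrow> a = b"
  by (metis UNIV_I bij_betw_iff_bijections)

lemma positions_range: "positions (p :: 'a::finite \<Rightarrow> nat) \<Longrightarrow> 1 \<le> p a \<and> p a \<le> CARD('a)"
  using bij_betwE by fastforce

lemma positions_surj:
  assumes "positions (p :: 'a::finite \<Rightarrow> nat)" "1 \<le> k" "k \<le> CARD('a)"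
  shows "\<exists>a. p a = k"
  using assms by (metis atLeastAtMost_iff bij_betw_imp_surj_on imageE)

lemma positions_inv:
  assumes "positions (p :: 'a::finite \<Rightarrow> nat)" "1 \<le> k" "k \<le> CARD('a)"
  shows "p (inv p k) = k"
  using positions_surj[OF assms] by (metis f_inv_into_f rangeI)

lemma positionsI:
  assumes "\<And>a b. p a = p b \<Longrightarrow> a = b" "\<And>a. 1 \<le> p a \<and> p a \<le> CARD('a)"
  shows "positions (p :: 'a::finite \<Rightarrow> nat)"
proof -
  have "inj p" using assms(1) by (auto intro: injI)
  moreover have "p ` UNIV = {1..CARD('a)}"
  proof (rule card_subset_eq)
    show "p ` UNIV \<subseteq> {1..CARD('a)}" using assms(2) by auto
    show "card (p ` UNIV) = card {1..CARD('a)}" using \<open>inj p\<close> by (simp add: card_image)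
  qed auto
  ultimately show ?thesis by (simp add: bij_betw_def)
qed

lemma positions_last:
  assumes "positions (p :: 'a::finite \<Rightarrow> nat)" "p a = CARD('a)"
  shows "p x < p a \<longleftrightarrow> x \<noteq> a" "p x < CARD('a) \<longleftrightarrow> x \<noteq> a"
proof -
  show "p x < p a \<longleftrightarrow> x \<noteq> a"
    using positions_range[OF assms(1), of x] positions_inj[OF assms(1), of x a] assms(2)
    by (cases "x = a") auto
  then show "p x < CARD('a) \<longleftrightarrow> x \<noteq> a" using assms(2) by simp
qed

lemma offs_last:
  assumes "positions (p :: 'a::finite \<Rightarrow> nat)" "p a = CARD('a)"
  shows "offs p len a + len a = (\<Sum>c\<in>UNIV. len c)"
proof -
  have "{c. p c < p a} = UNIV - {a}" using positions_last[OF assms] by auto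
  then show ?thesis unfolding offs_def by (simp add: sum.remove[of UNIV a])
qed

lemma offs_next:
  assumes "positions p" "p c = Suc (p a)"
  shows "offs p len c = offs p len a + len a"
proof -
  have "{x. p x < p c} = insert a {x. p x < p a}"
    using assms positions_inj[OF assms(1)] by (auto simp: less_Suc_eq)
  then show ?thesis unfolding offs_def by simp
qed

lemma offs_first: "positions p \<Longrightarrow> p a = 1 \<Longrightarrow> offs p len a = 0"
  using positions_range[of p] unfolding offs_def by (metis (no_types, lifting) Collect_empty_eq not_less sum.empty)

lemma offs_nonneg: "(\<And>c. 0 \<le> len c) \<Longrightarrow> 0 \<le> offs p len a"
  unfolding offs_def by (simp add: sum_nonneg)

lemma offs_mono:
  assumes "\<And>c. 0 \<le> len c" "p c < p a"
  shows "offs p len c + len c \<le> offs p len a"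
proof -
  have "offs p len c + len c = sum len (insert c {x. p x < p c})"
    unfolding offs_def by simp
  also have "\<dots> \<le> sum len {x. p x < p a}"
    by (rule sum_mono2) (use assms in auto)
  finally show ?thesis by (simp add: offs_def)
qed

lemma offs_le_sum:
  assumes "\<And>c. 0 \<le> len c"
  shows "offs p len a + len a \<le> (\<Sum>c\<in>UNIV. len c)"
proof -
  have "offs p len a + len a = sum len (insert a {x. p x < p a})"
    unfolding offs_def by simp
  also have "\<dots> \<le> sum len UNIV"
    by (rule sum_mono2) (use assms in auto)
  finally show ?thesis .
qed

text \<open>The letter is the last one whose left endpoint does not lie beyond \<open>x\<close>; its
  successor starts beyond \<open>x\<close>. The flag \<open>s\<close> selects [l,r) or (l,r], since
  the right and the left continuous version of the map are both needed.\<close>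

lemma offs_cover:
  fixes p :: "'a::finite \<Rightarrow> nat"
  assumes p: "positions p" and x: "btw s (\<not> s) 0 (\<Sum>c\<in>UNIV. len c) x"
  shows "\<exists>a. btw s (\<not> s) (offs p len a) (offs p len a + len a) x"
proof -
  define A where "A = {a. if s then offs p len a \<le> x else offs p len a < x}"
  obtain a1 where a1: "p a1 = 1" using positions_surj[OF p, of 1] by (auto simp: Suc_le_eq)
  have "a1 \<in> A" using x offs_first[OF p a1] by (auto simp: A_def btw_def split: if_splits)
  then have "Max (p ` A) \<in> p ` A" by (intro Max_in) auto
  then obtain a where a: "a \<in> A" "p a = Max (p ` A)" by auto
  have a_max: "p b \<le> p a" if "b \<in> A" for b
    unfolding a(2) using that by (intro Max_ge) auto
  show ?thesis
  proof (cases "p a = CARD('a)")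
    case True
    then show ?thesis using a(1) x offs_last[OF p True, of len]
      by (intro exI[of _ a]) (auto simp: A_def btw_def split: if_splits)
  next
    case False
    then obtain c where c: "p c = Suc (p a)"
      using positions_surj[OF p, of "Suc (p a)"] positions_range[OF p, of a] by auto
    then have "c \<notin> A" using a_max by force
    then show ?thesis using a(1) offs_next[OF p c, of len]
      by (intro exI[of _ a]) (auto simp: A_def btw_def split: if_splits)
  qed
qed

lemma offs_disjoint:
  assumes "positions p" "\<And>c. 0 \<le> len c" "btw s q (offs p len a) (offs p len a + len a) x"
    "btw s q (offs p len b) (offs p len b + len b) x" "\<not> (s \<and> q)"
  shows "a = b"
proof (rule ccontr)
  assume "a \<noteq> b"
  then consider "p a < p b" | "p b < p a" using positions_inj[OF assms(1)] by (metis linorder_neqE_nat)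
  then show False
    using offs_mono[of len p a b, OF assms(2)] offs_mono[of len p b a, OF assms(2)] assms(3-5)
    by cases (auto simp: btw_def split: if_splits)
qed

lemma positions_move:
  fixes p :: "'a::finite \<Rightarrow> nat"
  assumes p: "positions p" and a: "p a = CARD('a)" and ab: "a \<noteq> b"
  shows "positions (move_last_after a b p)"
proof (rule positionsI)
  have lt: "p c < CARD('a)" if "c \<noteq> a" for c
    using that positions_last[OF p a] by simp
  show "1 \<le> move_last_after a b p c \<and> move_last_after a b p c \<le> CARD('a)" for c
    using lt[of b] lt[of c] ab positions_range[OF p, of c] by (auto simp: move_last_after_def)
  show "c = e" if "move_last_after a b p c = move_last_after a b p e" for c e
    using that positions_inj[OF p] by (auto simp: move_last_after_def split: if_splits)
qed

text \<open>Letter \<open>a\<close> moves into the right end of the interval of \<open>b\<close> and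
  takes exactly the length that \<open>b\<close> gives up, so every other left endpoint stays in
  place.\<close>

lemma offs_move:
  fixes p :: "'a::finite \<Rightarrow> nat"
  assumes p: "positions p" and a: "p a = CARD('a)" and ab: "a \<noteq> b"
  shows "offs (move_last_after a b p) (len(b := len b - len a)) c =
    (if c = a then offs p len b + len b - len a else offs p len c)"
proof -
  let ?p = "move_last_after a b p" and ?l = "len(b := len b - len a)"
  have lt: "p c < CARD('a)" if "c \<noteq> a" for c
    using that positions_last[OF p a] by simp
  show ?thesis
  proof (cases "c = a")
    case True
    have "?p x < ?p c \<longleftrightarrow> x = b \<or> p x < p b" for x
      using True lt[of x] lt[OF ab[symmetric]] ab positions_inj[OF p, of x b] a
      by (auto simp: move_last_after_def)
    then have "{x. ?p x < ?p c} = insert b {x. p x < p b}" by blast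
    moreover have "sum ?l {x. p x < p b} = sum len {x. p x < p b}" by (intro sum.cong) auto
    ultimately show ?thesis using True by (simp add: offs_def)
  next
    case False
    show ?thesis
    proof (cases "p c \<le> p b")
      case True
      have "?p x < ?p c \<longleftrightarrow> p x < p c" for x
        using False True lt[OF False] lt[OF ab[symmetric]] a by (auto simp: move_last_after_def)
      then have "{x. ?p x < ?p c} = {x. p x < p c}" by blast
      moreover have "sum ?l {x. p x < p c} = sum len {x. p x < p c}"
        by (rule sum.cong) (use True in auto)
      ultimately show ?thesis using False by (simp add: offs_def)
    next
      case nle: False
      have "?p x < ?p c \<longleftrightarrow> x = a \<or> p x < p c" for x
        using False nle lt[OF False] a by (auto simp: move_last_after_def)
      then have "{x. ?p x < ?p c} = insert a {x. p x < p c}" "a \<notin> {x. p x < p c}" "b \<in> {x. p x < p c}"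
        using nle lt[OF False] a by auto
      then have *: "offs ?p ?l c = ?l a + (\<Sum>x\<in>{x. p x < p c}. ?l x)" by (simp add: offs_def)
      have "sum ?l ({x. p x < p c} - {b}) = sum len ({x. p x < p c} - {b})"
        by (rule sum.cong) auto
      then have "(\<Sum>x\<in>{x. p x < p c}. ?l x) = (\<Sum>x\<in>{x. p x < p c}. len x) - len a"
        using \<open>b \<in> {x. p x < p c}\<close> sum.remove[of "{x. p x < p c}" b ?l] sum.remove[of "{x. p x < p c}" b len]
        by simp
      then show ?thesis using * False ab by (simp add: offs_def)
    qed
  qed
qed

text \<open>Serves for the order that the step leaves alone: there the shortened letter is the last
  one, and no offset contains its length.\<close>

lemma offs_shrink_last:
  fixes p :: "'a::finite \<Rightarrow> nat"
  assumes p: "positions p" and b: "p b = CARD('a)"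
  shows "offs p (len(b := y)) c = offs p len c"
proof -
  have "b \<notin> {x. p x < p c}" using b positions_range[OF p, of c] by auto
  then show ?thesis unfolding offs_def by (intro sum.cong) auto
qed

section \<open>Irreducibility as the absence of a common initial segment\<close>

definition no_common_initial :: "('a \<Rightarrow> nat) \<Rightarrow> ('a \<Rightarrow> nat) \<Rightarrow> bool" where
  "no_common_initial p q \<longleftrightarrow>
     (\<forall>S. (\<forall>a\<in>S. \<forall>x\<in>-S. p a < p x \<and> q a < q x) \<longrightarrow> S = {} \<or> S = UNIV)"

lemma no_common_initial_sym: "no_common_initial p q = no_common_initial q p"
  unfolding no_common_initial_def by (simp add: conj_commute)

text \<open>An initial segment of an order is determined by its cardinality; this translates between
  sets of letters and sets of positions.\<close>

lemma initial_eq: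
  fixes p :: "'a::finite \<Rightarrow> nat"
  assumes p: "positions p" and S: "\<And>a x. a \<in> S \<Longrightarrow> x \<notin> S \<Longrightarrow> p a < p x"
  shows "p -` {1..card S} = S"
proof -
  have inj: "inj p" using p by (simp add: bij_betw_def)
  have down: "k \<in> p ` S" if "a \<in> S" "1 \<le> k" "k \<le> p a" for a k
  proof -
    have "k \<le> CARD('a)" using that positions_range[OF p, of a] by simp
    then obtain c where c: "p c = k" using positions_surj[OF p \<open>1 \<le> k\<close>] by blast
    then have "c \<in> S" using S[of a c] that by force
    then show ?thesis using c by auto
  qed
  have "p ` S = {1..card S}"
  proof (cases "S = {}")
    case False
    define m where "m = Max (p ` S)"
    have "m \<in> p ` S" unfolding m_def using False by (intro Max_in) auto
    then obtain a where a: "a \<in> S" "p a = m" by auto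
    have "p ` S = {1..m}"
      using down[OF a(1)] a(2) positions_range[OF p] by (auto simp: m_def)
    moreover have "card (p ` S) = card S" using inj by (simp add: card_image inj_on_subset)
    ultimately show ?thesis by simp
  qed auto
  then show ?thesis using inj by (metis inj_vimage_image_eq)
qed

lemma no_common_initialI:
  fixes p q :: "'a::finite \<Rightarrow> nat"
  assumes p: "positions p" and q: "positions q"
    and irr: "\<And>k. 0 < k \<Longrightarrow> k < CARD('a) \<Longrightarrow> p -` {1..k} \<noteq> q -` {1..k}"
  shows "no_common_initial p q"
  unfolding no_common_initial_def
proof (intro allI impI)
  fix S :: "'a set" assume init: "\<forall>a\<in>S. \<forall>x\<in>-S. p a < p x \<and> q a < q x"
  have "p -` {1..card S} = S" by (rule initial_eq[OF p]) (use init in auto)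
  moreover have "q -` {1..card S} = S" by (rule initial_eq[OF q]) (use init in auto)
  ultimately have *: "\<not> (0 < card S \<and> card S < CARD('a))" using irr[of "card S"] by metis
  have "card S < CARD('a)" if "S \<noteq> UNIV" by (rule psubset_card_mono) (use that in auto)
  then show "S = {} \<or> S = UNIV" using * by (auto simp: card_gt_0_iff)
qed

text \<open>A proper common initial segment of the new orders cannot contain \<open>b\<close>, which
  is last for \<open>q\<close>, nor therefore \<open>a\<close>, which now follows \<open>b\<close>.
  The remaining letters keep their relative order, so the segment was already common before.\<close>

lemma no_common_initial_move:
  fixes p q :: "'a::finite \<Rightarrow> nat"
  assumes p: "positions p" and q: "positions q" and a: "p a = CARD('a)" and b: "q b = CARD('a)"
    and ab: "a \<noteq> b" and irr: "no_common_initial p q"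
  shows "no_common_initial (move_last_after a b p) q"
  unfolding no_common_initial_def
proof (intro allI impI)
  let ?p = "move_last_after a b p"
  fix S :: "'a set" assume init: "\<forall>c\<in>S. \<forall>x\<in>-S. ?p c < ?p x \<and> q c < q x"
  show "S = {} \<or> S = UNIV"
  proof (cases "S = UNIV")
    case False
    then obtain y where y: "y \<in> -S" by blast
    have bS: "b \<in> -S"
    proof (rule ccontr)
      assume "b \<notin> -S"
      then have "q b < q y" using init y by auto
      then show False using positions_range[OF q, of y] b by auto
    qed
    have aS: "a \<in> -S"
    proof (rule ccontr)
      assume "a \<notin> -S"
      then have "?p a < ?p b" using init bS by auto
      then show False using ab by (simp add: move_last_after_def)
    qed
    have "p c < p x \<and> q c < q x" if "c \<in> S" "x \<in> -S" for c x
    proof -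
      have "c \<noteq> a" using that aS by auto
      then have "p c < CARD('a)" using positions_last[OF p a] by simp
      moreover have "?p c < ?p x \<and> q c < q x" using init that by blast
      ultimately show ?thesis using a \<open>c \<noteq> a\<close> by (auto simp: move_last_after_def split: if_splits)
    qed
    then show ?thesis using irr False unfolding no_common_initial_def by blast
  qed simp
qed

section \<open>One step of the Rauzy--Veech algorithm\<close>

definition tlft :: "'a::finite iet \<Rightarrow> 'a \<Rightarrow> real" where
  "tlft T a = iet_left T + offs (iet_top T) (iet_len T) a"

definition blft :: "'a::finite iet \<Rightarrow> 'a \<Rightarrow> real" where
  "blft T a = iet_left T + offs (iet_bot T) (iet_len T) a"

definition iet_right :: "'a::finite iet \<Rightarrow> real" where
  "iet_right T = iet_left T + (\<Sum>a\<in>UNIV. iet_len T a)"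

text \<open>The winner is the longer of the two last letters, the one that is shortened; the loser
  is the one that is moved. With these names both types of step have the same matrix and the same
  length formula.\<close>

definition rv_winner :: "'a::finite iet \<Rightarrow> 'a" where
  "rv_winner T = (if iet_len T (last_top T) < iet_len T (last_bot T) then last_bot T else last_top T)"

definition rv_loser :: "'a::finite iet \<Rightarrow> 'a" where
  "rv_loser T = (if iet_len T (last_top T) < iet_len T (last_bot T) then last_top T else last_bot T)"

text \<open>Forward orbits as a relation: each step names the letter used, so that no iterate of the
  partial map \<open>iet_map T\<close> has to be controlled.\<close>

inductive iet_orb :: "'a::finite iet \<Rightarrow> real \<Rightarrow> real \<Rightarrow> bool" for T where
  refl: "iet_orb T x x"
| step: "x \<in> top_int T a \<Longrightarrow> iet_orb T (x + iet_shift T a) y \<Longrightarrow> iet_orb T x y"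

lemma iet_orb_trans: "iet_orb T x y \<Longrightarrow> iet_orb T y z \<Longrightarrow> iet_orb T x z"
  by (induction rule: iet_orb.induct) (auto intro: iet_orb.intros)

text \<open>Connections between left endpoints of letters that are not first. This form passes
  through an induction step, where indices of singularities would be renumbered.\<close>

definition iet_conn :: "'a::finite iet \<Rightarrow> bool" where
  "iet_conn T \<longleftrightarrow> (\<exists>a b. 1 < iet_top T a \<and> 1 < iet_bot T b \<and> iet_orb T (blft T b) (tlft T a))"

lemma one_le_CARD: "1 \<le> CARD('a::finite)"
  by (metis One_nat_def Suc_leI zero_less_card_finite)

context
  fixes T :: "'a::finite iet"
  assumes T: "is_iet T"
begin

lemma top_positions: "positions (iet_top T)" and bot_positions: "positions (iet_bot T)"
  and len_pos: "0 < iet_len T a"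
  using T unfolding is_iet_def by auto

lemma last_top_pos: "iet_top T (last_top T) = CARD('a)"
  unfolding last_top_def by (rule positions_inv[OF top_positions one_le_CARD order_refl])

lemma last_bot_pos: "iet_bot T (last_bot T) = CARD('a)"
  unfolding last_bot_def by (rule positions_inv[OF bot_positions one_le_CARD order_refl])

lemma top_pt_pred: "top_pt T (iet_top T a - 1) = tlft T a"
  and bot_pt_pred: "bot_pt T (iet_bot T a - 1) = blft T a"
proof -
  have "c \<le> iet_top T a - 1 \<longleftrightarrow> c < iet_top T a" for c
    using positions_range[OF top_positions, of a] by auto
  then show "top_pt T (iet_top T a - 1) = tlft T a"
    by (simp add: top_pt_def tlft_def offs_def)
  have "c \<le> iet_bot T a - 1 \<longleftrightarrow> c < iet_bot T a" for c
    using positions_range[OF bot_positions, of a] by auto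
  then show "bot_pt T (iet_bot T a - 1) = blft T a"
    by (simp add: bot_pt_def blft_def offs_def)
qed

lemma top_pt_pos: "top_pt T (iet_top T a) = tlft T a + iet_len T a"
proof -
  have "{c. iet_top T c \<le> iet_top T a} = insert a {c. iet_top T c < iet_top T a}"
    using positions_inj[OF top_positions] by (auto simp: le_less)
  then show ?thesis by (simp add: top_pt_def tlft_def offs_def)
qed

lemma top_pt_0: "top_pt T 0 = iet_left T"
proof -
  have "\<not> iet_top T c \<le> 0" for c using positions_range[OF top_positions, of c] by simp
  then have *: "{c. iet_top T c \<le> 0} = {}" by blast
  show ?thesis unfolding top_pt_def * by simp
qed

lemma top_pt_CARD: "top_pt T CARD('a) = iet_right T"
  using positions_range[OF top_positions] by (simp add: top_pt_def iet_right_def)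

lemma iet_int_eq: "iet_int T = {iet_left T<..<iet_right T}"
  by (simp add: iet_int_def top_pt_0 top_pt_CARD)

lemma iet_left_less_right: "iet_left T < iet_right T"
proof -
  have "0 < (\<Sum>a\<in>UNIV. iet_len T a)" using len_pos by (intro sum_pos) auto
  then show ?thesis by (simp add: iet_right_def)
qed

lemma top_int_eq: "top_int T a = {tlft T a<..<tlft T a + iet_len T a}"
  unfolding top_int_def top_pt_pred top_pt_pos ..

lemma iet_shift_eq: "iet_shift T a = blft T a - tlft T a"
  unfolding iet_shift_def top_pt_pred bot_pt_pred ..

lemma tlft_last: "tlft T (last_top T) + iet_len T (last_top T) = iet_right T"
  using offs_last[OF top_positions last_top_pos, of "iet_len T"] by (simp add: tlft_def iet_right_def)

lemma blft_last: "blft T (last_bot T) + iet_len T (last_bot T) = iet_right T"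
  using offs_last[OF bot_positions last_bot_pos, of "iet_len T"] by (simp add: blft_def iet_right_def)

lemma tlft_bounds: "iet_left T \<le> tlft T a" "tlft T a + iet_len T a \<le> iet_right T"
  using offs_nonneg[of "iet_len T" "iet_top T" a] offs_le_sum[of "iet_len T" "iet_top T" a] len_pos
  by (auto simp: tlft_def iet_right_def less_imp_le)

lemma blft_bounds: "iet_left T \<le> blft T a" "blft T a + iet_len T a \<le> iet_right T"
  using offs_nonneg[of "iet_len T" "iet_bot T" a] offs_le_sum[of "iet_len T" "iet_bot T" a] len_pos
  by (auto simp: blft_def iet_right_def less_imp_le)

lemma top_cover:
  assumes "btw s (\<not> s) (iet_left T) (iet_right T) x"
  shows "\<exists>a. btw s (\<not> s) (tlft T a) (tlft T a + iet_len T a) x"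
proof -
  have "btw s (\<not> s) 0 (\<Sum>c\<in>UNIV. iet_len T c) (x - iet_left T)"
    using assms by (auto simp: btw_def iet_right_def split: if_splits)
  from offs_cover[OF top_positions this] show ?thesis
    by (auto simp: btw_def tlft_def algebra_simps split: if_splits)
qed

lemma top_int_unique: "x \<in> top_int T a \<Longrightarrow> x \<in> top_int T b \<Longrightarrow> a = b"
  by (rule offs_disjoint[OF top_positions, of "iet_len T" False False a "x - iet_left T"])
     (auto simp: top_int_eq btw_def tlft_def algebra_simps less_imp_le len_pos)

lemma iet_map_eq: "x \<in> top_int T a \<Longrightarrow> iet_map T x = x + iet_shift T a"
  unfolding iet_map_def using top_int_unique by (metis the_equality)

lemma iet_orb_imp_funpow:
  "iet_orb T x y \<Longrightarrow>
    \<exists>m. (\<forall>j<m. (iet_map T ^^ j) x \<in> (\<Union>a. top_int T a)) \<and> (iet_map T ^^ m) x = y"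
proof (induction rule: iet_orb.induct)
  case (refl x)
  show ?case by (rule exI[of _ 0]) auto
next
  case (step x a y)
  then obtain m where m: "\<forall>j<m. (iet_map T ^^ j) (iet_map T x) \<in> (\<Union>a. top_int T a)"
    "(iet_map T ^^ m) (iet_map T x) = y"
    by (auto simp: iet_map_eq)
  have "(iet_map T ^^ j) x \<in> (\<Union>a. top_int T a)" if "j < Suc m" for j
    using that m(1) step.hyps(1) by (cases j) (auto simp: funpow_swap1)
  then show ?case using m(2) by (intro exI[of _ "Suc m"]) (auto simp: funpow_swap1)
qed

lemma no_connections_imp: "no_connections T \<Longrightarrow> \<not> iet_conn T"
proof
  assume "no_connections T" "iet_conn T"
  then obtain a b where ab: "1 < iet_top T a" "1 < iet_bot T b" "iet_orb T (blft T b) (tlft T a)"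
    unfolding iet_conn_def by blast
  from iet_orb_imp_funpow[OF ab(3)] obtain m where
    m: "\<forall>j<m. (iet_map T ^^ j) (blft T b) \<in> (\<Union>a. top_int T a)" "(iet_map T ^^ m) (blft T b) = tlft T a"
    by blast
  have "iet_connection T (iet_top T a - 1) (iet_bot T b - 1) m"
    unfolding iet_connection_def top_pt_pred bot_pt_pred
    using ab m positions_range[OF top_positions, of a] positions_range[OF bot_positions, of b] by auto
  then show False using \<open>no_connections T\<close> unfolding no_connections_def by blast
qed

end

section \<open>Geometry of one induction step\<close>

lemma btw_mono:
  assumes "btw p q l r x" "l' \<le> l" "r \<le> r'"
  shows "btw p q l' r' x"
  using assms by (auto simp: btw_def split: if_splits)

lemma btw_shift: "btw p q l r x \<Longrightarrow> btw p q (l + c) (r + c) (x + c)"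
  by (auto simp: btw_def split: if_splits)

text \<open>The invariant of the induction: it makes the step well defined and is inherited by the
  induced map.\<close>

definition rv_good :: "'a::finite iet \<Rightarrow> bool" where
  "rv_good T \<longleftrightarrow> is_iet T \<and> no_common_initial (iet_top T) (iet_bot T) \<and> \<not> iet_conn T \<and> 2 \<le> CARD('a)"

context
  fixes T :: "'a::finite iet"
  assumes good: "rv_good T"
begin

lemma good_iet: "is_iet T" using good by (simp add: rv_good_def)

text \<open>If both orders ended with the same letter, its complement would be a common initial
  segment.\<close>

lemma last_neq: "last_top T \<noteq> last_bot T"
proof
  assume eq: "last_top T = last_bot T"
  let ?a = "last_top T"
  have *: "iet_top T c < iet_top T ?a \<and> iet_bot T c < iet_bot T ?a" if "c \<noteq> ?a" for c
    using that positions_last(2)[OF top_positions[OF good_iet] last_top_pos[OF good_iet], of c]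
     positions_last(2)[OF bot_positions[OF good_iet] last_bot_pos[OF good_iet], of c] eq
     last_top_pos[OF good_iet] last_bot_pos[OF good_iet] by simp
  have "- {?a} = {} \<or> - {?a} = (UNIV::'a set)"
    using good * unfolding rv_good_def no_common_initial_def by auto
  then have "UNIV = {?a}" by auto
  then have "CARD('a) = 1" by (metis is_singletonI is_singleton_altdef)
  then show False using good by (simp add: rv_good_def)
qed

text \<open>Equal lengths mean that the last singularities of the map and of its inverse coincide, a
  connection with m = 0.\<close>

lemma len_last_neq: "iet_len T (last_top T) \<noteq> iet_len T (last_bot T)"
proof
  assume "iet_len T (last_top T) = iet_len T (last_bot T)"
  then have "tlft T (last_top T) = blft T (last_bot T)"
    using tlft_last[OF good_iet] blft_last[OF good_iet] by simp
  then have "iet_orb T (blft T (last_bot T)) (tlft T (last_top T))" by (simp add: iet_orb.refl)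
  moreover have "1 < iet_top T (last_top T)" "1 < iet_bot T (last_bot T)"
    using good last_top_pos[OF good_iet] last_bot_pos[OF good_iet] by (simp_all add: rv_good_def)
  ultimately have "iet_conn T" unfolding iet_conn_def by blast
  then show False using good by (simp add: rv_good_def)
qed

text \<open>Both last intervals end at the right end of the whole interval, so the longer one starts
  further to the left.\<close>

lemma top_pt_less_iff:
  "bot_pt T (CARD('a) - 1) < top_pt T (CARD('a) - 1) \<longleftrightarrow> iet_len T (last_top T) < iet_len T (last_bot T)"
  "top_pt T (CARD('a) - 1) < bot_pt T (CARD('a) - 1) \<longleftrightarrow> iet_len T (last_bot T) < iet_len T (last_top T)"
proof -
  have "top_pt T (CARD('a) - 1) = tlft T (last_top T)" "bot_pt T (CARD('a) - 1) = blft T (last_bot T)"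
    using top_pt_pred[OF good_iet, of "last_top T"] bot_pt_pred[OF good_iet, of "last_bot T"]
    by (simp_all add: last_top_pos[OF good_iet] last_bot_pos[OF good_iet])
  then show "bot_pt T (CARD('a) - 1) < top_pt T (CARD('a) - 1) \<longleftrightarrow> iet_len T (last_top T) < iet_len T (last_bot T)"
    "top_pt T (CARD('a) - 1) < bot_pt T (CARD('a) - 1) \<longleftrightarrow> iet_len T (last_bot T) < iet_len T (last_top T)"
    using tlft_last[OF good_iet] blft_last[OF good_iet] by linarith+
qed

lemma rv_winner_loser:
  "iet_len T (rv_loser T) < iet_len T (rv_winner T)" "rv_loser T \<noteq> rv_winner T"
  "rv_winner T = last_bot T \<and> rv_loser T = last_top T \<or> rv_winner T = last_top T \<and> rv_loser T = last_bot T"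
  using len_last_neq last_neq by (auto simp: rv_winner_def rv_loser_def)

lemma rv_step_top:
  assumes "rv_loser T = last_top T"
  shows "rv_step T = T\<lparr>iet_top := move_last_after (rv_loser T) (rv_winner T) (iet_top T),
    iet_len := (iet_len T)(rv_winner T := iet_len T (rv_winner T) - iet_len T (rv_loser T))\<rparr>"
    and "rv_winner T = last_bot T"
  using assms last_neq unfolding rv_step_def rv_winner_def rv_loser_def Let_def top_pt_less_iff
  by (auto split: if_splits)

lemma rv_step_bot:
  assumes "rv_loser T = last_bot T"
  shows "rv_step T = T\<lparr>iet_bot := move_last_after (rv_loser T) (rv_winner T) (iet_bot T),
    iet_len := (iet_len T)(rv_winner T := iet_len T (rv_winner T) - iet_len T (rv_loser T))\<rparr>"
    and "rv_winner T = last_top T"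
  using assms last_neq len_last_neq unfolding rv_step_def rv_winner_def rv_loser_def Let_def top_pt_less_iff
  by (auto split: if_splits)

lemma rv_step_len:
  "iet_len (rv_step T) = (iet_len T)(rv_winner T := iet_len T (rv_winner T) - iet_len T (rv_loser T))"
  using rv_winner_loser(3) rv_step_top(1) rv_step_bot(1) by fastforce

lemma rv_step_left: "iet_left (rv_step T) = iet_left T"
  using rv_winner_loser(3) rv_step_top(1) rv_step_bot(1) by fastforce

lemma rv_mat_eq: "rv_mat T = mat 1 + elem_mat (rv_loser T) (rv_winner T)"
  using len_last_neq unfolding rv_mat_def Let_def top_pt_less_iff rv_winner_def rv_loser_def by auto

lemma rv_step_right: "iet_right (rv_step T) = iet_right T - iet_len T (rv_loser T)"
proof -
  have "(\<Sum>a\<in>UNIV. iet_len (rv_step T) a) = (\<Sum>a\<in>UNIV. iet_len T a) - iet_len T (rv_loser T)"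
    using sum.remove[of UNIV "rv_winner T" "iet_len T"] sum.remove[of UNIV "rv_winner T" "iet_len (rv_step T)"]
    by (simp add: rv_step_len)
  then show ?thesis by (simp add: iet_right_def rv_step_left)
qed

lemma rv_step_iet: "is_iet (rv_step T)"
proof -
  have "0 < iet_len (rv_step T) a" for a
    using rv_winner_loser(1) len_pos[OF good_iet] by (simp add: rv_step_len)
  moreover have "positions (iet_top (rv_step T)) \<and> positions (iet_bot (rv_step T))"
    using rv_winner_loser(3)
  proof
    assume *: "rv_winner T = last_bot T \<and> rv_loser T = last_top T"
    show ?thesis using rv_step_top(1) * positions_move[OF top_positions[OF good_iet] last_top_pos[OF good_iet] last_neq]
      bot_positions[OF good_iet] by simp
  next
    assume *: "rv_winner T = last_top T \<and> rv_loser T = last_bot T"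
    show ?thesis using rv_step_bot(1) * positions_move[OF bot_positions[OF good_iet] last_bot_pos[OF good_iet] last_neq[symmetric]]
      top_positions[OF good_iet] by simp
  qed
  ultimately show ?thesis unfolding is_iet_def by blast
qed

lemma rv_step_irred: "no_common_initial (iet_top (rv_step T)) (iet_bot (rv_step T))"
proof -
  have irr: "no_common_initial (iet_top T) (iet_bot T)" using good by (simp add: rv_good_def)
  note P = top_positions[OF good_iet] bot_positions[OF good_iet] 
  show ?thesis using rv_winner_loser(3)
  proof
    assume *: "rv_winner T = last_bot T \<and> rv_loser T = last_top T"
    show ?thesis using rv_step_top(1) * no_common_initial_move[OF P last_top_pos[OF good_iet] last_bot_pos[OF good_iet] last_neq irr]
      by simp
  next
    assume *: "rv_winner T = last_top T \<and> rv_loser T = last_bot T"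
    show ?thesis using rv_step_bot(1) * no_common_initial_move[OF P(2,1) last_bot_pos[OF good_iet] last_top_pos[OF good_iet]
      last_neq[symmetric]] irr by (simp add: no_common_initial_sym[of "iet_top T"])
  qed
qed

lemma rv_step_lft_top:
  assumes "rv_loser T = last_top T"
  shows "tlft (rv_step T) = (tlft T)(last_top T := tlft T (last_bot T) + iet_len T (last_bot T) - iet_len T (last_top T))"
    and "blft (rv_step T) = blft T"
proof -
  show "tlft (rv_step T) = (tlft T)(last_top T := tlft T (last_bot T) + iet_len T (last_bot T) - iet_len T (last_top T))"
    using offs_move[OF top_positions[OF good_iet] last_top_pos[OF good_iet] last_neq, of "iet_len T"]
    by (auto simp: tlft_def rv_step_left rv_step_len rv_step_top[OF assms] assms fun_eq_iff)
  show "blft (rv_step T) = blft T"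
    using offs_shrink_last[OF bot_positions[OF good_iet] last_bot_pos[OF good_iet], of "iet_len T"]
    by (auto simp: blft_def rv_step_left rv_step_len rv_step_top[OF assms] assms fun_eq_iff)
qed

lemma rv_step_lft_bot:
  assumes "rv_loser T = last_bot T"
  shows "blft (rv_step T) = (blft T)(last_bot T := blft T (last_top T) + iet_len T (last_top T) - iet_len T (last_bot T))"
    and "tlft (rv_step T) = tlft T"
proof -
  show "blft (rv_step T) = (blft T)(last_bot T := blft T (last_top T) + iet_len T (last_top T) - iet_len T (last_bot T))"
    using offs_move[OF bot_positions[OF good_iet] last_bot_pos[OF good_iet] last_neq[symmetric], of "iet_len T"]
    by (auto simp: blft_def rv_step_left rv_step_len rv_step_bot[OF assms] assms fun_eq_iff)
  show "tlft (rv_step T) = tlft T"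
    using offs_shrink_last[OF top_positions[OF good_iet] last_top_pos[OF good_iet], of "iet_len T"]
    by (auto simp: tlft_def rv_step_left rv_step_len rv_step_bot[OF assms] assms fun_eq_iff)
qed

text \<open>In both types of step, the points that leave the shortened interval do so through
  \<open>last_bot T\<close> and return after one more step through \<open>last_top T\<close>. This
  removes the case distinction from everything that follows.\<close>

lemma rv_step_shift:
  "iet_shift (rv_step T) a =
    (if a = rv_loser T then iet_shift T (last_bot T) + iet_shift T (last_top T) else iet_shift T a)"
  unfolding iet_shift_eq[OF good_iet] iet_shift_eq[OF rv_step_iet]
  using rv_winner_loser(3) tlft_last[OF good_iet] blft_last[OF good_iet]
  by (auto simp: rv_step_lft_top rv_step_lft_bot)

lemma rv_step_sub:
  assumes "btw p q (tlft (rv_step T) a) (tlft (rv_step T) a + iet_len (rv_step T) a) x"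
  shows "a \<noteq> rv_loser T \<Longrightarrow> btw p q (tlft T a) (tlft T a + iet_len T a) x"
    and "a = rv_loser T \<Longrightarrow> btw p q (tlft T (last_bot T)) (tlft T (last_bot T) + iet_len T (last_bot T)) x"
    and "a = rv_loser T \<Longrightarrow> btw p q (tlft T (last_top T)) (tlft T (last_top T) + iet_len T (last_top T))
           (x + iet_shift T (last_bot T))"
proof -
  note L = tlft_last[OF good_iet] blft_last[OF good_iet]
  have lw: "iet_len T (rv_loser T) < iet_len T (rv_winner T)" "0 < iet_len T (rv_loser T)"
    using rv_winner_loser(1) len_pos[OF good_iet] by auto
  consider (t) "rv_winner T = last_bot T" "rv_loser T = last_top T"
    | (b) "rv_winner T = last_top T" "rv_loser T = last_bot T" using rv_winner_loser(3) by blast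
  note c = this
  show "a \<noteq> rv_loser T \<Longrightarrow> btw p q (tlft T a) (tlft T a + iet_len T a) x"
    by (cases rule: c) (rule btw_mono[OF assms], use lw last_neq in \<open>auto simp: rv_step_lft_top rv_step_lft_bot rv_step_len\<close>)+
  show "a = rv_loser T \<Longrightarrow> btw p q (tlft T (last_bot T)) (tlft T (last_bot T) + iet_len T (last_bot T)) x"
    by (cases rule: c) (rule btw_mono[OF assms], use lw last_neq in \<open>auto simp: rv_step_lft_top rv_step_lft_bot rv_step_len\<close>)+
  show "a = rv_loser T \<Longrightarrow> btw p q (tlft T (last_top T)) (tlft T (last_top T) + iet_len T (last_top T))
           (x + iet_shift T (last_bot T))"
    by (cases rule: c) (rule btw_mono[OF btw_shift[OF assms]], use lw last_neq L in
      \<open>auto simp: rv_step_lft_top rv_step_lft_bot rv_step_len iet_shift_eq[OF good_iet]\<close>)+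
qed

text \<open>The piece that is cut off is the image, under the branch of \<open>last_bot T\<close>,
  of the loser's new interval.\<close>

lemma rv_step_removed:
  assumes "btw p q (iet_right (rv_step T)) (iet_right T) x"
  shows "btw p q (tlft T (last_top T)) (tlft T (last_top T) + iet_len T (last_top T)) x"
    and "btw p q (tlft (rv_step T) (rv_loser T)) (tlft (rv_step T) (rv_loser T) + iet_len (rv_step T) (rv_loser T))
           (x - iet_shift T (last_bot T))"
proof -
  note L = tlft_last[OF good_iet] blft_last[OF good_iet] rv_step_right
  have lw: "iet_len T (rv_loser T) < iet_len T (rv_winner T)" "0 < iet_len T (rv_loser T)"
    using rv_winner_loser(1) len_pos[OF good_iet] by auto
  consider (t) "rv_winner T = last_bot T" "rv_loser T = last_top T"
    | (b) "rv_winner T = last_top T" "rv_loser T = last_bot T" using rv_winner_loser(3) by blast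
  note c = this
  show "btw p q (tlft T (last_top T)) (tlft T (last_top T) + iet_len T (last_top T)) x"
    by (cases rule: c) (rule btw_mono[OF assms], use lw last_neq L in \<open>auto\<close>)+
  show "btw p q (tlft (rv_step T) (rv_loser T)) (tlft (rv_step T) (rv_loser T) + iet_len (rv_step T) (rv_loser T))
           (x - iet_shift T (last_bot T))"
  proof -
    have sh: "btw p q (iet_right (rv_step T) - iet_shift T (last_bot T)) (iet_right T - iet_shift T (last_bot T))
        (x - iet_shift T (last_bot T))"
      using btw_shift[OF assms, of "- iet_shift T (last_bot T)"] by simp
    show ?thesis
      by (rule btw_mono[OF sh]; cases rule: c) (use lw last_neq L in
        \<open>auto simp: rv_step_lft_top rv_step_lft_bot rv_step_len iet_shift_eq[OF good_iet]\<close>)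
  qed
qed

text \<open>A point that is kept keeps its letter, unless it lies in the part of
  \<open>last_bot T\<close> whose image is cut off; that part now belongs to the loser.\<close>

lemma rv_step_kept:
  assumes "btw s (\<not> s) (tlft T a) (tlft T a + iet_len T a) x" "btw s (\<not> s) (iet_left T) (iet_right (rv_step T)) x"
  shows "(a = last_bot T \<or> a \<noteq> rv_loser T) \<and> btw s (\<not> s) (tlft (rv_step T) a) (tlft (rv_step T) a + iet_len (rv_step T) a) x \<or>
    a = last_bot T \<and> btw s (\<not> s) (tlft (rv_step T) (rv_loser T)) (tlft (rv_step T) (rv_loser T) + iet_len (rv_step T) (rv_loser T)) x"
proof -
  note L = tlft_last[OF good_iet] blft_last[OF good_iet]
  consider (t) "rv_winner T = last_bot T" "rv_loser T = last_top T"
    | (b) "rv_winner T = last_top T" "rv_loser T = last_bot T" using rv_winner_loser(3) by blast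
  then show ?thesis
  proof cases
    case t
    then have R: "iet_right (rv_step T) = tlft T (last_top T)" using L rv_step_right by simp
    have "a \<noteq> last_top T" using assms unfolding R by (cases s) (auto simp: btw_def)
    then show ?thesis using assms(1) last_neq unfolding rv_step_len rv_step_lft_top[OF t(2)] t
      by (cases s) (auto simp: btw_def)
  next
    case b
    then have R: "iet_right (rv_step T) = iet_right T - iet_len T (last_bot T)" using rv_step_right by simp
    have "btw s (\<not> s) (tlft T a) (tlft T a + iet_len T a - iet_len T (last_bot T)) x" if "a = last_top T"
      using assms L(1) unfolding R that by (cases s) (auto simp: btw_def)
    then show ?thesis using assms(1) last_neq unfolding rv_step_len rv_step_lft_bot[OF b(2)] b
      by (cases "a = last_top T") (auto simp: add_diff_eq)
  qed
qed

lemma rv_step_orb: "iet_orb (rv_step T) x y \<Longrightarrow> iet_orb T x y"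
proof (induction rule: iet_orb.induct)
  case (refl x)
  show ?case by (rule iet_orb.refl)
next
  case (step x a y)
  have *: "btw False False (tlft (rv_step T) a) (tlft (rv_step T) a + iet_len (rv_step T) a) x"
    using step.hyps(1) by (simp add: top_int_eq[OF rv_step_iet] btw_def)
  show ?case
  proof (cases "a = rv_loser T")
    case True
    have "x \<in> top_int T (last_bot T)" "x + iet_shift T (last_bot T) \<in> top_int T (last_top T)"
      using rv_step_sub(2,3)[OF * True] by (auto simp: top_int_eq[OF good_iet] btw_def)
    moreover have "iet_orb T (x + iet_shift T (last_bot T) + iet_shift T (last_top T)) y"
      using step.IH True by (simp add: rv_step_shift add.assoc)
    ultimately show ?thesis by (meson iet_orb.step)
  next
    case False
    have "x \<in> top_int T a"
      using rv_step_sub(1)[OF * False] by (auto simp: top_int_eq[OF good_iet] btw_def)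
    moreover have "iet_orb T (x + iet_shift T a) y" using step.IH False by (simp add: rv_step_shift)
    ultimately show ?thesis by (rule iet_orb.step)
  qed
qed

text \<open>A step creates one new endpoint. If the top order changes, \<open>T\<close> sends the
  new left endpoint of \<open>last_top T\<close> to the old one; if the bottom order changes, the
  new left endpoint of \<open>last_bot T\<close> is the image of the old one. Either way a
  connection of the induced map extends to a connection of \<open>T\<close>.\<close>

lemma rv_step_conn: "\<not> iet_conn (rv_step T)"
proof
  assume "iet_conn (rv_step T)"
  then obtain a b where ab: "1 < iet_top (rv_step T) a" "1 < iet_bot (rv_step T) b"
    and "iet_orb (rv_step T) (blft (rv_step T) b) (tlft (rv_step T) a)"
    unfolding iet_conn_def by blast
  then have orb: "iet_orb T (blft (rv_step T) b) (tlft (rv_step T) a)" by (simp add: rv_step_orb)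
  have nc: "\<not> (1 < iet_top T a' \<and> 1 < iet_bot T b' \<and> iet_orb T (blft T b') (tlft T a'))" for a' b'
  proof -
    have "\<not> iet_conn T" using good by (simp add: rv_good_def)
    then show ?thesis unfolding iet_conn_def by simp
  qed
  have d2: "1 < CARD('a)" using good by (simp add: rv_good_def)
  have lw: "iet_len T (rv_loser T) < iet_len T (rv_winner T)" "0 < iet_len T (rv_loser T)"
    using rv_winner_loser(1) len_pos[OF good_iet] by auto
  note L = tlft_last[OF good_iet] blft_last[OF good_iet] last_neq
  have R: "1 \<le> iet_top T c" "1 \<le> iet_bot T c" for c
    using positions_range[OF top_positions[OF good_iet], of c] positions_range[OF bot_positions[OF good_iet], of c]
    by simp_all
  show False using rv_winner_loser(3)
  proof
    assume *: "rv_winner T = last_bot T \<and> rv_loser T = last_top T"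
    have "blft (rv_step T) b = blft T b" using * by (simp add: rv_step_lft_top)
    moreover have "1 < iet_bot T b" using ab(2) * by (simp add: rv_step_top(1))
    ultimately have b: "1 < iet_bot T b" "blft (rv_step T) b = blft T b" by simp_all
    show False
    proof (cases "a = last_top T")
      case True
      have "tlft (rv_step T) a = tlft T (last_bot T) + iet_len T (last_bot T) - iet_len T (last_top T)"
        using True * by (simp add: rv_step_lft_top)
      then have t: "tlft (rv_step T) a \<in> top_int T (last_bot T)"
        "tlft (rv_step T) a + iet_shift T (last_bot T) = tlft T a"
        using True * lw L(1,2) unfolding top_int_eq[OF good_iet] iet_shift_eq[OF good_iet] by simp_all
      have "iet_orb T (tlft (rv_step T) a) (tlft T a)"
        by (rule iet_orb.step[OF t(1)]) (simp add: t(2) iet_orb.refl)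
      then have "iet_orb T (blft T b) (tlft T a)" using iet_orb_trans[OF orb] b(2) by simp
      moreover have "1 < iet_top T a" using d2 True last_top_pos[OF good_iet] by simp
      ultimately show False using nc[of a b] b(1) by simp
    next
      case False
      then have "tlft (rv_step T) a = tlft T a" using * by (simp add: rv_step_lft_top)
      moreover have "1 < iet_top T a"
      proof (cases "iet_top T a \<le> iet_top T (last_bot T)")
        case True
        then show ?thesis using ab(1) * False by (simp add: rv_step_top(1) move_last_after_def)
      next
        case False
        then show ?thesis using R(1)[of "last_bot T"] by simp
      qed
      ultimately show False using nc[of a b] b orb by simp
    qed
  next
    assume *: "rv_winner T = last_top T \<and> rv_loser T = last_bot T"
    have "tlft (rv_step T) a = tlft T a" using * by (simp add: rv_step_lft_bot)
    moreover have "1 < iet_top T a" using ab(1) * by (simp add: rv_step_bot(1))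
    ultimately have a: "1 < iet_top T a" "tlft (rv_step T) a = tlft T a" by simp_all
    show False
    proof (cases "b = last_bot T")
      case True
      have "blft (rv_step T) b = blft T (last_top T) + iet_len T (last_top T) - iet_len T (last_bot T)"
        using True * by (simp add: rv_step_lft_bot)
      then have t: "blft T b \<in> top_int T (last_top T)"
        "blft T b + iet_shift T (last_top T) = blft (rv_step T) b"
        using True * lw L(1,2) unfolding top_int_eq[OF good_iet] iet_shift_eq[OF good_iet] by simp_all
      have "iet_orb T (blft T b) (blft (rv_step T) b)"
        by (rule iet_orb.step[OF t(1)]) (simp add: t(2) iet_orb.refl)
      then have "iet_orb T (blft T b) (tlft T a)" using iet_orb_trans[OF _ orb[unfolded a(2)]] by simp
      moreover have "1 < iet_bot T b" using d2 True last_bot_pos[OF good_iet] by simp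
      ultimately show False using nc[of a b] a(1) by simp
    next
      case False
      then have "blft (rv_step T) b = blft T b" using * by (simp add: rv_step_lft_bot)
      moreover have "1 < iet_bot T b"
      proof (cases "iet_bot T b \<le> iet_bot T (last_top T)")
        case True
        then show ?thesis using ab(2) * False by (simp add: rv_step_bot(1) move_last_after_def)
      next
        case False
        then show ?thesis using R(2)[of "last_top T"] by simp
      qed
      ultimately show False using nc[of a b] a orb by simp
    qed
  qed
qed

lemma rv_step_good: "rv_good (rv_step T)"
  using good rv_step_iet rv_step_irred rv_step_conn by (simp add: rv_good_def)

end

section \<open>Infinite Rauzy--Veech paths\<close>

lemma nat_mono_bounded_eventually_const:
  fixes f :: "nat \<Rightarrow> nat"
  assumes mono: "\<And>n. M \<le> n \<Longrightarrow> f n \<le> f (Suc n)" and bd: "\<And>n. f n \<le> B"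
  shows "\<forall>\<^sub>F n in sequentially. f (Suc n) = f n"
proof -
  define g where "g n = f (M + n)" for n
  have "incseq g" unfolding g_def by (rule incseq_SucI) (use mono in auto)
  have "finite (range g)" by (rule finite_subset[of _ "{..B}"]) (use bd in \<open>auto simp: g_def\<close>)
  then obtain n0 where n0: "g n0 = Max (range g)" using Max_in[of "range g"] by fastforce
  have eq: "g n = g n0" if "n0 \<le> n" for n
    using incseqD[OF \<open>incseq g\<close> that] Max_ge[OF \<open>finite (range g)\<close>, of "g n"] n0 by simp
  have "f (Suc n) = f n" if "M + n0 \<le> n" for n
    using eq[of "n - M"] eq[of "Suc n - M"] that by (simp add: g_def Suc_diff_le)
  then show ?thesis unfolding eventually_sequentially by blast
qed

locale rauzy_path =
  fixes T :: "'a::finite iet"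
  assumes good0: "rv_good T"
begin

lemma iter_good: "rv_good (rv_iter T n)"
  by (induction n) (simp_all add: rv_iter_def good0 rv_step_good)

lemma iter_iet: "is_iet (rv_iter T n)"
  using iter_good good_iet by blast

lemma iter_Suc: "rv_iter T (Suc n) = rv_step (rv_iter T n)"
  by (simp add: rv_iter_def)

lemma iter_0: "rv_iter T 0 = T"
  by (simp add: rv_iter_def)

lemma CARD_ge2: "2 \<le> CARD('a)"
  using good0 by (simp add: rv_good_def)

abbreviation "lam n \<equiv> iet_len (rv_iter T n)"
abbreviation "lft n \<equiv> tlft (rv_iter T n)"
abbreviation "sh n \<equiv> iet_shift (rv_iter T n)"
abbreviation "la n \<equiv> last_top (rv_iter T n)"
abbreviation "lb n \<equiv> last_bot (rv_iter T n)"
abbreviation "ws n \<equiv> rv_winner (rv_iter T n)"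
abbreviation "ls n \<equiv> rv_loser (rv_iter T n)"
abbreviation "rt n \<equiv> iet_right (rv_iter T n)"
abbreviation "lt \<equiv> iet_left T"

lemmas winner_loser = rv_winner_loser[OF iter_good]
lemmas lam_pos = len_pos[OF iter_iet]

lemma lam_Suc: "lam (Suc n) = (lam n)(ws n := lam n (ws n) - lam n (ls n))"
  by (simp add: iter_Suc rv_step_len[OF iter_good])

lemma left_iter: "iet_left (rv_iter T n) = lt"
  by (induction n) (simp_all add: iter_0 iter_Suc rv_step_left[OF iter_good])

lemma rt_Suc: "rt (Suc n) = rt n - lam n (ls n)"
  by (simp add: iter_Suc rv_step_right[OF iter_good])

lemma rt_eq: "rt n = lt + (\<Sum>a\<in>UNIV. lam n a)"
  by (simp add: iet_right_def left_iter)

lemma lt_less_rt: "lt < rt n"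
  using iet_left_less_right[OF iter_iet, of n] by (simp add: left_iter)

lemma sh_Suc: "sh (Suc n) a = (if a = ls n then sh n (lb n) + sh n (la n) else sh n a)"
  by (simp add: iter_Suc rv_step_shift[OF iter_good])

definition inI :: "bool \<Rightarrow> bool \<Rightarrow> nat \<Rightarrow> 'a \<Rightarrow> real \<Rightarrow> bool" where
  "inI p q n a x = btw p q (lft n a) (lft n a + lam n a) x"

lemma inI_Suc:
  assumes "inI p q (Suc n) a x"
  shows "a \<noteq> ls n \<Longrightarrow> inI p q n a x"
    and "a = ls n \<Longrightarrow> inI p q n (lb n) x"
    and "a = ls n \<Longrightarrow> inI p q n (la n) (x + sh n (lb n))"
  using rv_step_sub[OF iter_good, of p q n a x] assms by (simp_all add: inI_def iter_Suc)

lemma inI_removed: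
  assumes "btw p q (rt (Suc n)) (rt n) x"
  shows "inI p q n (la n) x" "inI p q (Suc n) (ls n) (x - sh n (lb n))"
  using rv_step_removed[OF iter_good, of p q n x] assms by (simp_all add: inI_def iter_Suc)

lemma inI_kept:
  assumes "inI s (\<not> s) n a x" "btw s (\<not> s) lt (rt (Suc n)) x"
  shows "(a = lb n \<or> a \<noteq> ls n) \<and> inI s (\<not> s) (Suc n) a x \<or> a = lb n \<and> inI s (\<not> s) (Suc n) (ls n) x"
  using rv_step_kept[OF iter_good, of s n a x] assms by (simp add: inI_def iter_Suc left_iter)

lemma inI_cover: "btw s (\<not> s) lt (rt n) x \<Longrightarrow> \<exists>a. inI s (\<not> s) n a x"
  using top_cover[OF iter_iet, of s n x] by (simp add: inI_def left_iter)

lemma inI_bounds: "inI p q n a x \<Longrightarrow> btw p q lt (rt n) x"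
  unfolding inI_def using tlft_bounds[OF iter_iet, of n a] by (erule_tac btw_mono) (auto simp: left_iter)

lemma pos_Suc:
  "iet_top (rv_iter T (Suc n)) =
     (if ls n = la n then move_last_after (ls n) (ws n) (iet_top (rv_iter T n)) else iet_top (rv_iter T n))"
  "iet_bot (rv_iter T (Suc n)) =
     (if ls n = lb n then move_last_after (ls n) (ws n) (iet_bot (rv_iter T n)) else iet_bot (rv_iter T n))"
  using winner_loser(3)[of n] rv_step_top(1)[OF iter_good, of n] rv_step_bot(1)[OF iter_good, of n]
    last_neq[OF iter_good, of n]
  by (auto simp: iter_Suc)

text \<open>Inserting the loser further to the left can only push other letters to the
  right.\<close>

lemma pos_mono:
  assumes "x \<noteq> ls n"
  shows "iet_top (rv_iter T n) x \<le> iet_top (rv_iter T (Suc n)) x"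
    and "iet_bot (rv_iter T n) x \<le> iet_bot (rv_iter T (Suc n)) x"
proof -
  have *: "p x \<le> (if C then move_last_after (ls n) (ws n) p else p) x" for p :: "'a \<Rightarrow> nat" and C
    using assms by (simp add: move_last_after_def)
  show "iet_top (rv_iter T n) x \<le> iet_top (rv_iter T (Suc n)) x"
    "iet_bot (rv_iter T n) x \<le> iet_bot (rv_iter T (Suc n)) x"
    unfolding pos_Suc by (rule *)+
qed

text \<open>The order in which the winner is last is not changed by the step.\<close>

lemma winner_stays: "ws n = la (Suc n) \<or> ws n = lb (Suc n)"
proof (cases "ls n = la n")
  case True
  then have w: "ws n = lb n" using winner_loser(3)[of n] last_neq[OF iter_good, of n] by auto
  have "ls n \<noteq> lb n" using True last_neq[OF iter_good, of n] by simp
  then have "iet_bot (rv_iter T (Suc n)) = iet_bot (rv_iter T n)" by (simp add: pos_Suc)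
  then show ?thesis using w by (simp add: last_bot_def)
next
  case False
  then have "ws n = la n" using winner_loser(3)[of n] by auto
  then show ?thesis using False by (simp add: last_top_def pos_Suc)
qed

lemma rt_decseq: "decseq rt"
  by (rule decseq_SucI) (simp add: rt_Suc less_imp_le lam_pos)

text \<open>The lengths of the losers are the amounts by which the interval shrinks, and its right
  endpoints converge.\<close>

lemma lam_loser_tendsto_0: "(\<lambda>n. lam n (ls n)) \<longlonglongrightarrow> 0"
proof -
  obtain L where L: "rt \<longlonglongrightarrow> L"
    using decseq_convergent[OF rt_decseq, of lt] lt_less_rt by (metis less_imp_le)
  have "(\<lambda>n. rt n - rt (Suc n)) \<longlonglongrightarrow> L - L"
    by (intro tendsto_diff L LIMSEQ_Suc[OF L])
  then show ?thesis by (simp add: rt_Suc)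
qed

text \<open>Letters that win only finitely often have eventually constant length and hence eventually do
  not lose either; their positions stabilise, and the other letters end up on their right.\<close>
lemma wins_frequently: "\<exists>\<^sub>F n in sequentially. ws n = a"
proof -
  define W where "W = {a. \<exists>\<^sub>F n in sequentially. ws n = a}"
  let ?p = "\<lambda>n. iet_top (rv_iter T n)" and ?q = "\<lambda>n. iet_bot (rv_iter T n)"
  note pos = top_positions[OF iter_iet] bot_positions[OF iter_iet]
  have e1: "\<forall>\<^sub>F n in sequentially. ws n \<in> W"
  proof -
    have "\<forall>\<^sub>F n in sequentially. \<forall>a\<in>-W. ws n \<noteq> a"
      by (rule eventually_ball_finite) (auto simp: W_def not_frequently)
    then show ?thesis by eventually_elim blast
  qed
  then obtain M where M: "\<And>n. M \<le> n \<Longrightarrow> ws n \<in> W" unfolding eventually_sequentially by blast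
  have lam_const: "lam n a = lam M a" if "a \<notin> W" "M \<le> n" for a n
    using that(2)
  proof (induction n rule: dec_induct)
    case (step n)
    then have "ws n \<noteq> a" using M[of n] that(1) by auto
    then show ?case using step by (simp add: lam_Suc)
  qed simp
  have e2: "\<forall>\<^sub>F n in sequentially. ls n \<in> W"
  proof -
    have "\<forall>\<^sub>F n in sequentially. lam n (ls n) < lam M a" for a
      using order_tendstoD(2)[OF lam_loser_tendsto_0 lam_pos] .
    then have "\<forall>\<^sub>F n in sequentially. \<forall>a\<in>UNIV. lam n (ls n) < lam M a"
      by (intro eventually_ball_finite) auto
    moreover have "\<forall>\<^sub>F n in sequentially. M \<le> n" by (rule eventually_ge_at_top)
    ultimately show ?thesis
    proof eventually_elim
      case (elim n)
      show ?case
      proof (rule ccontr)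
        assume "ls n \<notin> W"
        then show False using lam_const[of "ls n" n] elim by force
      qed
    qed
  qed
  obtain M1 where M1: "\<And>n. M1 \<le> n \<Longrightarrow> ls n \<in> W" using e2 unfolding eventually_sequentially by blast
  have "\<forall>\<^sub>F n in sequentially. \<forall>a\<in>-W. ?p (Suc n) a = ?p n a"
  proof (rule eventually_ball_finite)
    show "\<forall>a\<in>-W. \<forall>\<^sub>F n in sequentially. ?p (Suc n) a = ?p n a"
    proof
      fix a assume a: "a \<in> -W"
      show "\<forall>\<^sub>F n in sequentially. ?p (Suc n) a = ?p n a"
      proof (rule nat_mono_bounded_eventually_const)
        show "?p n a \<le> ?p (Suc n) a" if "M1 \<le> n" for n
          by (rule pos_mono) (use M1[OF that] a in auto)
        show "?p n a \<le> CARD('a)" for n using positions_range[OF pos(1)] by auto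
      qed
    qed
  qed simp
  moreover have "\<forall>\<^sub>F n in sequentially. \<forall>a\<in>-W. ?q (Suc n) a = ?q n a"
  proof (rule eventually_ball_finite)
    show "\<forall>a\<in>-W. \<forall>\<^sub>F n in sequentially. ?q (Suc n) a = ?q n a"
    proof
      fix a assume a: "a \<in> -W"
      show "\<forall>\<^sub>F n in sequentially. ?q (Suc n) a = ?q n a"
      proof (rule nat_mono_bounded_eventually_const)
        show "?q n a \<le> ?q (Suc n) a" if "M1 \<le> n" for n
          by (rule pos_mono) (use M1[OF that] a in auto)
        show "?q n a \<le> CARD('a)" for n using positions_range[OF pos(2)] by auto
      qed
    qed
  qed simp
  ultimately have "\<forall>\<^sub>F n in sequentially. ws n \<in> W \<and> ls n \<in> W \<and>
      (\<forall>a\<in>-W. ?p (Suc n) a = ?p n a) \<and> (\<forall>a\<in>-W. ?q (Suc n) a = ?q n a)"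
    using e1 e2 by eventually_elim simp
  then obtain N where N: "\<And>n. N \<le> n \<Longrightarrow> ws n \<in> W" "\<And>n. N \<le> n \<Longrightarrow> ls n \<in> W"
    "\<And>n a. N \<le> n \<Longrightarrow> a \<notin> W \<Longrightarrow> ?p (Suc n) a = ?p n a"
    "\<And>n a. N \<le> n \<Longrightarrow> a \<notin> W \<Longrightarrow> ?q (Suc n) a = ?q n a"
    unfolding eventually_sequentially by (metis ComplI)
  define right where "right n x \<longleftrightarrow> (\<forall>a\<in>-W. ?p n a < ?p n x \<and> ?q n a < ?q n x)" for n x
  \<comment> \<open>The winner is last in one order. In the other one the loser is inserted directly
    behind it, which would push a letter \<open>a\<close> standing to the right of the winner,
    against the stability of its position.\<close>
  have A: "right n (ws n)" if n: "N \<le> n" for n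
    unfolding right_def
  proof
    fix a assume "a \<in> -W"
    then have a: "a \<notin> W" by simp
    have ne: "a \<noteq> ws n" "a \<noteq> ls n" using N(1,2)[OF n] a by auto
    have L: "?p n (la n) = CARD('a)" "?q n (lb n) = CARD('a)"
      using last_top_pos[OF iter_iet] last_bot_pos[OF iter_iet] by auto
    show "?p n a < ?p n (ws n) \<and> ?q n a < ?q n (ws n)"
      using winner_loser(3)[of n]
    proof
      assume *: "ws n = lb n \<and> ls n = la n"
      then have "?p n a \<le> ?p n (ws n)" using N(3)[OF n a] ne
        by (simp add: pos_Suc move_last_after_def split: if_splits)
      moreover have "?p n a \<noteq> ?p n (ws n)" using positions_inj[OF pos(1)] ne by simp
      moreover have "?q n a < ?q n (ws n)" using positions_last(1)[OF pos(2) L(2)] * ne by simp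
      ultimately show ?thesis by simp
    next
      assume *: "ws n = la n \<and> ls n = lb n"
      then have "?q n a \<le> ?q n (ws n)" using N(4)[OF n a] ne
        by (simp add: pos_Suc move_last_after_def split: if_splits)
      moreover have "?q n a \<noteq> ?q n (ws n)" using positions_inj[OF pos(2)] ne by simp
      moreover have "?p n a < ?p n (ws n)" using positions_last(1)[OF pos(1) L(1)] * ne by simp
      ultimately show ?thesis by simp
    qed
  qed
  \<comment> \<open>Only the loser moves to the left, and it lands behind the winner, which is
    itself to the right of all of \<open>-W\<close>.\<close>
  have B: "right (Suc n) x" if n: "N \<le> n" and x: "right n x" for n x
    unfolding right_def
  proof
    fix a assume "a \<in> -W"
    then have a: "a \<notin> W" "?p n a < ?p n x" "?q n a < ?q n x" "?p n a < ?p n (ws n)" "?q n a < ?q n (ws n)"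
      using x A[OF n] by (auto simp: right_def)
    have "?p n a < ?p (Suc n) x \<and> ?q n a < ?q (Suc n) x"
    proof (cases "x = ls n")
      case True
      have *: "p a < p x \<Longrightarrow> p a < p (ws n) \<Longrightarrow>
          p a < (if C then move_last_after (ls n) (ws n) p else p) x" for p :: "'a \<Rightarrow> nat" and C
        using True by (simp add: move_last_after_def)
      show ?thesis unfolding pos_Suc by (intro conjI *) (use a in auto)
    next
      case False
      then show ?thesis using pos_mono[OF False] a by (meson less_le_trans)
    qed
    then show "?p (Suc n) a < ?p (Suc n) x \<and> ?q (Suc n) a < ?q (Suc n) x"
      using N(3,4)[OF n a(1)] by simp
  qed
  have "\<forall>\<^sub>F n in sequentially. right n x" if "x \<in> W" for x
  proof -
    have "\<forall>N. \<exists>n\<ge>N. ws n = x" using that by (simp add: W_def frequently_sequentially)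
    then obtain n0 where n0: "N \<le> n0" "ws n0 = x" by blast
    have "right n x" if "n0 \<le> n" for n
      using that
    proof (induction n rule: dec_induct)
      case base
      then show ?case using A[OF n0(1)] n0(2) by simp
    next
      case (step n)
      then show ?case using B[of n x] n0(1) by simp
    qed
    then show ?thesis unfolding eventually_sequentially by blast
  qed
  then have "\<forall>\<^sub>F n in sequentially. \<forall>x\<in>W. right n x"
    by (intro eventually_ball_finite) auto
  then obtain n where n: "\<forall>x\<in>W. right n x" unfolding eventually_sequentially by blast
  \<comment> \<open>Now \<open>-W\<close> is a common initial segment, and it is not everything
    because late winners lie in \<open>W\<close>.\<close>
  have "no_common_initial (?p n) (?q n)" using iter_good[of n] by (simp add: rv_good_def)
  moreover have "\<forall>a\<in>-W. \<forall>x\<in>-(-W). ?p n a < ?p n x \<and> ?q n a < ?q n x"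
    using n by (auto simp: right_def)
  ultimately have "-W = {} \<or> -W = UNIV" unfolding no_common_initial_def by blast
  moreover have "W \<noteq> {}" using N(1)[of N] by auto
  ultimately have "W = UNIV" by auto
  then show ?thesis unfolding W_def by blast
qed

section \<open>The matrices of the algorithm\<close>

lemma rv_mat_mult_entry:
  "(rv_mat (rv_iter T n) ** A) $ i $ j = A $ i $ j + (if i = ls n then A $ ws n $ j else 0)"
proof -
  have "(rv_mat (rv_iter T n) ** A) $ i $ j = (\<Sum>k\<in>UNIV. ((if i = k then 1 else 0) + (if i = ls n \<and> k = ws n then 1 else 0)) * A $ k $ j)"
    by (simp add: matrix_matrix_mult_def rv_mat_eq[OF iter_good] mat_def elem_mat_def)
  also have "\<dots> = (\<Sum>k\<in>UNIV. (if i = k then A $ k $ j else 0) + (if k = ws n then (if i = ls n then A $ k $ j else 0) else 0))"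
    by (rule sum.cong) (auto simp: algebra_simps)
  also have "\<dots> = A $ i $ j + (if i = ls n then A $ ws n $ j else 0)"
    by (simp add: sum.distrib)
  finally show ?thesis .
qed

abbreviation "B \<equiv> rv_B T"

lemma B_Suc_entry:
  "m \<le> n \<Longrightarrow> B m (Suc n) $ i $ j = B m n $ i $ j + (if i = ls n then B m n $ ws n $ j else 0)"
  by (simp add: rv_mat_mult_entry)

lemma B_self: "B m m = mat 1"
  by (cases m) auto

lemma B_mult:
  assumes "m \<le> n" "n \<le> p"
  shows "B m p = B n p ** B m n"
  using assms(2)
proof (induction p rule: dec_induct)
  case base
  show ?case by (simp add: B_self)
next
  case (step p)
  then show ?case using assms(1) by (simp add: matrix_mul_assoc)
qed

lemma B_Nats: "m \<le> n \<Longrightarrow> B m n $ i $ j \<in> \<nat>"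
proof (induction n arbitrary: i rule: dec_induct)
  case base
  show ?case by (simp add: B_self mat_def)
next
  case (step n)
  then show ?case by (simp add: B_Suc_entry del: rv_B.simps)
qed

lemma B_nonneg: "m \<le> n \<Longrightarrow> 0 \<le> B m n $ i $ j"
  using B_Nats by (metis Nats_altdef2 mem_Collect_eq)

lemma B_diag: "m \<le> n \<Longrightarrow> 1 \<le> B m n $ i $ i"
proof (induction n rule: dec_induct)
  case base
  show ?case by (simp add: B_self mat_def)
next
  case (step n)
  then have "0 \<le> B m n $ ws n $ i" by (simp add: B_nonneg)
  then show ?case using step.IH B_Suc_entry[OF step.hyps(1), of i i]
    by (cases "i = ls n") (simp_all del: rv_B.simps)
qed

lemma B_ge_1: "m \<le> n \<Longrightarrow> 0 < B m n $ i $ j \<Longrightarrow> 1 \<le> B m n $ i $ j"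
  using B_Nats[of m n i j] by (auto simp: Nats_def)

lemma B_mono:
  assumes "m \<le> n" "n \<le> p"
  shows "B m n $ i $ j \<le> B m p $ i $ j"
  using assms(2)
proof (induction p rule: dec_induct)
  case (step p)
  then have "m \<le> p" using assms(1) by simp
  then show ?case using step.IH B_nonneg[of m p "ws p" j] B_Suc_entry[of m p i j]
    by (cases "i = ls p") (simp_all del: rv_B.simps)
qed simp

text \<open>If the column of \<open>c\<close> had zeros forever, letters outside its support would win right before
  letters of the support do; but the winner of one step takes part in the next one.\<close>
lemma B_column_eventually_pos: "\<forall>\<^sub>F n in sequentially. \<forall>a. 0 < B m n $ a $ c"
proof -
  define A where "A = {a. \<exists>n\<ge>m. 0 < B m n $ a $ c}"
  have "\<forall>\<^sub>F n in sequentially. \<forall>a\<in>A. 0 < B m n $ a $ c"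
  proof (rule eventually_ball_finite)
    show "\<forall>a\<in>A. \<forall>\<^sub>F n in sequentially. 0 < B m n $ a $ c"
    proof
      fix a assume "a \<in> A"
      then obtain n where n: "m \<le> n" "0 < B m n $ a $ c" by (auto simp: A_def)
      have "0 < B m p $ a $ c" if "n \<le> p" for p
        using B_mono[OF n(1) that, of a c] n(2) by linarith
      then show "\<forall>\<^sub>F n in sequentially. 0 < B m n $ a $ c" unfolding eventually_sequentially by blast
    qed
  qed simp
  then obtain M0 where M0: "\<And>n a. M0 \<le> n \<Longrightarrow> a \<in> A \<Longrightarrow> 0 < B m n $ a $ c"
    unfolding eventually_sequentially by blast
  define M where "M = max m M0"
  have Mm: "m \<le> n" if "M \<le> n" for n using that by (simp add: M_def)
  have MA: "0 < B m n $ a $ c" if "M \<le> n" "a \<in> A" for n a using that M0 by (simp add: M_def)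
  have loser: "ls n \<in> A" if "M \<le> n" "ws n \<in> A" for n
  proof -
    have "0 < B m (Suc n) $ ls n $ c"
      using MA[OF that] B_nonneg[OF Mm[OF that(1)], of "ls n" c] Mm[OF that(1)]
      by (simp add: B_Suc_entry del: rv_B.simps)
    then show ?thesis unfolding A_def using Mm[OF that(1)] by (auto intro!: exI[of _ "Suc n"] simp del: rv_B.simps)
  qed
  have "c \<in> A" unfolding A_def using B_diag[of m m c] by (auto intro!: exI[of _ m] simp del: rv_B.simps)
  have "A = UNIV"
  proof (rule ccontr)
    assume "A \<noteq> UNIV"
    then obtain x where x: "x \<notin> A" by blast
    have "\<forall>N. \<exists>n\<ge>N. ws n = x" using wins_frequently[of x] by (simp add: frequently_sequentially)
    then obtain n1 where n1: "M \<le> n1" "ws n1 = x" by blast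
    have "\<forall>N. \<exists>n\<ge>N. ws n = c" using wins_frequently[of c] by (simp add: frequently_sequentially)
    then obtain n2 where n2: "n1 \<le> n2" "ws n2 = c" by blast
    \<comment> \<open>If the winner of the next step were in \<open>A\<close>, so would be its
      loser; but one of these two is the present winner.\<close>
    have "ws n \<notin> A" if "n1 \<le> n" for n
      using that
    proof (induction n rule: dec_induct)
      case base
      show ?case using n1 x by simp
    next
      case (step n)
      show ?case
      proof
        assume w: "ws (Suc n) \<in> A"
        then have "ls (Suc n) \<in> A" using loser[of "Suc n"] step n1(1) by simp
        then show False using winner_stays[of n] winner_loser(3)[of "Suc n"] w step.IH by auto
      qed
    qed
    then show False using n2 \<open>c \<in> A\<close> by auto
  qed
  then show ?thesis unfolding eventually_sequentially using MA by (intro exI[of _ M]) auto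
qed

lemma B_eventually_pos: "\<exists>n\<ge>m. \<forall>a b. 0 < B m n $ a $ b"
proof -
  have "\<forall>\<^sub>F n in sequentially. \<forall>c\<in>UNIV. \<forall>a. 0 < B m n $ a $ c"
    by (intro eventually_ball_finite) (auto intro: B_column_eventually_pos simp del: rv_B.simps)
  then have "\<forall>\<^sub>F n in sequentially. m \<le> n \<and> (\<forall>c\<in>UNIV. \<forall>a. 0 < B m n $ a $ c)"
    using eventually_ge_at_top[of m] by eventually_elim simp
  from eventually_happens'[OF sequentially_bot this]
  obtain n where "m \<le> n" "\<forall>c\<in>UNIV. \<forall>a. 0 < B m n $ a $ c" by (elim exE conjE)
  then show ?thesis by (intro exI[of _ n]) simp
qed

abbreviation "nk \<equiv> rv_time T"

lemma rv_time_Suc: "nk k \<le> nk (Suc k)" "0 < B (nk k) (nk (Suc k)) $ a $ b"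
proof -
  have "nk k \<le> nk (Suc k) \<and> (\<forall>a b. 0 < B (nk k) (nk (Suc k)) $ a $ b)"
    unfolding rv_time.simps by (rule LeastI_ex) (use B_eventually_pos[of "nk k"] in blast)
  then show "nk k \<le> nk (Suc k)" "0 < B (nk k) (nk (Suc k)) $ a $ b" by blast+
qed

lemma nk_mono: "k \<le> l \<Longrightarrow> nk k \<le> nk l"
  by (rule lift_Suc_mono_le[of nk]) (rule rv_time_Suc(1))

end

declare rv_B.simps(2) [simp del] rv_time.simps(2) [simp del]

section \<open>Special Birkhoff sums\<close>

context rauzy_path
begin

abbreviation cI :: "nat \<Rightarrow> 'a \<Rightarrow> real set" where
  "cI n a \<equiv> {lft n a .. lft n a + lam n a}"

lemma inI_closed: "inI True True n a x \<longleftrightarrow> x \<in> cI n a"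
  by (simp add: inI_def btw_def)

lemma inI_imp_cI: "inI p q n a x \<Longrightarrow> x \<in> cI n a"
  by (auto simp: inI_def btw_def split: if_splits)

lemma cI_Suc:
  assumes "x \<in> cI (Suc n) a"
  shows "a \<noteq> ls n \<Longrightarrow> x \<in> cI n a"
    and "a = ls n \<Longrightarrow> x \<in> cI n (lb n)"
    and "a = ls n \<Longrightarrow> x + sh n (lb n) \<in> cI n (la n)"
  using inI_Suc[of True True n a x] assms unfolding inI_closed by iprover+

text \<open>A point of the loser's interval passes through the tower of \<open>lb n\<close> and then
  through that of \<open>la n\<close>, whence the two terms. Functions are indexed by letters
  because two neighbouring intervals may give different values at their common endpoint.\<close>

primrec SB :: "('a \<Rightarrow> real \<Rightarrow> real) \<Rightarrow> nat \<Rightarrow> 'a \<Rightarrow> real \<Rightarrow> real" where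
  "SB \<phi> 0 = \<phi>"
| "SB \<phi> (Suc n) = (\<lambda>a x. if a = ls n then SB \<phi> n (lb n) x + SB \<phi> n (la n) (x + sh n (lb n)) else SB \<phi> n a x)"

lemma SB_diff: "SB (\<lambda>a x. \<phi> a x - \<psi> a x) n a x = SB \<phi> n a x - SB \<psi> n a x"
  by (induction n arbitrary: a x) auto

lemma SB_cong:
  assumes "\<And>a x. x \<in> cI 0 a \<Longrightarrow> \<phi> a x = \<psi> a x"
  shows "x \<in> cI n a \<Longrightarrow> SB \<phi> n a x = SB \<psi> n a x"
proof (induction n arbitrary: a x)
  case (Suc n)
  show ?case using cI_Suc[OF Suc.prems] Suc.IH by auto
qed (use assms in simp)

lemma Bv_Suc:
  assumes "m \<le> n"
  shows "(B m (Suc n) *v v) $ a = (if a = ls n then (B m n *v v) $ lb n + (B m n *v v) $ la n else (B m n *v v) $ a)"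
proof -
  have "(B m (Suc n) *v v) $ a = (B m n *v v) $ a + (if a = ls n then (B m n *v v) $ ws n else 0)"
    by (simp add: matrix_vector_mult_def B_Suc_entry[OF assms] algebra_simps sum.distrib)
  then show ?thesis using winner_loser(3)[of n] by auto
qed

lemma mat_vec_const: "((A :: real^'a^'a) *v (\<chi> a. c)) $ b = c * (\<Sum>a\<in>UNIV. A $ b $ a)"
  by (simp add: matrix_vector_mult_def sum_distrib_left mult.commute)

lemma SB_const: "SB (\<lambda>a x. v $ a) n a x = (B 0 n *v v) $ a"
  by (induction n arbitrary: a x) (auto simp: Bv_Suc)

text \<open>A special sum at level n is a sum of special sums at level m, with multiplicities from
  \<open>B m n\<close>. Approximate values and error bounds are therefore carried along by the same
  nonnegative matrix.\<close>

lemma SB_close: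
  assumes "m \<le> n" "\<And>a x. x \<in> cI m a \<Longrightarrow> \<bar>SB \<phi> m a x - c $ a\<bar> \<le> E $ a"
  shows "x \<in> cI n b \<Longrightarrow> \<bar>SB \<phi> n b x - (B m n *v c) $ b\<bar> \<le> (B m n *v E) $ b"
  using assms(1)
proof (induction n arbitrary: b x rule: dec_induct)
  case base
  then show ?case using assms(2) by (simp add: B_self)
next
  case (step n)
  show ?case
  proof (cases "b = ls n")
    case True
    note c = cI_Suc(2,3)[OF step.prems True]
    show ?thesis using step.IH[OF c(1)] step.IH[OF c(2)] True by (simp add: Bv_Suc[OF step.hyps(1)])
  next
    case False
    show ?thesis using step.IH[OF cI_Suc(1)[OF step.prems False]] False
      by (simp add: Bv_Suc[OF step.hyps(1)])
  qed
qed

text \<open>The branches are translations and preserve the order, so domination of increments is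
  preserved under summation along towers. It replaces bounded variation, which would be awkward to
  add up.\<close>

lemma SB_dom:
  assumes "\<And>a x y. x \<in> cI 0 a \<Longrightarrow> y \<in> cI 0 a \<Longrightarrow> x \<le> y \<Longrightarrow> \<bar>f a y - f a x\<bar> \<le> g a y - g a x"
  shows "x \<in> cI n a \<Longrightarrow> y \<in> cI n a \<Longrightarrow> x \<le> y \<Longrightarrow> \<bar>SB f n a y - SB f n a x\<bar> \<le> SB g n a y - SB g n a x"
proof (induction n arbitrary: a x y)
  case (Suc n)
  note c = cI_Suc[OF Suc.prems(1)] cI_Suc[OF Suc.prems(2)]
  show ?case
  proof (cases "a = ls n")
    case True
    show ?thesis using Suc.IH[OF c(2)[OF True] c(5)[OF True]] Suc.IH[OF c(3)[OF True] c(6)[OF True]] Suc.prems(3) True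
      by simp
  next
    case False
    show ?thesis using Suc.IH[OF c(1)[OF False] c(4)[OF False]] Suc.prems(3) False by simp
  qed
qed (use assms in simp)

text \<open>All branches have derivative 1, so special sums commute with differentiation.\<close>

lemma SB_deriv:
  assumes "\<And>a x. x \<in> cI 0 a \<Longrightarrow> (\<phi> a has_real_derivative f a x) (at x within cI 0 a)"
  shows "x \<in> cI n a \<Longrightarrow> (SB \<phi> n a has_real_derivative SB f n a x) (at x within cI n a)"
proof (induction n arbitrary: a x)
  case (Suc n)
  note c = cI_Suc[OF Suc.prems]
  show ?case
  proof (cases "a = ls n")
    case True
    have sub: "cI (Suc n) a \<subseteq> cI n (lb n)" "(\<lambda>x. x + sh n (lb n)) ` cI (Suc n) a \<subseteq> cI n (la n)"
      using cI_Suc(2,3)[OF _ True] by blast+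
    have 1: "(SB \<phi> n (lb n) has_real_derivative SB f n (lb n) x) (at x within cI (Suc n) a)"
      using Suc.IH[OF c(2)[OF True]] sub(1) by (rule DERIV_subset)
    have "(SB \<phi> n (la n) has_real_derivative SB f n (la n) (x + sh n (lb n)))
        (at (x + sh n (lb n)) within (\<lambda>x. x + sh n (lb n)) ` cI (Suc n) a)"
      using Suc.IH[OF c(3)[OF True]] sub(2) by (rule DERIV_subset)
    moreover have "((\<lambda>x. x + sh n (lb n)) has_real_derivative 1) (at x within cI (Suc n) a)"
      by (auto intro!: derivative_eq_intros)
    ultimately have 2: "((SB \<phi> n (la n) \<circ> (\<lambda>x. x + sh n (lb n))) has_real_derivative
        SB f n (la n) (x + sh n (lb n)) * 1) (at x within cI (Suc n) a)"
      by (rule DERIV_image_chain)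
    show ?thesis using DERIV_add[OF 1 2] True by (simp add: o_def)
  next
    case False
    have sub: "cI (Suc n) a \<subseteq> cI n a" using cI_Suc(1)[OF _ False] by blast
    have "SB \<phi> (Suc n) a = SB \<phi> n a" "SB f (Suc n) a = SB f n a" using False by (simp_all add: fun_eq_iff)
    then show ?thesis using DERIV_subset[OF Suc.IH[OF c(1)[OF False]] sub] by metis
  qed
qed (use assms in simp)

lemma SB_cont:
  assumes "\<And>a. continuous_on (cI 0 a) (\<phi> a)"
  shows "continuous_on (cI n a) (SB \<phi> n a)"
proof (induction n arbitrary: a)
  case (Suc n)
  show ?case
  proof (cases "a = ls n")
    case True
    have sub: "cI (Suc n) a \<subseteq> cI n (lb n)" "(\<lambda>x. x + sh n (lb n)) ` cI (Suc n) a \<subseteq> cI n (la n)"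
      using cI_Suc(2,3)[OF _ True] by blast+
    have "continuous_on (cI (Suc n) a) (\<lambda>x. SB \<phi> n (la n) (x + sh n (lb n)))"
      by (rule continuous_on_compose2[OF Suc.IH[of "la n"] _ sub(2)]) (intro continuous_intros)
    then have "continuous_on (cI (Suc n) a) (\<lambda>x. SB \<phi> n (lb n) x + SB \<phi> n (la n) (x + sh n (lb n)))"
      by (intro continuous_on_add continuous_on_subset[OF Suc.IH sub(1)])
    then show ?thesis using True by simp
  next
    case False
    have "cI (Suc n) a \<subseteq> cI n a" using cI_Suc(1)[OF _ False] by blast
    then show ?thesis using continuous_on_subset[OF Suc.IH[of a]] False by simp
  qed
qed (use assms in simp)

section \<open>Increments, conserved totals and mean values\<close>

definition incr :: "('a \<Rightarrow> real \<Rightarrow> real) \<Rightarrow> nat \<Rightarrow> 'a \<Rightarrow> real" where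
  "incr \<phi> n a = SB \<phi> n a (lft n a + lam n a) - SB \<phi> n a (lft n a)"

text \<open>For a differentiable \<phi> this is the integral of the derivative over I(n); for a
  function that dominates the increments of another one it bounds the total variation of the
  latter.\<close>

definition tot :: "('a \<Rightarrow> real \<Rightarrow> real) \<Rightarrow> nat \<Rightarrow> real" where
  "tot \<phi> n = (\<Sum>a\<in>UNIV. incr \<phi> n a)"

lemma lft_Suc_top:
  assumes "ls n = la n"
  shows "lft (Suc n) a = (if a = la n then lft n (lb n) + lam n (lb n) - lam n (la n) else lft n a)"
  using rv_step_lft_top(1)[OF iter_good assms] by (simp add: iter_Suc)

lemma lft_Suc_bot:
  assumes "ls n = lb n"
  shows "lft (Suc n) a = lft n a"
  using rv_step_lft_bot(2)[OF iter_good assms] by (simp add: iter_Suc)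

lemma last_ends:
  "lft n (la n) + lam n (la n) = rt n" "lft n (lb n) + sh n (lb n) + lam n (lb n) = rt n"
  using tlft_last[OF iter_iet] blft_last[OF iter_iet] by (simp_all add: iet_shift_eq[OF iter_iet])

text \<open>The new intervals of the last two letters, together with the image of the loser's new
  interval under the branch of \<open>lb n\<close>, subdivide their old intervals; the increments
  telescope.\<close>

lemma tot_Suc: "tot \<phi> (Suc n) = tot \<phi> n"
proof -
  have ne: "la n \<noteq> lb n" by (rule last_neq[OF iter_good])
  have split: "(\<Sum>a\<in>UNIV. F a) = F (la n) + F (lb n) + (\<Sum>a\<in>UNIV - {la n, lb n}. F a)" for F :: "'a \<Rightarrow> real"
  proof -
    have "(\<Sum>a\<in>UNIV. F a) = F (la n) + (\<Sum>a\<in>UNIV - {la n}. F a)" by (rule sum.remove) auto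
    also have "(\<Sum>a\<in>UNIV - {la n}. F a) = F (lb n) + (\<Sum>a\<in>UNIV - {la n} - {lb n}. F a)"
      by (rule sum.remove) (use ne in auto)
    also have "UNIV - {la n} - {lb n} = UNIV - {la n, lb n}" by auto
    finally show ?thesis by simp
  qed
  have rest: "(\<Sum>a\<in>UNIV - {la n, lb n}. incr \<phi> (Suc n) a) = (\<Sum>a\<in>UNIV - {la n, lb n}. incr \<phi> n a)"
  proof (rule sum.cong)
    fix a assume "a \<in> UNIV - {la n, lb n}"
    then have a: "a \<noteq> la n" "a \<noteq> lb n" "a \<noteq> ls n" "a \<noteq> ws n" using winner_loser(3)[of n] by auto
    have "lft (Suc n) a = lft n a"
      using winner_loser(3)[of n] lft_Suc_top[of n a] lft_Suc_bot[of n a] a by auto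
    then show "incr \<phi> (Suc n) a = incr \<phi> n a" using a by (simp add: incr_def lam_Suc)
  qed simp
  have "incr \<phi> (Suc n) (la n) + incr \<phi> (Suc n) (lb n) = incr \<phi> n (la n) + incr \<phi> n (lb n)"
    using winner_loser(3)[of n]
  proof
    assume *: "ws n = lb n \<and> ls n = la n"
    then have 1: "lft (Suc n) (la n) = lft n (lb n) + lam n (lb n) - lam n (la n)" "lft (Suc n) (lb n) = lft n (lb n)"
      "lam (Suc n) (la n) = lam n (la n)" "lam (Suc n) (lb n) = lam n (lb n) - lam n (la n)"
      using ne by (simp_all add: lft_Suc_top lam_Suc)
    have 2: "lft n (lb n) + lam n (lb n) - lam n (la n) + sh n (lb n) = lft n (la n)"
      "lft n (lb n) + lam n (lb n) + sh n (lb n) = lft n (la n) + lam n (la n)"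
      using last_ends[of n] by linarith+
    show ?thesis using ne * by (simp add: incr_def 1 2 add_diff_eq)
  next
    assume *: "ws n = la n \<and> ls n = lb n"
    then have 1: "lft (Suc n) (la n) = lft n (la n)" "lft (Suc n) (lb n) = lft n (lb n)"
      "lam (Suc n) (lb n) = lam n (lb n)" "lam (Suc n) (la n) = lam n (la n) - lam n (lb n)"
      using ne by (simp_all add: lft_Suc_bot lam_Suc)
    have 2: "lft n (lb n) + sh n (lb n) = lft n (la n) + lam n (la n) - lam n (lb n)"
      "lft n (lb n) + lam n (lb n) + sh n (lb n) = lft n (la n) + lam n (la n)"
      using last_ends[of n] by linarith+
    show ?thesis using ne * by (simp add: incr_def 1 2 add_diff_eq)
  qed
  then show ?thesis unfolding tot_def split rest by simp
qed

lemma tot_eq: "tot \<phi> n = tot \<phi> 0"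
  by (induction n) (simp_all add: tot_Suc)

text \<open>As increments are integrals of derivatives, these are the mean values of the special
  sums of the derivative of \<phi>.\<close>

definition mean :: "('a \<Rightarrow> real \<Rightarrow> real) \<Rightarrow> nat \<Rightarrow> real^'a" where
  "mean \<phi> n = (\<chi> a. incr \<phi> n a / lam n a)"

lemma mean_tot: "(\<Sum>a\<in>UNIV. lam n a * mean \<phi> n $ a) = tot \<phi> 0"
proof -
  have "lam n a * mean \<phi> n $ a = incr \<phi> n a" for a using lam_pos[of n a] by (simp add: mean_def)
  then have "(\<Sum>a\<in>UNIV. lam n a * mean \<phi> n $ a) = tot \<phi> n" unfolding tot_def by simp
  then show ?thesis unfolding tot_eq[of \<phi> n] .
qed

end

text \<open>\<open>f\<close> is the derivative of \<phi>, and \<open>g\<close> plays the part of a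
  variation function of \<open>f\<close>.\<close>

locale cocycle_data = rauzy_path T for T :: "'a::finite iet" +
  fixes \<phi> f g :: "'a \<Rightarrow> real \<Rightarrow> real"
  assumes deriv: "\<And>a x. x \<in> cI 0 a \<Longrightarrow> (\<phi> a has_real_derivative f a x) (at x within cI 0 a)"
    and dom: "\<And>a x y. x \<in> cI 0 a \<Longrightarrow> y \<in> cI 0 a \<Longrightarrow> x \<le> y \<Longrightarrow> \<bar>f a y - f a x\<bar> \<le> g a y - g a x"
begin

lemma incr_g_nonneg: "0 \<le> incr g n a"
proof -
  have "\<bar>SB f n a (lft n a + lam n a) - SB f n a (lft n a)\<bar> \<le> incr g n a"
    unfolding incr_def by (rule SB_dom[OF dom]) (use lam_pos[of n a] in auto)
  then show ?thesis by linarith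
qed

lemma tot_g_nonneg: "0 \<le> tot g 0"
  unfolding tot_def by (simp add: sum_nonneg incr_g_nonneg)

text \<open>The increments of the special sums of \<open>g\<close> over the intervals of level n are
  nonnegative and add up to the conserved \<open>tot g 0\<close>; hence a bound that does not depend
  on the level.\<close>

lemma f_osc: "x \<in> cI n a \<Longrightarrow> y \<in> cI n a \<Longrightarrow> \<bar>SB f n a x - SB f n a y\<bar> \<le> tot g 0"
proof -
  have *: "\<bar>SB f n a y - SB f n a x\<bar> \<le> tot g 0" if xy: "x \<in> cI n a" "y \<in> cI n a" "x \<le> y" for x y
  proof -
    have "\<bar>SB f n a y - SB f n a x\<bar> \<le> SB g n a y - SB g n a x" by (rule SB_dom[OF dom xy])
    moreover have "\<bar>SB f n a x - SB f n a (lft n a)\<bar> \<le> SB g n a x - SB g n a (lft n a)"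
      by (rule SB_dom[OF dom]) (use xy in auto)
    moreover have "\<bar>SB f n a (lft n a + lam n a) - SB f n a y\<bar> \<le> SB g n a (lft n a + lam n a) - SB g n a y"
      by (rule SB_dom[OF dom]) (use xy in auto)
    ultimately have "\<bar>SB f n a y - SB f n a x\<bar> \<le> incr g n a" unfolding incr_def by linarith
    also have "\<dots> \<le> tot g n"
      unfolding tot_def by (rule member_le_sum) (auto simp: incr_g_nonneg)
    finally show ?thesis unfolding tot_eq[of g n] .
  qed
  show "x \<in> cI n a \<Longrightarrow> y \<in> cI n a \<Longrightarrow> ?thesis"
    using *[of x y] *[of y x] by (cases "x \<le> y") (auto simp: abs_minus_commute)
qed

lemma SB_mvt:
  assumes "x \<in> cI n a" "y \<in> cI n a" "x < y"
  shows "\<exists>z\<in>cI n a. SB \<phi> n a y - SB \<phi> n a x = (y - x) * SB f n a z"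
proof -
  have "(SB \<phi> n a has_derivative (\<lambda>h. h * SB f n a z)) (at z within {x..y})"
    if "x \<le> z" "z \<le> y" for z
  proof -
    have "(SB \<phi> n a has_real_derivative SB f n a z) (at z within {x..y})"
      by (rule DERIV_subset[OF SB_deriv[OF deriv]]) (use assms that in auto)
    then show ?thesis by (simp add: has_field_derivative_def mult_commute_abs)
  qed
  from mvt_very_simple[OF less_imp_le[OF assms(3)], of "SB \<phi> n a" "\<lambda>z h. h * SB f n a z", OF this]
  obtain z where z: "z \<in> {x..y}" "SB \<phi> n a y - SB \<phi> n a x = (y - x) * SB f n a z" by auto
  then show ?thesis using assms by (intro bexI[of _ z]) auto
qed

lemma mean_mvt: "\<exists>z\<in>cI n a. mean \<phi> n $ a = SB f n a z"
proof -
  have "\<exists>z\<in>cI n a. incr \<phi> n a = (lft n a + lam n a - lft n a) * SB f n a z"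
    unfolding incr_def by (rule SB_mvt) (use lam_pos[of n a] in auto)
  then show ?thesis using lam_pos[of n a] by (auto simp: mean_def)
qed

lemma f_mean: "x \<in> cI n a \<Longrightarrow> \<bar>SB f n a x - mean \<phi> n $ a\<bar> \<le> tot g 0"
proof -
  assume x: "x \<in> cI n a"
  obtain z where z: "z \<in> cI n a" "mean \<phi> n $ a = SB f n a z" using mean_mvt by blast
  show ?thesis unfolding z(2) by (rule f_osc[OF x z(1)])
qed

text \<open>A mean value is attained by the special sum of \<open>f\<close>, and at level m that
  function stays within \<open>tot g 0\<close> of its mean. So the means follow the matrices up to
  row sums.\<close>

lemma mean_step:
  assumes "m \<le> n"
  shows "\<bar>(mean \<phi> n - B m n *v mean \<phi> m) $ b\<bar> \<le> tot g 0 * (\<Sum>a\<in>UNIV. B m n $ b $ a)"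
proof -
  obtain z where z: "z \<in> cI n b" "mean \<phi> n $ b = SB f n b z" using mean_mvt by blast
  have "\<bar>SB f n b z - (B m n *v mean \<phi> m) $ b\<bar> \<le> (B m n *v (\<chi> a. tot g 0)) $ b"
    by (rule SB_close[OF assms _ z(1)]) (use f_mean in auto)
  then show ?thesis using z(2) by (simp add: mat_vec_const)
qed

lemma phi_osc:
  assumes "x \<in> cI n a" "y \<in> cI n a"
  shows "\<bar>SB \<phi> n a x - SB \<phi> n a y\<bar> \<le> lam n a * (\<bar>mean \<phi> n $ a\<bar> + tot g 0)"
proof -
  have *: "\<bar>SB \<phi> n a y - SB \<phi> n a x\<bar> \<le> lam n a * (\<bar>mean \<phi> n $ a\<bar> + tot g 0)"
    if xy: "x \<in> cI n a" "y \<in> cI n a" "x < y" for x y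
  proof -
    obtain z where z: "z \<in> cI n a" "SB \<phi> n a y - SB \<phi> n a x = (y - x) * SB f n a z"
      using SB_mvt[OF xy] by blast
    have "\<bar>(y - x) * SB f n a z\<bar> \<le> lam n a * (\<bar>mean \<phi> n $ a\<bar> + tot g 0)"
      unfolding abs_mult by (rule mult_mono) (use xy f_mean[OF z(1)] lam_pos[of n a] in auto)
    then show ?thesis using z(2) by simp
  qed
  have "0 \<le> lam n a * (\<bar>mean \<phi> n $ a\<bar> + tot g 0)"
    using lam_pos[of n a] tot_g_nonneg by simp
  then show ?thesis using *[of x y] *[of y x] assms by (cases x y rule: linorder_cases) (auto simp: abs_minus_commute)
qed

end

section \<open>Summing along Rokhlin towers\<close>

lemma summable_increments_limit:
  fixes x :: "nat \<Rightarrow> real"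
  assumes "\<And>k. \<bar>x (Suc k) - x k\<bar> \<le> c k" "summable c"
  shows "convergent x" "\<bar>lim x - x k\<bar> \<le> (\<Sum>j. c (j + k))"
proof -
  have sum: "summable (\<lambda>j. x (Suc (j + k)) - x (j + k))" for k
    by (rule summable_comparison_test'[OF summable_ignore_initial_segment[OF assms(2), of k]]) (use assms(1) in auto)
  have tele: "(\<Sum>j<n. x (Suc (j + k)) - x (j + k)) = x (n + k) - x k" for n k
    by (induction n) auto
  have lim: "(\<lambda>n. x (n + k) - x k) \<longlonglongrightarrow> (\<Sum>j. x (Suc (j + k)) - x (j + k))" for k
    using summable_LIMSEQ[OF sum[of k]] by (simp add: tele)
  have "(\<lambda>n. (x (n + 0) - x 0) + x 0) \<longlonglongrightarrow> (\<Sum>j. x (Suc (j + 0)) - x (j + 0)) + x 0"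
    by (rule tendsto_add[OF lim[of 0] tendsto_const])
  then show conv: "convergent x" by (auto simp: convergent_def)
  then have "(\<lambda>n. x (n + k)) \<longlonglongrightarrow> lim x" by (simp add: convergent_LIMSEQ_iff LIMSEQ_ignore_initial_segment)
  then have "(\<lambda>n. x (n + k) - x k) \<longlonglongrightarrow> lim x - x k" by (intro tendsto_diff tendsto_const)
  from LIMSEQ_unique[OF this lim[of k]] have "lim x - x k = (\<Sum>j. x (Suc (j + k)) - x (j + k))" .
  also have "\<bar>\<dots>\<bar> \<le> (\<Sum>j. \<bar>x (Suc (j + k)) - x (j + k)\<bar>)"
    by (rule summable_rabs, rule summable_comparison_test'[OF summable_ignore_initial_segment[OF assms(2), of k]])
       (use assms(1) in auto)
  also have "\<dots> \<le> (\<Sum>j. c (j + k))"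
    by (rule suminf_le[OF _ _ summable_ignore_initial_segment[OF assms(2)]])
       (use assms(1) in \<open>auto intro!: summable_comparison_test'[OF summable_ignore_initial_segment[OF assms(2), of k]]\<close>)
  finally show "\<bar>lim x - x k\<bar> \<le> (\<Sum>j. c (j + k))" .
qed

section \<open>Towers, base points and partial sums\<close>

context rauzy_path
begin

lemma inI_unique: "inI s (\<not> s) n a x \<Longrightarrow> inI s (\<not> s) n b x \<Longrightarrow> a = b"
  unfolding inI_def
  by (rule offs_disjoint[OF top_positions[OF iter_iet], of "lam n" s "\<not> s" n a "x - iet_left (rv_iter T n)"])
     (auto simp: btw_def tlft_def algebra_simps less_imp_le lam_pos split: if_splits)

lemma inI_bot_bounds: "inI p q n a x \<Longrightarrow> btw p q lt (rt n) (x + sh n a)"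
proof -
  assume "inI p q n a x"
  then have "btw p q (lft n a + sh n a) (lft n a + lam n a + sh n a) (x + sh n a)"
    unfolding inI_def by (rule btw_shift)
  then show ?thesis
    by (rule btw_mono) (use blft_bounds[OF iter_iet, of n a] in \<open>auto simp: iet_shift_eq[OF iter_iet] left_iter\<close>)
qed

lemma inI_loser:
  assumes "inI p q (Suc n) (ls n) x"
  shows "btw p q (rt (Suc n)) (rt n) (x + sh n (lb n))"
proof -
  have "btw p q (lft (Suc n) (ls n) + sh n (lb n)) (lft (Suc n) (ls n) + lam (Suc n) (ls n) + sh n (lb n)) (x + sh n (lb n))"
    using assms unfolding inI_def by (rule btw_shift)
  then show ?thesis
  proof (rule btw_mono)
    have "lft (Suc n) (ls n) = lft n (lb n) + lam n (lb n) - lam n (ls n)"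
      using winner_loser(3)[of n] by (auto simp: lft_Suc_top lft_Suc_bot)
    moreover have "lam (Suc n) (ls n) = lam n (ls n)" using winner_loser(2)[of n] by (simp add: lam_Suc)
    ultimately show "rt (Suc n) \<le> lft (Suc n) (ls n) + sh n (lb n)"
      "lft (Suc n) (ls n) + lam (Suc n) (ls n) + sh n (lb n) \<le> rt n"
      using last_ends(2)[of n] by (simp_all add: rt_Suc)
  qed
qed

definition inside :: "bool \<Rightarrow> real \<Rightarrow> real \<Rightarrow> bool" where
  "inside s x e \<longleftrightarrow> (if s then x < e else x \<le> e)"

lemma btw_inside:
  "btw s (\<not> s) l r x \<Longrightarrow> inside s x e \<Longrightarrow> btw s (\<not> s) l e x"
  "btw s (\<not> s) l r x \<Longrightarrow> \<not> inside s x e \<Longrightarrow> btw s (\<not> s) e r x"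
  "btw s (\<not> s) l r x \<Longrightarrow> inside s x r"
  "btw s (\<not> s) e r x \<Longrightarrow> \<not> inside s x e"
  by (auto simp: btw_def inside_def)

text \<open>\<open>base s n y\<close> is the point below \<open>y\<close> in the tower of height given by the return time to the
  \<open>n\<close>-th interval, and \<open>psi s \<phi> n y\<close> the Birkhoff sum of \<open>\<phi>\<close> from there to \<open>y\<close>.  The flag \<open>s\<close>
  selects the right continuous (\<open>True\<close>) or the left continuous version of the map.\<close>
primrec base :: "bool \<Rightarrow> nat \<Rightarrow> real \<Rightarrow> real" where
  "base s 0 y = y"
| "base s (Suc n) y = (if inside s (base s n y) (rt (Suc n)) then base s n y else base s n y - sh n (lb n))"

primrec psi :: "bool \<Rightarrow> ('a \<Rightarrow> real \<Rightarrow> real) \<Rightarrow> nat \<Rightarrow> real \<Rightarrow> real" where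
  "psi s \<phi> 0 y = 0"
| "psi s \<phi> (Suc n) y = (if inside s (base s n y) (rt (Suc n)) then psi s \<phi> n y
     else psi s \<phi> n y + SB \<phi> n (lb n) (base s n y - sh n (lb n)))"

lemma base_in:
  assumes "btw s (\<not> s) lt (rt 0) y"
  shows "btw s (\<not> s) lt (rt n) (base s n y)"
proof (induction n)
  case (Suc n)
  show ?case
  proof (cases "inside s (base s n y) (rt (Suc n))")
    case True
    then show ?thesis using btw_inside(1)[OF Suc] by simp
  next
    case False
    from inI_bounds[OF inI_removed(2)[OF btw_inside(2)[OF Suc False]]] show ?thesis using False by simp
  qed
qed (use assms in simp)

lemma base_removed:
  assumes "btw s (\<not> s) lt (rt 0) y" "\<not> inside s (base s n y) (rt (Suc n))"
  shows "inI s (\<not> s) n (la n) (base s n y)" "inI s (\<not> s) (Suc n) (ls n) (base s n y - sh n (lb n))"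
    "base s n y - sh n (lb n) \<in> cI n (lb n)"
proof -
  note r = inI_removed[OF btw_inside(2)[OF base_in[OF assms(1)] assms(2)]]
  show "inI s (\<not> s) n (la n) (base s n y)" "inI s (\<not> s) (Suc n) (ls n) (base s n y - sh n (lb n))" by (rule r)+
  show "base s n y - sh n (lb n) \<in> cI n (lb n)" using inI_Suc(2)[OF r(2) HOL.refl] inI_imp_cI by blast
qed

abbreviation rsum :: "nat \<Rightarrow> nat \<Rightarrow> 'a \<Rightarrow> real" where
  "rsum m n b \<equiv> (\<Sum>a\<in>UNIV. B m n $ b $ a)"

lemma rsum_eq: "rsum m n b = (B m n *v (\<chi> a. 1)) $ b"
  by (simp add: mat_vec_const)

lemma rsum_Suc: "m \<le> n \<Longrightarrow> rsum m (Suc n) b = (if b = ls n then rsum m n (lb n) + rsum m n (la n) else rsum m n b)"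
  unfolding rsum_eq by (rule Bv_Suc)

lemma rsum_ge_1: "m \<le> n \<Longrightarrow> 1 \<le> rsum m n b"
proof -
  assume mn: "m \<le> n"
  have "B m n $ b $ b \<le> rsum m n b"
    by (rule member_le_sum) (auto simp: B_nonneg[OF mn])
  then show ?thesis using B_diag[OF mn, of b] by linarith
qed

lemma rsum_le_mat_norm: "m \<le> n \<Longrightarrow> rsum m n b \<le> mat_norm (B m n)"
proof -
  assume mn: "m \<le> n"
  have "rsum m n b \<le> (\<Sum>b\<in>UNIV. rsum m n b)"
    by (rule member_le_sum) (auto simp: B_nonneg[OF mn] sum_nonneg)
  then show ?thesis by (simp add: mat_norm_def B_nonneg[OF mn])
qed

lemma SB_bound:
  assumes "m \<le> n" "\<And>a x. x \<in> cI m a \<Longrightarrow> \<bar>SB \<phi> m a x\<bar> \<le> E" "x \<in> cI n b"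
  shows "\<bar>SB \<phi> n b x\<bar> \<le> rsum m n b * E"
proof -
  have "\<bar>SB \<phi> n b x - (B m n *v 0) $ b\<bar> \<le> (B m n *v (\<chi> a. E)) $ b"
    by (rule SB_close[OF assms(1) _ assms(3)]) (use assms(2) in auto)
  then show ?thesis by (simp add: mat_vec_const mult.commute)
qed

text \<open>The partial sum added between levels m and n covers the floors of a tower below the
  current one, at most its height minus 1. The \<open>- 1\<close> closes the induction: a full tower
  over \<open>lb n\<close> plus an incomplete one over \<open>la n\<close> is an incomplete tower
  over the loser.\<close>

lemma psi_increment:
  assumes mn: "m \<le> n" and E: "\<And>a x. x \<in> cI m a \<Longrightarrow> \<bar>SB \<phi> m a x\<bar> \<le> E"
    and y: "btw s (\<not> s) lt (rt 0) y"
  shows "inI s (\<not> s) n b (base s n y) \<Longrightarrow> \<bar>psi s \<phi> n y - psi s \<phi> m y\<bar> \<le> (rsum m n b - 1) * E"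
  using mn
proof (induction n arbitrary: b rule: dec_induct)
  case base
  then show ?case by (simp add: B_self mat_def)
next
  case (step n)
  have E0: "0 \<le> E" using E[of "lft m b" b] lam_pos[of m b] by force
  show ?case
  proof (cases "inside s (base s n y) (rt (Suc n))")
    case True
    then have b: "inI s (\<not> s) (Suc n) b (base s n y)" using step.prems by simp
    have *: "\<bar>psi s \<phi> n y - psi s \<phi> m y\<bar> \<le> (rsum m (Suc n) b - 1) * E" if "inI s (\<not> s) n c (base s n y)" "rsum m n c \<le> rsum m (Suc n) b" for c
    proof -
      have "(rsum m n c - 1) * E \<le> (rsum m (Suc n) b - 1) * E" using that(2) E0 by (intro mult_right_mono) auto
      then show ?thesis using step.IH[OF that(1)] by linarith
    qed
    show ?thesis
    proof (cases "b = ls n")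
      case t: True
      show ?thesis using *[OF inI_Suc(2)[OF b t]] True rsum_Suc[OF step.hyps(1), of b] t rsum_ge_1[OF step.hyps(1), of "la n"] by simp
    next
      case f: False
      show ?thesis using *[OF inI_Suc(1)[OF b f]] True rsum_Suc[OF step.hyps(1), of b] f by simp
    qed
  next
    case False
    note r = base_removed[OF y False]
    have "b = ls n" using inI_unique[OF _ r(2)] step.prems False by simp
    then have rb: "rsum m (Suc n) b = rsum m n (lb n) + rsum m n (la n)" using rsum_Suc[OF step.hyps(1)] by simp
    have "\<bar>SB \<phi> n (lb n) (base s n y - sh n (lb n))\<bar> \<le> rsum m n (lb n) * E"
      by (rule SB_bound[OF step.hyps(1) E r(3)])
    moreover have "\<bar>psi s \<phi> n y - psi s \<phi> m y\<bar> \<le> (rsum m n (la n) - 1) * E" by (rule step.IH[OF r(1)])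
    ultimately have "\<bar>psi s \<phi> (Suc n) y - psi s \<phi> m y\<bar> \<le> rsum m n (lb n) * E + (rsum m n (la n) - 1) * E"
      using False by simp
    then show ?thesis unfolding rb by (simp add: algebra_simps)
  qed
qed

lemma psi_increment_norm:
  assumes mn: "m \<le> n" and E: "\<And>a x. x \<in> cI m a \<Longrightarrow> \<bar>SB \<phi> m a x\<bar> \<le> E"
    and y: "btw s (\<not> s) lt (rt 0) y"
  shows "\<bar>psi s \<phi> n y - psi s \<phi> m y\<bar> \<le> mat_norm (B m n) * E"
proof -
  obtain b where b: "inI s (\<not> s) n b (base s n y)" using inI_cover[OF base_in[OF y]] by blast
  have E0: "0 \<le> E" using E[of "lft m b" b] lam_pos[of m b] by force
  have "(rsum m n b - 1) * E \<le> mat_norm (B m n) * E"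
    by (rule mult_right_mono[OF _ E0]) (use rsum_le_mat_norm[OF mn, of b] in linarith)
  then show ?thesis using psi_increment[OF mn E y b] by linarith
qed

text \<open>Either \<open>y\<close> and its image lie in the same tower of level n, or
  \<open>y\<close> is on the top floor of the tower of \<open>b\<close> and its image is on the
  ground floor of the next one. In the second case the sum over the whole tower drops out.\<close>

lemma psi_cocycle:
  assumes a: "inI s (\<not> s) 0 a y"
  defines "y' \<equiv> y + sh 0 a"
  shows "base s n y' = base s n y \<and> psi s \<phi> n y' = psi s \<phi> n y + \<phi> a y \<or>
    (\<exists>b. inI s (\<not> s) n b (base s n y) \<and> base s n y' = base s n y + sh n b \<and>
         psi s \<phi> n y' = psi s \<phi> n y + \<phi> a y - SB \<phi> n b (base s n y))"
    (is "?A n \<or> ?B n")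
proof (induction n)
  case 0
  have "?B 0" by (rule exI[of _ a]) (use a in \<open>simp add: y'_def\<close>)
  then show ?case ..
next
  case (Suc n)
  have y: "btw s (\<not> s) lt (rt 0) y" "btw s (\<not> s) lt (rt 0) y'"
    unfolding y'_def by (rule inI_bounds[OF a], rule inI_bot_bounds[OF a])
  from Suc show ?case
  proof
    assume "?A n"
    then show ?thesis by simp
  next
    assume "?B n"
    then obtain b where b: "inI s (\<not> s) n b (base s n y)" "base s n y' = base s n y + sh n b"
      "psi s \<phi> n y' = psi s \<phi> n y + \<phi> a y - SB \<phi> n b (base s n y)" by blast
    show ?thesis
    proof (cases "inside s (base s n y) (rt (Suc n))")
      case True
      note k = inI_kept[OF b(1) btw_inside(1)[OF base_in[OF y(1)] True]]
      show ?thesis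
      proof (cases "b = lb n \<and> inI s (\<not> s) (Suc n) (ls n) (base s n y)")
        \<comment> \<open>The return to the n-th interval is cut off, so the two towers are now
          stacked and the second alternative turns into the first.\<close>
        case t: True
        then have "\<not> inside s (base s n y') (rt (Suc n))"
          using btw_inside(4)[OF inI_loser[of s "\<not> s" n "base s n y"]] b(2) by simp
        then show ?thesis using True b t by simp
      next
        case f: False
        then have bn: "b \<noteq> ls n" "inI s (\<not> s) (Suc n) b (base s n y)" using k by auto
        have "inside s (base s n y') (rt (Suc n))"
          using btw_inside(3)[OF inI_bot_bounds[OF bn(2)]] bn(1) b(2) by (simp add: sh_Suc)
        then have "?B (Suc n)" using True b bn by (intro exI[of _ b]) (simp add: sh_Suc)
        then show ?thesis ..
      qed
    next
      case False
      note r = base_removed[OF y(1) False]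
      have ba: "b = la n" using inI_unique[OF b(1) r(1)] .
      have "inside s (base s n y') (rt (Suc n))"
        using btw_inside(3)[OF inI_bot_bounds[OF r(2)]] b(2) ba by (simp add: sh_Suc)
      then have "?B (Suc n)" using False b ba r(2) by (intro exI[of _ "ls n"]) (simp add: sh_Suc)
      then show ?thesis ..
    qed
  qed
qed

lemma base_psi_trivial:
  assumes "btw s (\<not> s) lt (rt n) y"
  shows "m \<le> n \<Longrightarrow> base s m y = y \<and> psi s \<phi> m y = 0"
proof (induction m)
  case (Suc m)
  have "rt n \<le> rt (Suc m)" using decseqD[OF rt_decseq Suc.prems] .
  then have "inside s y (rt (Suc m))" using assms by (auto simp: inside_def btw_def split: if_splits)
  then show ?case using Suc by simp
qed simp

definition side :: "bool \<Rightarrow> real \<Rightarrow> real set" where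
  "side s y = (if s then {y..} else {..y})"

lemma eventually_side_btw:
  assumes "btw s (\<not> s) l r y"
  shows "\<forall>\<^sub>F t in at y within side s y. btw s (\<not> s) l r t"
proof (cases s)
  case True
  then have "\<forall>\<^sub>F t in at y within side s y. t < r"
    using assms by (intro order_tendstoD(2)[OF tendsto_ident_at]) (auto simp: btw_def)
  moreover have "\<forall>\<^sub>F t in at y within side s y. t \<in> side s y" by (simp add: eventually_at_filter)
  ultimately show ?thesis by eventually_elim (use assms True in \<open>auto simp: btw_def side_def\<close>)
next
  case False
  then have "\<forall>\<^sub>F t in at y within side s y. l < t"
    using assms by (intro order_tendstoD(1)[OF tendsto_ident_at]) (auto simp: btw_def)
  moreover have "\<forall>\<^sub>F t in at y within side s y. t \<in> side s y" by (simp add: eventually_at_filter)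
  ultimately show ?thesis by eventually_elim (use assms False in \<open>auto simp: btw_def side_def\<close>)
qed

lemma eventually_side_inside:
  assumes ev: "\<forall>\<^sub>F t in at y within side s y. h t = h y + (t - y)"
  shows "\<forall>\<^sub>F t in at y within side s y. inside s (h t) e = inside s (h y) e"
proof -
  have side: "\<forall>\<^sub>F t in at y within side s y. t \<in> side s y" by (simp add: eventually_at_filter)
  have lim: "((\<lambda>t. h y + (t - y)) \<longlongrightarrow> h y + (y - y)) (at y within side s y)"
    by (intro tendsto_intros)
  consider "s" "h y < e" | "s" "e \<le> h y" | "\<not> s" "h y \<le> e" | "\<not> s" "e < h y" by linarith
  then show ?thesis
  proof cases
    case 1
    have "\<forall>\<^sub>F t in at y within side s y. h y + (t - y) < e" using 1 by (intro order_tendstoD(2)[OF lim]) simp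
    with ev show ?thesis by eventually_elim (use 1 in \<open>auto simp: inside_def\<close>)
  next
    case 2
    from ev side show ?thesis by eventually_elim (use 2 in \<open>auto simp: inside_def side_def\<close>)
  next
    case 3
    from ev side show ?thesis by eventually_elim (use 3 in \<open>auto simp: inside_def side_def\<close>)
  next
    case 4
    have "\<forall>\<^sub>F t in at y within side s y. e < h y + (t - y)" using 4 by (intro order_tendstoD(1)[OF lim]) simp
    with ev show ?thesis by eventually_elim (use 4 in \<open>auto simp: inside_def\<close>)
  qed
qed

text \<open>On the side \<open>s\<close> of \<open>y\<close> each test \<open>inside\<close> is
  locally constant, so the base point moves rigidly with \<open>y\<close> and the partial sums are
  finite sums of continuous functions.\<close>

lemma psi_side_continuous:
  assumes cont: "\<And>a. continuous_on (cI 0 a) (\<phi> a)" and y: "btw s (\<not> s) lt (rt 0) y"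
  shows "(\<forall>\<^sub>F t in at y within side s y. base s n t = base s n y + (t - y)) \<and>
    (psi s \<phi> n \<longlongrightarrow> psi s \<phi> n y) (at y within side s y)"
proof (induction n)
  case 0
  show ?case by simp
next
  case (Suc n)
  then have ev: "\<forall>\<^sub>F t in at y within side s y. base s n t = base s n y + (t - y)"
    and lim: "(psi s \<phi> n \<longlongrightarrow> psi s \<phi> n y) (at y within side s y)" by auto
  note ins = eventually_side_inside[OF ev, of "rt (Suc n)"]
  have ev': "\<forall>\<^sub>F t in at y within side s y. base s (Suc n) t = base s (Suc n) y + (t - y)"
    using ev ins by eventually_elim auto
  show ?case
  proof (cases "inside s (base s n y) (rt (Suc n))")
    case True
    have "\<forall>\<^sub>F t in at y within side s y. psi s \<phi> n t = psi s \<phi> (Suc n) t"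
      using ins by eventually_elim (use True in simp)
    then have "(psi s \<phi> (Suc n) \<longlongrightarrow> psi s \<phi> n y) (at y within side s y)"
      by (rule Lim_transform_eventually[OF lim])
    then show ?thesis using ev' True by (simp del: base.simps psi.simps(2)) (simp add: psi.simps(2))
  next
    case False
    let ?g = "\<lambda>t. base s n y + (t - y) - sh n (lb n)"
    have "(?g \<longlongrightarrow> base s n y + (y - y) - sh n (lb n)) (at y within side s y)" by (intro tendsto_intros)
    then have g: "(?g \<longlongrightarrow> base s n y - sh n (lb n)) (at y within side s y)" by simp
    have "\<forall>\<^sub>F t in at y within side s y. ?g t \<in> cI n (lb n)"
      using ev ins eventually_side_btw[OF y]
    proof eventually_elim
      case (elim t)
      then show ?case using base_removed(3)[OF elim(3), of n] False by simp
    qed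
    then have "((\<lambda>t. SB \<phi> n (lb n) (?g t)) \<longlongrightarrow> SB \<phi> n (lb n) (base s n y - sh n (lb n))) (at y within side s y)"
      by (rule continuous_on_tendsto_compose[OF SB_cont[OF cont] g base_removed(3)[OF y False]])
    from tendsto_add[OF lim this]
    have "((\<lambda>t. psi s \<phi> n t + SB \<phi> n (lb n) (?g t)) \<longlongrightarrow> psi s \<phi> (Suc n) y) (at y within side s y)"
      using False by simp
    moreover have "\<forall>\<^sub>F t in at y within side s y. psi s \<phi> n t + SB \<phi> n (lb n) (?g t) = psi s \<phi> (Suc n) t"
      using ev ins by eventually_elim (use False in simp)
    ultimately have "(psi s \<phi> (Suc n) \<longlongrightarrow> psi s \<phi> (Suc n) y) (at y within side s y)"
      by (rule Lim_transform_eventually)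
    then show ?thesis using ev' by blast
  qed
qed

end

section \<open>The limit of the partial sums and the solution\<close>

context rauzy_path
begin

abbreviation Z :: "nat \<Rightarrow> real" where
  "Z k \<equiv> mat_norm (B (nk k) (nk (Suc k)))"

definition psi_lim :: "bool \<Rightarrow> ('a \<Rightarrow> real \<Rightarrow> real) \<Rightarrow> real \<Rightarrow> real" where
  "psi_lim s \<phi> y = lim (\<lambda>k. psi s \<phi> (nk k) y)"

text \<open>At the right end of the interval only the left continuous version makes sense; the value
  0 outside is the encoding of functions on a set.\<close>

definition sol :: "('a \<Rightarrow> real \<Rightarrow> real) \<Rightarrow> real \<Rightarrow> real" where
  "sol \<phi> x = (if lt \<le> x \<and> x < rt 0 then psi_lim True \<phi> x else if x = rt 0 then psi_lim False \<phi> x else 0)"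

lemma Z_ge_1: "1 \<le> Z k"
  using rsum_ge_1[OF rv_time_Suc(1)] rsum_le_mat_norm[OF rv_time_Suc(1)] by (rule order_trans)

lemma inI_interior:
  assumes "lft n a < x" "x < lft n a + lam n a"
  shows "inI p q n a x"
  using assms by (auto simp: inI_def btw_def)

end

locale summable_cocycle = rauzy_path T for T :: "'a::finite iet" +
  fixes \<phi> :: "'a \<Rightarrow> real \<Rightarrow> real" and E :: "nat \<Rightarrow> real"
  assumes cont: "\<And>a. continuous_on (cI 0 a) (\<phi> a)"
    and E: "\<And>k a x. x \<in> cI (nk k) a \<Longrightarrow> \<bar>SB \<phi> (nk k) a x\<bar> \<le> E k"
    and sum: "summable (\<lambda>k. Z k * E k)"
begin

definition rem :: "nat \<Rightarrow> real" where "rem k = (\<Sum>j. Z (j + k) * E (j + k))"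

lemma rem_tendsto_0: "rem \<longlonglongrightarrow> 0"
  unfolding rem_def using suminf_exist_split2[OF sum] by simp

lemma E_nonneg: "0 \<le> E k"
  using E[of "lft (nk k) undefined" k undefined] lam_pos[of "nk k" undefined] by force

lemma E_tendsto_0: "E \<longlonglongrightarrow> 0"
proof (rule Lim_null_comparison[OF _ summable_LIMSEQ_zero[OF sum]])
  have "E k \<le> Z k * E k" for k
    using mult_right_mono[OF Z_ge_1[of k] E_nonneg[of k]] by simp
  then show "\<forall>\<^sub>F k in sequentially. norm (E k) \<le> Z k * E k"
    using E_nonneg by (intro always_eventually) auto
qed

lemma psi_lim_conv:
  assumes y: "btw s (\<not> s) lt (rt 0) y"
  shows "(\<lambda>k. psi s \<phi> (nk k) y) \<longlonglongrightarrow> psi_lim s \<phi> y" "\<bar>psi_lim s \<phi> y - psi s \<phi> (nk k) y\<bar> \<le> rem k"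
proof -
  have inc: "\<bar>psi s \<phi> (nk (Suc k)) y - psi s \<phi> (nk k) y\<bar> \<le> Z k * E k" for k
    by (rule psi_increment_norm[OF rv_time_Suc(1) E y])
  note L = summable_increments_limit[of "\<lambda>k. psi s \<phi> (nk k) y", OF inc sum]
  show "(\<lambda>k. psi s \<phi> (nk k) y) \<longlonglongrightarrow> psi_lim s \<phi> y"
    unfolding psi_lim_def using L(1) by (simp add: convergent_LIMSEQ_iff)
  show "\<bar>psi_lim s \<phi> y - psi s \<phi> (nk k) y\<bar> \<le> rem k"
    unfolding psi_lim_def rem_def by (rule L(2))
qed

text \<open>Points of the k-th interval are their own base points, so their partial sum up to level
  k is empty and the limit is a tail of the series.\<close>

lemma psi_lim_bound:
  assumes "btw s (\<not> s) lt (rt (nk k)) y"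
  shows "\<bar>psi_lim s \<phi> y\<bar> \<le> rem k"
proof -
  have "btw s (\<not> s) lt (rt 0) y"
    using btw_mono[OF assms order_refl] decseqD[OF rt_decseq, of 0 "nk k"] by simp
  from psi_lim_conv(2)[OF this, of k] show ?thesis using base_psi_trivial[OF assms order_refl] by simp
qed

lemma psi_lim_cocycle_0:
  assumes a: "inI s (\<not> s) 0 a y"
  shows "psi_lim s \<phi> (y + sh 0 a) = psi_lim s \<phi> y + \<phi> a y"
proof -
  have y: "btw s (\<not> s) lt (rt 0) y" "btw s (\<not> s) lt (rt 0) (y + sh 0 a)"
    by (rule inI_bounds[OF a], rule inI_bot_bounds[OF a])
  have "\<bar>psi s \<phi> (nk k) (y + sh 0 a) - (psi s \<phi> (nk k) y + \<phi> a y)\<bar> \<le> E k" for k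
    using psi_cocycle[OF a, of "nk k" \<phi>]
  proof (elim disjE exE conjE)
    assume "psi s \<phi> (nk k) (y + sh 0 a) = psi s \<phi> (nk k) y + \<phi> a y"
    then show ?thesis using E_nonneg by simp
  next
    fix b assume "inI s (\<not> s) (nk k) b (base s (nk k) y)"
      "psi s \<phi> (nk k) (y + sh 0 a) = psi s \<phi> (nk k) y + \<phi> a y - SB \<phi> (nk k) b (base s (nk k) y)"
    then show ?thesis using E[OF inI_imp_cI] by simp
  qed
  then have "(\<lambda>k. psi s \<phi> (nk k) (y + sh 0 a) - (psi s \<phi> (nk k) y + \<phi> a y)) \<longlonglongrightarrow> 0"
    by (intro Lim_null_comparison[OF _ E_tendsto_0] always_eventually) auto
  moreover have "(\<lambda>k. psi s \<phi> (nk k) (y + sh 0 a) - (psi s \<phi> (nk k) y + \<phi> a y)) \<longlonglongrightarrow>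
      psi_lim s \<phi> (y + sh 0 a) - (psi_lim s \<phi> y + \<phi> a y)"
    by (intro tendsto_intros psi_lim_conv(1) y)
  ultimately show ?thesis using LIMSEQ_unique by fastforce
qed

lemma psi_lim_cocycle:
  "inI s (\<not> s) n a y \<Longrightarrow> psi_lim s \<phi> (y + sh n a) = psi_lim s \<phi> y + SB \<phi> n a y"
proof (induction n arbitrary: a y)
  case 0
  then show ?case using psi_lim_cocycle_0 by simp
next
  case (Suc n)
  note c = inI_Suc[OF Suc.prems]
  show ?case
  proof (cases "a = ls n")
    case True
    show ?thesis using Suc.IH[OF c(2)[OF True]] Suc.IH[OF c(3)[OF True]] True
      by (simp add: sh_Suc add.assoc)
  next
    case False
    show ?thesis using Suc.IH[OF c(1)[OF False]] False by (simp add: sh_Suc)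
  qed
qed

definition jump :: "real \<Rightarrow> real" where
  "jump z = psi_lim True \<phi> z - psi_lim False \<phi> z"

text \<open>At an interior point both one-sided versions follow the same branch and gain the same
  special sum.\<close>

lemma jump_invariant:
  assumes "lft n a < z" "z < lft n a + lam n a"
  shows "jump (z + sh n a) = jump z"
  using psi_lim_cocycle[of True n a z] psi_lim_cocycle[of False n a z] inI_interior[OF assms]
  by (simp add: jump_def)

text \<open>A jump at any point recurs at some interior point of every interval of the induction, where
  \<open>psi_lim\<close> is small.\<close>
lemma jump_descend:
  assumes "lt < z" "z < rt 0"
  shows "\<exists>z'. lt < z' \<and> z' < rt n \<and> jump z' = jump z"
proof (induction n)
  case 0
  then show ?case using assms by blast
next
  case (Suc n)
  then obtain w where w: "lt < w" "w < rt n" "jump w = jump z" by blast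
  show ?case
  proof (cases "w < rt (Suc n)")
    case True
    then show ?thesis using w by blast
  next
    case False
    \<comment> \<open>The point \<open>w\<close> has been cut off; \<open>c\<close> is the point of
      the loser's new interval whose orbit returns through \<open>w\<close>.\<close>
    define c where "c = w - sh n (lb n)"
    have r: "inI True False n (la n) w" "inI True False (Suc n) (ls n) c"
      using inI_removed[of True False n w] False w by (auto simp: btw_def c_def)
    have c1: "lft n (lb n) \<le> c" "c < lft n (lb n) + lam n (lb n)"
      using inI_Suc(2)[OF r(2)] by (auto simp: inI_def btw_def)
    have c2: "c < rt (Suc n)" using inI_bounds[OF r(2)] by (simp add: btw_def)
    have c3: "lt \<le> lft n (lb n)" using tlft_bounds(1)[OF iter_iet, of n "lb n"] by (simp add: left_iter)
    show ?thesis
    proof (cases "lft n (lb n) < c")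
      case True
      then have "jump (c + sh n (lb n)) = jump c" using c1 by (intro jump_invariant)
      then have "jump c = jump z" using w by (simp add: c_def)
      then show ?thesis using True c2 c3 by (intro exI[of _ c]) auto
    next
      case eq: False
      then have ce: "c = lft n (lb n)" using c1 by simp
      \<comment> \<open>If the top letter lost, its new interval would start strictly inside that of
        \<open>lb n\<close>, and \<open>c\<close> could not be the left endpoint.\<close>
      have "ls n \<noteq> la n"
      proof
        assume l: "ls n = la n"
        then have "lam n (la n) < lam n (lb n)" using winner_loser(1,3)[of n] last_neq[OF iter_good, of n] by auto
        then show False using r(2) ce l by (simp add: inI_def btw_def lft_Suc_top)
      qed
      then have l: "ls n = lb n" "ws n = la n" using winner_loser(3)[of n] by auto
      have len: "0 < lam n (lb n)" "lam n (lb n) < lam n (la n)" using winner_loser(1)[of n] lam_pos l by auto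
      have we: "w = rt n - lam n (lb n)" using ce last_ends(2)[of n] by (simp add: c_def)
      \<comment> \<open>At an endpoint no invariance is available, so move forward instead:
        \<open>w\<close> is interior to the interval of \<open>la n\<close>, and its image, the
        return of \<open>c\<close>, lies in the shortened interval.\<close>
      have "jump (w + sh n (la n)) = jump w"
        by (rule jump_invariant) (use we len last_ends(1)[of n] in linarith)+
      moreover have wc: "w + sh n (la n) = c + sh (Suc n) (ls n)" by (simp add: sh_Suc c_def)
      have "lt < w + sh n (la n)"
        using we len last_ends(1)[of n] blft_bounds(1)[OF iter_iet, of n "la n"]
        by (simp add: iet_shift_eq[OF iter_iet] left_iter)
      moreover have "w + sh n (la n) < rt (Suc n)"
        unfolding wc using inI_bot_bounds[OF r(2)] by (simp add: btw_def)
      ultimately show ?thesis using w by metis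
    qed
  qed
qed

lemma no_jump:
  assumes z: "lt < z" "z < rt 0"
  shows "psi_lim True \<phi> z = psi_lim False \<phi> z"
proof -
  have "\<bar>jump z\<bar> \<le> 2 * rem k" for k
  proof -
    obtain w where w: "lt < w" "w < rt (nk k)" "jump w = jump z" using jump_descend[OF z] by blast
    have "\<bar>psi_lim True \<phi> w\<bar> \<le> rem k" "\<bar>psi_lim False \<phi> w\<bar> \<le> rem k"
      by (rule psi_lim_bound; use w in \<open>simp add: btw_def\<close>)+
    then have "\<bar>jump w\<bar> \<le> 2 * rem k" unfolding jump_def by linarith
    then show ?thesis by (simp add: w(3))
  qed
  then have ev: "\<exists>N. \<forall>k\<ge>N. \<bar>jump z\<bar> \<le> 2 * rem k" by blast
  have "(\<lambda>k. 2 * rem k) \<longlonglongrightarrow> 2 * 0" by (intro tendsto_intros rem_tendsto_0)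
  from LIMSEQ_le_const[OF this ev] have "\<bar>jump z\<bar> \<le> 2 * 0" .
  then show ?thesis by (simp add: jump_def)
qed

lemma psi_lim_side_continuous:
  assumes y: "btw s (\<not> s) lt (rt 0) y"
  shows "(psi_lim s \<phi> \<longlongrightarrow> psi_lim s \<phi> y) (at y within side s y)"
proof (rule tendstoI)
  fix e :: real assume e: "0 < e"
  have "\<forall>\<^sub>F k in sequentially. rem k < e / 3"
    using order_tendstoD(2)[OF rem_tendsto_0, of "e / 3"] e by simp
  then obtain k where k: "rem k < e / 3" using eventually_happens'[OF sequentially_bot] by blast
  have "(psi s \<phi> (nk k) \<longlongrightarrow> psi s \<phi> (nk k) y) (at y within side s y)"
    using psi_side_continuous[OF cont y] by blast
  then have "\<forall>\<^sub>F t in at y within side s y. dist (psi s \<phi> (nk k) t) (psi s \<phi> (nk k) y) < e / 3"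
    using e by (intro tendstoD) auto
  with eventually_side_btw[OF y]
  show "\<forall>\<^sub>F t in at y within side s y. dist (psi_lim s \<phi> t) (psi_lim s \<phi> y) < e"
  proof eventually_elim
    case (elim t)
    then show ?case using psi_lim_conv(2)[OF y, of k] psi_lim_conv(2)[OF elim(1), of k] k
      unfolding dist_real_def by linarith
  qed
qed

lemma sol_eq_psi_lim:
  assumes "btw s (\<not> s) lt (rt 0) y"
  shows "sol \<phi> y = psi_lim s \<phi> y"
proof (cases s)
  case True
  then show ?thesis using assms by (simp add: sol_def btw_def)
next
  case False
  then show ?thesis using assms no_jump[of y] by (cases "y = rt 0") (simp_all add: sol_def btw_def)
qed

lemma sol_bound: "\<bar>sol \<phi> x\<bar> \<le> rem 0"
proof (cases "lt \<le> x \<and> x \<le> rt 0")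
  case True
  then consider "btw True False lt (rt 0) x" | "btw False True lt (rt 0) x"
    using lt_less_rt[of 0] by (auto simp: btw_def le_less)
  then show ?thesis
  proof cases
    case 1
    then show ?thesis using sol_eq_psi_lim[of True x] psi_lim_bound[of True 0 x] by simp
  next
    case 2
    then show ?thesis using sol_eq_psi_lim[of False x] psi_lim_bound[of False 0 x] by simp
  qed
next
  case False
  have "0 \<le> rem 0" unfolding rem_def
  proof (rule suminf_nonneg)
    show "0 \<le> Z (j + 0) * E (j + 0)" for j
      using Z_ge_1[of j] E_nonneg[of j] by simp
  qed (use sum in simp)
  then show ?thesis using False lt_less_rt[of 0] by (auto simp: sol_def)
qed

lemma sol_continuous: "continuous_on {lt..rt 0} (sol \<phi>)"
  unfolding continuous_on_def
proof
  fix y assume y: "y \<in> {lt..rt 0}"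
  have side: "(sol \<phi> \<longlongrightarrow> sol \<phi> y) (at y within side s y)" if b: "btw s (\<not> s) lt (rt 0) y" for s
  proof -
    have "\<forall>\<^sub>F t in at y within side s y. psi_lim s \<phi> t = sol \<phi> t"
      using eventually_side_btw[OF b] by eventually_elim (simp add: sol_eq_psi_lim)
    with psi_lim_side_continuous[OF b] show ?thesis
      unfolding sol_eq_psi_lim[OF b] by (rule Lim_transform_eventually)
  qed
  have 1: "(sol \<phi> \<longlongrightarrow> sol \<phi> y) (at y within {lt..rt 0} \<inter> {y..})"
  proof (cases "y = rt 0")
    case True
    then have eq: "{lt..rt 0} \<inter> {y..} = {y}" using y by auto
    show ?thesis unfolding eq by (simp add: at_within_def)
  next
    case False
    then have "(sol \<phi> \<longlongrightarrow> sol \<phi> y) (at y within side True y)" using y by (intro side) (auto simp: btw_def)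
    then show ?thesis by (rule tendsto_within_subset) (auto simp: side_def)
  qed
  have 2: "(sol \<phi> \<longlongrightarrow> sol \<phi> y) (at y within {lt..rt 0} \<inter> {..y})"
  proof (cases "y = lt")
    case True
    then have eq: "{lt..rt 0} \<inter> {..y} = {y}" using y by auto
    show ?thesis unfolding eq by (simp add: at_within_def)
  next
    case False
    then have "(sol \<phi> \<longlongrightarrow> sol \<phi> y) (at y within side False y)" using y by (intro side) (auto simp: btw_def)
    then show ?thesis by (rule tendsto_within_subset) (auto simp: side_def)
  qed
  have eq: "{lt..rt 0} \<inter> {y..} \<union> {lt..rt 0} \<inter> {..y} = {lt..rt 0}" by auto
  have "(sol \<phi> \<longlongrightarrow> sol \<phi> y) (at y within {lt..rt 0} \<inter> {y..} \<union> {lt..rt 0} \<inter> {..y})"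
    using 1 2 unfolding Lim_within_Un ..
  then show "(sol \<phi> \<longlongrightarrow> sol \<phi> y) (at y within {lt..rt 0})" unfolding eq .
qed

text \<open>The equation passes to the limit at interior points; the endpoints, where one has to use
  the branch of \<open>a\<close> itself, follow by continuity.\<close>

lemma sol_cocycle:
  assumes x: "x \<in> cI 0 a"
  shows "sol \<phi> (x + sh 0 a) - sol \<phi> x = \<phi> a x"
proof -
  let ?S = "{lft 0 a <..< lft 0 a + lam 0 a}"
  have cl: "closure ?S = cI 0 a" using lam_pos[of 0 a] by simp
  have "continuous_on (cI 0 a) (\<lambda>x. sol \<phi> (x + sh 0 a) - sol \<phi> x - \<phi> a x)"
  proof (intro continuous_on_diff cont)
    show "continuous_on (cI 0 a) (\<lambda>x. sol \<phi> (x + sh 0 a))"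
    proof (rule continuous_on_compose2[OF sol_continuous])
      show "(\<lambda>x. x + sh 0 a) ` cI 0 a \<subseteq> {lt..rt 0}"
        using inI_bot_bounds[of True True 0 a] by (auto simp: inI_closed btw_def)
    qed (intro continuous_intros)
    show "continuous_on (cI 0 a) (sol \<phi>)"
    proof (rule continuous_on_subset[OF sol_continuous])
      show "cI 0 a \<subseteq> {lt..rt 0}" using inI_bounds[of True True 0 a] by (auto simp: inI_closed btw_def)
    qed
  qed
  moreover have "sol \<phi> (x + sh 0 a) - sol \<phi> x - \<phi> a x = 0" if "x \<in> ?S" for x
  proof -
    have i: "inI True (\<not> True) 0 a x" by (rule inI_interior) (use that in auto)
    show ?thesis using psi_lim_cocycle_0[OF i] sol_eq_psi_lim[OF inI_bounds[OF i]]
        sol_eq_psi_lim[OF inI_bot_bounds[OF i]] by simp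
  qed
  ultimately have "sol \<phi> (x + sh 0 a) - sol \<phi> x - \<phi> a x = 0"
    using continuous_constant_on_closure[of ?S "\<lambda>x. sol \<phi> (x + sh 0 a) - sol \<phi> x - \<phi> a x" 0 x] x
    unfolding cl by blast
  then show ?thesis by simp
qed

end

context rauzy_path
begin

lemma psi_lincomb: "psi s (\<lambda>a x. c * \<phi> a x + e * \<xi> a x) n y = c * psi s \<phi> n y + e * psi s \<xi> n y"
proof -
  have SB: "SB (\<lambda>a x. c * \<phi> a x + e * \<xi> a x) n a x = c * SB \<phi> n a x + e * SB \<xi> n a x" for n a x
    by (induction n arbitrary: a x) (auto simp: algebra_simps)
  show ?thesis by (induction n) (auto simp: SB algebra_simps)
qed

lemma sol_lincomb:
  assumes "summable_cocycle T \<phi> E" "summable_cocycle T \<xi> F"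
  shows "sol (\<lambda>a x. c * \<phi> a x + e * \<xi> a x) x = c * sol \<phi> x + e * sol \<xi> x"
proof -
  have "psi_lim s (\<lambda>a x. c * \<phi> a x + e * \<xi> a x) x = c * psi_lim s \<phi> x + e * psi_lim s \<xi> x"
    if "btw s (\<not> s) lt (rt 0) x" for s
  proof -
    have "(\<lambda>k. c * psi s \<phi> (nk k) x + e * psi s \<xi> (nk k) x) \<longlonglongrightarrow> c * psi_lim s \<phi> x + e * psi_lim s \<xi> x"
      by (intro tendsto_intros summable_cocycle.psi_lim_conv(1)[OF _ that, OF assms(1)]
          summable_cocycle.psi_lim_conv(1)[OF _ that, OF assms(2)])
    then show ?thesis by (simp add: psi_lim_def[of _ "\<lambda>a x. c * \<phi> a x + e * \<xi> a x"] psi_lincomb limI)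
  qed
  from this[of True] this[of False] show ?thesis using lt_less_rt[of 0] by (auto simp: sol_def btw_def)
qed

end

section \<open>Matrix norms and growth\<close>

lemma mat_norm_nonneg: "0 \<le> mat_norm A"
  by (simp add: mat_norm_def sum_nonneg)

lemma entry_le_mat_norm: "\<bar>A $ i $ j\<bar> \<le> mat_norm A"
proof -
  have "\<bar>A $ i $ j\<bar> \<le> (\<Sum>j\<in>UNIV. \<bar>A $ i $ j\<bar>)" by (rule member_le_sum) auto
  also have "\<dots> \<le> mat_norm A" unfolding mat_norm_def
    by (rule member_le_sum[where f = "\<lambda>i. \<Sum>j\<in>UNIV. \<bar>A $ i $ j\<bar>"]) (auto simp: sum_nonneg)
  finally show ?thesis .
qed

lemma norm_matrix_vector_le: "norm ((A :: real^'n^'m) *v v) \<le> mat_norm A * norm v"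
proof -
  have "norm (A *v v) \<le> (\<Sum>i\<in>UNIV. \<bar>(A *v v) $ i\<bar>)" by (rule norm_le_l1_cart)
  also have "\<dots> \<le> (\<Sum>i\<in>UNIV. \<Sum>j\<in>UNIV. \<bar>A $ i $ j\<bar> * norm v)"
  proof (rule sum_mono)
    fix i
    have "\<bar>(A *v v) $ i\<bar> \<le> (\<Sum>j\<in>UNIV. \<bar>A $ i $ j * v $ j\<bar>)"
      unfolding matrix_vector_mult_def by simp
    also have "\<dots> \<le> (\<Sum>j\<in>UNIV. \<bar>A $ i $ j\<bar> * norm v)"
      by (rule sum_mono) (simp add: abs_mult mult_left_mono component_le_norm_cart)
    finally show "\<bar>(A *v v) $ i\<bar> \<le> (\<Sum>j\<in>UNIV. \<bar>A $ i $ j\<bar> * norm v)" .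
  qed
  finally show ?thesis by (simp add: mat_norm_def sum_distrib_right)
qed

text \<open>Every product in the Leibniz formula takes exactly one factor from column
  \<open>k\<close>. Keeping one column apart serves both Cramer's rule and the volume argument for
  zero-mean vectors.\<close>

lemma det_column_bound:
  fixes X :: "real^'a::finite^'a"
  assumes c: "\<And>i. \<bar>X $ i $ k\<bar> \<le> c" and M: "\<And>i j. j \<noteq> k \<Longrightarrow> \<bar>X $ i $ j\<bar> \<le> M"
  shows "\<bar>det X\<bar> \<le> fact CARD('a) * c * M ^ (CARD('a) - 1)"
proof -
  have "\<bar>det X\<bar> \<le> (\<Sum>p\<in>{p. p permutes (UNIV :: 'a set)}. \<bar>of_int (sign p) * (\<Prod>i\<in>UNIV. X $ i $ p i)\<bar>)"
    unfolding det_def by (rule sum_abs)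
  also have "\<dots> \<le> (\<Sum>p\<in>{p. p permutes (UNIV :: 'a set)}. c * M ^ (CARD('a) - 1))"
  proof (rule sum_mono)
    fix p assume "p \<in> {p. p permutes (UNIV :: 'a set)}"
    then have p: "p permutes UNIV" by simp
    define i0 where "i0 = inv p k"
    have i0: "p i0 = k" unfolding i0_def using permutes_inverses(1)[OF p] by simp
    have other: "p i \<noteq> k" if "i \<noteq> i0" for i
      using that permutes_inj[OF p] i0 by (metis injD)
    have "\<bar>of_int (sign p) * (\<Prod>i\<in>UNIV. X $ i $ p i)\<bar> = (\<Prod>i\<in>UNIV. \<bar>X $ i $ p i\<bar>)"
      by (simp add: abs_mult abs_prod sign_def)
    also have "\<dots> = \<bar>X $ i0 $ p i0\<bar> * (\<Prod>i\<in>UNIV - {i0}. \<bar>X $ i $ p i\<bar>)"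
      by (rule prod.remove) auto
    also have "\<dots> \<le> c * (\<Prod>i\<in>UNIV - {i0}. M)"
    proof (rule mult_mono)
      show "\<bar>X $ i0 $ p i0\<bar> \<le> c" using c i0 by simp
      show "(\<Prod>i\<in>UNIV - {i0}. \<bar>X $ i $ p i\<bar>) \<le> (\<Prod>i\<in>UNIV - {i0}. M)"
        by (rule prod_mono) (use other M in auto)
      show "0 \<le> c" using c[of i0] by linarith
    qed (auto intro: prod_nonneg)
    also have "(\<Prod>i\<in>UNIV - {i0}. M) = M ^ (CARD('a) - 1)" by simp
    finally show "\<bar>of_int (sign p) * (\<Prod>i\<in>UNIV. X $ i $ p i)\<bar> \<le> c * M ^ (CARD('a) - 1)" .
  qed
  also have "\<dots> = fact CARD('a) * c * M ^ (CARD('a) - 1)"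
    by (simp add: card_permutations)
  finally show ?thesis .
qed

text \<open>Cramer's rule with denominator 1: each unknown is a determinant with one column replaced
  by \<open>A *v x\<close>. This is the origin of the exponent d - 1 in all pull-backs.\<close>

lemma norm_le_inverse_bound:
  fixes A :: "real^'a::finite^'a"
  assumes "det A = 1"
  shows "norm x \<le> real CARD('a) * fact CARD('a) * mat_norm A ^ (CARD('a) - 1) * norm (A *v x)"
proof -
  define y where "y = A *v x"
  have x: "x = (\<chi> k. det (\<chi> i j. if j = k then y $ i else A $ i $ j) / det A)"
    using cramer[of A x y] assms y_def by simp
  have "\<bar>x $ k\<bar> \<le> fact CARD('a) * norm y * mat_norm A ^ (CARD('a) - 1)" for k
  proof -
    have "x $ k = det (\<chi> i j. if j = k then y $ i else A $ i $ j)"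
      by (subst x) (simp add: assms)
    then show ?thesis
      using det_column_bound[of "\<chi> i j. if j = k then y $ i else A $ i $ j" k "norm y" "mat_norm A"]
      by (simp add: component_le_norm_cart entry_le_mat_norm)
  qed
  then have "(\<Sum>k\<in>UNIV. \<bar>x $ k\<bar>) \<le> (\<Sum>k\<in>(UNIV :: 'a set). fact CARD('a) * norm y * mat_norm A ^ (CARD('a) - 1))"
    by (intro sum_mono) auto
  then show ?thesis using norm_le_l1_cart[of x] unfolding y_def by (simp add: algebra_simps)
qed

section \<open>Growth of the matrices and decay of the lengths\<close>

context rauzy_path
begin

abbreviation N :: "nat \<Rightarrow> real" where
  "N k \<equiv> mat_norm (acc_B T 0 k)"

abbreviation tlen :: "nat \<Rightarrow> real" where
  "tlen n \<equiv> (\<Sum>a\<in>UNIV. lam n a)"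

lemma acc_B_0: "acc_B T 0 k = B 0 (nk k)"
  by (simp add: acc_B_def)

lemma det_B: "m \<le> n \<Longrightarrow> det (B m n) = 1"
proof (induction n rule: dec_induct)
  case base
  show ?case by (simp add: B_self)
next
  case (step n)
  have eq: "B m (Suc n) = (\<chi> k. if k = ls n then row (ls n) (B m n) + 1 *s row (ws n) (B m n) else row k (B m n))"
    by (simp add: vec_eq_iff B_Suc_entry[OF step.hyps(1)] row_def)
  have "det (B m (Suc n)) = det (B m n)" unfolding eq by (rule det_row_operation[OF winner_loser(2)])
  then show ?case using step.IH by simp
qed

lemma mat_norm_B: "m \<le> n \<Longrightarrow> mat_norm (B m n) = (\<Sum>b\<in>UNIV. rsum m n b)"
  by (simp add: mat_norm_def B_nonneg)

lemma rsum_mult: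
  assumes "m \<le> n" "n \<le> p"
  shows "rsum m p b = (\<Sum>c\<in>UNIV. B n p $ b $ c * rsum m n c)"
proof -
  have comp: "(A *v v) $ b = (\<Sum>c\<in>UNIV. A $ b $ c * v $ c)" for A :: "real^'a^'a" and v
    by (simp add: matrix_vector_mult_def)
  have "rsum m p b = (B m p *v (\<chi> a. 1)) $ b" by (rule rsum_eq)
  also have "\<dots> = (B n p *v (B m n *v (\<chi> a. 1))) $ b"
    unfolding B_mult[OF assms] matrix_vector_mul_assoc ..
  also have "\<dots> = (\<Sum>c\<in>UNIV. B n p $ b $ c * rsum m n c)"
    unfolding comp[of "B n p"] rsum_eq ..
  finally show ?thesis .
qed

lemma mat_norm_B_mult:
  assumes "m \<le> n" "n \<le> p"
  shows "mat_norm (B m p) \<le> mat_norm (B n p) * mat_norm (B m n)"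
proof -
  have "rsum m p b \<le> rsum n p b * mat_norm (B m n)" for b
    unfolding rsum_mult[OF assms] sum_distrib_right
    by (intro sum_mono mult_left_mono rsum_le_mat_norm[OF assms(1)] B_nonneg[OF assms(2)])
  then have "(\<Sum>b\<in>UNIV. rsum m p b) \<le> (\<Sum>b\<in>UNIV. rsum n p b * mat_norm (B m n))" by (rule sum_mono)
  then show ?thesis using assms by (simp add: mat_norm_B sum_distrib_right)
qed

text \<open>All entries of one accelerated matrix are positive integers, so each row at the next
  level dominates the sum of all rows at the present one.\<close>

lemma N_le_rsum: "N k \<le> rsum 0 (nk (Suc k)) b"
proof -
  have "N k = (\<Sum>c\<in>UNIV. 1 * rsum 0 (nk k) c)" by (simp add: acc_B_0 mat_norm_B)
  also have "\<dots> \<le> (\<Sum>c\<in>UNIV. B (nk k) (nk (Suc k)) $ b $ c * rsum 0 (nk k) c)"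
    by (intro sum_mono mult_right_mono B_ge_1 rv_time_Suc order_trans[OF zero_le_one rsum_ge_1]) auto
  also have "\<dots> = rsum 0 (nk (Suc k)) b" by (rule rsum_mult[symmetric]) (auto simp: rv_time_Suc)
  finally show ?thesis .
qed

lemma N_Suc_ge: "2 * N k \<le> N (Suc k)"
proof -
  have N0: "0 \<le> N k" by (rule mat_norm_nonneg)
  have "2 * N k \<le> real CARD('a) * N k"
    by (rule mult_right_mono[OF _ N0]) (use CARD_ge2 in simp)
  also have "\<dots> = (\<Sum>b\<in>(UNIV::'a set). N k)" by simp
  also have "\<dots> \<le> (\<Sum>b\<in>UNIV. rsum 0 (nk (Suc k)) b)" by (intro sum_mono N_le_rsum)
  finally show ?thesis by (simp add: acc_B_0 mat_norm_B)
qed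

lemma N_ge: "2 ^ k \<le> N k"
proof (induction k)
  case 0
  have "1 \<le> mat_norm (B 0 0)"
    using rsum_ge_1[OF order_refl] rsum_le_mat_norm[OF order_refl] by (rule order_trans)
  then show ?case by (simp add: acc_B_0)
next
  case (Suc k)
  then show ?case using N_Suc_ge[of k] by simp
qed

lemma N_ge_1: "1 \<le> N k"
  using N_ge[of k] one_le_power[of "2::real" k] by linarith

lemma N_pos: "0 < N k"
  using N_ge_1[of k] by linarith

lemma N_mono: "j \<le> k \<Longrightarrow> N j \<le> N k"
  by (rule lift_Suc_mono_le[of N]) (use N_Suc_ge N_pos in \<open>smt (verit)\<close>)

lemma N_Suc_le: "N (Suc k) \<le> Z k * N k"
  unfolding acc_B_0 by (rule mat_norm_B_mult) (auto simp: rv_time_Suc)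

text \<open>Pairing with the lengths is integration of a piecewise constant function, and special
  sums keep the integral because the towers over I(n) tile I(m).\<close>

lemma lam_pairing:
  assumes "m \<le> n"
  shows "(\<Sum>b\<in>UNIV. lam n b * (B m n *v v) $ b) = (\<Sum>a\<in>UNIV. lam m a * v $ a)"
  using assms
proof (induction n rule: dec_induct)
  case base
  show ?case by (simp add: B_self)
next
  case (step n)
  let ?v = "B m n *v v"
  have v: "(B m (Suc n) *v v) $ b = ?v $ b + (if b = ls n then ?v $ ws n else 0)" for b
    by (simp add: matrix_vector_mult_def B_Suc_entry[OF step.hyps(1)] algebra_simps sum.distrib)
  have "(\<Sum>b\<in>UNIV. lam (Suc n) b * (B m (Suc n) *v v) $ b) =
      (\<Sum>b\<in>UNIV. lam n b * ?v $ b + ((if b = ls n then lam n b * ?v $ ws n else 0) - (if b = ws n then lam n (ls n) * ?v $ b else 0)))"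
    by (rule sum.cong) (use winner_loser(2)[of n] in \<open>auto simp: v lam_Suc algebra_simps\<close>)
  also have "\<dots> = (\<Sum>b\<in>UNIV. lam n b * ?v $ b)"
    by (simp add: sum.distrib sum_subtractf)
  finally show ?case using step.IH by simp
qed

lemma tlen_pos: "0 < tlen n"
  using lam_pos by (intro sum_pos) auto

lemma lam_le_tlen: "lam n a \<le> tlen n"
  by (rule member_le_sum) (use lam_pos less_imp_le in auto)

text \<open>Pair the lengths with the constant vector 1: every tower over I(n_(k+1)) has at least
  \<open>N k\<close> floors.\<close>

lemma tlen_N: "tlen (nk (Suc k)) * N k \<le> tlen 0"
proof -
  have "tlen (nk (Suc k)) * N k \<le> (\<Sum>b\<in>UNIV. lam (nk (Suc k)) b * rsum 0 (nk (Suc k)) b)"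
    unfolding sum_distrib_right
    by (intro sum_mono mult_left_mono N_le_rsum) (use lam_pos less_imp_le in auto)
  also have "\<dots> = (\<Sum>b\<in>UNIV. lam (nk (Suc k)) b * (B 0 (nk (Suc k)) *v (\<chi> a. 1)) $ b)"
    by (simp add: mat_vec_const)
  also have "\<dots> = tlen 0" by (subst lam_pairing) auto
  finally show ?thesis .
qed

text \<open>The length removed is that of the loser, less than half of the last two letters
  together.\<close>

lemma tlen_Suc: "tlen (Suc n) \<le> tlen n" "tlen n \<le> 2 * tlen (Suc n)"
proof -
  have eq: "tlen (Suc n) = tlen n - lam n (ls n)" using rt_Suc[of n] by (simp add: rt_eq)
  then show "tlen (Suc n) \<le> tlen n" using lam_pos[of n "ls n"] by simp
  have "lam n (ls n) + lam n (ws n) = (\<Sum>a\<in>{ls n, ws n}. lam n a)" using winner_loser(2)[of n] by simp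
  also have "\<dots> \<le> tlen n" by (rule sum_mono2) (use lam_pos less_imp_le in auto)
  finally show "tlen n \<le> 2 * tlen (Suc n)" using eq winner_loser(1)[of n] by simp
qed

lemma tlen_antimono: "m \<le> n \<Longrightarrow> tlen n \<le> tlen m"
  by (rule lift_Suc_antimono_le[of tlen]) (rule tlen_Suc)

text \<open>The L1 norm of a piecewise constant function on I(n). Unlike the Euclidean norm it does
  not increase under the matrices.\<close>

definition wnorm :: "nat \<Rightarrow> real^'a \<Rightarrow> real" where
  "wnorm n v = (\<Sum>a\<in>UNIV. lam n a * \<bar>v $ a\<bar>)"

lemma wnorm_nonneg: "0 \<le> wnorm n v"
  unfolding wnorm_def by (intro sum_nonneg mult_nonneg_nonneg) (use lam_pos less_imp_le in auto)

lemma wnorm_triangle: "wnorm n (v + w) \<le> wnorm n v + wnorm n w"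
  unfolding wnorm_def sum.distrib[symmetric] distrib_left[symmetric]
  by (intro sum_mono mult_left_mono) (use lam_pos less_imp_le in auto)

lemma wnorm_sum: "finite A \<Longrightarrow> wnorm n (\<Sum>i\<in>A. v i) \<le> (\<Sum>i\<in>A. wnorm n (v i))"
proof (induction A rule: finite_induct)
  case empty
  show ?case by (simp add: wnorm_def)
next
  case (insert x F)
  then show ?case using wnorm_triangle[of n "v x" "\<Sum>i\<in>F. v i"] by simp
qed

lemma wnorm_le_norm: "wnorm n v \<le> tlen n * norm v"
  unfolding wnorm_def sum_distrib_right
  by (intro sum_mono mult_left_mono component_le_norm_cart) (use lam_pos less_imp_le in auto)

lemma wnorm_B:
  assumes mn: "m \<le> n"
  shows "wnorm n (B m n *v v) \<le> wnorm m v"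
proof -
  have "\<bar>(B m n *v v) $ b\<bar> \<le> (B m n *v (\<chi> a. \<bar>v $ a\<bar>)) $ b" for b
  proof -
    have "\<bar>(B m n *v v) $ b\<bar> \<le> (\<Sum>a\<in>UNIV. \<bar>B m n $ b $ a * v $ a\<bar>)"
      unfolding matrix_vector_mult_def by simp
    then show ?thesis by (simp add: matrix_vector_mult_def abs_mult B_nonneg[OF mn])
  qed
  then have "wnorm n (B m n *v v) \<le> (\<Sum>b\<in>UNIV. lam n b * (B m n *v (\<chi> a. \<bar>v $ a\<bar>)) $ b)"
    unfolding wnorm_def by (intro sum_mono mult_left_mono) (auto simp: less_imp_le lam_pos)
  then show ?thesis unfolding lam_pairing[OF mn] by (simp add: wnorm_def)
qed

text \<open>Each step adds a copy of the winner's row, whose sum is at least 1.\<close>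

lemma steps_le_mat_norm: "m \<le> n \<Longrightarrow> real (n - m) \<le> mat_norm (B m n)"
proof (induction n rule: dec_induct)
  case base
  show ?case by (simp add: mat_norm_nonneg)
next
  case (step n)
  have "(\<Sum>b\<in>UNIV. rsum m (Suc n) b) = (\<Sum>b\<in>UNIV. rsum m n b + (if b = ls n then rsum m n (ws n) else 0))"
    by (rule sum.cong) (use rsum_Suc[OF step.hyps(1)] winner_loser(3)[of n] in auto)
  also have "\<dots> = mat_norm (B m n) + rsum m n (ws n)" using step.hyps(1) by (simp add: sum.distrib mat_norm_B)
  finally have "mat_norm (B m (Suc n)) = mat_norm (B m n) + rsum m n (ws n)"
    using step.hyps(1) by (simp add: mat_norm_B)
  then show ?case using step rsum_ge_1[OF step.hyps(1), of "ws n"] by (simp add: Suc_diff_le)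
qed

end

section \<open>Consequences of the Diophantine condition\<close>

text \<open>The finitely many exceptional indices are absorbed into the constant, by adding their
  quotients to it.\<close>

lemma bigo_imp_bound:
  fixes f g :: "nat \<Rightarrow> real"
  assumes "f \<in> O(g)" "\<And>q. p \<le> q \<Longrightarrow> 0 < g q"
  shows "\<exists>C>0. \<forall>q\<ge>p. \<bar>f q\<bar> \<le> C * g q"
proof -
  obtain c where c: "c > 0" "\<forall>\<^sub>F q in sequentially. norm (f q) \<le> c * norm (g q)"
    using assms(1) by (rule landau_o.bigE)
  then obtain Q where Q: "\<And>q. Q \<le> q \<Longrightarrow> \<bar>f q\<bar> \<le> c * \<bar>g q\<bar>"
    unfolding eventually_sequentially by auto
  define C where "C = c + (\<Sum>q\<in>{p..<Q}. \<bar>f q\<bar> / g q)"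
  have pos: "0 \<le> \<bar>f q\<bar> / g q" if "q \<in> {p..<Q}" for q
    using assms(2)[of q] that by simp
  have "0 \<le> (\<Sum>q\<in>{p..<Q}. \<bar>f q\<bar> / g q)" by (rule sum_nonneg) (rule pos)
  then have C: "c \<le> C" unfolding C_def by simp
  have "\<bar>f q\<bar> \<le> C * g q" if q: "p \<le> q" for q
  proof (cases "q < Q")
    case True
    have "\<bar>f q\<bar> / g q \<le> (\<Sum>q\<in>{p..<Q}. \<bar>f q\<bar> / g q)"
      by (rule member_le_sum) (use True q pos in auto)
    then have "\<bar>f q\<bar> / g q \<le> C" using c(1) by (simp add: C_def)
    then show ?thesis using assms(2)[OF q] by (simp add: divide_le_eq)
  next
    case False
    then have "\<bar>f q\<bar> \<le> c * g q" using Q[of q] assms(2)[OF q] by simp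
    also have "\<dots> \<le> C * g q" by (rule mult_right_mono) (use C assms(2)[OF q] in auto)
    finally show ?thesis .
  qed
  then show ?thesis using C c(1) by (intro exI[of _ C]) auto
qed

lemma boundedI_bigo:
  fixes f g :: "nat \<Rightarrow> real"
  assumes "\<And>q. p \<le> q \<Longrightarrow> \<bar>f q\<bar> \<le> C * g q" "\<And>q. p \<le> q \<Longrightarrow> 0 < g q"
  shows "f \<in> O(g)"
proof (rule bigoI)
  have "norm (f q) \<le> C * norm (g q)" if "p \<le> q" for q
    using assms(1)[OF that] assms(2)[OF that] by simp
  then show "\<forall>\<^sub>F q in sequentially. norm (f q) \<le> C * norm (g q)"
    unfolding eventually_sequentially by blast
qed

text \<open>In finite dimension bounds for single vectors become uniform: expand in an orthonormal
  basis of the subspace and add the constants.\<close>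

lemma uniform_on_subspace:
  fixes A :: "nat \<Rightarrow> real^'n^'m" and V :: "(real^'n) set"
  assumes V: "subspace V" and g: "\<And>k. 0 \<le> g k"
    and bd: "\<And>v. v \<in> V \<Longrightarrow> \<exists>C. \<forall>k. norm (A k *v v) \<le> C * g k"
  shows "\<exists>C>0. \<forall>v\<in>V. \<forall>k. norm (A k *v v) \<le> C * g k * norm v"
proof -
  obtain S where S: "S \<subseteq> V" "pairwise orthogonal S" "\<And>b. b \<in> S \<Longrightarrow> norm b = 1" "independent S" "span S = V"
    using orthonormal_basis_subspace[OF V] by metis
  have fin: "finite S" using S(4) independent_imp_finite by blast
  obtain c where c: "\<And>b k. b \<in> S \<Longrightarrow> norm (A k *v b) \<le> c b * g k"
    using bd S(1) by (metis subsetD)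
  define C where "C = 1 + (\<Sum>b\<in>S. \<bar>c b\<bar>)"
  have "norm (A k *v v) \<le> C * g k * norm v" if v: "v \<in> V" for v k
  proof -
    have exp: "(\<Sum>b\<in>S. (v \<bullet> b) *\<^sub>R b) = v"
      by (rule orthonormal_basis_expand) (use S v fin in auto)
    have "A k *v v = A k *v (\<Sum>b\<in>S. (v \<bullet> b) *\<^sub>R b)" unfolding exp ..
    also have "\<dots> = (\<Sum>b\<in>S. (v \<bullet> b) *\<^sub>R (A k *v b))"
      by (simp add: linear_sum[OF matrix_vector_mul_linear] matrix_vector_mult_scaleR)
    finally have "norm (A k *v v) = norm (\<Sum>b\<in>S. (v \<bullet> b) *\<^sub>R (A k *v b))" by simp
    also have "\<dots> \<le> (\<Sum>b\<in>S. norm ((v \<bullet> b) *\<^sub>R (A k *v b)))" by (rule norm_sum)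
    also have "\<dots> \<le> (\<Sum>b\<in>S. norm v * (\<bar>c b\<bar> * g k))"
    proof (rule sum_mono)
      fix b assume b: "b \<in> S"
      have "\<bar>v \<bullet> b\<bar> \<le> norm v" using Cauchy_Schwarz_ineq2[of v b] S(3)[OF b] by simp
      moreover have "norm (A k *v b) \<le> \<bar>c b\<bar> * g k"
        using c[OF b, of k] mult_right_mono[OF abs_ge_self g[of k]] by (meson order_trans)
      ultimately show "norm ((v \<bullet> b) *\<^sub>R (A k *v b)) \<le> norm v * (\<bar>c b\<bar> * g k)"
        unfolding norm_scaleR by (intro mult_mono) auto
    qed
    also have "\<dots> = (\<Sum>b\<in>S. \<bar>c b\<bar>) * (g k * norm v)"
      by (simp add: sum_distrib_left sum_distrib_right mult_ac)
    also have "\<dots> \<le> C * (g k * norm v)"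
      by (rule mult_right_mono) (use g[of k] in \<open>auto simp: C_def\<close>)
    finally show ?thesis by (simp add: mult.assoc)
  qed
  moreover have "0 < C" unfolding C_def by (simp add: add_pos_nonneg sum_nonneg)
  ultimately show ?thesis by blast
qed

lemma op_norm_le:
  assumes V: "subspace V" and v: "v \<in> V"
  shows "norm ((A :: real^'n^'m) *v v) \<le> op_norm V norm norm ((*v) A) * norm v"
proof (cases "v = 0")
  case False
  let ?w = "(1 / norm v) *\<^sub>R v"
  have "bdd_above ((\<lambda>v. norm (A *v v)) ` {v \<in> V. norm v \<le> 1})"
  proof (rule bdd_aboveI)
    fix x assume "x \<in> (\<lambda>v. norm (A *v v)) ` {v \<in> V. norm v \<le> 1}"
    then obtain v where v: "norm v \<le> 1" "x = norm (A *v v)" by auto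
    have "mat_norm A * norm v \<le> mat_norm A * 1" by (rule mult_left_mono[OF v(1) mat_norm_nonneg])
    then show "x \<le> mat_norm A" using norm_matrix_vector_le[of A v] v(2) by simp
  qed
  moreover have "?w \<in> {v \<in> V. norm v \<le> 1}" using V v False by (simp add: subspace_scale)
  ultimately have "norm (A *v ?w) \<le> op_norm V norm norm ((*v) A)"
    unfolding op_norm_def by (intro cSUP_upper)
  moreover have "norm (A *v ?w) = norm (A *v v) / norm v" by (simp add: matrix_vector_mult_scaleR)
  ultimately show ?thesis using False by (simp add: divide_le_eq)
qed simp

lemma elt_set_plus_iff: "x \<in> v +o S \<longleftrightarrow> (\<exists>s\<in>S. x = v + s)"
  by (auto simp: elt_set_plus_def)

lemma quot_norm_le: "v \<in> C \<Longrightarrow> quot_norm norm C \<le> norm v"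
  unfolding quot_norm_def by (rule cINF_lower) (auto intro: bdd_belowI[of _ 0])

lemma quot_norm_approx:
  assumes "C \<noteq> {}" "quot_norm norm C < y"
  shows "\<exists>v\<in>C. norm v < y"
proof -
  have "bdd_below (norm ` C)" by (rule bdd_belowI[of _ 0]) auto
  from cINF_less_iff[OF assms(1) this, of y] assms(2) show ?thesis unfolding quot_norm_def by simp
qed

section \<open>Stable subspaces and their quotients\<close>

context rauzy_path
begin

lemma acc_B_self: "acc_B T k k = mat 1"
  by (simp add: acc_B_def B_self)

lemma acc_B_mult: "k \<le> l \<Longrightarrow> l \<le> q \<Longrightarrow> acc_B T k q = acc_B T l q ** acc_B T k l"
  unfolding acc_B_def by (rule B_mult) (auto intro: nk_mono)

lemma det_acc_B: "k \<le> l \<Longrightarrow> det (acc_B T k l) = 1"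
  unfolding acc_B_def by (rule det_B) (rule nk_mono)

lemma mat_norm_acc_ge_1: "k \<le> l \<Longrightarrow> 1 \<le> mat_norm (acc_B T k l)"
  unfolding acc_B_def using rsum_ge_1[OF nk_mono] rsum_le_mat_norm[OF nk_mono] by (meson order_trans)

lemma mat_norm_B_antimono:
  assumes "m \<le> n" "n \<le> p"
  shows "mat_norm (B n p) \<le> mat_norm (B m p)"
proof -
  have "rsum n p b \<le> rsum m p b" for b
  proof -
    have "(\<Sum>c\<in>UNIV. B n p $ b $ c * 1) \<le> (\<Sum>c\<in>UNIV. B n p $ b $ c * rsum m n c)"
      by (intro sum_mono mult_left_mono rsum_ge_1 B_nonneg assms)
    then show ?thesis unfolding rsum_mult[OF assms] by simp
  qed
  then show ?thesis using assms by (simp add: mat_norm_B sum_mono)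
qed

lemma mat_norm_acc_antimono: "k \<le> l \<Longrightarrow> l \<le> q \<Longrightarrow> mat_norm (acc_B T l q) \<le> mat_norm (acc_B T k q)"
  unfolding acc_B_def by (rule mat_norm_B_antimono) (auto intro: nk_mono)

lemma mat_norm_acc_mult: "k \<le> l \<Longrightarrow> l \<le> q \<Longrightarrow> mat_norm (acc_B T k q) \<le> mat_norm (acc_B T l q) * mat_norm (acc_B T k l)"
  unfolding acc_B_def by (rule mat_norm_B_mult) (auto intro: nk_mono)

lemma acc_B_surj: "k \<le> l \<Longrightarrow> \<exists>u. acc_B T k l *v u = v"
proof -
  assume "k \<le> l"
  then have "invertible (acc_B T k l)" using det_acc_B by (simp add: invertible_det_nz)
  then obtain A where "acc_B T k l ** A = mat 1" unfolding invertible_def by blast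
  then have "acc_B T k l *v (A *v v) = v" by (simp add: matrix_vector_mul_assoc)
  then show ?thesis by blast
qed

lemma Gamma_s_iff:
  "v \<in> Gamma_s T \<sigma> p \<longleftrightarrow> (\<exists>C>0. \<forall>q\<ge>p. norm (acc_B T p q *v v) \<le> C * mat_norm (acc_B T p q) powr (-\<sigma>))"
proof -
  have pos: "0 < mat_norm (acc_B T p q) powr (-\<sigma>)" if "p \<le> q" for q
    using mat_norm_acc_ge_1[OF that] by simp
  show ?thesis
    using bigo_imp_bound[of "\<lambda>q. norm (acc_B T p q *v v)" "\<lambda>q. mat_norm (acc_B T p q) powr (-\<sigma>)" p, OF _ pos]
      boundedI_bigo[of p "\<lambda>q. norm (acc_B T p q *v v)" _ "\<lambda>q. mat_norm (acc_B T p q) powr (-\<sigma>)", OF _ pos]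
    unfolding Gamma_s_def by auto
qed

lemma Gamma_sE:
  assumes "v \<in> Gamma_s T \<sigma> p"
  obtains C where "0 < C" "\<And>q. p \<le> q \<Longrightarrow> norm (acc_B T p q *v v) \<le> C * mat_norm (acc_B T p q) powr (-\<sigma>)"
  using assms unfolding Gamma_s_iff by (elim exE conjE) simp

lemma Gamma_sI:
  assumes "0 < C" "\<And>q. p \<le> q \<Longrightarrow> norm (acc_B T p q *v v) \<le> C * mat_norm (acc_B T p q) powr (-\<sigma>)"
  shows "v \<in> Gamma_s T \<sigma> p"
  unfolding Gamma_s_iff using assms by (intro exI[of _ C]) simp

lemma subspace_Gamma_s: "subspace (Gamma_s T \<sigma> p)"
proof (rule subspaceI)
  show "0 \<in> Gamma_s T \<sigma> p" by (rule Gamma_sI[of 1]) simp_all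
  fix v w assume v: "v \<in> Gamma_s T \<sigma> p"
  then obtain C where C: "0 < C" "\<And>q. p \<le> q \<Longrightarrow> norm (acc_B T p q *v v) \<le> C * mat_norm (acc_B T p q) powr (-\<sigma>)"
    by (rule Gamma_sE) blast
  {
    assume "w \<in> Gamma_s T \<sigma> p"
    then obtain D where D: "0 < D" "\<And>q. p \<le> q \<Longrightarrow> norm (acc_B T p q *v w) \<le> D * mat_norm (acc_B T p q) powr (-\<sigma>)"
      by (rule Gamma_sE) blast
    have "norm (acc_B T p q *v (v + w)) \<le> (C + D) * mat_norm (acc_B T p q) powr (-\<sigma>)" if "q \<ge> p" for q
      using norm_triangle_ineq[of "acc_B T p q *v v" "acc_B T p q *v w"] C(2)[OF that] D(2)[OF that]
      by (simp add: matrix_vector_right_distrib distrib_right)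
    then show "v + w \<in> Gamma_s T \<sigma> p" using C(1) D(1) by (intro Gamma_sI[of "C + D"]) auto
  }
  fix c
  have "norm (acc_B T p q *v (c *\<^sub>R v)) \<le> ((\<bar>c\<bar> + 1) * C) * mat_norm (acc_B T p q) powr (-\<sigma>)" if "q \<ge> p" for q
  proof -
    have "norm (acc_B T p q *v (c *\<^sub>R v)) = \<bar>c\<bar> * norm (acc_B T p q *v v)" by (simp add: matrix_vector_mult_scaleR)
    also have "\<dots> \<le> (\<bar>c\<bar> + 1) * (C * mat_norm (acc_B T p q) powr (-\<sigma>))"
      by (rule mult_mono) (use C(2)[OF that] in auto)
    finally show ?thesis by simp
  qed
  then show "c *\<^sub>R v \<in> Gamma_s T \<sigma> p" using C(1) by (intro Gamma_sI[of "(\<bar>c\<bar> + 1) * C"]) auto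
qed

text \<open>Forward, the norm of B(n_l,n_q) is at most that of B(n_k,n_q). Backward,
  submultiplicativity loses only the fixed factor \<open>K powr \<sigma>\<close>, and the finitely
  many q < l do not affect the order of growth.\<close>

lemma Gamma_s_invariant:
  assumes kl: "k \<le> l" and s: "0 < \<sigma>"
  shows "acc_B T k l *v v \<in> Gamma_s T \<sigma> l \<longleftrightarrow> v \<in> Gamma_s T \<sigma> k"
proof
  assume "v \<in> Gamma_s T \<sigma> k"
  then obtain C where C: "0 < C" "\<And>q. k \<le> q \<Longrightarrow> norm (acc_B T k q *v v) \<le> C * mat_norm (acc_B T k q) powr (-\<sigma>)"
    by (rule Gamma_sE) blast
  have "norm (acc_B T l q *v (acc_B T k l *v v)) \<le> C * mat_norm (acc_B T l q) powr (-\<sigma>)" if q: "q \<ge> l" for q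
  proof -
    have "norm (acc_B T l q *v (acc_B T k l *v v)) \<le> C * mat_norm (acc_B T k q) powr (-\<sigma>)"
      unfolding matrix_vector_mul_assoc acc_B_mult[OF kl q, symmetric] using C(2)[of q] kl q by simp
    also have "\<dots> \<le> C * mat_norm (acc_B T l q) powr (-\<sigma>)"
      by (intro mult_left_mono powr_mono2') (use mat_norm_acc_antimono[OF kl q] mat_norm_acc_ge_1[OF q] s C(1) in auto)
    finally show ?thesis .
  qed
  then show "acc_B T k l *v v \<in> Gamma_s T \<sigma> l" by (rule Gamma_sI[OF C(1)])
next
  assume "acc_B T k l *v v \<in> Gamma_s T \<sigma> l"
  then obtain C where C: "0 < C" "\<And>q. l \<le> q \<Longrightarrow> norm (acc_B T l q *v (acc_B T k l *v v)) \<le> C * mat_norm (acc_B T l q) powr (-\<sigma>)"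
    by (rule Gamma_sE) blast
  define K where "K = mat_norm (acc_B T k l)"
  have K: "1 \<le> K" unfolding K_def by (rule mat_norm_acc_ge_1[OF kl])
  have pos: "0 < mat_norm (acc_B T k q) powr (-\<sigma>)" if "l \<le> q" for q
    using mat_norm_acc_ge_1[of k q] kl that by simp
  have "\<bar>norm (acc_B T k q *v v)\<bar> \<le> (C * K powr \<sigma>) * mat_norm (acc_B T k q) powr (-\<sigma>)" if q: "l \<le> q" for q
  proof -
    have m: "mat_norm (acc_B T k q) / K \<le> mat_norm (acc_B T l q)" "0 < mat_norm (acc_B T k q)"
      using mat_norm_acc_mult[OF kl q] K mat_norm_acc_ge_1[of k q] kl q by (auto simp: K_def divide_le_eq)
    have "norm (acc_B T k q *v v) \<le> C * mat_norm (acc_B T l q) powr (-\<sigma>)"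
      using C(2)[OF q] unfolding matrix_vector_mul_assoc acc_B_mult[OF kl q, symmetric] .
    also have "\<dots> \<le> C * (mat_norm (acc_B T k q) / K) powr (-\<sigma>)"
      by (intro mult_left_mono powr_mono2') (use m K s C(1) in auto)
    also have "\<dots> = (C * K powr \<sigma>) * mat_norm (acc_B T k q) powr (-\<sigma>)"
      using m(2) K by (simp add: powr_divide powr_minus divide_simps)
    finally show ?thesis by simp
  qed
  from boundedI_bigo[OF this pos] show "v \<in> Gamma_s T \<sigma> k" unfolding Gamma_s_def by simp
qed

end

locale dc_path = rauzy_path T for T :: "'a::finite iet" +
  fixes \<eta> \<theta> \<sigma> :: real
  assumes DC: "in_DC \<eta> \<theta> \<sigma> T" and eta: "0 \<le> \<eta>" and theta: "0 < \<theta>" and sigma: "0 < \<sigma>"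
begin

lemma DC_c:
  "\<forall>\<epsilon>>0. \<exists>C. \<forall>k l. k \<le> l \<longrightarrow> norm_B_s T \<sigma> k l \<le> C * N l powr \<epsilon> \<and> norm_B_flat_inv T \<sigma> k l \<le> C * N l powr \<epsilon>"
  using DC unfolding in_DC_def by (elim conjE)

lemma DC_a:
  assumes "\<eta> < \<eta>'"
  shows "\<exists>C>0. \<forall>k. Z k \<le> C * N k powr \<eta>'"
proof -
  have "(\<lambda>k. mat_norm (acc_B T k (Suc k))) \<in> O(\<lambda>k. N k powr (\<eta> + (\<eta>' - \<eta>)))"
    using DC assms unfolding in_DC_def by (meson diff_gt_0_iff_gt)
  moreover have "0 < N q powr (\<eta> + (\<eta>' - \<eta>))" for q using N_pos[of q] by simp
  ultimately have "\<exists>C>0. \<forall>q\<ge>0. \<bar>mat_norm (acc_B T q (Suc q))\<bar> \<le> C * N q powr (\<eta> + (\<eta>' - \<eta>))"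
    by (rule bigo_imp_bound)
  then show ?thesis by (simp add: acc_B_def mat_norm_nonneg)
qed

lemma subspace_Gamma_zero: "subspace (Gamma_zero T)"
  by (rule subspaceI) (auto simp: Gamma_zero_def algebra_simps sum.distrib simp flip: sum_distrib_left)

lemma DC_b: "\<exists>C>0. \<forall>k. \<forall>v\<in>Gamma_zero T. norm (B 0 (nk k) *v v) \<le> C * N k powr (1 - \<theta>) * norm v"
proof -
  have "(\<lambda>k. op_norm (Gamma_zero T) norm norm ((*v) (acc_B T 0 k))) \<in> O(\<lambda>k. N k powr (1 - \<theta>))"
    using DC unfolding in_DC_def by blast
  moreover have "0 < N q powr (1 - \<theta>)" for q using N_pos[of q] by simp
  ultimately have "\<exists>C>0. \<forall>q\<ge>0. \<bar>op_norm (Gamma_zero T) norm norm ((*v) (acc_B T 0 q))\<bar> \<le> C * N q powr (1 - \<theta>)"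
    by (rule bigo_imp_bound)
  then obtain C where C: "C > 0"
    "\<And>k. \<bar>op_norm (Gamma_zero T) norm norm ((*v) (acc_B T 0 k))\<bar> \<le> C * N k powr (1 - \<theta>)"
    by auto
  have "norm (B 0 (nk k) *v v) \<le> C * N k powr (1 - \<theta>) * norm v" if "v \<in> Gamma_zero T" for k v
  proof -
    have "op_norm (Gamma_zero T) norm norm ((*v) (acc_B T 0 k)) \<le> C * N k powr (1 - \<theta>)"
      using C(2)[of k] by linarith
    from mult_right_mono[OF this, of "norm v"] show ?thesis
      using op_norm_le[OF subspace_Gamma_zero that, of "acc_B T 0 k"] unfolding acc_B_0 by simp
  qed
  then show ?thesis using C(1) by blast
qed

lemma DC_c1:
  assumes "0 < \<epsilon>"
  shows "\<exists>C>0. \<forall>k l v. k \<le> l \<longrightarrow> v \<in> Gamma_s T \<sigma> k \<longrightarrow> norm (acc_B T k l *v v) \<le> C * N l powr \<epsilon> * norm v"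
proof -
  obtain C where C: "\<And>k l. k \<le> l \<Longrightarrow> norm_B_s T \<sigma> k l \<le> C * N l powr \<epsilon>"
    using DC_c assms by (elim allE[of _ \<epsilon>]) blast
  have "norm (acc_B T k l *v v) \<le> (\<bar>C\<bar> + 1) * N l powr \<epsilon> * norm v" if "k \<le> l" "v \<in> Gamma_s T \<sigma> k" for k l v
  proof -
    have "norm_B_s T \<sigma> k l \<le> (\<bar>C\<bar> + 1) * N l powr \<epsilon>"
      by (rule order_trans[OF C[OF that(1)]], rule mult_right_mono) auto
    from mult_right_mono[OF this, of "norm v"] show ?thesis
      using op_norm_le[OF subspace_Gamma_s that(2), of "acc_B T k l"] unfolding norm_B_s_def by simp
  qed
  then show ?thesis by (intro exI[of _ "\<bar>C\<bar> + 1"]) auto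
qed

text \<open>The matrix is invertible, so every coset at level l has a preimage; this makes
  \<open>inv_into\<close> a genuine right inverse.\<close>

lemma B_flat_range:
  assumes kl: "k \<le> l" and C: "C \<in> quot_space UNIV (Gamma_s T \<sigma> l)"
  shows "C \<in> B_flat T \<sigma> k l ` quot_space UNIV (Gamma_s T \<sigma> k)"
proof -
  obtain v where v: "C = v +o Gamma_s T \<sigma> l" using C unfolding quot_space_def by auto
  obtain u where u: "acc_B T k l *v u = v" using acc_B_surj[OF kl] by blast
  have "B_flat T \<sigma> k l (u +o Gamma_s T \<sigma> k) = C"
  proof (intro equalityI subsetI)
    fix x assume "x \<in> B_flat T \<sigma> k l (u +o Gamma_s T \<sigma> k)"
    then obtain s t where st: "s \<in> Gamma_s T \<sigma> k" "t \<in> Gamma_s T \<sigma> l" "x = acc_B T k l *v (u + s) + t"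
      unfolding B_flat_def quot_map_def by (auto simp: set_plus_def elt_set_plus_iff)
    then have "acc_B T k l *v s + t \<in> Gamma_s T \<sigma> l"
      using Gamma_s_invariant[OF kl sigma] subspace_add[OF subspace_Gamma_s] by blast
    then show "x \<in> C" unfolding v elt_set_plus_iff using st(3) u
      by (intro bexI[of _ "acc_B T k l *v s + t"]) (auto simp: matrix_vector_right_distrib)
  next
    fix x assume "x \<in> C"
    then obtain t where t: "t \<in> Gamma_s T \<sigma> l" "x = v + t" unfolding v elt_set_plus_iff by blast
    have "u \<in> u +o Gamma_s T \<sigma> k" unfolding elt_set_plus_iff
      using subspace_0[OF subspace_Gamma_s] by (intro bexI[of _ 0]) auto
    then have "acc_B T k l *v u + t \<in> (*v) (acc_B T k l) ` (u +o Gamma_s T \<sigma> k) + Gamma_s T \<sigma> l"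
      by (intro set_plus_intro imageI t(1))
    then show "x \<in> B_flat T \<sigma> k l (u +o Gamma_s T \<sigma> k)"
      unfolding B_flat_def quot_map_def t(2) u .
  qed
  then show ?thesis unfolding quot_space_def by blast
qed

text \<open>An operator norm defined as a supremum of reals gives information only if the set is
  bounded. The bound on the inverse matrix from Cramer's rule supplies this.\<close>

lemma B_flat_inv_bdd:
  assumes kl: "k \<le> l"
  shows "bdd_above ((\<lambda>C. quot_norm norm (inv_into (quot_space UNIV (Gamma_s T \<sigma> k)) (B_flat T \<sigma> k l) C)) `
    {C \<in> quot_space UNIV (Gamma_s T \<sigma> l). quot_norm norm C \<le> 1})"
proof (rule bdd_aboveI)
  let ?Q = "quot_space UNIV (Gamma_s T \<sigma> k)"
  define K where "K = real CARD('a) * fact CARD('a) * mat_norm (acc_B T k l) ^ (CARD('a) - 1)"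
  have K0: "0 \<le> K" unfolding K_def by (simp add: mat_norm_nonneg)
  fix y assume "y \<in> (\<lambda>C. quot_norm norm (inv_into ?Q (B_flat T \<sigma> k l) C)) ` {C \<in> quot_space UNIV (Gamma_s T \<sigma> l). quot_norm norm C \<le> 1}"
  then obtain C where C: "C \<in> quot_space UNIV (Gamma_s T \<sigma> l)" "quot_norm norm C \<le> 1"
    "y = quot_norm norm (inv_into ?Q (B_flat T \<sigma> k l) C)" by auto
  define X where "X = inv_into ?Q (B_flat T \<sigma> k l) C"
  have X: "X \<in> ?Q" "B_flat T \<sigma> k l X = C"
    unfolding X_def by (rule inv_into_into[OF B_flat_range[OF kl C(1)]], rule f_inv_into_f[OF B_flat_range[OF kl C(1)]])
  obtain u0 where u0: "X = u0 +o Gamma_s T \<sigma> k" using X(1) unfolding quot_space_def by auto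
  have "C \<noteq> {}" using C(1) subspace_0[OF subspace_Gamma_s] unfolding quot_space_def elt_set_plus_def by auto
  then obtain c where c: "c \<in> C" "norm c < 2" using quot_norm_approx[of C 2] C(2) by auto
  then obtain x s where xs: "x \<in> X" "s \<in> Gamma_s T \<sigma> l" "c = acc_B T k l *v x + s"
    using X(2) unfolding B_flat_def quot_map_def by (auto simp: set_plus_def)
  obtain s' where s': "acc_B T k l *v s' = s" using acc_B_surj[OF kl] by blast
  have s'G: "s' \<in> Gamma_s T \<sigma> k" using xs(2) Gamma_s_invariant[OF kl sigma, of s'] s' by simp
  obtain t where t: "t \<in> Gamma_s T \<sigma> k" "x = u0 + t" using xs(1) unfolding u0 elt_set_plus_iff by blast
  have "x + s' \<in> X" unfolding u0 elt_set_plus_iff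
    using t s'G subspace_add[OF subspace_Gamma_s t(1) s'G] by (intro bexI[of _ "t + s'"]) (auto simp: add.assoc)
  then have "quot_norm norm X \<le> norm (x + s')" by (rule quot_norm_le)
  also have "\<dots> \<le> K * norm (acc_B T k l *v (x + s'))"
    unfolding K_def by (rule norm_le_inverse_bound[OF det_acc_B[OF kl]])
  also have "acc_B T k l *v (x + s') = c" using xs(3) s' by (simp add: matrix_vector_right_distrib)
  also have "K * norm c \<le> K * 2" by (rule mult_left_mono) (use c K0 in auto)
  finally show "y \<le> K * 2" using C(3) X_def by simp
qed

text \<open>The estimate of (c) on the quotient, turned into one on vectors: up to a stable error
  every \<open>v\<close> is the image of some \<open>u\<close> that is larger by at most a small
  power of the norm.\<close>

lemma DC_c2:
  assumes "0 < \<epsilon>"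
  shows "\<exists>C>0. \<forall>k l v. k \<le> l \<longrightarrow>
    (\<exists>u. v - acc_B T k l *v u \<in> Gamma_s T \<sigma> l \<and> norm u \<le> C * N l powr \<epsilon> * norm v)"
proof -
  obtain C where C: "\<And>k l. k \<le> l \<Longrightarrow> norm_B_flat_inv T \<sigma> k l \<le> C * N l powr \<epsilon>"
    using DC_c assms by (elim allE[of _ \<epsilon>]) blast
  have "\<exists>u. v - acc_B T k l *v u \<in> Gamma_s T \<sigma> l \<and> norm u \<le> (\<bar>C\<bar> + 1) * N l powr \<epsilon> * norm v" if kl: "k \<le> l" for k l v
  proof (cases "v = 0")
    case True
    then show ?thesis using subspace_0[OF subspace_Gamma_s] by (intro exI[of _ 0]) simp
  next
    case False
    let ?Q = "quot_space UNIV (Gamma_s T \<sigma> k)"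
    define w where "w = (1 / norm v) *\<^sub>R v"
    define D where "D = w +o Gamma_s T \<sigma> l"
    have wD: "w \<in> D" unfolding D_def elt_set_plus_iff using subspace_0[OF subspace_Gamma_s] by (intro bexI[of _ 0]) auto
    have nD: "quot_norm norm D \<le> 1" using quot_norm_le[OF wD] False by (simp add: w_def)
    have DQ: "D \<in> quot_space UNIV (Gamma_s T \<sigma> l)" unfolding D_def quot_space_def by blast
    define X where "X = inv_into ?Q (B_flat T \<sigma> k l) D"
    have X: "X \<in> ?Q" "B_flat T \<sigma> k l X = D"
      unfolding X_def by (rule inv_into_into[OF B_flat_range[OF kl DQ]], rule f_inv_into_f[OF B_flat_range[OF kl DQ]])
    have "quot_norm norm X \<le> norm_B_flat_inv T \<sigma> k l"
      unfolding norm_B_flat_inv_def op_norm_def X_def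
      by (rule cSUP_upper[OF _ B_flat_inv_bdd[OF kl]]) (use DQ nD in simp)
    also have "\<dots> \<le> C * N l powr \<epsilon>" by (rule C[OF kl])
    \<comment> \<open>The larger constant makes the inequality strict, so that the infimum over the
      coset yields an actual representative.\<close>
    also have "\<dots> < (\<bar>C\<bar> + 1) * N l powr \<epsilon>"
      by (rule mult_strict_right_mono) (use N_pos[of l] in auto)
    finally have "quot_norm norm X < (\<bar>C\<bar> + 1) * N l powr \<epsilon>" .
    moreover have "X \<noteq> {}" using X(1) subspace_0[OF subspace_Gamma_s] unfolding quot_space_def elt_set_plus_def by auto
    ultimately have "\<exists>u\<in>X. norm u < (\<bar>C\<bar> + 1) * N l powr \<epsilon>" by (intro quot_norm_approx)
    then obtain u where u: "u \<in> X" "norm u < (\<bar>C\<bar> + 1) * N l powr \<epsilon>" by (rule bexE)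
    have "acc_B T k l *v u + 0 \<in> (*v) (acc_B T k l) ` X + Gamma_s T \<sigma> l"
      by (intro set_plus_intro imageI u(1) subspace_0[OF subspace_Gamma_s])
    then have "acc_B T k l *v u \<in> D" using X(2) unfolding B_flat_def quot_map_def by simp
    then obtain s where s: "s \<in> Gamma_s T \<sigma> l" "acc_B T k l *v u = w + s" unfolding D_def elt_set_plus_iff by blast
    have "norm v *\<^sub>R (- s) \<in> Gamma_s T \<sigma> l"
      by (intro subspace_scale[OF subspace_Gamma_s] subspace_neg[OF subspace_Gamma_s] s)
    moreover have eq: "v - acc_B T k l *v (norm v *\<^sub>R u) = norm v *\<^sub>R (- s)"
      using False s(2) by (simp add: matrix_vector_mult_scaleR scaleR_add_right w_def)
    moreover have "norm (norm v *\<^sub>R u) \<le> (\<bar>C\<bar> + 1) * N l powr \<epsilon> * norm v"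
      using mult_right_mono[OF less_imp_le[OF u(2)], of "norm v"] by (simp add: mult.commute)
    ultimately show ?thesis by (intro exI[of _ "norm v *\<^sub>R u"]) (simp only: eq simp_thms)
  qed
  then show ?thesis by (intro exI[of _ "\<bar>C\<bar> + 1"]) auto
qed

lemma DC_s0: "\<exists>C>0. \<forall>v\<in>Gamma_s T \<sigma> 0. \<forall>k. norm (acc_B T 0 k *v v) \<le> C * N k powr (-\<sigma>) * norm v"
proof (rule uniform_on_subspace[OF subspace_Gamma_s])
  fix v assume "v \<in> Gamma_s T \<sigma> 0"
  then show "\<exists>C. \<forall>k. norm (acc_B T 0 k *v v) \<le> C * N k powr (-\<sigma>)" by (rule Gamma_sE) blast
qed simp

end

section \<open>Power estimates\<close>

text \<open>A quantity below two bounds is below their weighted geometric mean.\<close>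

lemma weighted_min:
  fixes X a b c t :: real
  assumes "0 \<le> X" "X \<le> c * a" "X \<le> c * b" "0 < c" "0 < a" "0 < b" "0 \<le> t" "t \<le> 1"
  shows "X \<le> c * (a powr (1 - t) * b powr t)"
proof (cases "X = 0")
  case False
  define Y where "Y = X / c"
  have Y: "0 < Y" "Y \<le> a" "Y \<le> b" using assms False by (auto simp: Y_def divide_le_eq mult.commute)
  have "Y = Y powr (1 - t) * Y powr t" using Y(1) by (simp flip: powr_add)
  also have "\<dots> \<le> a powr (1 - t) * b powr t"
    by (intro mult_mono powr_mono2) (use Y assms in auto)
  finally show ?thesis using assms(4) by (simp add: Y_def divide_le_eq mult.commute)
qed (use assms in simp)

text \<open>With \<kappa> = \<theta>/d the main hypothesis reads 4h + (d-1)h/\<sigma> < \<kappa>.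
  The weight \<open>t\<close> has to lie above X/(\<theta>-h), where X collects the losses, and
  below 1/D. There is room if X D < \<theta> - h, where D is close to d for small h.\<close>

lemma exponent_choice:
  fixes d h \<theta> \<sigma> :: real
  defines "\<beta> \<equiv> 1 / (1 + h)"
  assumes d: "3 \<le> d" and h: "0 < h" and s: "0 < \<sigma>"
    and main: "(4 * d + d * (d - 1) / \<sigma>) * h < \<theta>" and th: "(d - 1) * (\<theta> - 1) \<le> 1"
  shows "\<exists>t. 0 < t \<and> t < 1 \<and> t * (\<beta>\<^sup>2 + d - 1 + h) < \<beta>\<^sup>2 \<and> (\<theta> - h) * t \<le> \<beta> \<and>
    2 * h + (1 + h) * ((d - 1) * h / \<sigma>) < (\<theta> - h) * t \<and> h < \<sigma> \<and> h < \<theta>"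
proof -
  define \<kappa> where "\<kappa> = \<theta> / d"
  define Q where "Q = (d - 1) * h / \<sigma>"
  define X where "X = 2 * h + (1 + h) * Q"
  \<comment> \<open>As \<beta> = 1/(1+h), the condition t (\<beta>^2 + d - 1 + h) < \<beta>^2 says t
    D < 1.\<close>
  define D where "D = 1 + (d - 1 + h) * (1 + h)\<^sup>2"
  have Q0: "0 < Q" unfolding Q_def using d h s by simp
  have "(4 * d + d * (d - 1) / \<sigma>) * h = d * (4 * h + Q)"
    unfolding Q_def using s by (simp add: field_simps)
  then have "d * (4 * h + Q) < d * \<kappa>" using main d by (simp add: \<kappa>_def)
  then have k1: "4 * h + Q < \<kappa>" using d by simp
  \<comment> \<open>The bound \<open>th\<close> gives \<theta> \<le> d/(d-1), hence \<kappa> \<le>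
    1/(d-1); here d \<ge> 3 enters.\<close>
  have k2: "\<kappa> \<le> 1 / 2"
  proof -
    have "\<theta> - 1 \<le> 1 / (d - 1)" using th d by (simp add: le_divide_eq mult.commute)
    then have "\<theta> \<le> d / (d - 1)" using d by (simp add: field_simps)
    then have "\<kappa> \<le> 1 / (d - 1)" unfolding \<kappa>_def using d by (simp add: field_simps)
    also have "\<dots> \<le> 1 / 2" using d by (simp add: field_simps)
    finally show ?thesis .
  qed
  have h8: "h < 1 / 8" using k1 k2 Q0 by linarith
  have th_eq: "\<theta> = d * \<kappa>" using d by (simp add: \<kappa>_def)
  have X0: "0 < X" unfolding X_def using h Q0 by (simp add: add_pos_pos)
  have X1: "X < \<kappa> - 2 * h + h * \<kappa>"
  proof -
    have "(1 + h) * Q < (1 + h) * (\<kappa> - 4 * h)" by (rule mult_strict_left_mono) (use k1 h in auto)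
    also have "\<dots> = \<kappa> - 4 * h + h * \<kappa> - 4 * h\<^sup>2" by (simp add: algebra_simps power2_eq_square)
    finally have "X < \<kappa> - 2 * h + h * \<kappa> - 4 * h\<^sup>2" unfolding X_def by linarith
    moreover have "0 \<le> 4 * h\<^sup>2" by simp
    ultimately show ?thesis by linarith
  qed
  \<comment> \<open>13/6 = 2 + 1/6: the fraction absorbs the term (d+1)h^2, by d + 1 \<le> 4d/3 and
    h < 1/8, while the cubic term is absorbed by -h.\<close>
  have D1: "D \<le> d * (1 + 13 / 6 * h)"
  proof -
    have "D = d * (1 + 2 * h) - h + (d + 1) * h\<^sup>2 + h * h\<^sup>2"
      unfolding D_def by (simp add: algebra_simps power2_eq_square power3_eq_cube)
    moreover have "h\<^sup>2 \<le> h * (1 / 8)" unfolding power2_eq_square by (rule mult_left_mono) (use h8 h in auto)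
    moreover have "(d + 1) * h\<^sup>2 \<le> (4 / 3 * d) * (h * (1 / 8))"
      by (rule mult_mono) (use calculation d in auto)
    moreover have "h * h\<^sup>2 \<le> h * 1"
      by (rule mult_left_mono) (use calculation h h8 in auto)
    ultimately have "D \<le> d * (1 + 2 * h) + (4 / 3 * d) * (h * (1 / 8))" by linarith
    then show ?thesis by (simp add: algebra_simps)
  qed
  have Dd: "d \<le> D"
  proof -
    have "(1 + h)\<^sup>2 \<ge> 1" using h by simp
    then have "(d - 1 + h) * 1 \<le> (d - 1 + h) * (1 + h)\<^sup>2" using d h by (intro mult_left_mono) auto
    then have "d - 1 + h \<le> D - 1" unfolding D_def by simp
    then show ?thesis using h by linarith
  qed
  then have D0: "0 < D" using d by linarith
  have XD: "X * D < \<theta> - h"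
  proof -
    have "X * D < (\<kappa> - 2 * h + h * \<kappa>) * D" by (rule mult_strict_right_mono[OF X1 D0])
    also have "\<dots> \<le> (\<kappa> - 2 * h + h * \<kappa>) * (d * (1 + 13 / 6 * h))"
      by (rule mult_left_mono[OF D1]) (use X1 X0 in linarith)
    also have "\<dots> = d * (\<kappa> - 2 * h + h * \<kappa> * (19 / 6) + 13 / 6 * h\<^sup>2 * (\<kappa> - 2))"
      by (simp add: field_simps power2_eq_square)
    also have "\<dots> \<le> d * (\<kappa> - 2 * h + h * (1 / 2) * (19 / 6))"
    proof (rule mult_left_mono)
      have "h * \<kappa> \<le> h * (1 / 2)" by (rule mult_left_mono) (use k2 h in auto)
      moreover have "13 / 6 * h\<^sup>2 * (\<kappa> - 2) \<le> 0" by (rule mult_nonneg_nonpos) (use k2 in auto)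
      ultimately show "\<kappa> - 2 * h + h * \<kappa> * (19 / 6) + 13 / 6 * h\<^sup>2 * (\<kappa> - 2) \<le> \<kappa> - 2 * h + h * (1 / 2) * (19 / 6)"
        by linarith
    qed (use d in simp)
    \<comment> \<open>5/12 = 2 - 19/12, and multiplied by d \<ge> 3 it exceeds 1.\<close>
    also have "\<dots> = \<theta> - 5 / 12 * (d * h)" unfolding th_eq by (simp add: field_simps)
    also have "\<dots> < \<theta> - h"
    proof -
      have "3 * h \<le> d * h" by (rule mult_right_mono) (use d h in auto)
      then show ?thesis using h by linarith
    qed
    finally show ?thesis .
  qed
  have thh: "0 < \<theta> - h" using XD mult_pos_pos[OF X0 D0] by linarith
  have lt: "X / (\<theta> - h) < 1 / D" using XD thh D0 by (simp add: field_simps)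
  obtain t where t2: "X / (\<theta> - h) < t" "t < 1 / D" using dense[OF lt] by blast
  have "0 < X / (\<theta> - h)" using X0 thh by simp
  then have t: "0 < t" "X / (\<theta> - h) < t" "t < 1 / D" using t2 by linarith+
  have "1 / D \<le> 1 / d" using Dd d by (simp add: frac_le)
  then have td: "t < 1 / d" using t(3) by linarith
  moreover have "1 / d < 1" using d by simp
  ultimately have t1: "t < 1" by linarith
  have b: "\<beta>\<^sup>2 + d - 1 + h = \<beta>\<^sup>2 * D"
  proof -
    have "\<beta>\<^sup>2 * (1 + h)\<^sup>2 = 1" unfolding \<beta>_def using h by (simp add: power_divide)
    moreover have "\<beta>\<^sup>2 * D = \<beta>\<^sup>2 * 1 + (d - 1 + h) * (\<beta>\<^sup>2 * (1 + h)\<^sup>2)"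
      unfolding D_def by (simp only: distrib_left mult.left_commute)
    ultimately show ?thesis by simp
  qed
  have b0: "0 < \<beta>" unfolding \<beta>_def using h by simp
  have "t * (\<beta>\<^sup>2 + d - 1 + h) < \<beta>\<^sup>2"
  proof -
    have "t * D < 1" using t(3) D0 by (simp add: field_simps)
    then have "\<beta>\<^sup>2 * (t * D) < \<beta>\<^sup>2 * 1" by (intro mult_strict_left_mono) (use b0 in auto)
    then show ?thesis unfolding b by (simp add: mult_ac)
  qed
  moreover have "(\<theta> - h) * t \<le> \<beta>"
  proof -
    have "(\<theta> - h) * t \<le> \<theta> * (1 / d)" by (rule mult_mono) (use h td thh t in auto)
    also have "\<dots> = \<kappa>" by (simp add: \<kappa>_def)
    also have "\<dots> \<le> 1 / 2" by (rule k2)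
    also have "\<dots> \<le> \<beta>" unfolding \<beta>_def using h h8 by (simp add: field_simps)
    finally show ?thesis .
  qed
  moreover have "X < (\<theta> - h) * t" using t(2) thh by (simp add: field_simps)
  moreover have "h < \<sigma>"
  proof -
    have "(d - 1) * h < \<sigma> * \<kappa>" using k1 h s unfolding Q_def by (simp add: field_simps) (smt (verit) mult_pos_pos)
    also have "\<dots> \<le> \<sigma> * (1 / 2)" by (rule mult_left_mono) (use k2 s in auto)
    finally have "(d - 1) * h < \<sigma> * (1 / 2)" .
    moreover have "1 * h \<le> (d - 1) * h" by (rule mult_right_mono) (use d h in auto)
    ultimately show ?thesis using s by linarith
  qed
  ultimately show ?thesis using t(1) t1 thh unfolding X_def Q_def by (intro exI[of _ t]) auto
qed

section \<open>Series of negative powers of the norms\<close>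

context rauzy_path
begin

lemma N_add_ge: "2 ^ j * N k \<le> N (j + k)"
proof (induction j)
  case (Suc j)
  then show ?case using N_Suc_ge[of "j + k"] by simp
qed simp

lemma N_powr_mono: "j \<le> k \<Longrightarrow> 0 \<le> p \<Longrightarrow> N k powr (-p) \<le> N j powr (-p)"
  by (rule powr_mono2') (use N_pos N_mono in auto)

lemma N_powr_le: "p \<le> q \<Longrightarrow> N k powr p \<le> N k powr q"
  by (rule powr_mono) (use N_ge_1 in auto)

text \<open>The norms at least double from level to level, so a geometric series dominates and the
  sum is comparable to its first term.\<close>

lemma N_powr_sum:
  assumes p: "0 < p"
  shows "\<exists>C>0. \<forall>k. summable (\<lambda>j. N (j + k) powr (-p)) \<and> (\<Sum>j. N (j + k) powr (-p)) \<le> C * N k powr (-p)"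
proof -
  define r :: real where "r = 2 powr (-p)"
  have r: "0 < r" "r < 1" unfolding r_def using p by (auto simp: powr_minus inverse_less_1_iff)
  have le: "N (j + k) powr (-p) \<le> r ^ j * N k powr (-p)" for j k
  proof -
    have "N (j + k) powr (-p) \<le> (2 ^ j * N k) powr (-p)"
      by (rule powr_mono2') (use N_add_ge N_pos p in auto)
    also have "\<dots> = (2 ^ j) powr (-p) * N k powr (-p)" using N_pos[of k] by (simp add: powr_mult)
    also have "(2 ^ j) powr (-p) = r ^ j"
      unfolding r_def by (simp add: powr_powr powr_power mult.commute flip: powr_realpow)
    finally show ?thesis .
  qed
  have gs: "summable (\<lambda>j. r ^ j * N k powr (-p))" for k
    by (intro summable_mult2 summable_geometric) (use r in simp)
  have sm: "summable (\<lambda>j. N (j + k) powr (-p))" for k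
    by (rule summable_comparison_test'[OF gs[of k], of 0]) (use le in auto)
  have "(\<Sum>j. N (j + k) powr (-p)) \<le> (1 / (1 - r)) * N k powr (-p)" for k
  proof -
    have "(\<Sum>j. N (j + k) powr (-p)) \<le> (\<Sum>j. r ^ j * N k powr (-p))" by (rule suminf_le[OF le sm gs])
    also have "\<dots> = (\<Sum>j. r ^ j) * N k powr (-p)" by (rule suminf_mult2[symmetric]) (use r in \<open>simp add: summable_geometric\<close>)
    finally show ?thesis using r by (simp add: suminf_geometric)
  qed
  then show ?thesis using sm r by (intro exI[of _ "1 / (1 - r)"]) auto
qed

lemma N_powr_finite_sum:
  assumes "0 < p"
  shows "\<exists>C>0. \<forall>k. (\<Sum>j<k. N j powr (-p)) \<le> C"
proof -
  obtain C where C: "0 < C" "summable (\<lambda>j. N (j + 0) powr (-p))" "(\<Sum>j. N (j + 0) powr (-p)) \<le> C * N 0 powr (-p)"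
    using N_powr_sum[OF assms] by blast
  have "(\<Sum>j<k. N j powr (-p)) \<le> C * N 0 powr (-p)" for k
    using sum_le_suminf[OF C(2), of "{..<k}"] C(3) by simp
  moreover have "0 < C * N 0 powr (-p)" using C(1) N_pos[of 0] by simp
  ultimately show ?thesis by blast
qed

text \<open>Variation of constants for the inhomogeneous recursion of the matrices.\<close>

lemma recurrence_expand:
  assumes "\<And>k. x (Suc k) = acc_B T k (Suc k) *v x k + e k"
  shows "x k = acc_B T 0 k *v x 0 + (\<Sum>j<k. acc_B T (Suc j) k *v e j)"
proof (induction k)
  case 0
  show ?case by (simp add: acc_B_self)
next
  case (Suc k)
  have A: "acc_B T k (Suc k) *v (acc_B T j k *v v) = acc_B T j (Suc k) *v v" if "j \<le> k" for j v
    using acc_B_mult[of j k "Suc k"] that by (simp add: matrix_vector_mul_assoc)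
  have "acc_B T k (Suc k) *v (\<Sum>j<k. acc_B T (Suc j) k *v e j) = (\<Sum>j<k. acc_B T (Suc j) (Suc k) *v e j)"
    unfolding linear_sum[OF matrix_vector_mul_linear] by (intro sum.cong A) auto
  then show ?case unfolding assms Suc
    by (simp add: matrix_vector_right_distrib A acc_B_self add.assoc)
qed

end

context dc_path
begin

text \<open>Since \<open>det B = 1\<close>, the hyperplane \<open>Gamma_zero T\<close> cannot be contracted too fast.\<close>
lemma theta_bound: "(real CARD('a) - 1) * (\<theta> - 1) \<le> 1"
proof (rule ccontr)
  assume "\<not> ?thesis"
  then have gt: "1 < (real CARD('a) - 1) * (\<theta> - 1)" by simp
  define d where "d = CARD('a) - 1"
  have d: "real d = real CARD('a) - 1" unfolding d_def by (simp add: of_nat_diff one_le_CARD)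
  obtain a0 :: 'a where True by blast
  define L where "L j = lam 0 j / lam 0 a0" for j
  \<comment> \<open>The columns of \<open>X\<close> other than column \<open>a0\<close> form a basis
    of the zero-mean hyperplane; column \<open>a0\<close> is a unit vector outside it.
    \<open>Y\<close> is the inverse of \<open>X\<close>.\<close>
  define X :: "real^'a^'a" where "X = (\<chi> i j. if i = j then 1 else if i = a0 then - L j else 0)"
  define Y :: "real^'a^'a" where "Y = (\<chi> i j. if i = j then 1 else if i = a0 then L j else 0)"
  have "X ** Y = mat 1"
  proof -
    have "(\<Sum>k\<in>UNIV. X $ i $ k * Y $ k $ j) = (if i = j then 1 else 0)" for i j
    proof (cases "i = a0")
      case False
      then have "(\<Sum>k\<in>UNIV. X $ i $ k * Y $ k $ j) = (\<Sum>k\<in>UNIV. if i = k then Y $ k $ j else 0)"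
        by (intro sum.cong) (auto simp: X_def)
      then show ?thesis using False by (simp add: Y_def)
    next
      case True
      have "(\<Sum>k\<in>UNIV. X $ i $ k * Y $ k $ j) = Y $ a0 $ j + (\<Sum>k\<in>UNIV - {a0}. X $ i $ k * Y $ k $ j)"
        using True by (subst sum.remove[of UNIV a0]) (auto simp: X_def)
      also have "(\<Sum>k\<in>UNIV - {a0}. X $ i $ k * Y $ k $ j) = (\<Sum>k\<in>UNIV - {a0}. if k = j then - L k else 0)"
        by (rule sum.cong) (use True in \<open>auto simp: X_def Y_def\<close>)
      also have "\<dots> = (if j = a0 then 0 else - L j)" by (simp add: sum.delta')
      finally show ?thesis using True by (auto simp: Y_def)
    qed
    then show ?thesis by (simp add: vec_eq_iff matrix_matrix_mult_def mat_def)
  qed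
  then have "det X * det Y = 1" using det_mul[of X Y] by simp
  then have X0: "det X \<noteq> 0" by auto
  obtain C where C: "C > 0" "\<And>k v. v \<in> Gamma_zero T \<Longrightarrow> norm (B 0 (nk k) *v v) \<le> C * N k powr (1 - \<theta>) * norm v"
    using DC_b by blast
  have col: "(B 0 (nk k) ** X) $ i $ j = (B 0 (nk k) *v column j X) $ i" for i j k
    by (simp add: matrix_matrix_mult_def matrix_vector_mult_def column_def)
  have colG: "column j X \<in> Gamma_zero T" if "j \<noteq> a0" for j
  proof -
    have "(\<Sum>a\<in>UNIV. lam 0 a * column j X $ a) = (\<Sum>a\<in>UNIV. (if a = j then lam 0 a else 0) - (if a = a0 then lam 0 a * L j else 0))"
      by (rule sum.cong) (use that in \<open>auto simp: column_def X_def\<close>)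
    also have "\<dots> = 0" using lam_pos[of 0 a0] by (simp add: sum_subtractf L_def)
    finally show ?thesis by (simp add: Gamma_zero_def iter_0)
  qed
  define K where "K = 1 + (\<Sum>j\<in>UNIV. norm (column j X))"
  have K: "norm (column j X) \<le> K" for j
    using member_le_sum[of j UNIV "\<lambda>j. norm (column j X)"] by (simp add: K_def)
  have K1: "1 \<le> K" by (simp add: K_def sum_nonneg)
  \<comment> \<open>The determinant of the product stays equal to \<open>det X\<close>, although all
    columns but one are of order N^(1-\<theta>) and the last one is at most of order N.\<close>
  have bd: "\<bar>det X\<bar> \<le> fact CARD('a) * (N k * K) * (C * N k powr (1 - \<theta>) * K) ^ d" for k
  proof -
    have "\<bar>det (B 0 (nk k) ** X)\<bar> \<le> fact CARD('a) * (N k * K) * (C * N k powr (1 - \<theta>) * K) ^ (CARD('a) - 1)"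
    proof (rule det_column_bound[where k = a0])
      fix i
      have "\<bar>(B 0 (nk k) ** X) $ i $ a0\<bar> \<le> norm (B 0 (nk k) *v column a0 X)"
        unfolding col by (rule component_le_norm_cart)
      also have "\<dots> \<le> N k * norm (column a0 X)" using norm_matrix_vector_le[of "B 0 (nk k)"] by (simp add: acc_B_0)
      also have "\<dots> \<le> N k * K" by (rule mult_left_mono[OF K]) (use N_pos[of k] in simp)
      finally show "\<bar>(B 0 (nk k) ** X) $ i $ a0\<bar> \<le> N k * K" .
    next
      fix i j :: 'a assume j: "j \<noteq> a0"
      have "\<bar>(B 0 (nk k) ** X) $ i $ j\<bar> \<le> norm (B 0 (nk k) *v column j X)"
        unfolding col by (rule component_le_norm_cart)
      also have "\<dots> \<le> C * N k powr (1 - \<theta>) * norm (column j X)" by (rule C(2)[OF colG[OF j]])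
      also have "\<dots> \<le> C * N k powr (1 - \<theta>) * K" by (rule mult_left_mono[OF K]) (use C(1) in simp)
      finally show "\<bar>(B 0 (nk k) ** X) $ i $ j\<bar> \<le> C * N k powr (1 - \<theta>) * K" .
    qed
    then show ?thesis by (simp add: det_mul det_B d_def)
  qed
  \<comment> \<open>If the claim failed, the product of these orders would be N^(-q) with q > 0 and
    would force \<open>det X\<close> to vanish.\<close>
  define q where "q = real d * (\<theta> - 1) - 1"
  have q: "0 < q" using gt d by (simp add: q_def)
  define W where "W = fact CARD('a) * K * (C * K) ^ d"
  have W: "\<bar>det X\<bar> \<le> W * N k powr (-q)" for k
  proof -
    have "(N k powr (1 - \<theta>)) ^ d = N k powr (real d * (1 - \<theta>))"
      using N_pos[of k] by (simp add: powr_power)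
    then have "N k * (N k powr (1 - \<theta>)) ^ d = N k powr (1 + real d * (1 - \<theta>))"
      using N_pos[of k] by (simp add: powr_mult_base)
    also have "1 + real d * (1 - \<theta>) = -q" by (simp add: q_def algebra_simps)
    finally have "N k * (N k powr (1 - \<theta>)) ^ d = N k powr (-q)" .
    then have "W * N k powr (-q) = W * (N k * (N k powr (1 - \<theta>)) ^ d)" by simp
    also have "\<dots> = fact CARD('a) * (N k * K) * (C * N k powr (1 - \<theta>) * K) ^ d"
      unfolding W_def by (simp add: power_mult_distrib mult_ac)
    finally show ?thesis using bd[of k] by simp
  qed
  obtain C' where "summable (\<lambda>j. N (j + 0) powr (-q))" using N_powr_sum[OF q] by blast
  then have "(\<lambda>j. W * N j powr (-q)) \<longlonglongrightarrow> W * 0" by (intro tendsto_intros) (simp add: summable_LIMSEQ_zero)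
  moreover have "\<exists>n. \<forall>k\<ge>n. \<bar>det X\<bar> \<le> W * N k powr (-q)" using W by blast
  ultimately have "\<bar>det X\<bar> \<le> W * 0" by (rule LIMSEQ_le_const)
  then show False using X0 by simp
qed

end

text \<open>\<open>h\<close> stands for an exponent slightly above \<eta>, for which (a) holds with
  a fixed constant.\<close>

locale dc_growth = dc_path T \<eta> \<theta> \<sigma> for T :: "'a::finite iet" and \<eta> \<theta> \<sigma> :: real +
  fixes h Ca :: real
  assumes h: "0 < h" and Ca: "1 \<le> Ca" and Z_le: "\<And>k. Z k \<le> Ca * N k powr h"
begin

text \<open>The factor by which a decay exponent shrinks when a bound in \<open>N k\<close> is
  rewritten in \<open>N (Suc k)\<close>.\<close>

definition "beta = 1 / (1 + h)"

lemma beta: "0 < beta" "beta \<le> 1" "1 - beta \<le> h"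
  unfolding beta_def using h by (auto simp: field_simps)

lemma N_Suc_powr: "N (Suc k) \<le> Ca * N k powr (1 + h)"
proof -
  have "N (Suc k) \<le> Z k * N k" by (rule N_Suc_le)
  also have "\<dots> \<le> Ca * N k powr h * N k" by (rule mult_right_mono[OF Z_le]) (use N_pos[of k] in simp)
  also have "\<dots> = Ca * N k powr (1 + h)" using powr_mult_base[of "N k" h] N_pos[of k] by (simp add: mult_ac)
  finally show ?thesis .
qed

lemma N_Suc_powr_pos:
  assumes "0 \<le> p"
  shows "N (Suc k) powr p \<le> Ca powr p * N k powr ((1 + h) * p)"
proof -
  have "N (Suc k) powr p \<le> (Ca * N k powr (1 + h)) powr p"
    by (rule powr_mono2) (use assms N_Suc_powr N_pos less_imp_le in auto)
  also have "\<dots> = Ca powr p * N k powr ((1 + h) * p)" using Ca by (simp add: powr_mult powr_powr)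
  finally show ?thesis .
qed

lemma N_powr_Suc_neg:
  assumes "0 \<le> p"
  shows "N k powr (-p) \<le> Ca powr (p * beta) * N (Suc k) powr (- (p * beta))"
proof -
  have hb: "(1 + h) * beta = 1" unfolding beta_def using h by simp
  have "N (Suc k) powr (p * beta) \<le> Ca powr (p * beta) * N k powr ((1 + h) * (p * beta))"
    by (rule N_Suc_powr_pos) (use assms beta in simp)
  also have "(1 + h) * (p * beta) = p" using hb by (simp add: algebra_simps)
  finally have "N (Suc k) powr (p * beta) * N k powr (-p) \<le> Ca powr (p * beta)"
    using N_pos[of k] by (simp add: powr_minus divide_simps)
  then show ?thesis using N_pos[of "Suc k"] by (simp add: powr_minus divide_simps mult.commute)
qed

text \<open>The length at the next level is at most a constant over \<open>N k\<close>; expressing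
  this in the norm of that next level costs the exponent \<open>beta\<close>. Level 0 is covered by
  the constant.\<close>

lemma tlen_powr: "\<exists>C>0. \<forall>k. tlen (nk k) \<le> C * N k powr (-beta)"
proof -
  define C where "C = tlen 0 * (Ca powr beta + N 0 powr beta)"
  have C0: "0 < C" unfolding C_def using tlen_pos[of 0] Ca by (simp add: add_pos_nonneg)
  have "tlen (nk k) \<le> C * N k powr (-beta)" for k
  proof (cases k)
    case 0
    have "tlen 0 * N 0 powr beta \<le> C" unfolding C_def using tlen_pos[of 0] by (intro mult_left_mono) auto
    then have "tlen 0 * N 0 powr beta * N 0 powr (-beta) \<le> C * N 0 powr (-beta)" by (rule mult_right_mono) simp
    then have "tlen 0 * (N 0 powr beta * N 0 powr (-beta)) \<le> C * N 0 powr (-beta)" by (simp only: mult.assoc)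
    then show ?thesis using 0 N_pos[of 0] by (simp add: powr_add[symmetric])
  next
    case (Suc j)
    have "tlen (nk k) \<le> tlen 0 * N j powr (-1)"
      using tlen_N[of j] N_pos[of j] Suc by (simp add: powr_minus divide_simps)
    also have "\<dots> \<le> tlen 0 * (Ca powr beta * N k powr (-beta))"
      using N_powr_Suc_neg[of 1 j] Suc tlen_pos[of 0] by (intro mult_left_mono) auto
    also have "\<dots> \<le> tlen 0 * ((Ca powr beta + N 0 powr beta) * N k powr (-beta))"
      by (intro mult_left_mono mult_right_mono) (auto simp: less_imp_le tlen_pos)
    also have "\<dots> = C * N k powr (-beta)" unfolding C_def by (simp only: mult.assoc)
    finally show ?thesis .
  qed
  then show ?thesis using C0 by blast
qed

lemma inverse_growth:
  "norm v \<le> real CARD('a) * fact CARD('a) * N k powr (real CARD('a) - 1) * norm (acc_B T 0 k *v v)"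
proof -
  have "N k powr real (CARD('a) - 1) = N k ^ (CARD('a) - 1)" by (rule powr_realpow[OF N_pos])
  moreover have "real (CARD('a) - 1) = real CARD('a) - 1" by (simp add: of_nat_diff one_le_CARD)
  ultimately show ?thesis using norm_le_inverse_bound[OF det_acc_B[of 0 k], of v] by simp
qed

text \<open>The means of the derivative have zero integral and obey the recursion of the matrices up
  to bounded multiples of row sums. Each defect is estimated in two ways and interpolated: by the
  contraction of the weighted norm, which gives \<open>N (Suc j)\<close> to the power -
  \<open>beta\<close> squared, and from level 0 by (b) after a pull-back. Multiplied by the length
  of an interval, the means control the oscillation.\<close>

lemma osc_estimate:
  assumes t: "0 < t" "t < 1" "t * (beta\<^sup>2 + real CARD('a) - 1 + h) < beta\<^sup>2" "(\<theta> - h) * t \<le> beta" "h < \<theta>"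
  shows "\<exists>C>0. \<forall>\<phi> f g M. cocycle_data T \<phi> f g \<longrightarrow> 0 < M \<longrightarrow> tot \<phi> 0 = 0 \<longrightarrow> tot g 0 \<le> M \<longrightarrow>
    norm (mean \<phi> 0) \<le> M \<longrightarrow> (\<forall>k a x y. x \<in> cI (nk k) a \<longrightarrow> y \<in> cI (nk k) a \<longrightarrow>
      \<bar>SB \<phi> (nk k) a x - SB \<phi> (nk k) a y\<bar> \<le> C * M * N k powr (- ((\<theta> - h) * t)))"
proof -
  obtain C1 where C1: "0 < C1" "\<And>k. tlen (nk k) \<le> C1 * N k powr (-beta)" using tlen_powr by blast
  obtain C2 where C2: "0 < C2" "\<And>k v. v \<in> Gamma_zero T \<Longrightarrow> norm (B 0 (nk k) *v v) \<le> C2 * N k powr (1 - \<theta>) * norm v"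
    using DC_b by blast
  define d where "d = real CARD('a) - 1"
  define C3 where "C3 = real CARD('a) * fact CARD('a)"
  have C3: "0 < C3" "\<And>k v. norm v \<le> C3 * N k powr d * norm (B 0 (nk k) *v v)"
    using inverse_growth unfolding C3_def d_def acc_B_0 by simp_all
  define C4 where "C4 = Ca powr (beta * beta)"
  have C4: "0 < C4" "\<And>j. N j powr (-beta) \<le> C4 * N (Suc j) powr (- (beta\<^sup>2))"
    unfolding C4_def power2_eq_square using Ca N_powr_Suc_neg[of beta] beta(1) by auto
  \<comment> \<open>The exponent of \<open>N (Suc j)\<close> that remains after interpolation; the
    hypothesis on \<open>t\<close> makes it positive, so the sum over j converges.\<close>
  define \<epsilon> where "\<epsilon> = beta\<^sup>2 * (1 - t) - t * (d + h)"
  have eps: "0 < \<epsilon>" unfolding \<epsilon>_def using t(3) by (simp add: d_def algebra_simps)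
  obtain C5 where C5: "0 < C5" "\<And>k. (\<Sum>j<k. N j powr (-\<epsilon>)) \<le> C5" using N_powr_finite_sum[OF eps] by blast
  define R where "R = (\<theta> - h) * t"
  define K where "K = C1 * C4 + C1 * C2 * C3 * Ca"
  have K: "0 < K" "C1 * C4 \<le> K" "C1 * C2 * C3 * Ca \<le> K"
    unfolding K_def using C1(1) C2(1) C3(1) C4(1) Ca by (auto simp: add_pos_pos)
  define C where "C = C1 * C2 + K * C5 + C1"
  have C: "0 < C" unfolding C_def using C1 C2 K C5 by (simp add: add_pos_pos)
  have R1: "R \<le> \<theta> - h" unfolding R_def using t by (simp add: mult_left_le)
  have main: "\<bar>SB \<phi> (nk k) a x - SB \<phi> (nk k) a y\<bar> \<le> C * M * N k powr (-R)"
    if data: "cocycle_data T \<phi> f g" and M: "0 < M" and tot0: "tot \<phi> 0 = 0" and V: "tot g 0 \<le> M"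
      and m0: "norm (mean \<phi> 0) \<le> M" and xy: "x \<in> cI (nk k) a" "y \<in> cI (nk k) a" for \<phi> f g M k a x y
  proof -
    interpret cocycle_data T \<phi> f g by (rule data)
    define m where "m k = mean \<phi> (nk k)" for k
    define e where "e k = m (Suc k) - acc_B T k (Suc k) *v m k" for k
    have m_sum: "(\<Sum>b\<in>UNIV. lam (nk k) b * m k $ b) = 0" for k
      unfolding m_def mean_tot tot0 ..
    have eb: "\<bar>e k $ b\<bar> \<le> tot g 0 * rsum (nk k) (nk (Suc k)) b" for k b
      unfolding e_def m_def acc_B_def by (rule mean_step[OF rv_time_Suc(1)])
    have e1: "wnorm (nk (Suc j)) (e j) \<le> M * tlen (nk j)" for j
    proof -
      have "wnorm (nk (Suc j)) (e j) \<le> (\<Sum>b\<in>UNIV. lam (nk (Suc j)) b * (tot g 0 * rsum (nk j) (nk (Suc j)) b))"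
        unfolding wnorm_def by (intro sum_mono mult_left_mono eb) (simp add: less_imp_le lam_pos)
      also have "\<dots> = tot g 0 * (\<Sum>b\<in>UNIV. lam (nk (Suc j)) b * (B (nk j) (nk (Suc j)) *v (\<chi> a. 1)) $ b)"
        unfolding mat_vec_const by (simp add: sum_distrib_left mult_ac)
      also have "\<dots> = tot g 0 * tlen (nk j)" unfolding lam_pairing[OF rv_time_Suc(1)] by simp
      also have "\<dots> \<le> M * tlen (nk j)" by (rule mult_right_mono[OF V]) (simp add: less_imp_le tlen_pos)
      finally show ?thesis .
    qed
    have e2: "norm (e j) \<le> M * (Ca * N (Suc j) powr h)" for j
    proof -
      have "norm (e j) \<le> (\<Sum>b\<in>UNIV. \<bar>e j $ b\<bar>)" by (rule norm_le_l1_cart)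
      also have "\<dots> \<le> (\<Sum>b\<in>UNIV. tot g 0 * rsum (nk j) (nk (Suc j)) b)" by (intro sum_mono eb)
      also have "\<dots> = tot g 0 * Z j" by (simp add: sum_distrib_left[symmetric] mat_norm_B rv_time_Suc(1))
      also have "\<dots> \<le> M * (Ca * N (Suc j) powr h)"
      proof (rule mult_mono[OF V])
        have "Ca * N j powr h \<le> Ca * N (Suc j) powr h"
          by (intro mult_left_mono powr_mono2) (use h Ca N_mono[of j "Suc j"] N_pos[of j] in auto)
        then show "Z j \<le> Ca * N (Suc j) powr h" using Z_le[of j] by linarith
      qed (use M mat_norm_nonneg in auto)
      finally show ?thesis .
    qed
    have summand: "wnorm (nk k) (acc_B T (Suc j) k *v e j) \<le> (M * K) * (N j powr (-\<epsilon>) * N k powr (-R))" if j: "j < k" for j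
    proof -
      let ?X = "wnorm (nk k) (acc_B T (Suc j) k *v e j)"
      have "?X \<le> wnorm (nk (Suc j)) (e j)" unfolding acc_B_def by (rule wnorm_B) (use j in \<open>simp add: nk_mono\<close>)
      also have "\<dots> \<le> M * (C1 * (C4 * N (Suc j) powr (- (beta\<^sup>2))))"
      proof -
        have "tlen (nk j) \<le> C1 * (C4 * N (Suc j) powr (- (beta\<^sup>2)))"
          using C1(2)[of j] mult_left_mono[OF C4(2)[of j], of C1] C1(1) by linarith
        then show ?thesis using e1[of j] mult_left_mono[of _ _ M] M by (meson less_imp_le order_trans)
      qed
      also have "\<dots> \<le> (M * K) * N (Suc j) powr (- (beta\<^sup>2))"
        using mult_right_mono[OF K(2), of "M * N (Suc j) powr (- (beta\<^sup>2))"] M by (simp add: mult_ac)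
      finally have X1: "?X \<le> (M * K) * N (Suc j) powr (- (beta\<^sup>2))" .
      \<comment> \<open>The preimage of the defect at level 0. It has zero mean because the means
        have zero integral at every level and the pairing with the lengths is invariant; hence (b)
        applies.\<close>
      obtain w where w: "acc_B T 0 (Suc j) *v w = e j" using acc_B_surj[of 0 "Suc j" "e j"] by auto
      have wG: "w \<in> Gamma_zero T"
      proof -
        have "(\<Sum>a\<in>UNIV. lam 0 a * w $ a) = (\<Sum>b\<in>UNIV. lam (nk (Suc j)) b * e j $ b)"
          unfolding w[symmetric] acc_B_0 by (rule lam_pairing[symmetric]) simp
        also have "\<dots> = (\<Sum>b\<in>UNIV. lam (nk (Suc j)) b * m (Suc j) $ b) -
            (\<Sum>b\<in>UNIV. lam (nk (Suc j)) b * (B (nk j) (nk (Suc j)) *v m j) $ b)"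
          by (simp add: e_def acc_B_def right_diff_distrib sum_subtractf)
        also have "\<dots> = 0" unfolding lam_pairing[OF rv_time_Suc(1)] m_sum by simp
        finally show ?thesis by (simp add: Gamma_zero_def iter_0)
      qed
      have eq: "acc_B T (Suc j) k *v e j = B 0 (nk k) *v w"
        using acc_B_mult[of 0 "Suc j" k] j by (simp add: w[symmetric] matrix_vector_mul_assoc acc_B_0)
      have "norm w \<le> C3 * N (Suc j) powr d * norm (e j)"
        using C3(2)[of w "Suc j"] w by (simp add: acc_B_0)
      also have "\<dots> \<le> C3 * N (Suc j) powr d * (M * (Ca * N (Suc j) powr h))"
        by (rule mult_left_mono[OF e2]) (use C3(1) in simp)
      also have "\<dots> = M * C3 * Ca * N (Suc j) powr (d + h)" unfolding powr_add by (simp add: mult_ac)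
      finally have nw: "norm w \<le> M * C3 * Ca * N (Suc j) powr (d + h)" .
      have "?X \<le> tlen (nk k) * norm (B 0 (nk k) *v w)" unfolding eq by (rule wnorm_le_norm)
      also have "\<dots> \<le> (C1 * N k powr (-beta)) * (C2 * N k powr (1 - \<theta>) * (M * C3 * Ca * N (Suc j) powr (d + h)))"
      proof (rule mult_mono[OF C1(2)])
        show "norm (B 0 (nk k) *v w) \<le> C2 * N k powr (1 - \<theta>) * (M * C3 * Ca * N (Suc j) powr (d + h))"
          by (rule order_trans[OF C2(2)[OF wG]], rule mult_left_mono[OF nw]) (use C2(1) in simp)
      qed (use C1(1) in auto)
      also have "\<dots> = (C1 * C2 * C3 * Ca) * (M * (N k powr (-beta + (1 - \<theta>)) * N (Suc j) powr (d + h)))"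
        unfolding powr_add by (simp add: mult_ac)
      \<comment> \<open>-beta + 1 - \<theta> \<le> -(\<theta> - h), because 1 - beta \<le>
        h.\<close>
      also have "\<dots> \<le> K * (M * (N k powr (- (\<theta> - h)) * N (Suc j) powr (d + h)))"
        by (intro mult_mono mult_left_mono mult_right_mono N_powr_le K) (use beta(3) K M in auto)
      finally have X2: "?X \<le> (M * K) * (N k powr (- (\<theta> - h)) * N (Suc j) powr (d + h))" by (simp add: mult_ac)
      \<comment> \<open>Weight 1 - t on the contraction bound and t on the bound from level 0: the
        powers of \<open>N (Suc j)\<close> combine to -\<epsilon>, those of \<open>N k\<close> to
        -R.\<close>
      have "?X \<le> (M * K) * ((N (Suc j) powr (- (beta\<^sup>2))) powr (1 - t) * (N k powr (- (\<theta> - h)) * N (Suc j) powr (d + h)) powr t)"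
        by (rule weighted_min[OF wnorm_nonneg X1 X2]) (use M K(1) t N_pos[of "Suc j"] N_pos[of k] in auto)
      also have "(N (Suc j) powr (- (beta\<^sup>2))) powr (1 - t) * (N k powr (- (\<theta> - h)) * N (Suc j) powr (d + h)) powr t
          = N (Suc j) powr (- (beta\<^sup>2) * (1 - t) + (d + h) * t) * N k powr (- (\<theta> - h) * t)"
        unfolding powr_add[of _ "- (beta\<^sup>2) * (1 - t)"] by (simp add: powr_mult powr_powr mult_ac)
      also have "- (beta\<^sup>2) * (1 - t) + (d + h) * t = -\<epsilon>" unfolding \<epsilon>_def by (simp add: mult.commute)
      also have "- (\<theta> - h) * t = -R" unfolding R_def by (rule mult_minus_left)
      also have "(M * K) * (N (Suc j) powr (-\<epsilon>) * N k powr (-R)) \<le> (M * K) * (N j powr (-\<epsilon>) * N k powr (-R))"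
        by (intro mult_left_mono mult_right_mono N_powr_mono) (use M K eps in auto)
      finally show ?thesis .
    qed
    have m0G: "m 0 \<in> Gamma_zero T" using m_sum[of 0] by (simp add: Gamma_zero_def iter_0)
    have "m k = acc_B T 0 k *v m 0 + (\<Sum>j<k. acc_B T (Suc j) k *v e j)"
      by (rule recurrence_expand) (simp add: e_def)
    then have "wnorm (nk k) (m k) \<le> wnorm (nk k) (acc_B T 0 k *v m 0) + wnorm (nk k) (\<Sum>j<k. acc_B T (Suc j) k *v e j)"
      by (simp only: wnorm_triangle)
    also have "\<dots> \<le> wnorm (nk k) (acc_B T 0 k *v m 0) + (\<Sum>j<k. wnorm (nk k) (acc_B T (Suc j) k *v e j))"
      by (intro add_left_mono wnorm_sum) simp
    also have "\<dots> \<le> C1 * C2 * M * N k powr (-R) + M * K * C5 * N k powr (-R)"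
    proof (rule add_mono)
      have "wnorm (nk k) (acc_B T 0 k *v m 0) \<le> tlen (nk k) * norm (B 0 (nk k) *v m 0)"
        unfolding acc_B_0 by (rule wnorm_le_norm)
      also have "\<dots> \<le> (C1 * N k powr (-beta)) * (C2 * N k powr (1 - \<theta>) * M)"
      proof (rule mult_mono[OF C1(2)])
        show "norm (B 0 (nk k) *v m 0) \<le> C2 * N k powr (1 - \<theta>) * M"
          by (rule order_trans[OF C2(2)[OF m0G]], rule mult_left_mono) (use C2(1) m0 in \<open>auto simp: m_def\<close>)
      qed (use C1(1) in auto)
      also have "\<dots> = C1 * C2 * M * N k powr (-beta + (1 - \<theta>))" unfolding powr_add by (simp add: mult_ac)
      also have "\<dots> \<le> C1 * C2 * M * N k powr (-R)"
        by (intro mult_left_mono N_powr_le) (use beta(3) R1 C1 C2 M in auto)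
      finally show "wnorm (nk k) (acc_B T 0 k *v m 0) \<le> C1 * C2 * M * N k powr (-R)" .
      have "(\<Sum>j<k. wnorm (nk k) (acc_B T (Suc j) k *v e j)) \<le> (\<Sum>j<k. (M * K) * (N j powr (-\<epsilon>) * N k powr (-R)))"
        by (rule sum_mono) (rule summand, simp)
      also have "\<dots> = (M * K) * N k powr (-R) * (\<Sum>j<k. N j powr (-\<epsilon>))" by (simp add: sum_distrib_left mult_ac)
      also have "\<dots> \<le> (M * K) * N k powr (-R) * C5" by (rule mult_left_mono[OF C5(2)]) (use M K in simp)
      finally show "(\<Sum>j<k. wnorm (nk k) (acc_B T (Suc j) k *v e j)) \<le> M * K * C5 * N k powr (-R)" by (simp add: mult_ac)
    qed
    finally have wm: "wnorm (nk k) (m k) \<le> C1 * C2 * M * N k powr (-R) + M * K * C5 * N k powr (-R)" .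
    have "\<bar>SB \<phi> (nk k) a x - SB \<phi> (nk k) a y\<bar> \<le> lam (nk k) a * \<bar>m k $ a\<bar> + lam (nk k) a * tot g 0"
      using phi_osc[OF xy] by (simp add: m_def distrib_left)
    also have "\<dots> \<le> wnorm (nk k) (m k) + C1 * M * N k powr (-R)"
    proof (rule add_mono)
      show "lam (nk k) a * \<bar>m k $ a\<bar> \<le> wnorm (nk k) (m k)"
        unfolding wnorm_def by (rule member_le_sum) (auto simp: less_imp_le lam_pos)
      have "lam (nk k) a * tot g 0 \<le> (C1 * N k powr (-beta)) * M"
        by (rule mult_mono) (use lam_le_tlen[of "nk k" a] C1(2)[of k] V C1(1) tot_g_nonneg in auto)
      also have "\<dots> \<le> C1 * M * N k powr (-R)"
        using mult_left_mono[OF N_powr_le[of "-beta" "-R" k], of "C1 * M"] t(4) C1(1) M by (simp add: R_def mult_ac)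
      finally show "lam (nk k) a * tot g 0 \<le> C1 * M * N k powr (-R)" .
    qed
    finally show ?thesis using wm by (simp add: C_def algebra_simps)
  qed
  show ?thesis using C main unfolding R_def by (intro exI[of _ C]) auto
qed

end

section \<open>Pulling the defects back to level 0\<close>

context dc_growth
begin

text \<open>The defects \<open>c (Suc k) - B c k\<close> are pulled back to level \<open>k\<close> modulo the stable spaces; the sum of
  these pull-backs at level 0 is the correction.  What remains at level \<open>k\<close> is a sum of stable
  vectors, each of which is estimated both by (c) and by the decay from level 0.\<close>
lemma correction:
  fixes \<epsilon> p0 :: real
  defines "p \<equiv> p0 - (1 + h) * \<epsilon>" and "t \<equiv> (h + 3 * \<epsilon>) / \<sigma>"
  defines "q \<equiv> p - h - (1 + h) * ((real CARD('a) - 1) * t)"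
  assumes eps: "0 < \<epsilon>" and p: "0 < p" and t: "t \<le> 1" and q: "0 < q"
  shows "\<exists>C>0. \<forall>c M. 0 < M \<longrightarrow> (\<forall>k. norm (c (Suc k) - acc_B T k (Suc k) *v c k) \<le> M * N k powr (-p0)) \<longrightarrow>
    (\<exists>v. norm (c 0 - v) \<le> C * M \<and>
      (\<forall>k. norm (c k - acc_B T 0 k *v v) \<le> C * M * (N k powr (-p) + N k powr (- (h + 2 * \<epsilon>)))))"
proof -
  have t0: "0 \<le> t" unfolding t_def using h eps sigma by simp
  obtain D1 where D1: "0 < D1" "\<And>k l v. k \<le> l \<Longrightarrow> v \<in> Gamma_s T \<sigma> k \<Longrightarrow> norm (acc_B T k l *v v) \<le> D1 * N l powr \<epsilon> * norm v"
    using DC_c1[OF eps] by auto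
  obtain D2 where D2: "0 < D2" "\<And>k l v. k \<le> l \<Longrightarrow> \<exists>u. v - acc_B T k l *v u \<in> Gamma_s T \<sigma> l \<and> norm u \<le> D2 * N l powr \<epsilon> * norm v"
    using DC_c2[OF eps] by auto
  obtain D3 where D3: "0 < D3" "\<And>k v. v \<in> Gamma_s T \<sigma> 0 \<Longrightarrow> norm (acc_B T 0 k *v v) \<le> D3 * N k powr (-\<sigma>) * norm v"
    using DC_s0 by auto
  obtain D4 where D4: "0 < D4" "\<And>k. summable (\<lambda>j. N (j + k) powr (-p))" "\<And>k. (\<Sum>j. N (j + k) powr (-p)) \<le> D4 * N k powr (-p)"
    using N_powr_sum[OF p] by auto
  obtain D5 where D5: "0 < D5" "\<And>k. (\<Sum>j<k. N j powr (-q)) \<le> D5" using N_powr_finite_sum[OF q] by auto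
  define d where "d = real CARD('a) - 1"
  have d: "0 \<le> d" unfolding d_def using CARD_ge2 by simp
  define C3 where "C3 = real CARD('a) * fact CARD('a)"
  have C3: "0 < C3" "\<And>k v. norm v \<le> C3 * N k powr d * norm (acc_B T 0 k *v v)"
    using inverse_growth unfolding C3_def d_def by simp_all
  define E1 where "E1 = D2 * Ca powr \<epsilon>"
  define E2 where "E2 = 1 + E1 * D4 + Ca * E1 * D4"
  define K where "K = D1 + D3 * C3"
  define C where "C = E1 * D4 + E2 * K * Ca powr (d * t) * D5"
  have pos: "0 < E1" "0 < E2" "0 < K" using D1 D2 D3 D4 C3 Ca unfolding E1_def E2_def K_def
    by (auto simp: add_pos_pos add_pos_nonneg)
  have C: "0 < C" unfolding C_def using pos D4 D5 Ca by (intro add_pos_pos mult_pos_pos) auto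
  have "\<exists>v. norm (c 0 - v) \<le> C * M \<and>
      (\<forall>k. norm (c k - acc_B T 0 k *v v) \<le> C * M * (N k powr (-p) + N k powr (- (h + 2 * \<epsilon>))))"
    if M: "0 < M" and dl_le: "\<And>k. norm (c (Suc k) - acc_B T k (Suc k) *v c k) \<le> M * N k powr (-p0)" for c M
  proof -
    define dl where "dl k = c (Suc k) - acc_B T k (Suc k) *v c k" for k
    \<comment> \<open>The defect \<open>dl i\<close> is a vector of level \<open>Suc i\<close>, so
      it has pull-backs for k \<le> Suc i; \<open>us k\<close> below sums those of all defects with
      i \<ge> k.\<close>
    define u where "u k i = (SOME u. dl i - acc_B T k (Suc i) *v u \<in> Gamma_s T \<sigma> (Suc i) \<and> norm u \<le> D2 * N (Suc i) powr \<epsilon> * norm (dl i))" for k i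
    have u: "dl i - acc_B T k (Suc i) *v u k i \<in> Gamma_s T \<sigma> (Suc i)" "norm (u k i) \<le> D2 * N (Suc i) powr \<epsilon> * norm (dl i)"
      if "k \<le> Suc i" for k i
      using someI_ex[OF D2(2)[OF that, of "dl i"]] unfolding u_def by auto
    have u_le: "norm (u k i) \<le> E1 * M * N i powr (-p)" if "k \<le> Suc i" for k i
    proof -
      have "norm (u k i) \<le> D2 * (Ca powr \<epsilon> * N i powr ((1 + h) * \<epsilon>)) * (M * N i powr (-p0))"
        by (rule order_trans[OF u(2)[OF that]], intro mult_mono mult_left_mono N_Suc_powr_pos)
           (use D2(1) eps dl_le Ca in \<open>auto simp: dl_def\<close>)
      also have "\<dots> = E1 * M * (N i powr ((1 + h) * \<epsilon>) * N i powr (-p0))" unfolding E1_def by (simp only: mult_ac)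
      also have "N i powr ((1 + h) * \<epsilon>) * N i powr (-p0) = N i powr (-p)"
        unfolding p_def powr_add[symmetric] by (simp add: algebra_simps)
      finally show ?thesis .
    qed
    define us where "us k = (\<Sum>i. u k (i + k))" for k
    have sm: "summable (\<lambda>i. E1 * M * N (i + k) powr (-p))" for k by (intro summable_mult D4)
    have smu: "summable (\<lambda>i. u k (i + k))" "summable (\<lambda>i. norm (u k (i + k)))" for k
      by (rule summable_comparison_test'[OF sm[of k], of 0]; use u_le in simp)+
    have us_le: "norm (us k) \<le> E1 * D4 * M * N k powr (-p)" for k
    proof -
      have "norm (us k) \<le> (\<Sum>i. norm (u k (i + k)))" unfolding us_def by (rule summable_norm[OF smu(2)])
      also have "\<dots> \<le> (\<Sum>i. E1 * M * N (i + k) powr (-p))" by (rule suminf_le[OF _ smu(2) sm]) (use u_le in simp)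
      also have "\<dots> = E1 * M * (\<Sum>i. N (i + k) powr (-p))" by (rule suminf_mult[OF D4(2)])
      also have "\<dots> \<le> E1 * M * (D4 * N k powr (-p))" by (rule mult_left_mono[OF D4(3)]) (use pos M in simp)
      finally show ?thesis by (simp only: mult_ac)
    qed
    define e where "e k = dl k + us (Suc k) - acc_B T k (Suc k) *v us k" for k
    \<comment> \<open>Pull-backs of one defect to levels k and k + 1, compared at level k + 1, have
      images at the level of the defect that differ by a stable vector, so they differ by a stable
      vector already. The infinite sum stays in the subspace because it is closed.\<close>
    have eG: "e k \<in> Gamma_s T \<sigma> (Suc k)" for k
    proof -
      let ?A = "acc_B T k (Suc k)"
      let ?w = "\<lambda>i. u (Suc k) (i + Suc k) - ?A *v u k (i + Suc k)"
      have mem: "?w i \<in> Gamma_s T \<sigma> (Suc k)" for i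
      proof -
        let ?j = "i + Suc k"
        have "acc_B T (Suc k) (Suc ?j) *v (?A *v v) = acc_B T k (Suc ?j) *v v" for v
          using acc_B_mult[of k "Suc k" "Suc ?j"] by (simp add: matrix_vector_mul_assoc)
        then have "acc_B T (Suc k) (Suc ?j) *v ?w i =
            (dl ?j - acc_B T k (Suc ?j) *v u k ?j) - (dl ?j - acc_B T (Suc k) (Suc ?j) *v u (Suc k) ?j)"
          by (simp add: matrix_vector_mult_diff_distrib)
        also have "\<dots> \<in> Gamma_s T \<sigma> (Suc ?j)"
          by (intro subspace_diff[OF subspace_Gamma_s] u(1)) auto
        finally show ?thesis using Gamma_s_invariant[of "Suc k" "Suc ?j" \<sigma> "?w i", OF _ sigma] by simp
      qed
      have smw: "summable (\<lambda>i. u k (i + Suc k))" using summable_ignore_initial_segment[OF smu(1)[of k], of 1] by simp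
      have smA: "summable (\<lambda>i. ?A *v u k (i + Suc k))"
        by (rule bounded_linear.summable[OF matrix_vector_mul_bounded_linear smw])
      have us1: "us k = u k k + (\<Sum>i. u k (i + Suc k))"
        unfolding us_def using suminf_split_head[OF smu(1)[of k]] by simp
      have "?A *v us k = ?A *v u k k + (\<Sum>i. ?A *v u k (i + Suc k))"
        unfolding us1 matrix_vector_right_distrib
          bounded_linear.suminf[OF matrix_vector_mul_bounded_linear smw] ..
      moreover have "us (Suc k) - (\<Sum>i. ?A *v u k (i + Suc k)) = (\<Sum>i. ?w i)"
        unfolding us_def by (rule suminf_diff[OF smu(1)[of "Suc k"] smA])
      ultimately have e_eq: "e k = (dl k - ?A *v u k k) + (\<Sum>i. ?w i)"
        unfolding e_def by (simp add: algebra_simps)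
      have lim: "(\<lambda>n. \<Sum>i<n. ?w i) \<longlonglongrightarrow> (\<Sum>i. ?w i)"
        by (rule summable_LIMSEQ[OF summable_diff[OF smu(1)[of "Suc k"] smA]])
      have part: "(\<Sum>i<n. ?w i) \<in> Gamma_s T \<sigma> (Suc k)" for n
        by (rule subspace_sum[OF subspace_Gamma_s]) (rule mem)
      have "(\<Sum>i. ?w i) \<in> Gamma_s T \<sigma> (Suc k)"
        by (rule closed_sequentially[OF closed_subspace[OF subspace_Gamma_s] part lim])
      then show ?thesis unfolding e_eq
        by (intro subspace_add[OF subspace_Gamma_s] u(1)) auto
    qed
    have e_le: "norm (e k) \<le> M * E2 * N k powr (h - p)" for k
    proof -
      have 1: "norm (dl k) \<le> M * N k powr (h - p)"
      proof -
        have "M * N k powr (-p0) \<le> M * N k powr (h - p)"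
          by (intro mult_left_mono N_powr_le) (use M h eps in \<open>auto simp: p_def\<close>)
        then show ?thesis using dl_le[of k] unfolding dl_def by linarith
      qed
      have 2: "norm (us (Suc k)) \<le> E1 * D4 * M * N k powr (h - p)"
      proof -
        have "N (Suc k) powr (-p) \<le> N k powr (-p)" by (rule N_powr_mono) (use p in auto)
        also have "\<dots> \<le> N k powr (h - p)" by (rule N_powr_le) (use h in simp)
        finally show ?thesis using us_le[of "Suc k"] mult_left_mono[of _ _ "E1 * D4 * M"] pos D4(1) M
          by (meson less_imp_le mult_pos_pos order_trans)
      qed
      have 3: "norm (acc_B T k (Suc k) *v us k) \<le> Ca * E1 * D4 * M * N k powr (h - p)"
      proof -
        have "norm (acc_B T k (Suc k) *v us k) \<le> Z k * norm (us k)"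
          unfolding acc_B_def by (rule norm_matrix_vector_le)
        also have "\<dots> \<le> (Ca * N k powr h) * (E1 * D4 * M * N k powr (-p))"
          by (intro mult_mono Z_le us_le) (use Ca in auto)
        also have "\<dots> = Ca * E1 * D4 * M * (N k powr h * N k powr (-p))" by (simp only: mult_ac)
        also have "N k powr h * N k powr (-p) = N k powr (h - p)" by (simp add: powr_add[symmetric])
        finally show ?thesis .
      qed
      have "norm (e k) \<le> norm (dl k) + norm (us (Suc k)) + norm (acc_B T k (Suc k) *v us k)"
        unfolding e_def by (meson add_right_mono norm_triangle_ineq norm_triangle_ineq4 order_trans)
      then show ?thesis using 1 2 3 unfolding E2_def by (simp add: algebra_simps)
    qed
    \<comment> \<open>With this choice \<open>s 0 = 0\<close>, so that \<open>s\<close> is fed by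
      the stable vectors \<open>e j\<close> alone.\<close>
    define v where "v = c 0 + us 0"
    define s where "s k = c k - acc_B T 0 k *v v + us k" for k
    have s_rec: "s (Suc k) = acc_B T k (Suc k) *v s k + e k" for k
    proof -
      have "acc_B T k (Suc k) *v (acc_B T 0 k *v v) = acc_B T 0 (Suc k) *v v"
        using acc_B_mult[of 0 k "Suc k"] by (simp add: matrix_vector_mul_assoc)
      then show ?thesis unfolding s_def e_def dl_def
        by (simp add: matrix_vector_right_distrib matrix_vector_mult_diff_distrib)
    qed
    have s0: "s 0 = 0" unfolding s_def v_def by (simp add: acc_B_self)
    have summand: "norm (acc_B T (Suc j) k *v e j) \<le> (M * E2 * K) * Ca powr (d * t) * N k powr (- (h + 2 * \<epsilon>)) * N j powr (-q)"
      if j: "j < k" for j k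
    proof -
      let ?X = "norm (acc_B T (Suc j) k *v e j)"
      have "?X \<le> D1 * N k powr \<epsilon> * norm (e j)" by (rule D1(2)[OF _ eG]) (use j in simp)
      also have "\<dots> \<le> D1 * N k powr \<epsilon> * (M * E2 * N j powr (h - p))"
        by (rule mult_left_mono[OF e_le]) (use D1 in simp)
      also have "\<dots> = D1 * (M * E2 * (N k powr \<epsilon> * N j powr (h - p)))" by (simp only: mult_ac)
      also have "\<dots> \<le> K * (M * E2 * (N k powr \<epsilon> * N j powr (h - p)))"
        by (rule mult_right_mono) (use D3 C3 M pos in \<open>auto simp: K_def\<close>)
      finally have X1: "?X \<le> (M * E2 * K) * (N k powr \<epsilon> * N j powr (h - p))" by (simp only: mult_ac)
      obtain w where w: "acc_B T 0 (Suc j) *v w = e j" using acc_B_surj[of 0 "Suc j" "e j"] by auto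
      have wG: "w \<in> Gamma_s T \<sigma> 0" using eG[of j] Gamma_s_invariant[of 0 "Suc j" \<sigma> w, OF _ sigma] w by simp
      have eq: "acc_B T (Suc j) k *v e j = acc_B T 0 k *v w"
        using acc_B_mult[of 0 "Suc j" k] j by (simp add: w[symmetric] matrix_vector_mul_assoc)
      have "?X \<le> D3 * N k powr (-\<sigma>) * norm w" unfolding eq by (rule D3(2)[OF wG])
      also have "\<dots> \<le> D3 * N k powr (-\<sigma>) * (C3 * N (Suc j) powr d * (M * E2 * N j powr (h - p)))"
      proof (rule mult_left_mono)
        have "norm w \<le> C3 * N (Suc j) powr d * norm (e j)" using C3(2)[of w "Suc j"] w by simp
        also have "\<dots> \<le> C3 * N (Suc j) powr d * (M * E2 * N j powr (h - p))"
          by (rule mult_left_mono[OF e_le]) (use C3 in simp)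
        finally show "norm w \<le> C3 * N (Suc j) powr d * (M * E2 * N j powr (h - p))" .
      qed (use D3 in simp)
      also have "\<dots> = (D3 * C3) * (M * E2 * (N k powr (-\<sigma>) * N (Suc j) powr d * N j powr (h - p)))" by (simp only: mult_ac)
      also have "\<dots> \<le> K * (M * E2 * (N k powr (-\<sigma>) * N (Suc j) powr d * N j powr (h - p)))"
        by (rule mult_right_mono) (use D1 M pos in \<open>auto simp: K_def\<close>)
      finally have X2: "?X \<le> (M * E2 * K) * (N k powr (-\<sigma>) * N (Suc j) powr d * N j powr (h - p))" by (simp only: mult_ac)
      have Np: "0 < N k" "0 < N (Suc j)" "0 < N j" by (rule N_pos)+
      \<comment> \<open>Since \<sigma> t = h + 3\<epsilon>, the exponent of \<open>N k\<close>
        becomes at most -(h + 2\<epsilon>), enough to beat \<open>Z k\<close>, while the exponent of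
        \<open>N j\<close> becomes -q and is summable.\<close>
      have "?X \<le> (M * E2 * K) * ((N k powr \<epsilon> * N j powr (h - p)) powr (1 - t) * (N k powr (-\<sigma>) * N (Suc j) powr d * N j powr (h - p)) powr t)"
        by (rule weighted_min[OF norm_ge_zero X1 X2]) (use M pos t t0 Np in auto)
      also have "(N k powr \<epsilon> * N j powr (h - p)) powr (1 - t) * (N k powr (-\<sigma>) * N (Suc j) powr d * N j powr (h - p)) powr t
         = N k powr (\<epsilon> * (1 - t) + (-\<sigma>) * t) * (N (Suc j) powr (d * t) * N j powr ((h - p) * (1 - t) + (h - p) * t))"
        unfolding powr_add by (simp add: powr_mult powr_powr mult_ac)
      also have "(h - p) * (1 - t) + (h - p) * t = h - p" by (simp add: algebra_simps)
      also have "(M * E2 * K) * (N k powr (\<epsilon> * (1 - t) + (-\<sigma>) * t) * (N (Suc j) powr (d * t) * N j powr (h - p)))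
         \<le> (M * E2 * K) * (N k powr (- (h + 2 * \<epsilon>)) * ((Ca powr (d * t) * N j powr ((1 + h) * (d * t))) * N j powr (h - p)))"
      proof -
        have "\<sigma> * t = h + 3 * \<epsilon>" unfolding t_def using sigma by simp
        then have "\<epsilon> * (1 - t) + (-\<sigma>) * t \<le> - (h + 2 * \<epsilon>)" using mult_nonneg_nonneg[of \<epsilon> t] eps t0
          by (simp add: algebra_simps)
        then show ?thesis
          by (intro mult_left_mono mult_mono mult_right_mono N_powr_le N_Suc_powr_pos) (use d t0 M pos in auto)
      qed
      also have "\<dots> = (M * E2 * K) * Ca powr (d * t) * N k powr (- (h + 2 * \<epsilon>)) * (N j powr ((1 + h) * (d * t)) * N j powr (h - p))"
        by (simp only: mult_ac)
      also have "N j powr ((1 + h) * (d * t)) * N j powr (h - p) = N j powr (-q)"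
        unfolding powr_add[symmetric] q_def d_def by (simp add: algebra_simps)
      finally show ?thesis .
    qed
    have s_le: "norm (s k) \<le> E2 * K * Ca powr (d * t) * D5 * M * N k powr (- (h + 2 * \<epsilon>))" for k
    proof -
      have "s k = acc_B T 0 k *v s 0 + (\<Sum>j<k. acc_B T (Suc j) k *v e j)" by (rule recurrence_expand[OF s_rec])
      then have "norm (s k) \<le> (\<Sum>j<k. norm (acc_B T (Suc j) k *v e j))" by (simp add: s0 norm_sum)
      also have "\<dots> \<le> (\<Sum>j<k. (M * E2 * K) * Ca powr (d * t) * N k powr (- (h + 2 * \<epsilon>)) * N j powr (-q))"
        by (rule sum_mono) (rule summand, simp)
      also have "\<dots> = (M * E2 * K) * Ca powr (d * t) * N k powr (- (h + 2 * \<epsilon>)) * (\<Sum>j<k. N j powr (-q))"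
        by (rule sum_distrib_left[symmetric])
      also have "\<dots> \<le> (M * E2 * K) * Ca powr (d * t) * N k powr (- (h + 2 * \<epsilon>)) * D5"
        by (rule mult_left_mono[OF D5(2)]) (use M pos in simp)
      finally show ?thesis by (simp only: mult_ac)
    qed
    have "norm (c k - acc_B T 0 k *v v) \<le> C * M * (N k powr (-p) + N k powr (- (h + 2 * \<epsilon>)))" for k
    proof -
      have "c k - acc_B T 0 k *v v = s k - us k" unfolding s_def by simp
      then have "norm (c k - acc_B T 0 k *v v) \<le> norm (s k) + norm (us k)" by (simp add: norm_triangle_ineq4)
      also have "\<dots> \<le> C * M * N k powr (- (h + 2 * \<epsilon>)) + C * M * N k powr (-p)"
      proof (rule add_mono)
        show "norm (s k) \<le> C * M * N k powr (- (h + 2 * \<epsilon>))"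
          by (rule order_trans[OF s_le], intro mult_right_mono) (use pos D4 M in \<open>auto simp: C_def\<close>)
        show "norm (us k) \<le> C * M * N k powr (-p)"
          by (rule order_trans[OF us_le], intro mult_right_mono) (use pos D5 M in \<open>auto simp: C_def\<close>)
      qed
      finally show ?thesis by (simp add: distrib_left)
    qed
    moreover have "norm (c 0 - v) \<le> C * M"
    proof -
      have "norm (c 0 - v) \<le> E1 * D4 * M * N 0 powr (-p)" using us_le[of 0] by (simp add: v_def)
      also have "\<dots> \<le> E1 * D4 * M * 1"
        by (rule mult_left_mono) (use N_powr_le[of "-p" 0 0] p N_pos[of 0] pos D4 M in auto)
      also have "\<dots> \<le> C * M" unfolding C_def using pos D5 M by (simp add: distrib_right)
      finally show ?thesis .
    qed
    ultimately show ?thesis by blast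
  qed
  then show ?thesis using C by (intro exI[of _ C]) auto
qed

end

section \<open>Special sums after correction\<close>

context rauzy_path
begin

text \<open>\<open>M\<close> stands for the norm of \<phi>: the constant and the rate
  \<open>r\<close> are common to all functions, as needed for bounded operators. Summability of
  \<open>Z k * r k\<close> is asked for separately.\<close>

definition corrected :: "real \<Rightarrow> (nat \<Rightarrow> real) \<Rightarrow> bool" where
  "corrected C r \<longleftrightarrow> (\<forall>\<phi> f g M. cocycle_data T \<phi> f g \<longrightarrow> 0 < M \<longrightarrow> tot \<phi> 0 = 0 \<longrightarrow> tot g 0 \<le> M \<longrightarrow>
     (\<forall>b x. x \<in> cI 0 b \<longrightarrow> \<bar>\<phi> b x\<bar> \<le> M \<and> \<bar>f b x\<bar> \<le> M) \<longrightarrow>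
     (\<exists>v. norm v \<le> C * M \<and>
       (\<forall>k b x. x \<in> cI (nk k) b \<longrightarrow> \<bar>SB \<phi> (nk k) b x - (B 0 (nk k) *v v) $ b\<bar> \<le> C * M * r k)))"

lemma summable_N_powr:
  assumes "0 < p"
  shows "summable (\<lambda>k. N k powr (-p))"
proof -
  obtain C where "\<forall>k. summable (\<lambda>j. N (j + k) powr (-p)) \<and> (\<Sum>j. N (j + k) powr (-p)) \<le> C * N k powr (-p)"
    using N_powr_sum[OF assms] by auto
  then have "summable (\<lambda>j. N (j + 0) powr (-p))" by blast
  then show ?thesis by simp
qed

lemma left_in_cI: "lft n b \<in> cI n b"
  using lam_pos[of n b] by simp

lemma norm_le_card: "(\<And>b. \<bar>v $ b\<bar> \<le> M) \<Longrightarrow> norm (v :: real^'a) \<le> real CARD('a) * M"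
  using norm_le_l1_cart[of v] sum_bounded_above[of UNIV "\<lambda>b. \<bar>v $ b\<bar>" M] by simp

lemma norm_mean_le:
  assumes "cocycle_data T \<phi> f g" "\<And>b x. x \<in> cI 0 b \<Longrightarrow> \<bar>f b x\<bar> \<le> M"
  shows "norm (mean \<phi> 0) \<le> real CARD('a) * M"
proof (rule norm_le_card)
  interpret cocycle_data T \<phi> f g by (rule assms(1))
  fix b
  obtain z where "z \<in> cI 0 b" "mean \<phi> 0 $ b = SB f 0 b z" using mean_mvt by blast
  then show "\<bar>mean \<phi> 0 $ b\<bar> \<le> M" using assms(2) by simp
qed

text \<open>A bound on the derivative makes \<open>M * x\<close> dominate the increments of \<phi>,
  so the estimates for derivatives can be used one order lower, for \<phi> itself.\<close>

lemma antiderivative_data: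
  assumes "cocycle_data T \<phi> f g" and bd: "\<And>b x. x \<in> cI 0 b \<Longrightarrow> \<bar>f b x\<bar> \<le> M"
    and Phi: "\<And>a x. x \<in> cI 0 a \<Longrightarrow> (\<Phi> a has_real_derivative \<phi> a x) (at x within cI 0 a)"
  shows "cocycle_data T \<Phi> \<phi> (\<lambda>a x. M * x)"
proof (rule cocycle_data.intro[OF rauzy_path_axioms], rule cocycle_data_axioms.intro)
  interpret cocycle_data T \<phi> f g by (rule assms(1))
  show "x \<in> cI 0 a \<Longrightarrow> (\<Phi> a has_real_derivative \<phi> a x) (at x within cI 0 a)" for a x by (rule Phi)
  fix a x y assume h: "x \<in> cI 0 a" "y \<in> cI 0 a" "x \<le> y"
  show "\<bar>\<phi> a y - \<phi> a x\<bar> \<le> M * y - M * x"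
  proof (cases "x = y")
    case False
    then have "\<exists>z\<in>cI 0 a. SB \<phi> 0 a y - SB \<phi> 0 a x = (y - x) * SB f 0 a z"
      using h by (intro SB_mvt) auto
    then obtain z where z: "z \<in> cI 0 a" "\<phi> a y - \<phi> a x = (y - x) * f a z" by auto
    have "(y - x) * \<bar>f a z\<bar> \<le> (y - x) * M" by (rule mult_left_mono) (use h z bd in auto)
    moreover have "\<bar>(y - x) * f a z\<bar> = (y - x) * \<bar>f a z\<bar>" using h by (simp add: abs_mult)
    moreover have "(y - x) * M = M * y - M * x" by (simp add: algebra_simps)
    ultimately show ?thesis unfolding z(2) by simp
  qed simp
  qed

end

context dc_growth
begin

text \<open>Special sums oscillate so little that their values at left endpoints are almost an orbit
  of the matrices; the defects of this orbit are what the correction removes.\<close>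

lemma corrected_ge_3:
  assumes d3: "3 \<le> CARD('a)"
    and main: "(4 * real CARD('a) + real CARD('a) * (real CARD('a) - 1) / \<sigma>) * h < \<theta>"
  shows "\<exists>C>0. \<exists>r. (\<forall>k. 0 \<le> r k) \<and> summable (\<lambda>k. Z k * r k) \<and> corrected C r"
proof -
  define d where "d = real CARD('a)"
  have d: "3 \<le> d" unfolding d_def using d3 by simp
  obtain t where t: "0 < t" "t < 1" "t * (beta\<^sup>2 + d - 1 + h) < beta\<^sup>2" "(\<theta> - h) * t \<le> beta"
    "2 * h + (1 + h) * ((d - 1) * h / \<sigma>) < (\<theta> - h) * t" "h < \<sigma>" "h < \<theta>"
    using exponent_choice[OF d h sigma] main theta_bound unfolding d_def beta_def by blast
  define R where "R = (\<theta> - h) * t"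
  obtain C0 where C0: "0 < C0" "\<And>\<phi> f g M k a x y. cocycle_data T \<phi> f g \<Longrightarrow> 0 < M \<Longrightarrow> tot \<phi> 0 = 0 \<Longrightarrow> tot g 0 \<le> M \<Longrightarrow>
    norm (mean \<phi> 0) \<le> M \<Longrightarrow> x \<in> cI (nk k) a \<Longrightarrow> y \<in> cI (nk k) a \<Longrightarrow>
      \<bar>SB \<phi> (nk k) a x - SB \<phi> (nk k) a y\<bar> \<le> C0 * M * N k powr (-R)"
    using osc_estimate[of t] t unfolding d_def R_def by auto
  define gap where "gap = R - 2 * h - (1 + h) * ((d - 1) * h / \<sigma>)"
  have gap: "0 < gap" unfolding gap_def R_def using t(5) by simp
  define c where "c = (1 + h) * (1 + 3 * (d - 1) / \<sigma>)"
  have c: "0 < c" unfolding c_def using h d sigma by (intro mult_pos_pos add_pos_nonneg) auto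
  \<comment> \<open>The first bound makes q = gap - \<epsilon> c positive, the second keeps the
    interpolation weight \<open>t2\<close> at most 1.\<close>
  define \<epsilon> where "\<epsilon> = min (gap / (2 * c)) ((\<sigma> - h) / 3)"
  have eps: "0 < \<epsilon>" unfolding \<epsilon>_def using gap c t(6) by simp
  have eps_c: "\<epsilon> * c < gap"
  proof -
    have "\<epsilon> * c \<le> gap / (2 * c) * c" by (rule mult_right_mono) (use c in \<open>auto simp: \<epsilon>_def\<close>)
    also have "\<dots> < gap" using gap c by simp
    finally show ?thesis .
  qed
  define t2 where "t2 = (h + 3 * \<epsilon>) / \<sigma>"
  have "\<epsilon> \<le> (\<sigma> - h) / 3" unfolding \<epsilon>_def by (rule min.cobounded2)
  then have t2: "0 < t2" "t2 \<le> 1" unfolding t2_def using eps h sigma by simp_all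
  \<comment> \<open>One accelerated step multiplies the oscillation, of order N^(-R), by
    \<open>Z k\<close>, of order at most N^h.\<close>
  define p0 where "p0 = R - h"
  define p where "p = p0 - (1 + h) * \<epsilon>"
  define q where "q = p - h - (1 + h) * ((d - 1) * t2)"
  have "q = gap - \<epsilon> * c" unfolding q_def p_def p0_def gap_def t2_def c_def using sigma by (simp add: field_simps)
  then have q: "0 < q" using eps_c by simp
  have "0 < (1 + h) * ((d - 1) * t2)" using h d t2 by simp
  then have ph: "h < p" using q unfolding q_def by simp
  have "0 < (1 + h) * \<epsilon>" using eps h by simp
  then have Rh: "h < R" using ph h unfolding p_def p0_def by linarith
  have "\<exists>C>0. \<forall>c M. 0 < M \<longrightarrow> (\<forall>k. norm (c (Suc k) - acc_B T k (Suc k) *v c k) \<le> M * N k powr (-p0)) \<longrightarrow>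
    (\<exists>v. norm (c 0 - v) \<le> C * M \<and>
      (\<forall>k. norm (c k - acc_B T 0 k *v v) \<le> C * M * (N k powr (-p) + N k powr (- (h + 2 * \<epsilon>)))))"
    unfolding p_def
  proof (rule correction[OF eps])
    show "0 < p0 - (1 + h) * \<epsilon>" using ph h unfolding p_def by linarith
    show "(h + 3 * \<epsilon>) / \<sigma> \<le> 1" using t2(2) unfolding t2_def .
    show "0 < p0 - (1 + h) * \<epsilon> - h - (1 + h) * ((real CARD('a) - 1) * ((h + 3 * \<epsilon>) / \<sigma>))"
      using q unfolding q_def p_def t2_def d_def .
  qed
  then obtain C1 where C1a: "0 < C1 \<and> (\<forall>c M. 0 < M \<longrightarrow> (\<forall>k. norm (c (Suc k) - acc_B T k (Suc k) *v c k) \<le> M * N k powr (-p0)) \<longrightarrow>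
    (\<exists>v. norm (c 0 - v) \<le> C1 * M \<and>
      (\<forall>k. norm (c k - acc_B T 0 k *v v) \<le> C1 * M * (N k powr (-p) + N k powr (- (h + 2 * \<epsilon>))))))" ..
  have C1: "0 < C1" "\<And>c M. 0 < M \<Longrightarrow> (\<And>k. norm (c (Suc k) - acc_B T k (Suc k) *v c k) \<le> M * N k powr (-p0)) \<Longrightarrow>
    \<exists>v. norm (c 0 - v) \<le> C1 * M \<and>
      (\<forall>k. norm (c k - acc_B T 0 k *v v) \<le> C1 * M * (N k powr (-p) + N k powr (- (h + 2 * \<epsilon>))))"
    by (rule C1a[THEN conjunct1], rule C1a[THEN conjunct2, rule_format], assumption, blast)
  \<comment> \<open>Three sources of error: the oscillation inside an interval, the tail of the
    pulled-back defects, and the stable remainder.\<close>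
  define r where "r k = N k powr (-R) + (N k powr (-p) + N k powr (- (h + 2 * \<epsilon>)))" for k
  define C where "C = C0 * d + C1 * Ca * C0 * d + d"
  have C: "0 < C" unfolding C_def using C0 C1 Ca d by (intro add_nonneg_pos) auto
  have "summable (\<lambda>k. Z k * r k)"
  proof (rule summable_comparison_test')
    note sm = summable_N_powr
    show "summable (\<lambda>k. Ca * (N k powr (- (R - h)) + (N k powr (- (p - h)) + N k powr (- (2 * \<epsilon>)))))"
      by (intro summable_mult summable_add sm) (use Rh ph eps in auto)
    fix k
    have "Z k * r k \<le> (Ca * N k powr h) * r k" by (rule mult_right_mono[OF Z_le]) (simp add: r_def)
    also have "\<dots> = Ca * (N k powr (h + (-R)) + (N k powr (h + (-p)) + N k powr (h + (- (h + 2 * \<epsilon>)))))"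
      unfolding powr_add r_def by (simp add: distrib_left mult_ac)
    finally show "norm (Z k * r k) \<le> Ca * (N k powr (- (R - h)) + (N k powr (- (p - h)) + N k powr (- (2 * \<epsilon>))))"
      by (simp add: r_def mat_norm_nonneg abs_mult)
  qed
  moreover have "corrected C r"
    unfolding corrected_def
  proof (intro allI impI)
    fix \<phi> f g :: "'a \<Rightarrow> real \<Rightarrow> real" and M :: real
    assume data: "cocycle_data T \<phi> f g" and M: "0 < M" and tot0: "tot \<phi> 0 = 0" and V: "tot g 0 \<le> M"
      and bd: "\<forall>b x. x \<in> cI 0 b \<longrightarrow> \<bar>\<phi> b x\<bar> \<le> M \<and> \<bar>f b x\<bar> \<le> M"
    define M1 where "M1 = d * M"
    have M1: "0 < M1" "M \<le> M1" unfolding M1_def using d M by auto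
    have m0: "norm (mean \<phi> 0) \<le> M1" unfolding M1_def d_def by (rule norm_mean_le[OF data]) (use bd in blast)
    have V1: "tot g 0 \<le> M1" using V M1(2) by linarith
    note osc = C0(2)[OF data M1(1) tot0 V1 m0]
    define c where "c k = (\<chi> b. SB \<phi> (nk k) b (lft (nk k) b))" for k
    define M2 where "M2 = Ca * C0 * M1"
    have M2: "0 < M2" unfolding M2_def using Ca C0 M1 by simp
    have "norm (c (Suc k) - acc_B T k (Suc k) *v c k) \<le> M2 * N k powr (-p0)" for k
    proof -
      have "\<bar>(c (Suc k) - acc_B T k (Suc k) *v c k) $ b\<bar> \<le> rsum (nk k) (nk (Suc k)) b * (C0 * M1 * N k powr (-R))" for b
      proof -
        have "\<bar>SB \<phi> (nk (Suc k)) b (lft (nk (Suc k)) b) - (B (nk k) (nk (Suc k)) *v c k) $ b\<bar>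
            \<le> (B (nk k) (nk (Suc k)) *v (\<chi> a. C0 * M1 * N k powr (-R))) $ b"
        proof (rule SB_close[OF rv_time_Suc(1) _ left_in_cI])
          fix a x assume "x \<in> cI (nk k) a"
          then show "\<bar>SB \<phi> (nk k) a x - c k $ a\<bar> \<le> (\<chi> a. C0 * M1 * N k powr (-R)) $ a"
            using osc[OF _ left_in_cI, of x k a] by (simp add: c_def)
        qed
        then show ?thesis unfolding mat_vec_const by (simp add: acc_B_def c_def[of "Suc k"] mult.commute)
      qed
      then have "(\<Sum>b\<in>UNIV. \<bar>(c (Suc k) - acc_B T k (Suc k) *v c k) $ b\<bar>) \<le>
          (\<Sum>b\<in>UNIV. rsum (nk k) (nk (Suc k)) b * (C0 * M1 * N k powr (-R)))" by (rule sum_mono)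
      also have "\<dots> = Z k * (C0 * M1 * N k powr (-R))"
        by (simp add: sum_distrib_right[symmetric] mat_norm_B rv_time_Suc(1))
      also have "\<dots> \<le> (Ca * N k powr h) * (C0 * M1 * N k powr (-R))"
        by (rule mult_right_mono[OF Z_le]) (use C0 M1 in simp)
      also have "\<dots> = M2 * (N k powr h * N k powr (-R))" unfolding M2_def by (simp only: mult_ac)
      also have "N k powr h * N k powr (-R) = N k powr (-p0)" unfolding p0_def by (simp add: powr_add[symmetric])
      finally show ?thesis by (rule order_trans[OF norm_le_l1_cart])
    qed
    from C1(2)[OF M2 this] obtain v where v: "norm (c 0 - v) \<le> C1 * M2"
      "\<And>k. norm (c k - acc_B T 0 k *v v) \<le> C1 * M2 * (N k powr (-p) + N k powr (- (h + 2 * \<epsilon>)))" by blast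
    have "norm (c 0) \<le> d * M" unfolding d_def
      by (rule norm_le_card) (use bd left_in_cI[of 0] in \<open>simp add: c_def\<close>)
    then have "norm v \<le> d * M + C1 * M2" using v(1) norm_triangle_ineq4[of "c 0" "c 0 - v"] by simp
    also have "\<dots> \<le> C * M" unfolding C_def M2_def M1_def using C0 d M by (simp add: algebra_simps)
    finally have nv: "norm v \<le> C * M" .
    have "\<bar>SB \<phi> (nk k) b x - (B 0 (nk k) *v v) $ b\<bar> \<le> C * M * r k" if x: "x \<in> cI (nk k) b" for k b x
    proof -
      have 1: "\<bar>SB \<phi> (nk k) b x - c k $ b\<bar> \<le> (C0 * d) * M * N k powr (-R)"
        using osc[OF x left_in_cI] by (simp add: c_def M1_def mult_ac)
      have "\<bar>(c k - acc_B T 0 k *v v) $ b\<bar> \<le> C1 * M2 * (N k powr (-p) + N k powr (- (h + 2 * \<epsilon>)))"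
        by (rule order_trans[OF component_le_norm_cart v(2)])
      then have 2: "\<bar>c k $ b - (B 0 (nk k) *v v) $ b\<bar> \<le> (C1 * Ca * C0 * d) * M * (N k powr (-p) + N k powr (- (h + 2 * \<epsilon>)))"
        unfolding M2_def M1_def by (simp add: acc_B_0 mult_ac)
      have 3: "(C0 * d) * M * N k powr (-R) \<le> C * M * N k powr (-R)"
        unfolding C_def using C0 C1 Ca d M by (intro mult_right_mono) auto
      have 4: "(C1 * Ca * C0 * d) * M * (N k powr (-p) + N k powr (- (h + 2 * \<epsilon>))) \<le>
          C * M * (N k powr (-p) + N k powr (- (h + 2 * \<epsilon>)))"
        unfolding C_def using C0 C1 Ca d M by (intro mult_right_mono) auto
      have "C * M * r k = C * M * N k powr (-R) + C * M * (N k powr (-p) + N k powr (- (h + 2 * \<epsilon>)))"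
        unfolding r_def by (rule distrib_left)
      then show ?thesis using 1 2 3 4 by linarith
    qed
    then show "\<exists>v. norm v \<le> C * M \<and> (\<forall>k b x. x \<in> cI (nk k) b \<longrightarrow> \<bar>SB \<phi> (nk k) b x - (B 0 (nk k) *v v) $ b\<bar> \<le> C * M * r k)"
      using nv by blast
  qed
  moreover have "0 \<le> r k" for k by (simp add: r_def)
  ultimately show ?thesis using C by (intro exI[of _ C] exI[of _ r] conjI allI)
qed

end

section \<open>Two letters\<close>

text \<open>For two letters the hyperplanes of zero-mean vectors are lines, on which the algorithm acts by
  the ratio of the lengths.\<close>
locale two_letters = rauzy_path T for T :: "'a::finite iet" +
  fixes x0 y0 :: 'a
  assumes xy: "x0 \<noteq> y0" "UNIV = {x0, y0}"
begin

text \<open>Spans the zero-mean line of level n, normalised so that each step matrix carries it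
  exactly to the next one.\<close>

definition J :: "nat \<Rightarrow> real^'a" where
  "J n = (\<chi> a. if a = x0 then lam n y0 else - lam n x0)"

lemma letters: "a = x0 \<or> a = y0"
  using xy(2) by blast

lemma sum_letters: "(\<Sum>a\<in>UNIV. F a) = F x0 + (F y0 :: real)"
  unfolding xy(2) using xy(1) by simp

lemma winner_loser_letters: "ws n = x0 \<and> ls n = y0 \<or> ws n = y0 \<and> ls n = x0"
  using winner_loser(2)[of n] letters[of "ws n"] letters[of "ls n"] by auto

lemma last_letters: "la n = x0 \<and> lb n = y0 \<or> la n = y0 \<and> lb n = x0"
  using last_neq[OF iter_good, of n] letters[of "la n"] letters[of "lb n"] by auto

lemma B_J: "B n (Suc n) *v J n = J (Suc n)"
proof -
  have "(B n (Suc n) *v J n) $ a = J (Suc n) $ a" for a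
    using winner_loser_letters[of n] last_letters[of n] letters[of a] xy(1)
    by (auto simp: Bv_Suc[OF order_refl] B_self J_def lam_Suc)
  then show ?thesis by (intro vec_eq_iff[THEN iffD2] allI)
qed

lemma zero_mean_J:
  assumes "(\<Sum>a\<in>UNIV. lam n a * v $ a) = 0"
  shows "v = (v $ x0 / lam n y0) *\<^sub>R J n"
proof -
  have "v $ a = ((v $ x0 / lam n y0) *\<^sub>R J n) $ a" for a
    using letters[of a] assms xy(1) lam_pos[of n x0] lam_pos[of n y0]
    by (auto simp: J_def sum_letters field_simps)
  then show ?thesis by (intro vec_eq_iff[THEN iffD2] allI)
qed

lemma J_le: "\<bar>J n $ a\<bar> \<le> tlen n"
  using lam_pos[of n x0] lam_pos[of n y0] by (simp add: J_def sum_letters)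

text \<open>The two entries of \<open>J n\<close> are, up to sign, the two lengths, whose sum is
  \<open>tlen n\<close>; this gives the factor 2.\<close>

lemma J_coeff: "(\<And>a. \<bar>(c *\<^sub>R J n) $ a\<bar> \<le> D) \<Longrightarrow> \<bar>c\<bar> \<le> 2 * D / tlen n"
proof -
  assume D: "\<And>a. \<bar>(c *\<^sub>R J n) $ a\<bar> \<le> D"
  have "\<bar>c\<bar> * lam n y0 \<le> D" "\<bar>c\<bar> * lam n x0 \<le> D"
    using D[of x0] D[of y0] xy(1) lam_pos[of n x0] lam_pos[of n y0] by (auto simp: J_def abs_mult)
  then have "\<bar>c\<bar> * tlen n \<le> 2 * D" by (simp add: sum_letters distrib_left)
  then show ?thesis using tlen_pos[of n] by (simp add: le_divide_eq)
qed

text \<open>Coefficients with respect to \<open>J\<close> are unchanged by the matrices. Only the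
  defects accumulate, each divided by the length at the level where it arises.\<close>

lemma zero_mean_recurrence:
  assumes z: "\<And>n. (\<Sum>a\<in>UNIV. lam n a * v n $ a) = 0"
    and D: "\<And>n a. \<bar>(v (Suc n) - B n (Suc n) *v v n) $ a\<bar> \<le> D n"
    and v0: "\<And>a. \<bar>v 0 $ a\<bar> \<le> D0"
  shows "\<bar>v n $ a\<bar> \<le> tlen n * (2 * D0 / tlen 0 + (\<Sum>j<n. 2 * D j / tlen (Suc j)))"
proof -
  define c where "c n = v n $ x0 / lam n y0" for n
  have vc: "v n = c n *\<^sub>R J n" for n unfolding c_def by (rule zero_mean_J[OF z])
  have c: "\<bar>c n\<bar> \<le> 2 * D0 / tlen 0 + (\<Sum>j<n. 2 * D j / tlen (Suc j))"
  proof (induction n)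
    case 0
    show ?case using J_coeff[of "c 0" 0 D0] v0 vc[of 0] by simp
  next
    case (Suc n)
    have "v (Suc n) - B n (Suc n) *v v n = (c (Suc n) - c n) *\<^sub>R J (Suc n)"
      by (subst vc[of n], subst vc[of "Suc n"]) (simp add: matrix_vector_mult_scaleR B_J scaleR_left_diff_distrib)
    then have "\<bar>c (Suc n) - c n\<bar> \<le> 2 * D n / tlen (Suc n)"
      using D[of n] J_coeff[of "c (Suc n) - c n" "Suc n" "D n"] by simp
    then show ?case using Suc by simp
  qed
  have "\<bar>v n $ a\<bar> = \<bar>c n\<bar> * \<bar>J n $ a\<bar>" by (subst vc) (simp add: abs_mult)
  also have "\<dots> \<le> (2 * D0 / tlen 0 + (\<Sum>j<n. 2 * D j / tlen (Suc j))) * tlen n"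
    by (rule mult_mono[OF c J_le]) (use order_trans[OF abs_ge_zero c] in auto)
  finally show ?thesis by (simp add: mult.commute)
qed

lemma rsum_step: "rsum n (Suc n) b \<le> 2"
  using rsum_Suc[OF order_refl, of n b] by (simp add: B_self mat_def)

text \<open>The recurrence is used twice. For the means of the derivative, bounded defects give
  growth linear in n, hence an oscillation of \<phi> of order n times the length. For the means of
  \<phi> itself, defects of that order give n^2 times the length.\<close>

lemma two_letter_estimate:
  assumes data: "cocycle_data T \<phi> f g" and M: "0 < M" and tot0: "tot \<phi> 0 = 0" and V: "tot g 0 \<le> M"
    and bd: "\<And>b x. x \<in> cI 0 b \<Longrightarrow> \<bar>\<phi> b x\<bar> \<le> M \<and> \<bar>f b x\<bar> \<le> M"
    and Phi: "\<And>a x. x \<in> cI 0 a \<Longrightarrow> (\<Phi> a has_real_derivative \<phi> a x) (at x within cI 0 a)" "tot \<Phi> 0 = 0"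
    and x: "x \<in> cI n b"
  shows "\<bar>SB \<phi> n b x\<bar> \<le> (90 + 2 / tlen 0) * M * (tlen n * (real n + 1)\<^sup>2)"
proof -
  interpret cocycle_data T \<phi> f g by (rule data)
  have two: "tot g 0 * rsum n (Suc n) b \<le> 2 * M" for n b
  proof -
    have "tot g 0 * rsum n (Suc n) b \<le> M * 2"
      by (rule mult_mono[OF V rsum_step]) (use M rsum_ge_1[of n "Suc n" b] in auto)
    then show ?thesis by simp
  qed
  have mean_bd: "\<bar>mean \<phi> n $ a\<bar> \<le> (2 + 4 * real n) * M" for n a
  proof -
    have "\<bar>mean \<phi> n $ a\<bar> \<le> tlen n * (2 * M / tlen 0 + (\<Sum>j<n. 2 * (2 * M) / tlen (Suc j)))"
    proof (rule zero_mean_recurrence)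
      show "(\<Sum>a\<in>UNIV. lam n a * mean \<phi> n $ a) = 0" for n unfolding mean_tot by (rule tot0)
      show "\<bar>(mean \<phi> (Suc n) - B n (Suc n) *v mean \<phi> n) $ a\<bar> \<le> 2 * M" for n a
        using mean_step[of n "Suc n" a] two[of n a] by simp
      show "\<bar>mean \<phi> 0 $ a\<bar> \<le> M" for a
        using mean_mvt[of 0 a] bd by auto
    qed
    also have "\<dots> \<le> tlen n * (2 * M / tlen n + (\<Sum>j<n. 2 * (2 * M) / tlen n))"
    proof (rule mult_left_mono[OF add_mono])
      have *: "x / tlen m \<le> x / tlen n" if "m \<le> n" "0 \<le> x" for m and x :: real
        by (rule divide_left_mono[OF tlen_antimono]) (use that tlen_pos in auto)
      show "2 * M / tlen 0 \<le> 2 * M / tlen n" by (rule *) (use M in auto)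
      show "(\<Sum>j<n. 2 * (2 * M) / tlen (Suc j)) \<le> (\<Sum>j<n. 2 * (2 * M) / tlen n)"
        by (rule sum_mono, rule *) (use M in auto)
    qed (simp add: less_imp_le tlen_pos)
    also have "\<dots> = (2 + 4 * real n) * M" using tlen_pos[of n] by (simp add: field_simps)
    finally show ?thesis .
  qed
  define W where "W n = 5 * M * (real n + 1) * tlen n" for n
  have osc: "\<bar>SB \<phi> n a x - SB \<phi> n a y\<bar> \<le> W n" if "x \<in> cI n a" "y \<in> cI n a" for n a x y
  proof -
    have "lam n a * (\<bar>mean \<phi> n $ a\<bar> + tot g 0) \<le> tlen n * ((2 + 4 * real n) * M + M)"
      by (intro mult_mono add_mono lam_le_tlen mean_bd V) (use tot_g_nonneg tlen_pos in \<open>auto simp: less_imp_le\<close>)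
    also have "\<dots> \<le> tlen n * (5 * M * (real n + 1))"
      by (rule mult_left_mono) (use M tlen_pos[of n] in \<open>auto simp: algebra_simps\<close>)
    finally have "lam n a * (\<bar>mean \<phi> n $ a\<bar> + tot g 0) \<le> W n" by (simp only: W_def mult_ac)
    then show ?thesis using phi_osc[OF that] by linarith
  qed
  have data2: "cocycle_data T \<Phi> \<phi> (\<lambda>a x. M * x)"
    by (rule antiderivative_data[OF data _ Phi(1)]) (use bd in auto)
  interpret P: cocycle_data T \<Phi> \<phi> "\<lambda>a x. M * x" by (rule data2)
  have near: "\<bar>SB \<phi> n a x - mean \<Phi> n $ a\<bar> \<le> W n" if "x \<in> cI n a" for n a x
  proof -
    obtain z where "z \<in> cI n a" "mean \<Phi> n $ a = SB \<phi> n a z" using P.mean_mvt by blast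
    then show ?thesis using osc[OF that] by simp
  qed
  have Wn: "0 \<le> W n" for n unfolding W_def using M tlen_pos[of n] by simp
  have "\<bar>mean \<Phi> n $ b\<bar> \<le> tlen n * (2 * M / tlen 0 + (\<Sum>j<n. 2 * (2 * W j) / tlen (Suc j)))"
  proof (rule zero_mean_recurrence)
    show "(\<Sum>a\<in>UNIV. lam n a * mean \<Phi> n $ a) = 0" for n unfolding mean_tot by (rule Phi(2))
    show "\<bar>mean \<Phi> 0 $ a\<bar> \<le> M" for a using P.mean_mvt[of 0 a] bd by auto
    show "\<bar>(mean \<Phi> (Suc n) - B n (Suc n) *v mean \<Phi> n) $ a\<bar> \<le> 2 * W n" for n a
    proof -
      obtain z where z: "z \<in> cI (Suc n) a" "mean \<Phi> (Suc n) $ a = SB \<phi> (Suc n) a z" using P.mean_mvt by blast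
      have "\<bar>SB \<phi> (Suc n) a z - (B n (Suc n) *v mean \<Phi> n) $ a\<bar> \<le> (B n (Suc n) *v (\<chi> a. W n)) $ a"
        by (rule SB_close[OF _ _ z(1)]) (use near in auto)
      also have "\<dots> = rsum n (Suc n) a * W n" unfolding mat_vec_const by (rule mult.commute)
      also have "\<dots> \<le> 2 * W n" by (rule mult_right_mono[OF rsum_step Wn])
      finally show ?thesis using z(2) by simp
    qed
  qed
  also have "\<dots> \<le> tlen n * (2 * M / tlen 0 + (\<Sum>j<n. 40 * M * (real n + 1)))"
  proof (intro mult_left_mono add_left_mono sum_mono)
    fix j assume "j \<in> {..<n}"
    then have j: "real j + 1 \<le> real n + 1" by simp
    \<comment> \<open>40 = 2 * 2 * 5 * 2, where the last factor comes from tlen j \<le> 2 tlen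
      (j+1).\<close>
    have "2 * (2 * W j) \<le> 40 * M * (real j + 1) * tlen (Suc j)"
      using mult_left_mono[OF tlen_Suc(2)[of j], of "20 * M * (real j + 1)"] M by (simp add: W_def algebra_simps)
    also have "\<dots> \<le> 40 * M * (real n + 1) * tlen (Suc j)"
      by (intro mult_right_mono mult_left_mono j) (use M tlen_pos in \<open>auto simp: less_imp_le\<close>)
    finally show "2 * (2 * W j) / tlen (Suc j) \<le> 40 * M * (real n + 1)"
      using tlen_pos[of "Suc j"] by (simp add: divide_le_eq)
  qed (use tlen_pos in \<open>auto simp: less_imp_le\<close>)
  also have "\<dots> = tlen n * M * (2 / tlen 0 + 40 * real n * (real n + 1))" by (simp add: algebra_simps)
  finally have mean2: "\<bar>mean \<Phi> n $ b\<bar> \<le> tlen n * M * (2 / tlen 0 + 40 * real n * (real n + 1))" .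
  have "\<bar>SB \<phi> n b x\<bar> \<le> tlen n * M * (2 / tlen 0 + 40 * real n * (real n + 1)) + tlen n * M * (5 * (real n + 1))"
    using near[OF x] mean2 unfolding W_def by (simp add: algebra_simps)
  also have "\<dots> = tlen n * M * (2 / tlen 0 + 40 * real n * (real n + 1) + 5 * (real n + 1))" by (simp only: distrib_left)
  also have "\<dots> \<le> tlen n * M * ((90 + 2 / tlen 0) * (real n + 1)\<^sup>2)"
  proof (rule mult_left_mono)
    have 1: "1 \<le> (real n + 1)\<^sup>2" by simp
    have "2 / tlen 0 * 1 \<le> 2 / tlen 0 * (real n + 1)\<^sup>2" by (rule mult_left_mono[OF 1]) (use tlen_pos[of 0] in simp)
    moreover have "40 * real n * (real n + 1) + 5 * (real n + 1) \<le> 90 * (real n + 1)\<^sup>2"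
      by (simp add: power2_eq_square algebra_simps)
    ultimately show "2 / tlen 0 + 40 * real n * (real n + 1) + 5 * (real n + 1) \<le> (90 + 2 / tlen 0) * (real n + 1)\<^sup>2"
      by (simp add: distrib_right)
  qed (use M tlen_pos[of n] in simp)
  finally show ?thesis by (simp only: mult_ac)
qed

end

context dc_growth
begin

text \<open>The number of elementary steps in one accelerated step is at most the norm of its
  matrix; \<delta> pays for summing over the levels.\<close>

lemma nk_powr: "0 < \<delta> \<Longrightarrow> \<exists>C>0. \<forall>i. real (nk (Suc i)) + 1 \<le> C * N i powr (h + \<delta>)"
proof -
  assume \<delta>: "0 < \<delta>"
  obtain D where D: "0 < D" "\<And>k. (\<Sum>j<k. N j powr (-\<delta>)) \<le> D" using N_powr_finite_sum[OF \<delta>] by auto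
  have nk_sum: "real (nk k) \<le> (\<Sum>j<k. Z j)" for k
  proof (induction k)
    case (Suc k)
    have "real (nk (Suc k) - nk k) \<le> Z k" by (rule steps_le_mat_norm[OF rv_time_Suc(1)])
    then show ?case using Suc rv_time_Suc(1)[of k] by simp
  qed simp
  have "real (nk (Suc i)) + 1 \<le> (Ca * D + 1) * N i powr (h + \<delta>)" for i
  proof -
    have "Z j \<le> Ca * (N i powr (h + \<delta>) * N j powr (-\<delta>))" if "j < Suc i" for j
    proof -
      have "N j powr h = N j powr (h + \<delta>) * N j powr (-\<delta>)" by (simp add: powr_add[symmetric])
      also have "\<dots> \<le> N i powr (h + \<delta>) * N j powr (-\<delta>)"
        by (intro mult_right_mono powr_mono2) (use h \<delta> N_mono[of j i] N_pos[of j] that in auto)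
      finally have "Ca * N j powr h \<le> Ca * (N i powr (h + \<delta>) * N j powr (-\<delta>))"
        by (rule mult_left_mono) (use Ca in simp)
      then show ?thesis by (rule order_trans[OF Z_le])
    qed
    then have "(\<Sum>j<Suc i. Z j) \<le> (\<Sum>j<Suc i. Ca * (N i powr (h + \<delta>) * N j powr (-\<delta>)))" by (intro sum_mono) simp
    also have "\<dots> = Ca * N i powr (h + \<delta>) * (\<Sum>j<Suc i. N j powr (-\<delta>))" unfolding sum_distrib_left by (simp only: mult_ac)
    also have "\<dots> \<le> Ca * N i powr (h + \<delta>) * D" by (rule mult_left_mono[OF D(2)]) (use Ca in simp)
    finally have "real (nk (Suc i)) \<le> Ca * D * N i powr (h + \<delta>)" using nk_sum[of "Suc i"] by (simp add: mult_ac)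
    moreover have "1 \<le> N i powr (h + \<delta>)" by (rule ge_one_powr_ge_zero) (use N_ge_1 h \<delta> in auto)
    ultimately show ?thesis by (simp add: distrib_right)
  qed
  then show ?thesis using D(1) Ca by (intro exI[of _ "Ca * D + 1"]) (auto intro: add_pos_pos)
qed

lemma corrected_2:
  assumes d2: "CARD('a) = 2"
    and main: "(4 * real CARD('a) + real CARD('a) * (real CARD('a) - 1) / \<sigma>) * h < \<theta>"
  shows "\<exists>C>0. \<exists>r. (\<forall>k. 0 \<le> r k) \<and> summable (\<lambda>k. Z k * r k) \<and> corrected C r"
proof -
  obtain x0 y0 :: 'a where xy: "UNIV = {x0, y0}" "x0 \<noteq> y0" using d2 card_2_iff[of "UNIV :: 'a set"] by auto
  interpret two_letters T x0 y0 by unfold_locales (use xy in auto)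
  \<comment> \<open>For two letters the bound on \<theta> reads \<theta> \<le> 2, which limits
    \<open>h\<close> to less than 1/4.\<close>
  have "\<theta> \<le> 2" using theta_bound d2 by simp
  moreover have "0 < 2 / \<sigma> * h" using sigma h by simp
  moreover have "8 * h + 2 / \<sigma> * h < \<theta>" using main d2 by (simp add: algebra_simps)
  ultimately have h4: "h < 1 / 4" by linarith
  define r where "r k = tlen (nk k) * (real (nk k) + 1)\<^sup>2" for k
  have r0: "0 \<le> r k" for k unfolding r_def using tlen_pos[of "nk k"] by simp
  define C where "C = 2 * (90 + 2 / tlen 0) + 2"
  have C: "0 < C" "2 * (90 + 2 / tlen 0) \<le> C" "2 \<le> C" unfolding C_def using tlen_pos[of 0] by (auto simp: add_pos_pos)
  have "summable (\<lambda>k. Z k * r k)"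
  proof -
    obtain D where D: "0 < D" "\<And>i. real (nk (Suc i)) + 1 \<le> D * N i powr (h + 1 / 20)" using nk_powr[of "1 / 20"] by auto
    \<comment> \<open>The sum of the exponents in \<open>N i\<close>, with opposite sign: (1+h)h
      from \<open>Z\<close>, -1 from the length, 2(h + 1/20) from the squared number of
      steps.\<close>
    define e where "e = 9 / 10 - 3 * h - h * h"
    have e: "0 < e"
    proof -
      have "h * h \<le> h * (1 / 4)" by (rule mult_left_mono) (use h h4 in auto)
      then show ?thesis unfolding e_def using h4 by linarith
    qed
    define K where "K = Ca * Ca powr h * tlen 0 * D\<^sup>2"
    have "summable (\<lambda>i. Z (Suc i) * r (Suc i))"
    proof (rule summable_comparison_test')
      show "summable (\<lambda>i. K * N i powr (-e))" by (intro summable_mult summable_N_powr e)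
      fix i
      have 1: "Z (Suc i) \<le> Ca * (Ca powr h * N i powr ((1 + h) * h))"
        by (rule order_trans[OF Z_le], rule mult_left_mono[OF N_Suc_powr_pos]) (use h Ca in auto)
      have 2: "tlen (nk (Suc i)) \<le> tlen 0 * N i powr (-1)"
        using tlen_N[of i] N_pos[of i] by (simp add: powr_minus divide_simps)
      have 3: "(real (nk (Suc i)) + 1)\<^sup>2 \<le> D\<^sup>2 * N i powr (2 * (h + 1 / 20))"
      proof -
        have sq: "(N i powr y)\<^sup>2 = N i powr (2 * y)" for y
          by (simp only: power2_eq_square powr_add[symmetric] mult_2)
        have "(real (nk (Suc i)) + 1)\<^sup>2 \<le> (D * N i powr (h + 1 / 20))\<^sup>2" by (rule power_mono[OF D(2)]) simp
        also have "(D * N i powr (h + 1 / 20))\<^sup>2 = D\<^sup>2 * N i powr (2 * (h + 1 / 20))"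
          unfolding power_mult_distrib sq ..
        finally show ?thesis .
      qed
      have ee: "(1 + h) * h + (-1 + 2 * (h + 1 / 20)) = -e" unfolding e_def by (simp add: algebra_simps)
      have "Z (Suc i) * r (Suc i) \<le> (Ca * (Ca powr h * N i powr ((1 + h) * h))) * ((tlen 0 * N i powr (-1)) * (D\<^sup>2 * N i powr (2 * (h + 1 / 20))))"
        unfolding r_def by (intro mult_mono 1 2 3) (use Ca tlen_pos r0 in \<open>auto simp: less_imp_le\<close>)
      also have "\<dots> = K * N i powr ((1 + h) * h + (-1 + 2 * (h + 1 / 20)))"
        unfolding K_def powr_add by (simp only: mult_ac)
      finally have "Z (Suc i) * r (Suc i) \<le> K * N i powr (-e)" unfolding ee .
      then show "norm (Z (Suc i) * r (Suc i)) \<le> K * N i powr (-e)"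
        using r0[of "Suc i"] by (simp add: abs_mult mat_norm_nonneg)
    qed
    then show ?thesis by (rule summable_Suc_iff[THEN iffD1])
  qed
  moreover have "corrected C r"
    unfolding corrected_def
  proof (intro allI impI)
    fix \<phi> f g :: "'a \<Rightarrow> real \<Rightarrow> real" and M :: real
    assume data: "cocycle_data T \<phi> f g" and M: "0 < M" and tot0: "tot \<phi> 0 = 0" and V: "tot g 0 \<le> M"
      and bd: "\<forall>b x. x \<in> cI 0 b \<longrightarrow> \<bar>\<phi> b x\<bar> \<le> M \<and> \<bar>f b x\<bar> \<le> M"
    note D = cocycle_data.deriv[OF data] cocycle_data.dom[OF data]
    define \<Phi>0 where "\<Phi>0 a x = integral {lft 0 a..x} (\<phi> a)" for a x
    have dPhi0: "(\<Phi>0 a has_real_derivative \<phi> a x) (at x within cI 0 a)" if "x \<in> cI 0 a" for a x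
      unfolding \<Phi>0_def using D(1) that by (intro integral_has_real_derivative DERIV_continuous_on[of _ "\<phi> a" "f a"]) auto
    have data0: "cocycle_data T \<Phi>0 \<phi> (\<lambda>a x. M * x)"
      by (rule antiderivative_data[OF data _ dPhi0]) (use bd in auto)
    \<comment> \<open>The mean value of \<phi> over the whole interval. Removing it gives the
      antiderivative total increment 0, so the constant vector with this entry is the
      correction.\<close>
    define cbar where "cbar = tot \<Phi>0 0 / tlen 0"
    have cbar: "\<bar>cbar\<bar> \<le> M"
    proof -
      have "\<bar>incr \<Phi>0 0 a\<bar> \<le> lam 0 a * M" for a
      proof -
        obtain z where z: "z \<in> cI 0 a" "mean \<Phi>0 0 $ a = SB \<phi> 0 a z" using cocycle_data.mean_mvt[OF data0] by blast
        have "incr \<Phi>0 0 a = lam 0 a * mean \<Phi>0 0 $ a" using lam_pos[of 0 a] by (simp add: mean_def)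
        then show ?thesis using z bd lam_pos[of 0 a] by (simp add: abs_mult)
      qed
      then have "(\<Sum>a\<in>UNIV. \<bar>incr \<Phi>0 0 a\<bar>) \<le> tlen 0 * M" unfolding sum_distrib_right by (rule sum_mono)
      then have "\<bar>tot \<Phi>0 0\<bar> \<le> tlen 0 * M" unfolding tot_def by (rule order_trans[OF sum_abs])
      then show ?thesis unfolding cbar_def using tlen_pos[of 0] by (simp add: abs_div divide_le_eq mult.commute)
    qed
    define v :: "real^'a" where "v = (\<chi> a. cbar)"
    define \<phi>' where "\<phi>' a x = \<phi> a x - v $ a" for a x
    define \<Phi> where "\<Phi> a x = \<Phi>0 a x - cbar * x" for a x
    have data': "cocycle_data T \<phi>' f g"
    proof (rule cocycle_data.intro[OF rauzy_path_axioms], rule cocycle_data_axioms.intro)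
      show "x \<in> cI 0 a \<Longrightarrow> (\<phi>' a has_real_derivative f a x) (at x within cI 0 a)" for a x
        unfolding \<phi>'_def using DERIV_diff[OF D(1)[of x a] DERIV_const[of "v $ a"]] by simp
    qed (rule D(2))
    have dPhi: "(\<Phi> a has_real_derivative \<phi>' a x) (at x within cI 0 a)" if "x \<in> cI 0 a" for a x
      unfolding \<Phi>_def \<phi>'_def v_def using that by (auto intro!: derivative_eq_intros dPhi0)
    have tot': "tot \<phi>' 0 = 0" using tot0 by (simp add: tot_def incr_def \<phi>'_def)
    have "tot \<Phi> 0 = tot \<Phi>0 0 - cbar * tlen 0"
      by (simp add: tot_def incr_def \<Phi>_def sum_subtractf sum_distrib_left algebra_simps sum.distrib)
    then have totP: "tot \<Phi> 0 = 0" unfolding cbar_def using tlen_pos[of 0] by simp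
    have est: "\<bar>SB \<phi>' n b x\<bar> \<le> (90 + 2 / tlen 0) * (2 * M) * (tlen n * (real n + 1)\<^sup>2)" if "x \<in> cI n b" for n b x
    proof (rule two_letter_estimate[OF data' _ tot' _ _ dPhi totP that])
      show "\<bar>\<phi>' b x\<bar> \<le> 2 * M \<and> \<bar>f b x\<bar> \<le> 2 * M" if "x \<in> cI 0 b" for b x
        using bd[rule_format, OF that] cbar M unfolding \<phi>'_def v_def by (simp, linarith)
    qed (use M V in auto)
    have "norm v \<le> real CARD('a) * M" by (rule norm_le_card) (use cbar in \<open>simp add: v_def\<close>)
    also have "\<dots> \<le> C * M" by (rule mult_right_mono) (use C d2 M in auto)
    finally have nv: "norm v \<le> C * M" .
    have "\<bar>SB \<phi> (nk k) b x - (B 0 (nk k) *v v) $ b\<bar> \<le> C * M * r k" if x: "x \<in> cI (nk k) b" for k b x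
    proof -
      have "SB \<phi>' (nk k) b x = SB \<phi> (nk k) b x - (B 0 (nk k) *v v) $ b"
        unfolding \<phi>'_def SB_diff SB_const ..
      then have "\<bar>SB \<phi> (nk k) b x - (B 0 (nk k) *v v) $ b\<bar> \<le> (2 * (90 + 2 / tlen 0)) * (M * r k)"
        using est[OF x] unfolding r_def by (simp add: mult_ac)
      also have "\<dots> \<le> C * (M * r k)" by (rule mult_right_mono[OF C(2)]) (use M r0 in simp)
      finally show ?thesis by (simp add: mult_ac)
    qed
    then show "\<exists>v. norm v \<le> C * M \<and> (\<forall>k b x. x \<in> cI (nk k) b \<longrightarrow> \<bar>SB \<phi> (nk k) b x - (B 0 (nk k) *v v) $ b\<bar> \<le> C * M * r k)"
      using nv by blast
  qed
  ultimately show ?thesis using C(1) r0 by (intro exI[of _ C] exI[of _ r] conjI allI)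
qed

end

text \<open>The strict main inequality leaves room for an exponent \<open>h\<close> above \<eta>,
  for which (a) holds with one constant.\<close>

lemma (in dc_path) corrected_exists:
  assumes main: "(4 * real CARD('a) + real CARD('a) * (real CARD('a) - 1) / \<sigma>) * \<eta> < \<theta>"
  shows "\<exists>C>0. \<exists>r. (\<forall>k. 0 \<le> r k) \<and> summable (\<lambda>k. Z k * r k) \<and> corrected C r"
proof -
  define A where "A = 4 * real CARD('a) + real CARD('a) * (real CARD('a) - 1) / \<sigma>"
  have A: "0 < A" unfolding A_def using sigma CARD_ge2 by (intro add_pos_nonneg) auto
  have "\<eta> < \<theta> / A" using main A unfolding A_def[symmetric] by (simp add: less_divide_eq mult.commute)
  then obtain h where h: "\<eta> < h" "h < \<theta> / A" using dense by blast
  have main': "A * h < \<theta>" using h(2) A by (simp add: less_divide_eq mult.commute)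
  obtain C0 where C0: "0 < C0" "\<And>k. Z k \<le> C0 * N k powr h" using DC_a[OF h(1)] by auto
  interpret dc_growth T \<eta> \<theta> \<sigma> h "max 1 C0"
  proof unfold_locales
    show "0 < h" using h(1) eta by simp
    show "Z k \<le> max 1 C0 * N k powr h" for k
      by (rule order_trans[OF C0(2)]) (intro mult_right_mono, auto)
  qed simp
  consider "CARD('a) = 2" | "3 \<le> CARD('a)" using CARD_ge2 by linarith
  then show ?thesis
    using corrected_2 corrected_ge_3 main' unfolding A_def by cases auto
qed

section \<open>A linear choice of the correction\<close>

context rauzy_path
begin

lemma SB_lincomb: "SB (\<lambda>a x. c * \<phi> a x + e * \<xi> a x) n a x = c * SB \<phi> n a x + e * SB \<xi> n a x"
  by (induction n arbitrary: a x) (auto simp: algebra_simps)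

text \<open>The correction of a function is unique up to the vectors whose images decay like \<open>r\<close>;
  projecting along this subspace makes it linear.\<close>
lemma linear_correction:
  fixes V :: "('a \<Rightarrow> real \<Rightarrow> real) set" and nrm :: "('a \<Rightarrow> real \<Rightarrow> real) \<Rightarrow> real"
  assumes r: "\<And>k. 0 \<le> r k" and C: "0 < C" and nrm: "\<And>\<phi>. \<phi> \<in> V \<Longrightarrow> 0 \<le> nrm \<phi>"
    and ex: "\<And>\<phi>. \<phi> \<in> V \<Longrightarrow> \<exists>v. norm v \<le> C * nrm \<phi> \<and>
      (\<forall>k b x. x \<in> cI (nk k) b \<longrightarrow> \<bar>SB \<phi> (nk k) b x - (B 0 (nk k) *v v) $ b\<bar> \<le> C * nrm \<phi> * r k)"
    and V: "\<And>\<phi> \<xi> c e. \<phi> \<in> V \<Longrightarrow> \<xi> \<in> V \<Longrightarrow> (\<lambda>a x. c * \<phi> a x + e * \<xi> a x) \<in> V"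
  shows "\<exists>cor C'. 0 < C' \<and>
    (\<forall>\<phi>\<in>V. \<forall>\<xi>\<in>V. \<forall>c e. cor (\<lambda>a x. c * \<phi> a x + e * \<xi> a x) = c *\<^sub>R cor \<phi> + e *\<^sub>R cor \<xi>) \<and>
    (\<forall>\<phi>\<in>V. \<forall>k b x. x \<in> cI (nk k) b \<longrightarrow> \<bar>SB (\<lambda>a x. \<phi> a x - cor \<phi> $ a) (nk k) b x\<bar> \<le> C' * nrm \<phi> * r k)"
proof -
  define G where "G = {v. \<exists>D. \<forall>k. norm (B 0 (nk k) *v v) \<le> D * r k}"
  have G: "subspace G"
  proof (rule subspaceI)
    show "0 \<in> G" unfolding G_def using r by (auto intro!: exI[of _ 0])
    fix v w assume v: "v \<in> G"
    then obtain D where D: "\<And>k. norm (B 0 (nk k) *v v) \<le> D * r k" unfolding G_def by blast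
    {
      assume "w \<in> G"
      then obtain D' where D': "\<And>k. norm (B 0 (nk k) *v w) \<le> D' * r k" unfolding G_def by blast
      have "norm (B 0 (nk k) *v (v + w)) \<le> (D + D') * r k" for k
        unfolding matrix_vector_right_distrib distrib_right
        by (rule order_trans[OF norm_triangle_ineq]) (rule add_mono[OF D D'])
      then show "v + w \<in> G" unfolding G_def by blast
    }
    fix c
    have "norm (B 0 (nk k) *v (c *\<^sub>R v)) \<le> (\<bar>c\<bar> * D) * r k" for k
      using mult_left_mono[OF D[of k], of "\<bar>c\<bar>"] by (simp add: matrix_vector_mult_scaleR mult.assoc)
    then show "c *\<^sub>R v \<in> G" unfolding G_def by blast
  qed
  \<comment> \<open>Uniform decay on \<open>G\<close> means that changing a correction by its part
    in \<open>G\<close> costs only a constant.\<close>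
  have "\<exists>D>0. \<forall>v\<in>G. \<forall>k. norm (B 0 (nk k) *v v) \<le> D * r k * norm v"
    by (rule uniform_on_subspace[OF G r]) (simp add: G_def)
  then obtain D where D: "0 < D" "\<And>v k. v \<in> G \<Longrightarrow> norm (B 0 (nk k) *v v) \<le> D * r k * norm v" by blast
  obtain S where S: "S \<subseteq> G" "pairwise orthogonal S" "\<And>b. b \<in> S \<Longrightarrow> norm b = 1" "independent S" "span S = G"
    using orthonormal_basis_subspace[OF G] by metis
  have fin: "finite S" using S(4) independent_imp_finite by blast
  \<comment> \<open>\<open>w\<close> is the orthogonal projection onto \<open>G\<close> and
    \<open>p\<close> the complementary one.\<close>
  define w where "w v = (\<Sum>b\<in>S. (v \<bullet> b) *\<^sub>R b)" for v
  define p where "p v = v - w v" for v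
  have w_lin: "w (c *\<^sub>R u + e *\<^sub>R v) = c *\<^sub>R w u + e *\<^sub>R w v" for c e u v
    unfolding w_def by (simp add: inner_add_left scaleR_add_left sum.distrib scaleR_sum_right)
  have p_lin: "p (c *\<^sub>R u + e *\<^sub>R v) = c *\<^sub>R p u + e *\<^sub>R p v" for c e u v
    unfolding p_def w_lin by (simp add: scaleR_diff_right)
  have wG: "w v \<in> G" for v
    unfolding w_def by (intro subspace_sum[OF G] subspace_scale[OF G]) (use S(1) in auto)
  have p_0: "p v = 0" if "v \<in> G" for v
    using orthonormal_basis_expand[of S v] S that fin unfolding p_def w_def by simp
  have nw: "norm (w v) \<le> real (card S) * norm v" for v
  proof -
    have "norm (w v) \<le> (\<Sum>b\<in>S. norm ((v \<bullet> b) *\<^sub>R b))" unfolding w_def by (rule norm_sum)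
    also have "\<dots> \<le> (\<Sum>b\<in>S. norm v)"
      by (rule sum_mono) (use S(3) Cauchy_Schwarz_ineq2[of v] in \<open>auto, metis mult.right_neutral\<close>)
    finally show ?thesis by simp
  qed
  define good where "good \<phi> v \<longleftrightarrow> (\<exists>E. \<forall>k b x. x \<in> cI (nk k) b \<longrightarrow> \<bar>SB \<phi> (nk k) b x - (B 0 (nk k) *v v) $ b\<bar> \<le> E * r k)" for \<phi> v
  have good_diff: "u - v \<in> G" if "good \<phi> u" "good \<phi> v" for \<phi> u v
  proof -
    obtain E E' where E: "\<And>k b x. x \<in> cI (nk k) b \<Longrightarrow> \<bar>SB \<phi> (nk k) b x - (B 0 (nk k) *v u) $ b\<bar> \<le> E * r k"
      "\<And>k b x. x \<in> cI (nk k) b \<Longrightarrow> \<bar>SB \<phi> (nk k) b x - (B 0 (nk k) *v v) $ b\<bar> \<le> E' * r k"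
      using \<open>good \<phi> u\<close> \<open>good \<phi> v\<close> unfolding good_def by blast
    have "norm (B 0 (nk k) *v (u - v)) \<le> (real CARD('a) * (E + E')) * r k" for k
    proof -
      have "\<bar>(B 0 (nk k) *v (u - v)) $ b\<bar> \<le> (E + E') * r k" for b
        using E(1)[OF left_in_cI[of "nk k" b]] E(2)[OF left_in_cI[of "nk k" b]]
        unfolding matrix_vector_mult_diff_distrib vector_minus_component distrib_right by linarith
      from norm_le_card[OF this] show ?thesis by (simp add: mult.assoc)
    qed
    then show ?thesis unfolding G_def by blast
  qed
  \<comment> \<open>The choice does not matter: two good vectors differ by an element of
    \<open>G\<close>, which \<open>p\<close> annihilates. Hence \<open>cor\<close> is linear
    although the choice is not.\<close>
  define cor where "cor \<phi> = p (SOME v. good \<phi> v)" for \<phi>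
  have cor: "cor \<phi> = p v" if "good \<phi> v" for \<phi> v
  proof -
    have "good \<phi> (SOME v. good \<phi> v)" using that by (rule someI)
    from p_0[OF good_diff[OF this that]] show ?thesis
      using p_lin[of 1 "SOME v. good \<phi> v" "-1" v] unfolding cor_def by simp
  qed
  have good_ex: "\<exists>v. norm v \<le> C * nrm \<phi> \<and> good \<phi> v \<and>
      (\<forall>k b x. x \<in> cI (nk k) b \<longrightarrow> \<bar>SB \<phi> (nk k) b x - (B 0 (nk k) *v v) $ b\<bar> \<le> C * nrm \<phi> * r k)" if "\<phi> \<in> V" for \<phi>
    using ex[OF that] unfolding good_def by blast
  have lin: "cor (\<lambda>a x. c * \<phi> a x + e * \<xi> a x) = c *\<^sub>R cor \<phi> + e *\<^sub>R cor \<xi>" if pv: "\<phi> \<in> V" "\<xi> \<in> V" for \<phi> \<xi> c e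
  proof -
    obtain u v where uv: "good \<phi> u" "good \<xi> v" using good_ex[OF pv(1)] good_ex[OF pv(2)] by blast
    then obtain E E' where E: "\<And>k b x. x \<in> cI (nk k) b \<Longrightarrow> \<bar>SB \<phi> (nk k) b x - (B 0 (nk k) *v u) $ b\<bar> \<le> E * r k"
      "\<And>k b x. x \<in> cI (nk k) b \<Longrightarrow> \<bar>SB \<xi> (nk k) b x - (B 0 (nk k) *v v) $ b\<bar> \<le> E' * r k"
      unfolding good_def by blast
    have "\<bar>SB (\<lambda>a x. c * \<phi> a x + e * \<xi> a x) (nk k) b x - (B 0 (nk k) *v (c *\<^sub>R u + e *\<^sub>R v)) $ b\<bar> \<le> (\<bar>c\<bar> * E + \<bar>e\<bar> * E') * r k"
      if x: "x \<in> cI (nk k) b" for k b x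
    proof -
      have "SB (\<lambda>a x. c * \<phi> a x + e * \<xi> a x) (nk k) b x - (B 0 (nk k) *v (c *\<^sub>R u + e *\<^sub>R v)) $ b
        = c * (SB \<phi> (nk k) b x - (B 0 (nk k) *v u) $ b) + e * (SB \<xi> (nk k) b x - (B 0 (nk k) *v v) $ b)"
        unfolding SB_lincomb by (simp add: matrix_vector_right_distrib matrix_vector_mult_scaleR algebra_simps)
      also have "\<bar>\<dots>\<bar> \<le> \<bar>c\<bar> * \<bar>SB \<phi> (nk k) b x - (B 0 (nk k) *v u) $ b\<bar> + \<bar>e\<bar> * \<bar>SB \<xi> (nk k) b x - (B 0 (nk k) *v v) $ b\<bar>"
        unfolding abs_mult[symmetric] by (rule abs_triangle_ineq)
      also have "\<dots> \<le> \<bar>c\<bar> * (E * r k) + \<bar>e\<bar> * (E' * r k)" by (intro add_mono mult_left_mono E x) auto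
      finally show ?thesis by (simp add: algebra_simps)
    qed
    then have "good (\<lambda>a x. c * \<phi> a x + e * \<xi> a x) (c *\<^sub>R u + e *\<^sub>R v)" unfolding good_def by blast
    from cor[OF this] show ?thesis unfolding cor[OF uv(1)] cor[OF uv(2)] p_lin .
  qed
  define C' where "C' = C + D * real (card S) * C"
  have C': "0 < C'" unfolding C'_def using C D(1) by (intro add_pos_nonneg) auto
  have "\<bar>SB (\<lambda>a x. \<phi> a x - cor \<phi> $ a) (nk k) b x\<bar> \<le> C' * nrm \<phi> * r k" if pv: "\<phi> \<in> V" and x: "x \<in> cI (nk k) b" for \<phi> k b x
  proof -
    obtain v where v: "norm v \<le> C * nrm \<phi>" "good \<phi> v"
      "\<And>k b x. x \<in> cI (nk k) b \<Longrightarrow> \<bar>SB \<phi> (nk k) b x - (B 0 (nk k) *v v) $ b\<bar> \<le> C * nrm \<phi> * r k"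
      using good_ex[OF pv] by blast
    have "SB (\<lambda>a x. \<phi> a x - cor \<phi> $ a) (nk k) b x = (SB \<phi> (nk k) b x - (B 0 (nk k) *v v) $ b) + (B 0 (nk k) *v w v) $ b"
      unfolding SB_diff SB_const cor[OF v(2)] p_def by (simp add: matrix_vector_mult_diff_distrib)
    moreover have "\<bar>(B 0 (nk k) *v w v) $ b\<bar> \<le> D * real (card S) * C * nrm \<phi> * r k"
    proof -
      have "\<bar>(B 0 (nk k) *v w v) $ b\<bar> \<le> D * r k * norm (w v)"
        by (rule order_trans[OF component_le_norm_cart D(2)[OF wG]])
      also have "\<dots> \<le> D * r k * (real (card S) * (C * nrm \<phi>))"
        by (intro mult_left_mono order_trans[OF nw] v(1)) (use D(1) r in auto)
      finally show ?thesis by (simp only: mult_ac)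
    qed
    ultimately show ?thesis using v(3)[OF x] unfolding C'_def distrib_right by linarith
  qed
  then show ?thesis using C' lin by (intro exI[of _ cor] exI[of _ C']) blast
qed

end

section \<open>Functions on a compact interval\<close>

lemma differentiable_on_lincomb:
  fixes f g :: "real \<Rightarrow> real"
  shows "f differentiable_on S \<Longrightarrow> g differentiable_on S \<Longrightarrow> (\<lambda>x. c * f x + e * g x) differentiable_on S"
  by (intro differentiable_on_add differentiable_on_mult differentiable_on_const)

lemma variation_sumsI:
  "(\<And>i. i \<le> n \<Longrightarrow> t i \<in> S) \<Longrightarrow> (\<And>i. i < n \<Longrightarrow> t i \<le> t (Suc i)) \<Longrightarrow>
    (\<Sum>i<n. \<bar>f (t (Suc i)) - f (t i)\<bar>) \<in> variation_sums f S"
  unfolding variation_sums_def by blast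

lemma zero_in_variation_sums: "y \<in> S \<Longrightarrow> 0 \<in> variation_sums f S"
  using variation_sumsI[of 0 "\<lambda>_. y" S f] by simp

lemma variation_sums_lincomb:
  assumes "bounded_variation_on f S" "bounded_variation_on g S"
  shows "bounded_variation_on (\<lambda>x. c * f x + e * g x) S"
proof -
  obtain M M' where M: "\<And>s. s \<in> variation_sums f S \<Longrightarrow> s \<le> M" "\<And>s. s \<in> variation_sums g S \<Longrightarrow> s \<le> M'"
    using assms unfolding bounded_variation_on_def bdd_above_def by blast
  show ?thesis unfolding bounded_variation_on_def
  proof (rule bdd_aboveI)
    fix s assume "s \<in> variation_sums (\<lambda>x. c * f x + e * g x) S"
    then obtain t n where t: "\<forall>i\<le>n. t i \<in> S" "\<forall>i<n. t i \<le> t (Suc i)"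
      and s: "s = (\<Sum>i<n. \<bar>(c * f (t (Suc i)) + e * g (t (Suc i))) - (c * f (t i) + e * g (t i))\<bar>)"
      unfolding variation_sums_def by blast
    have *: "(\<Sum>i<n. \<bar>h (t (Suc i)) - h (t i)\<bar>) \<in> variation_sums h S" for h
      unfolding variation_sums_def using t by blast
    have "\<bar>(c * f y + e * g y) - (c * f x + e * g x)\<bar> \<le> \<bar>c\<bar> * \<bar>f y - f x\<bar> + \<bar>e\<bar> * \<bar>g y - g x\<bar>" for x y
    proof -
      have "(c * f y + e * g y) - (c * f x + e * g x) = c * (f y - f x) + e * (g y - g x)" by (simp add: algebra_simps)
      then show ?thesis using abs_triangle_ineq[of "c * (f y - f x)" "e * (g y - g x)"] by (simp add: abs_mult)
    qed
    then have "s \<le> (\<Sum>i<n. \<bar>c\<bar> * \<bar>f (t (Suc i)) - f (t i)\<bar> + \<bar>e\<bar> * \<bar>g (t (Suc i)) - g (t i)\<bar>)"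
      unfolding s by (intro sum_mono)
    also have "\<dots> = \<bar>c\<bar> * (\<Sum>i<n. \<bar>f (t (Suc i)) - f (t i)\<bar>) + \<bar>e\<bar> * (\<Sum>i<n. \<bar>g (t (Suc i)) - g (t i)\<bar>)"
      by (simp only: sum.distrib sum_distrib_left)
    also have "\<dots> \<le> \<bar>c\<bar> * M + \<bar>e\<bar> * M'" by (intro add_mono mult_left_mono M *) auto
    finally show "s \<le> \<bar>c\<bar> * M + \<bar>e\<bar> * M'" .
  qed
qed

lemma total_variation_nonneg:
  assumes "bounded_variation_on f S" "S \<noteq> {}"
  shows "0 \<le> total_variation f S"
proof -
  have "0 \<in> variation_sums f S" using assms(2) zero_in_variation_sums by blast
  then show ?thesis
    unfolding total_variation_def using assms(1) by (intro cSup_upper) (auto simp: bounded_variation_on_def)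
qed

section \<open>Derivatives, norms and variation on a closed interval\<close>

context
  fixes p q :: real
  assumes pq: "p < q"
begin

lemma deriv_on_eq: "x \<in> {p..q} \<Longrightarrow> (f has_real_derivative D) (at x within {p..q}) \<Longrightarrow> deriv_on {p..q} f x = D"
  using vector_derivative_within_closed_interval[OF pq]
  by (simp add: deriv_on_def has_real_derivative_iff_has_vector_derivative)

lemma deriv_on_works:
  assumes "f differentiable_on {p..q}" "x \<in> {p..q}"
  shows "(f has_real_derivative deriv_on {p..q} f x) (at x within {p..q})"
proof -
  obtain D where D: "(f has_real_derivative D) (at x within {p..q})"
    using assms unfolding differentiable_on_def real_differentiable_def by blast
  show ?thesis using deriv_on_eq[OF assms(2) D] D by simp
qed

lemma deriv_on_lincomb:
  assumes "f differentiable_on {p..q}" "g differentiable_on {p..q}"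
  shows "deriv_on {p..q} (\<lambda>x. c * f x + e * g x) = (\<lambda>x. c * deriv_on {p..q} f x + e * deriv_on {p..q} g x)"
proof
  fix x
  show "deriv_on {p..q} (\<lambda>x. c * f x + e * g x) x = c * deriv_on {p..q} f x + e * deriv_on {p..q} g x"
  proof (cases "x \<in> {p..q}")
    case True
    show ?thesis
      by (rule deriv_on_eq[OF True]) (intro DERIV_add DERIV_cmult deriv_on_works assms True)
  next
    case False
    then show ?thesis by (simp only: deriv_on_def if_False mult_zero_right add_0)
  qed
qed

lemma C_on_Suc:
  "f \<in> C_on (Suc k) {p..q} \<longleftrightarrow>
    (\<forall>x. x \<notin> {p..q} \<longrightarrow> f x = 0) \<and> f differentiable_on {p..q} \<and> deriv_on {p..q} f \<in> C_on k {p..q}"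
proof -
  have "(\<forall>i<Suc k. (deriv_on {p..q} ^^ i) f differentiable_on {p..q}) \<longleftrightarrow>
      f differentiable_on {p..q} \<and> (\<forall>i<k. (deriv_on {p..q} ^^ i) (deriv_on {p..q} f) differentiable_on {p..q})"
    by (auto simp: funpow_Suc_right less_Suc_eq_0_disj simp del: funpow.simps(2))
  moreover have "deriv_on {p..q} f x = 0" if "x \<notin> {p..q}" for x using that by (simp only: deriv_on_def if_False)
  ultimately show ?thesis
    unfolding C_on_def by (auto simp: funpow_Suc_right simp del: funpow.simps(2))
qed

lemma C_on_lincomb:
  "f \<in> C_on k {p..q} \<Longrightarrow> g \<in> C_on k {p..q} \<Longrightarrow> (\<lambda>x. c * f x + e * g x) \<in> C_on k {p..q}"
proof (induction k arbitrary: f g)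
  case 0
  then show ?case unfolding C_on_def by (auto intro!: continuous_intros)
next
  case (Suc k)
  then show ?case unfolding C_on_Suc by (simp add: deriv_on_lincomb differentiable_on_lincomb)
qed

lemma C_on_deriv_lincomb:
  "f \<in> C_on k {p..q} \<Longrightarrow> g \<in> C_on k {p..q} \<Longrightarrow> i \<le> k \<Longrightarrow>
    (deriv_on {p..q} ^^ i) (\<lambda>x. c * f x + e * g x) =
    (\<lambda>x. c * (deriv_on {p..q} ^^ i) f x + e * (deriv_on {p..q} ^^ i) g x)"
proof (induction i)
  case (Suc i)
  then have "(deriv_on {p..q} ^^ i) f differentiable_on {p..q}" "(deriv_on {p..q} ^^ i) g differentiable_on {p..q}"
    unfolding C_on_def by auto
  with Suc show ?case by (simp add: deriv_on_lincomb)
qed simp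

lemma C_on_continuous: "f \<in> C_on k {p..q} \<Longrightarrow> i \<le> k \<Longrightarrow> continuous_on {p..q} ((deriv_on {p..q} ^^ i) f)"
  unfolding C_on_def by (cases "i = k") (auto intro: differentiable_imp_continuous_on)

lemma C_on_mono: "f \<in> C_on k {p..q} \<Longrightarrow> i \<le> k \<Longrightarrow> f \<in> C_on i {p..q}"
  using C_on_continuous[of f k i] unfolding C_on_def by auto

lemma C_on_bdd: "f \<in> C_on k {p..q} \<Longrightarrow> i \<le> k \<Longrightarrow> bdd_above ((\<lambda>x. \<bar>(deriv_on {p..q} ^^ i) f x\<bar>) ` {p..q})"
  by (intro bounded_imp_bdd_above compact_imp_bounded compact_continuous_image continuous_on_rabs C_on_continuous) auto

lemma C_norm_terms:
  assumes "f \<in> C_on k {p..q}"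
  shows "i \<le> k \<Longrightarrow> 0 \<le> (SUP x\<in>{p..q}. \<bar>(deriv_on {p..q} ^^ i) f x\<bar>)"
    and "i \<le> k \<Longrightarrow> x \<in> {p..q} \<Longrightarrow> \<bar>(deriv_on {p..q} ^^ i) f x\<bar> \<le> (SUP x\<in>{p..q}. \<bar>(deriv_on {p..q} ^^ i) f x\<bar>)"
proof -
  show 1: "i \<le> k \<Longrightarrow> x \<in> {p..q} \<Longrightarrow> \<bar>(deriv_on {p..q} ^^ i) f x\<bar> \<le> (SUP x\<in>{p..q}. \<bar>(deriv_on {p..q} ^^ i) f x\<bar>)" for x
    by (rule cSUP_upper[OF _ C_on_bdd[OF assms]])
  then show "i \<le> k \<Longrightarrow> 0 \<le> (SUP x\<in>{p..q}. \<bar>(deriv_on {p..q} ^^ i) f x\<bar>)"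
    using pq by (intro order_trans[OF abs_ge_zero 1[of p]]) auto
qed

lemma C_norm_bound:
  assumes "f \<in> C_on k {p..q}" "i \<le> k" "x \<in> {p..q}"
  shows "\<bar>(deriv_on {p..q} ^^ i) f x\<bar> \<le> C_norm k {p..q} f"
proof -
  have "(SUP x\<in>{p..q}. \<bar>(deriv_on {p..q} ^^ i) f x\<bar>) \<le> C_norm k {p..q} f"
    unfolding C_norm_def using C_norm_terms(1)[OF assms(1)] assms(2)
    by (intro member_le_sum[of i "{..k}" "\<lambda>i. SUP x\<in>{p..q}. \<bar>(deriv_on {p..q} ^^ i) f x\<bar>"]) auto
  with C_norm_terms(2)[OF assms] show ?thesis by linarith
qed

lemma C_norm_nonneg: "f \<in> C_on k {p..q} \<Longrightarrow> 0 \<le> C_norm k {p..q} f"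
  unfolding C_norm_def by (intro sum_nonneg C_norm_terms(1)) auto

lemma C_norm_Suc: "C_norm (Suc k) {p..q} f = (SUP x\<in>{p..q}. \<bar>f x\<bar>) + C_norm k {p..q} (deriv_on {p..q} f)"
  unfolding C_norm_def sum.atMost_Suc_shift by (simp add: funpow_Suc_right del: funpow.simps(2))

text \<open>Contracting towards the midpoint moves partitions of the closed interval into the open one.\<close>
lemma variation_sum_le_total:
  assumes cont: "continuous_on {p..q} f" and bv: "bounded_variation_on f {p<..<q}"
    and s: "s \<in> variation_sums f {p..q}"
  shows "s \<le> total_variation f {p<..<q}"
proof -
  obtain t n where t: "\<forall>i\<le>n. t i \<in> {p..q}" "\<forall>i<n. t i \<le> t (Suc i)" and s: "s = (\<Sum>i<n. \<bar>f (t (Suc i)) - f (t i)\<bar>)"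
    using s unfolding variation_sums_def by blast
  define c where "c = (p + q) / 2"
  define w :: "nat \<Rightarrow> real" where "w m = 1 - inverse (real (Suc (Suc m)))" for m
  have w: "0 < w m" "w m < 1" for m unfolding w_def by (auto simp: field_simps)
  define u where "u m x = c + w m * (x - c)" for m x
  have u_in: "u m x \<in> {p<..<q}" if "x \<in> {p..q}" for m x
  proof -
    have "w m * (x - c) \<le> w m * (q - c)" "w m * (p - c) \<le> w m * (x - c)"
      using that w[of m] by (auto intro!: mult_left_mono)
    moreover have "w m * (q - c) < 1 * (q - c)" "w m * (c - p) < 1 * (c - p)"
      by (rule mult_strict_right_mono; use w pq in \<open>simp add: c_def\<close>)+
    ultimately show ?thesis unfolding u_def by (auto simp: algebra_simps)
  qed
  have u_lim: "(\<lambda>m. u m x) \<longlonglongrightarrow> x" for x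
  proof -
    have "(\<lambda>m. inverse (real (Suc (Suc m)))) \<longlonglongrightarrow> 0"
      using LIMSEQ_inverse_real_of_nat LIMSEQ_Suc by blast
    then have "(\<lambda>m. c + (1 - inverse (real (Suc (Suc m)))) * (x - c)) \<longlonglongrightarrow> c + (1 - 0) * (x - c)"
      by (intro tendsto_intros)
    then show ?thesis unfolding u_def w_def by simp
  qed
  have fu: "(\<lambda>m. f (u m x)) \<longlonglongrightarrow> f x" if x: "x \<in> {p..q}" for x
  proof (rule continuous_on_tendsto_compose[OF cont u_lim x])
    show "\<forall>\<^sub>F m in sequentially. u m x \<in> {p..q}" using u_in[OF x] by (auto intro!: always_eventually simp: less_imp_le)
  qed
  have "(\<lambda>m. \<Sum>i<n. \<bar>f (u m (t (Suc i))) - f (u m (t i))\<bar>) \<longlonglongrightarrow> s"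
    unfolding s using t(1) by (intro tendsto_intros fu) auto
  moreover have "(\<Sum>i<n. \<bar>f (u m (t (Suc i))) - f (u m (t i))\<bar>) \<le> total_variation f {p<..<q}" for m
  proof -
    have "(\<Sum>i<n. \<bar>f (u m (t (Suc i))) - f (u m (t i))\<bar>) \<in> variation_sums f {p<..<q}"
    proof (rule variation_sumsI)
      fix i assume "i \<le> n" then show "u m (t i) \<in> {p<..<q}" using u_in t(1) by blast
    next
      fix i assume "i < n"
      then have "w m * (t i - c) \<le> w m * (t (Suc i) - c)" using t(2) w(1)[of m] by (intro mult_left_mono) auto
      then show "u m (t i) \<le> u m (t (Suc i))" unfolding u_def by simp
    qed
    then show ?thesis unfolding total_variation_def using bv by (intro cSup_upper) (auto simp: bounded_variation_on_def)
  qed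
  ultimately show ?thesis by (intro LIMSEQ_le_const2) auto
qed

text \<open>The variation over [p,x] as a function of x. By continuity the endpoints contribute
  nothing beyond the variation over the open interval.\<close>

lemma variation_function:
  assumes cont: "continuous_on {p..q} f" and bv: "bounded_variation_on f {p<..<q}"
  shows "\<exists>g. (\<forall>x y. p \<le> x \<longrightarrow> x \<le> y \<longrightarrow> y \<le> q \<longrightarrow> \<bar>f y - f x\<bar> \<le> g y - g x) \<and> g q - g p \<le> total_variation f {p<..<q}"
proof -
  define g where "g x = Sup (variation_sums f {p..x})" for x
  have sub: "variation_sums f {p..x} \<subseteq> variation_sums f {p..q}" if xq: "x \<le> q" for x
  proof
    fix s assume "s \<in> variation_sums f {p..x}"
    then obtain t n where t: "\<forall>i\<le>n. t i \<in> {p..x}" "\<forall>i<n. t i \<le> t (Suc i)" and s: "s = (\<Sum>i<n. \<bar>f (t (Suc i)) - f (t i)\<bar>)"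
      unfolding variation_sums_def by blast
    show "s \<in> variation_sums f {p..q}" unfolding s
    proof (rule variation_sumsI)
      show "t i \<in> {p..q}" if "i \<le> n" for i using t(1)[rule_format, OF that] xq by simp
    qed (use t(2) in blast)
  qed
  have bdd: "bdd_above (variation_sums f {p..x})" if "x \<le> q" for x
    using variation_sum_le_total[OF cont bv] sub[OF that] by (intro bdd_aboveI) blast
  have zero: "0 \<in> variation_sums f {p..x}" if "p \<le> x" for x
    by (rule zero_in_variation_sums[of p]) (use that in simp)
  have "\<bar>f y - f x\<bar> \<le> g y - g x" if xy: "p \<le> x" "x \<le> y" "y \<le> q" for x y
  proof -
    have "g x \<le> g y - \<bar>f y - f x\<bar>" unfolding g_def
    proof (rule cSup_least)
      show "variation_sums f {p..x} \<noteq> {}" using zero[OF xy(1)] by blast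
      fix s assume "s \<in> variation_sums f {p..x}"
      then obtain t n where t: "\<forall>i\<le>n. t i \<in> {p..x}" "\<forall>i<n. t i \<le> t (Suc i)" and s: "s = (\<Sum>i<n. \<bar>f (t (Suc i)) - f (t i)\<bar>)"
        unfolding variation_sums_def by blast
      \<comment> \<open>Append \<open>x\<close> and \<open>y\<close> to a partition of [p,x]; the
        step from its last point to \<open>x\<close> is simply nonnegative.\<close>
      define t' where "t' i = (if i \<le> n then t i else if i = Suc n then x else y)" for i
      have "(\<Sum>i<Suc (Suc n). \<bar>f (t' (Suc i)) - f (t' i)\<bar>) \<in> variation_sums f {p..y}"
      proof (rule variation_sumsI)
        fix i show "t' i \<in> {p..y}" if "i \<le> Suc (Suc n)" using t(1)[rule_format, of i] xy unfolding t'_def by auto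
        show "t' i \<le> t' (Suc i)" if "i < Suc (Suc n)"
          using t(1)[rule_format, of i] t(2)[rule_format, of i] xy that unfolding t'_def by auto
      qed
      then have "(\<Sum>i<Suc (Suc n). \<bar>f (t' (Suc i)) - f (t' i)\<bar>) \<le> Sup (variation_sums f {p..y})"
        by (rule cSup_upper[OF _ bdd[OF xy(3)]])
      moreover have "(\<Sum>i<n. \<bar>f (t' (Suc i)) - f (t' i)\<bar>) = s" unfolding s t'_def by (intro sum.cong) auto
      moreover have "\<bar>f (t' (Suc (Suc n))) - f (t' (Suc n))\<bar> = \<bar>f y - f x\<bar>" unfolding t'_def by simp
      moreover have "0 \<le> \<bar>f (t' (Suc n)) - f (t' n)\<bar>" by simp
      ultimately show "s \<le> Sup (variation_sums f {p..y}) - \<bar>f y - f x\<bar>" unfolding sum.lessThan_Suc by linarith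
    qed
    then show ?thesis by simp
  qed
  moreover have "g q - g p \<le> total_variation f {p<..<q}"
  proof -
    have "g q \<le> total_variation f {p<..<q}" unfolding g_def
      using zero[of q] pq by (intro cSup_least variation_sum_le_total[OF cont bv]) auto
    moreover have "0 \<le> g p" unfolding g_def using pq by (intro cSup_upper zero bdd) auto
    ultimately show ?thesis by simp
  qed
  ultimately show ?thesis by blast
qed

end

lemma poly_antiderivative:
  fixes u :: "real poly"
  shows "\<exists>v. pderiv v = u \<and> degree v \<le> Suc (degree u)"
proof (intro exI conjI)
  let ?v = "\<Sum>i\<le>degree u. monom (coeff u i / of_nat (Suc i)) (Suc i)"
  have "pderiv ?v = (\<Sum>i\<le>degree u. monom (coeff u i) i)"
  proof -
    have "pderiv (sum h A) = (\<Sum>i\<in>A. pderiv (h i))" for h :: "nat \<Rightarrow> real poly" and A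
      by (induction A rule: infinite_finite_induct) (simp_all add: pderiv_add)
    then show ?thesis by (auto simp: pderiv_monom simp del: of_nat_Suc intro!: sum.cong)
  qed
  then show "pderiv ?v = u" by (simp add: poly_as_sum_of_monoms)
  show "degree ?v \<le> Suc (degree u)"
    by (rule degree_sum_le) (auto intro!: order_trans[OF degree_monom_le])
qed

section \<open>The boundary operator\<close>

lemma boundary_lincomb: "boundary T (\<lambda>a x. c * \<phi> a x + e * \<xi> a x) C = c * boundary T \<phi> C + e * boundary T \<xi> C"
proof -
  have "signed_end_value T (\<lambda>a x. c * \<phi> a x + e * \<xi> a x) d = c * signed_end_value T \<phi> d + e * signed_end_value T \<xi> d" for d
    by (auto simp: signed_end_value_def algebra_simps split: prod.split side.split)
  then show ?thesis unfolding boundary_def by (simp add: sum.distrib sum_distrib_left)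
qed

context
  fixes T :: "'a::finite iet"
  assumes T: "is_iet T"
begin

lemma finite_ends: "finite (UNIV :: ('a \<times> side) set)"
proof -
  have "(UNIV :: side set) = {LeftEnd, RightEnd}" using side.exhaust by auto
  then have "finite (UNIV :: side set)" by (metis finite.emptyI finite.insertI)
  from finite_cartesian_product[OF finite this, of "UNIV :: 'a set"] show ?thesis by simp
qed

lemma sum_ends: "(\<Sum>c\<in>UNIV. F c) = (\<Sum>a\<in>(UNIV :: 'a set). F (a, LeftEnd) + F (a, RightEnd))"
proof -
  have s: "(UNIV :: side set) = {LeftEnd, RightEnd}" using side.exhaust by auto
  have "(\<Sum>c\<in>UNIV \<times> UNIV. F c) = (\<Sum>a\<in>(UNIV :: 'a set). \<Sum>s\<in>UNIV. F (a, s))"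
    by (simp only: sum.cartesian_product case_prod_eta)
  also have "\<dots> = (\<Sum>a\<in>(UNIV :: 'a set). F (a, LeftEnd) + F (a, RightEnd))" unfolding s by simp
  finally show ?thesis by (simp only: UNIV_Times_UNIV)
qed

lemmas tops = top_positions[OF T] and bots = bot_positions[OF T]

lemma tau_cases:
  "iet_top T a \<noteq> CARD('a) \<Longrightarrow> \<exists>b. iet_tau T (a, RightEnd) = (b, LeftEnd) \<and> iet_top T b = Suc (iet_top T a)"
  "iet_top T a = CARD('a) \<Longrightarrow> \<exists>b. iet_tau T (a, RightEnd) = (b, RightEnd) \<and> iet_bot T b = CARD('a)"
  "iet_bot T a \<noteq> 1 \<Longrightarrow> \<exists>b. iet_tau T (a, LeftEnd) = (b, RightEnd) \<and> Suc (iet_bot T b) = iet_bot T a"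
  "iet_bot T a = 1 \<Longrightarrow> \<exists>b. iet_tau T (a, LeftEnd) = (b, LeftEnd) \<and> iet_top T b = 1"
  using positions_range[OF tops, of a] positions_range[OF bots, of a]
    positions_inv[OF tops, of "Suc (iet_top T a)"] positions_inv[OF bots, of "CARD('a)"]
    positions_inv[OF bots, of "iet_bot T a - 1"] positions_inv[OF tops, of 1]
  by (auto simp: iet_tau_def)

text \<open>Each end has an explicit predecessor, the neighbour in the other direction. On a finite
  set this makes \<tau> a permutation, so its orbits are cycles.\<close>

lemma tau_surj: "surj (iet_tau T)"
unfolding surj_def
proof
  fix c :: "'a \<times> side"
  obtain b s where c: "c = (b, s)" by (metis surj_pair)
  have "\<exists>d. iet_tau T d = (b, s)"
  proof (cases s)
    case LeftEnd
    show ?thesis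
    proof (cases "iet_top T b = 1")
      case True
      obtain a where a: "iet_bot T a = 1"
        using positions_inv[OF bots, of 1] by (intro that[of "inv (iet_bot T) 1"]) auto
      obtain b' where b': "iet_tau T (a, LeftEnd) = (b', LeftEnd)" "iet_top T b' = 1" using tau_cases(4)[OF a] by auto
      then have "b' = b" using positions_inj[OF tops, of b' b] a True by simp
      then show ?thesis using b'(1) LeftEnd by (intro exI[of _ "(a, LeftEnd)"]) simp
    next
      case False
      obtain a where a: "Suc (iet_top T a) = iet_top T b"
        using positions_inv[OF tops, of "iet_top T b - 1"] positions_range[OF tops, of b] False by (intro that[of "inv (iet_top T) (iet_top T b - 1)"]) auto
      have na: "iet_top T a \<noteq> CARD('a)" using positions_range[OF tops, of b] a by simp
      obtain b' where b': "iet_tau T (a, RightEnd) = (b', LeftEnd)" "iet_top T b' = Suc (iet_top T a)" using tau_cases(1)[OF na] by auto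
      then have "b' = b" using positions_inj[OF tops, of b' b] a False by simp
      then show ?thesis using b'(1) LeftEnd by (intro exI[of _ "(a, RightEnd)"]) simp
    qed
  next
    case RightEnd
    show ?thesis
    proof (cases "iet_bot T b = CARD('a)")
      case True
      obtain a where a: "iet_top T a = CARD('a)"
        using positions_inv[OF tops, of "CARD('a)"] by (intro that[of "inv (iet_top T) CARD('a)"]) auto
      obtain b' where b': "iet_tau T (a, RightEnd) = (b', RightEnd)" "iet_bot T b' = CARD('a)" using tau_cases(2)[OF a] by auto
      then have "b' = b" using positions_inj[OF bots, of b' b] a True by simp
      then show ?thesis using b'(1) RightEnd by (intro exI[of _ "(a, RightEnd)"]) simp
    next
      case False
      obtain a where a: "iet_bot T a = Suc (iet_bot T b)"
        using positions_inv[OF bots, of "Suc (iet_bot T b)"] positions_range[OF bots, of b] False by (intro that[of "inv (iet_bot T) (Suc (iet_bot T b))"]) auto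
      have na: "iet_bot T a \<noteq> 1" using positions_range[OF bots, of b] a by simp
      obtain b' where b': "iet_tau T (a, LeftEnd) = (b', RightEnd)" "Suc (iet_bot T b') = iet_bot T a" using tau_cases(3)[OF na] by auto
      then have "b' = b" using positions_inj[OF bots, of b' b] a False by simp
      then show ?thesis using b'(1) RightEnd by (intro exI[of _ "(a, LeftEnd)"]) simp
    qed
  qed
  then show "\<exists>d. c = iet_tau T d" unfolding c by metis
qed

lemma tau_inj: "inj (iet_tau T)"
  using finite_UNIV_surj_inj[OF finite_ends] tau_surj .

lemma tau_permutation: "permutation (iet_tau T)"
proof -
  have "bij (iet_tau T)" using tau_inj tau_surj by (simp add: bij_def)
  then have "iet_tau T permutes UNIV" by (intro bij_imp_permutes) auto
  then show ?thesis using finite_ends permutation_permutes by blast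
qed

lemma boundary_cob_telescope:
  assumes C: "C \<in> iet_cycles T" and F: "\<And>c. signed_end_value T \<phi> c = F c - F (iet_tau T c)"
  shows "boundary T \<phi> C = 0"
proof -
  obtain c where c: "C = orbit (iet_tau T) c" using C unfolding iet_cycles_def by (rule imageE)
  have cyc: "cyclic_on (iet_tau T) C" unfolding c by (rule cyclic_on_orbit'[OF tau_permutation])
  have "iet_tau T ` C \<subseteq> C" using cyclic_on_inI[OF cyc] by blast
  moreover have fin: "finite C" by (rule finite_subset[OF subset_UNIV finite_ends])
  ultimately have "iet_tau T ` C = C" using tau_inj by (intro endo_inj_surj) (auto intro: inj_on_subset)
  then have "bij_betw (iet_tau T) C C" using tau_inj by (auto simp: bij_betw_def intro: inj_on_subset)
  from sum.reindex_bij_betw[OF this, of F] show ?thesis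
    unfolding boundary_def F sum_subtractf by simp
qed

text \<open>Split the coboundary at an end into the value of \<psi> at an endpoint of a top interval
  and one at an endpoint of a bottom interval. \<tau> passes to the end that shares the point with
  negative sign, so one of the two values is \<open>F\<close> of the end and the other is
  \<open>F\<close> of its successor.\<close>

lemma boundary_cob: "C \<in> iet_cycles T \<Longrightarrow> boundary T (coboundary T \<psi>) C = 0"
proof (rule boundary_cob_telescope)
  define F where "F c = (case c of (a, LeftEnd) \<Rightarrow> \<psi> (tlft T a) | (a, RightEnd) \<Rightarrow> \<psi> (blft T a + iet_len T a))" for c
  define G where "G c = (case c of (a, LeftEnd) \<Rightarrow> \<psi> (blft T a) | (a, RightEnd) \<Rightarrow> \<psi> (tlft T a + iet_len T a))" for c
  have pts: "tlft T b = tlft T a + iet_len T a" if "iet_top T b = Suc (iet_top T a)" for a b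
    using top_pt_pred[OF T, of b] top_pt_pos[OF T, of a] that by simp
  have ptsb: "blft T b = blft T a + iet_len T a" if "Suc (iet_bot T a) = iet_bot T b" for a b
    using offs_next[OF bots that[symmetric], of "iet_len T"] by (simp add: blft_def)
  have p1: "tlft T b = iet_left T" if "iet_top T b = 1" for b
    using top_pt_pred[OF T, of b] top_pt_0[OF T] that by simp
  have b1: "blft T b = iet_left T" if "iet_bot T b = 1" for b
    using that offs_first[OF bots] by (simp add: blft_def)
  have pd: "tlft T b + iet_len T b = iet_right T" if "iet_top T b = CARD('a)" for b
    using top_pt_pos[OF T, of b] top_pt_CARD[OF T] that by simp
  have bd: "blft T b + iet_len T b = iet_right T" if "iet_bot T b = CARD('a)" for b
    using offs_last[OF bots that, of "iet_len T"] by (simp add: blft_def iet_right_def)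
  have G: "G c = F (iet_tau T c)" for c
  proof -
    obtain a s where c: "c = (a, s)" by (metis surj_pair)
    show ?thesis
    proof (cases s)
      case LeftEnd
      show ?thesis
        using tau_cases(3,4)[of a] ptsb[of _ a] p1 b1[of a] unfolding c LeftEnd
        by (cases "iet_bot T a = 1") (auto simp: F_def G_def)
    next
      case RightEnd
      show ?thesis
      proof (cases "iet_top T a = CARD('a)")
        case True
        then obtain b where b: "iet_tau T (a, RightEnd) = (b, RightEnd)" "iet_bot T b = CARD('a)" using tau_cases(2) by blast
        show ?thesis unfolding c RightEnd b(1) F_def G_def using pd[OF True] bd[OF b(2)] by simp
      next
        case False
        then obtain b where b: "iet_tau T (a, RightEnd) = (b, LeftEnd)" "iet_top T b = Suc (iet_top T a)" using tau_cases(1) by blast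
        show ?thesis unfolding c RightEnd b(1) F_def G_def using pts[OF b(2)] by simp
      qed
    qed
  qed
  fix c
  show "signed_end_value T (coboundary T \<psi>) c = F c - F (iet_tau T c)"
    unfolding G[symmetric] using len_pos[OF T]
    by (auto simp: signed_end_value_def F_def G_def coboundary_def top_pt_pred[OF T, unfolded One_nat_def] top_pt_pos[OF T]
        top_int_eq[OF T] iet_shift_eq[OF T] less_imp_le add.commute split: prod.split side.split)
qed

text \<open>The cycles partition all ends, so adding up the boundary values gives the total
  increment of \<phi>. This is how the boundary condition yields a derivative of zero
  integral.\<close>

lemma boundary_total:
  assumes "\<And>C. C \<in> iet_cycles T \<Longrightarrow> boundary T \<phi> C = 0"
  shows "(\<Sum>a\<in>UNIV. \<phi> a (tlft T a + iet_len T a) - \<phi> a (tlft T a)) = 0"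
proof -
  let ?f = "iet_tau T"
  have cyc: "cyclic_on ?f C" if C: "C \<in> iet_cycles T" for C
  proof -
    obtain c where "C = orbit ?f c" using C unfolding iet_cycles_def by (rule imageE)
    then show ?thesis by (simp only: cyclic_on_orbit'[OF tau_permutation])
  qed
  have "c \<in> \<Union>(iet_cycles T)" for c
    unfolding iet_cycles_def by (rule UnionI[of "orbit ?f c"]) (auto intro: permutation_self_in_orbit[OF tau_permutation])
  then have "\<Union>(iet_cycles T) = UNIV" by (intro equalityI subsetI UNIV_I)
  moreover have "\<forall>C\<in>iet_cycles T. finite C" by (intro ballI finite_subset[OF subset_UNIV finite_ends])
  moreover have "\<forall>C\<in>iet_cycles T. \<forall>D\<in>iet_cycles T. C \<noteq> D \<longrightarrow> C \<inter> D = {}"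
  proof (intro ballI impI equals0I)
    fix C D c assume C: "C \<in> iet_cycles T" and D: "D \<in> iet_cycles T" and "C \<noteq> D" and "c \<in> C \<inter> D"
    then show False using orbit_cyclic_eq3[OF cyc[OF C], of c] orbit_cyclic_eq3[OF cyc[OF D], of c] by simp
  qed
  ultimately have "(\<Sum>c\<in>UNIV. signed_end_value T \<phi> c) = (\<Sum>C\<in>iet_cycles T. \<Sum>c\<in>C. signed_end_value T \<phi> c)"
    using sum.Union_disjoint[of "iet_cycles T" "signed_end_value T \<phi>"] by (simp add: comp_def)
  also have "\<dots> = 0" using assms unfolding boundary_def by simp
  finally show ?thesis
    unfolding sum_ends by (simp add: signed_end_value_def top_pt_pred[OF T, unfolded One_nat_def] top_pt_pos[OF T])
qed

end

section \<open>Piecewise smooth functions and piecewise polynomials\<close>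

context
  fixes T :: "'a::finite iet"
  assumes T: "is_iet T"
begin

abbreviation (input) cl :: "'a \<Rightarrow> real set" where "cl a \<equiv> {tlft T a..tlft T a + iet_len T a}"
abbreviation (input) J :: "real set" where "J \<equiv> {iet_left T..iet_right T}"

lemma closure_top: "closure (top_int T a) = cl a"
  using len_pos[OF T, of a] by (simp add: top_int_eq[OF T])

lemma closure_int: "closure (iet_int T) = J"
  using iet_left_less_right[OF T] by (simp add: iet_int_eq[OF T])

lemma cl_less: "tlft T a < tlft T a + iet_len T a"
  using len_pos[OF T, of a] by simp

lemma J_less: "iet_left T < iet_right T"
  by (rule iet_left_less_right[OF T])

lemma cl_J: "x \<in> cl a \<Longrightarrow> x \<in> J" and cl_shift_J: "x \<in> cl a \<Longrightarrow> x + iet_shift T a \<in> J"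
  using tlft_bounds[OF T, of a] blft_bounds[OF T, of a] by (auto simp: iet_shift_eq[OF T])

lemma pw_D_eq: "pw_D T \<phi> a = deriv_on (cl a) (\<phi> a)"
  by (simp add: pw_D_def closure_top)

lemma pw_D_pow: "(pw_D T ^^ i) \<phi> a = (deriv_on (cl a) ^^ i) (\<phi> a)"
  by (induction i) (simp_all add: pw_D_eq)

lemma pw_D_Suc: "(pw_D T ^^ Suc i) \<phi> = (pw_D T ^^ i) (pw_D T \<phi>)"
  by (simp only: funpow_Suc_right comp_apply)

lemma pw_C_iff: "\<phi> \<in> pw_C T r \<longleftrightarrow> (\<forall>a. \<phi> a \<in> C_on r (cl a))"
  by (simp add: pw_C_def closure_top)

lemma pw_C_Suc: "\<phi> \<in> pw_C T (Suc r) \<longleftrightarrow>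
    (\<forall>a. (\<forall>x. x \<notin> cl a \<longrightarrow> \<phi> a x = 0) \<and> \<phi> a differentiable_on cl a) \<and> pw_D T \<phi> \<in> pw_C T r"
  unfolding pw_C_iff C_on_Suc[OF cl_less] pw_D_eq by blast

lemma pw_C_D_works:
  "\<phi> \<in> pw_C T (Suc r) \<Longrightarrow> x \<in> cl a \<Longrightarrow> (\<phi> a has_real_derivative pw_D T \<phi> a x) (at x within cl a)"
  unfolding pw_D_eq by (rule deriv_on_works[OF cl_less]) (simp add: pw_C_Suc)

lemma pw_C_lincomb:
  "\<phi> \<in> pw_C T r \<Longrightarrow> \<xi> \<in> pw_C T r \<Longrightarrow> (\<lambda>a x. c * \<phi> a x + e * \<xi> a x) \<in> pw_C T r"
  unfolding pw_C_iff by (intro allI C_on_lincomb[OF cl_less]) auto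

lemma pw_C_mono: "\<phi> \<in> pw_C T r \<Longrightarrow> k \<le> r \<Longrightarrow> \<phi> \<in> pw_C T k"
  unfolding pw_C_iff using C_on_mono[OF cl_less] by blast

lemma pw_D_lincomb:
  assumes "\<phi> \<in> pw_C T r" "\<xi> \<in> pw_C T r" "i \<le> r"
  shows "(pw_D T ^^ i) (\<lambda>a x. c * \<phi> a x + e * \<xi> a x) = (\<lambda>a x. c * (pw_D T ^^ i) \<phi> a x + e * (pw_D T ^^ i) \<xi> a x)"
proof
  fix a
  show "(pw_D T ^^ i) (\<lambda>a x. c * \<phi> a x + e * \<xi> a x) a = (\<lambda>x. c * (pw_D T ^^ i) \<phi> a x + e * (pw_D T ^^ i) \<xi> a x)"
    unfolding pw_D_pow using assms unfolding pw_C_iff by (intro C_on_deriv_lincomb[OF cl_less]) auto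
qed

lemma boundary_zero_lincomb:
  assumes "\<phi> \<in> pw_C T r" "\<xi> \<in> pw_C T r" "boundary_zero_upto T r \<phi>" "boundary_zero_upto T r \<xi>"
  shows "boundary_zero_upto T r (\<lambda>a x. c * \<phi> a x + e * \<xi> a x)"
  using assms unfolding boundary_zero_upto_def
  by (auto simp: pw_D_lincomb[OF assms(1,2)] boundary_lincomb)

lemma pw_CBV_bd_lincomb:
  assumes "\<phi> \<in> pw_CBV_bd T r" "\<xi> \<in> pw_CBV_bd T r"
  shows "(\<lambda>a x. c * \<phi> a x + e * \<xi> a x) \<in> pw_CBV_bd T r"
proof -
  have C: "\<phi> \<in> pw_C T r" "\<xi> \<in> pw_C T r" using assms unfolding pw_CBV_bd_def pw_CBV_def by auto
  have "bounded_variation_on ((pw_D T ^^ r) (\<lambda>a x. c * \<phi> a x + e * \<xi> a x) a) (top_int T a)" for a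
    unfolding pw_D_lincomb[OF C order_refl]
    using assms unfolding pw_CBV_bd_def pw_CBV_def by (intro variation_sums_lincomb) auto
  then show ?thesis
    using assms pw_C_lincomb[OF C] boundary_zero_lincomb[OF C] unfolding pw_CBV_bd_def pw_CBV_def by simp
qed

lemma pw_CBV_D: "\<phi> \<in> pw_CBV T (Suc r) \<Longrightarrow> pw_D T \<phi> \<in> pw_CBV T r"
  unfolding pw_CBV_def pw_D_Suc by (auto simp: pw_C_Suc)

lemma boundary_zero_Suc:
  "boundary_zero_upto T (Suc r) \<phi> \<longleftrightarrow> (\<forall>C\<in>iet_cycles T. boundary T \<phi> C = 0) \<and> boundary_zero_upto T r (pw_D T \<phi>)"
  unfolding boundary_zero_upto_def pw_D_Suc[symmetric]
  by (auto simp: less_Suc_eq_0_disj simp del: funpow.simps(2))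

lemma pw_CBV_bd_D: "\<phi> \<in> pw_CBV_bd T (Suc r) \<Longrightarrow> pw_D T \<phi> \<in> pw_CBV_bd T r"
  unfolding pw_CBV_bd_def using pw_CBV_D by (simp add: boundary_zero_Suc)

definition pw_sup :: "nat \<Rightarrow> ('a \<Rightarrow> real \<Rightarrow> real) \<Rightarrow> real" where
  "pw_sup i \<phi> = (SUP (a, x)\<in>(SIGMA a:UNIV. closure (top_int T a)). \<bar>(pw_D T ^^ i) \<phi> a x\<bar>)"

lemma pw_sup_upper:
  assumes "\<phi> \<in> pw_C T r" "i \<le> r" "x \<in> cl a"
  shows "\<bar>(pw_D T ^^ i) \<phi> a x\<bar> \<le> pw_sup i \<phi>"
proof -
  have "bdd_above ((\<lambda>x. \<bar>(pw_D T ^^ i) \<phi> a x\<bar>) ` cl a)" for a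
    unfolding pw_D_pow using assms by (intro C_on_bdd[OF cl_less]) (auto simp: pw_C_iff)
  then have "bdd_above (\<Union>a. (\<lambda>x. \<bar>(pw_D T ^^ i) \<phi> a x\<bar>) ` cl a)" by simp
  moreover have "(\<lambda>(a, x). \<bar>(pw_D T ^^ i) \<phi> a x\<bar>) ` (SIGMA a:UNIV. closure (top_int T a)) = (\<Union>a. (\<lambda>x. \<bar>(pw_D T ^^ i) \<phi> a x\<bar>) ` cl a)"
    unfolding closure_top by (auto simp: image_iff Bex_def split: prod.split)
  ultimately have bdd: "bdd_above ((\<lambda>(a, x). \<bar>(pw_D T ^^ i) \<phi> a x\<bar>) ` (SIGMA a:UNIV. closure (top_int T a)))" by simp
  have "(a, x) \<in> (SIGMA a:UNIV. closure (top_int T a))" using assms(3) by (simp add: closure_top)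
  from cSUP_upper[OF this bdd] show ?thesis unfolding pw_sup_def by simp
qed

lemma pw_sup_least:
  assumes "\<And>a x. x \<in> cl a \<Longrightarrow> \<bar>(pw_D T ^^ i) \<phi> a x\<bar> \<le> M"
  shows "pw_sup i \<phi> \<le> M"
  unfolding pw_sup_def
proof (rule cSUP_least)
  have "(undefined, tlft T undefined) \<in> (SIGMA a:UNIV. closure (top_int T a))"
    using cl_less[of undefined] by (simp add: closure_top)
  then show "(SIGMA a:UNIV. closure (top_int T a)) \<noteq> {}" by blast
qed (use assms in \<open>auto simp: closure_top\<close>)

lemma pw_sup_nonneg: "\<phi> \<in> pw_C T r \<Longrightarrow> i \<le> r \<Longrightarrow> 0 \<le> pw_sup i \<phi>"
  using cl_less[of undefined] by (intro order_trans[OF abs_ge_zero pw_sup_upper[of \<phi> r i "tlft T undefined" undefined]]) auto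

lemma pw_norm_eq:
  "pw_CBV_norm T r \<phi> = (\<Sum>i\<le>r. pw_sup i \<phi>) + (\<Sum>a\<in>UNIV. total_variation ((pw_D T ^^ r) \<phi> a) (top_int T a))"
  unfolding pw_CBV_norm_def pw_sup_def ..

lemma top_int_nonempty: "top_int T a \<noteq> {}"
  using cl_less[of a] by (simp add: top_int_eq[OF T])

context
  fixes \<phi> r
  assumes \<phi>: "\<phi> \<in> pw_CBV T r"
begin

lemma pw_CBV_C: "\<phi> \<in> pw_C T r"
  using \<phi> unfolding pw_CBV_def by simp

lemma pw_CBV_variation: "bounded_variation_on ((pw_D T ^^ r) \<phi> a) (top_int T a)"
  using \<phi> unfolding pw_CBV_def by simp

lemma pw_variation_nonneg: "0 \<le> (\<Sum>a\<in>UNIV. total_variation ((pw_D T ^^ r) \<phi> a) (top_int T a))"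
  by (intro sum_nonneg total_variation_nonneg pw_CBV_variation top_int_nonempty)

lemma pw_sups_nonneg: "0 \<le> (\<Sum>i\<le>r. pw_sup i \<phi>)"
  by (intro sum_nonneg pw_sup_nonneg[OF pw_CBV_C]) simp

lemma pw_norm_nonneg: "0 \<le> pw_CBV_norm T r \<phi>"
  unfolding pw_norm_eq using pw_variation_nonneg pw_sups_nonneg by simp

lemma pw_norm_variation: "(\<Sum>a\<in>UNIV. total_variation ((pw_D T ^^ r) \<phi> a) (top_int T a)) \<le> pw_CBV_norm T r \<phi>"
  unfolding pw_norm_eq using pw_sups_nonneg by simp

lemma pw_norm_bound:
  assumes "i \<le> r" "x \<in> cl a"
  shows "\<bar>(pw_D T ^^ i) \<phi> a x\<bar> \<le> pw_CBV_norm T r \<phi>"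
proof -
  have "pw_sup i \<phi> \<le> (\<Sum>i\<le>r. pw_sup i \<phi>)"
    using assms(1) pw_sup_nonneg[OF pw_CBV_C] by (intro member_le_sum) auto
  then show ?thesis using pw_sup_upper[OF pw_CBV_C assms] pw_variation_nonneg unfolding pw_norm_eq by linarith
qed

end

lemma pw_norm_D:
  assumes "\<phi> \<in> pw_CBV T (Suc r)"
  shows "pw_CBV_norm T r (pw_D T \<phi>) \<le> pw_CBV_norm T (Suc r) \<phi>"
proof -
  have "pw_sup (Suc i) \<phi> = pw_sup i (pw_D T \<phi>)" for i unfolding pw_sup_def pw_D_Suc ..
  then have "pw_CBV_norm T (Suc r) \<phi> = pw_sup 0 \<phi> + pw_CBV_norm T r (pw_D T \<phi>)"
    unfolding pw_norm_eq sum.atMost_Suc_shift pw_D_Suc by simp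
  then show ?thesis using pw_sup_nonneg[OF pw_CBV_C[OF assms], of 0] by simp
qed

lemma cob_deriv:
  assumes f: "f differentiable_on J" and x: "x \<in> cl a"
  shows "(coboundary T f a has_real_derivative coboundary T (deriv_on J f) a x) (at x within cl a)"
proof -
  have im: "(\<lambda>x. x + iet_shift T a) ` cl a \<subseteq> J" using cl_shift_J by blast
  have "(f has_real_derivative deriv_on J f (x + iet_shift T a)) (at (x + iet_shift T a) within (\<lambda>x. x + iet_shift T a) ` cl a)"
    by (rule DERIV_subset[OF deriv_on_works[OF J_less f cl_shift_J[OF x]] im])
  moreover have "((\<lambda>x. x + iet_shift T a) has_real_derivative 1) (at x within cl a)" by (auto intro!: derivative_eq_intros)
  ultimately have "((\<lambda>x. f (x + iet_shift T a)) has_real_derivative deriv_on J f (x + iet_shift T a)) (at x within cl a)"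
    using DERIV_image_chain by (fastforce simp: comp_def)
  moreover have "(f has_real_derivative deriv_on J f x) (at x within cl a)"
    by (rule DERIV_subset[OF deriv_on_works[OF J_less f cl_J[OF x]]]) (use cl_J in blast)
  ultimately have "((\<lambda>x. f (x + iet_shift T a) - f x) has_real_derivative deriv_on J f (x + iet_shift T a) - deriv_on J f x) (at x within cl a)"
    by (rule DERIV_diff)
  then show ?thesis
    by (rule has_field_derivative_transform_within[OF _ zero_less_one x, THEN DERIV_cong])
      (use x in \<open>simp_all add: coboundary_def closure_top\<close>)
qed

lemma cob_D:
  assumes "f differentiable_on J"
  shows "pw_D T (coboundary T f) = coboundary T (deriv_on J f)"
proof (intro ext)
  fix a x
  show "pw_D T (coboundary T f) a x = coboundary T (deriv_on J f) a x"
  proof (cases "x \<in> cl a")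
    case True
    show ?thesis unfolding pw_D_eq by (rule deriv_on_eq[OF cl_less True cob_deriv[OF assms True]])
  next
    case False
    then show ?thesis unfolding pw_D_eq coboundary_def closure_top deriv_on_def by (simp only: if_False)
  qed
qed

lemma cob_off: "x \<notin> cl a \<Longrightarrow> coboundary T f a x = 0"
  unfolding coboundary_def closure_top by (simp only: if_False)

lemma cob_C: "f \<in> C_on k J \<Longrightarrow> coboundary T f \<in> pw_C T k"
proof (induction k arbitrary: f)
  case 0
  have "continuous_on (cl a) (coboundary T f a)" for a
  proof -
    have cf: "continuous_on J f" using 0 by (simp add: C_on_def)
    have "continuous_on (cl a) (\<lambda>x. f (x + iet_shift T a))"
      by (rule continuous_on_compose2[OF cf]) (intro continuous_intros, rule image_subsetI, rule cl_shift_J)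
    moreover have "continuous_on (cl a) f" by (rule continuous_on_subset[OF cf], rule subsetI, rule cl_J)
    ultimately have "continuous_on (cl a) (\<lambda>x. f (x + iet_shift T a) - f x)" by (rule continuous_on_diff)
    then show ?thesis by (rule continuous_on_eq) (simp add: coboundary_def closure_top)
  qed
  then show ?case unfolding pw_C_iff C_on_def by (auto simp: coboundary_def closure_top)
next
  case (Suc k)
  then have f: "f differentiable_on J" "deriv_on J f \<in> C_on k J" using C_on_Suc[OF J_less] by auto
  have "coboundary T f a differentiable_on cl a" for a
    unfolding differentiable_on_def real_differentiable_def using cob_deriv[OF f(1), of _ a] by blast
  then show ?case unfolding pw_C_Suc cob_D[OF f(1)] using Suc.IH[OF f(2)] cob_off by blast
qed

lemma cob_D_pow: "f \<in> C_on k J \<Longrightarrow> i \<le> k \<Longrightarrow> (pw_D T ^^ i) (coboundary T f) = coboundary T ((deriv_on J ^^ i) f)"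
proof (induction i)
  case (Suc i)
  then have "(deriv_on J ^^ i) f differentiable_on J" unfolding C_on_def by auto
  with Suc show ?case by (simp add: cob_D)
qed simp

lemma cob_lincomb:
  "coboundary T (\<lambda>x. c * f x + e * g x) = (\<lambda>a x. c * coboundary T f a x + e * coboundary T g a x)"
  by (intro ext) (simp add: coboundary_def algebra_simps)

lemma Gamma_poly_lincomb:
  assumes "\<omega> \<in> Gamma_poly T r" "\<xi> \<in> Gamma_poly T r"
  shows "(\<lambda>a x. c * \<omega> a x + e * \<xi> a x) \<in> Gamma_poly T r"
  unfolding Gamma_poly_def
proof (intro CollectI allI conjI impI)
  fix a
  obtain p q where p: "p = 0 \<or> degree p < r" "\<forall>x\<in>closure (top_int T a). \<omega> a x = poly p x"
    and q: "q = 0 \<or> degree q < r" "\<forall>x\<in>closure (top_int T a). \<xi> a x = poly q x"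
    using assms unfolding Gamma_poly_def by blast
  have "smult c p + smult e q = 0 \<or> degree (smult c p + smult e q) < r"
  proof (cases "r = 0")
    case False
    then have "degree p < r" "degree q < r" using p(1) q(1) by auto
    then show ?thesis by (intro disjI2 degree_add_less) (auto intro: le_less_trans[OF degree_smult_le])
  qed (use p(1) q(1) in simp)
  then show "\<exists>p. (p = 0 \<or> degree p < r) \<and> (\<forall>x\<in>closure (top_int T a). c * \<omega> a x + e * \<xi> a x = poly p x)"
    using p(2) q(2) by (intro exI[of _ "smult c p + smult e q"]) simp
next
  fix a x assume "x \<notin> closure (top_int T a)"
  then show "c * \<omega> a x + e * \<xi> a x = 0" using assms unfolding Gamma_poly_def by simp
qed

lemma Gamma_poly_D:
  assumes "\<omega> \<in> Gamma_poly T r"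
  shows "\<omega> a differentiable_on cl a" "pw_D T \<omega> \<in> Gamma_poly T (r - 1)"
proof -
  have *: "\<exists>p. (p = 0 \<or> degree p < r) \<and> (\<forall>x\<in>cl a. (\<omega> a has_real_derivative poly (pderiv p) x) (at x within cl a))" for a
  proof -
    obtain p where p: "p = 0 \<or> degree p < r" "\<forall>x\<in>cl a. \<omega> a x = poly p x"
      using assms unfolding Gamma_poly_def closure_top by blast
    have "(\<omega> a has_real_derivative poly (pderiv p) x) (at x within cl a)" if "x \<in> cl a" for x
      by (rule has_field_derivative_transform_within[OF DERIV_subset[OF poly_DERIV subset_UNIV] zero_less_one that])
        (use p(2) in simp)
    then show ?thesis using p(1) by blast
  qed
  show "\<omega> a differentiable_on cl a"
    unfolding differentiable_on_def real_differentiable_def using *[of a] by blast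
  show "pw_D T \<omega> \<in> Gamma_poly T (r - 1)"
    unfolding Gamma_poly_def closure_top pw_D_eq
  proof (intro CollectI allI conjI impI)
    fix a
    obtain p where p: "p = 0 \<or> degree p < r" "\<forall>x\<in>cl a. (\<omega> a has_real_derivative poly (pderiv p) x) (at x within cl a)"
      using * by blast
    have "pderiv p = 0 \<or> degree (pderiv p) < r - 1"
      using p(1) by (cases "degree p = 0") (auto simp: pderiv_eq_0_iff degree_pderiv)
    then show "\<exists>p. (p = 0 \<or> degree p < r - 1) \<and> (\<forall>x\<in>cl a. deriv_on (cl a) (\<omega> a) x = poly p x)"
      using p(2) deriv_on_eq[OF cl_less] by blast
  next
    fix a x assume "x \<notin> cl a"
    then show "deriv_on (cl a) (\<omega> a) x = 0" by (simp only: deriv_on_def if_False)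
  qed
qed

lemma Gamma_poly_C: "\<omega> \<in> Gamma_poly T r \<Longrightarrow> \<omega> \<in> pw_C T k"
proof (induction k arbitrary: \<omega> r)
  case 0
  then have "continuous_on (cl a) (\<omega> a)" for a by (intro differentiable_imp_continuous_on Gamma_poly_D(1))
  then show ?case using 0 unfolding pw_C_iff C_on_def Gamma_poly_def closure_top by simp
next
  case (Suc k)
  have "\<forall>x. x \<notin> cl a \<longrightarrow> \<omega> a x = 0" for a using Suc.prems unfolding Gamma_poly_def closure_top by blast
  then show ?case unfolding pw_C_Suc using Gamma_poly_D[OF Suc.prems] Suc.IH by blast
qed

text \<open>This kills both the variation term and the top derivative in the norm of a piecewise
  polynomial.\<close>

lemma Gamma_poly_D_top:
  assumes "\<omega> \<in> Gamma_poly T r"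
  shows "(pw_D T ^^ r) \<omega> a = (\<lambda>x. 0)"
proof -
  have *: "(pw_D T ^^ i) \<omega> \<in> Gamma_poly T (r - i)" for i
  proof (induction i)
    case (Suc i)
    from Gamma_poly_D(2)[OF this] show ?case by simp
  qed (simp add: assms)
  have "(pw_D T ^^ r) \<omega> a x = 0" for x
  proof (cases "x \<in> closure (top_int T a)")
    case True
    obtain p where p: "p = 0 \<or> degree p < r - r" "\<forall>x\<in>closure (top_int T a). (pw_D T ^^ r) \<omega> a x = poly p x"
      using *[of r] unfolding Gamma_poly_def by blast
    then show ?thesis using True by simp
  qed (use *[of r] in \<open>unfold Gamma_poly_def, blast\<close>)
  then show ?thesis by blast
qed

lemma Gamma_poly_CBV: "\<omega> \<in> Gamma_poly T r \<Longrightarrow> \<omega> \<in> pw_CBV T r"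
  unfolding pw_CBV_def
  by (auto simp: Gamma_poly_C Gamma_poly_D_top bounded_variation_on_def variation_sums_def bdd_above_def)

text \<open>The constant of integration may differ from letter to letter, which is harmless for
  piecewise polynomials.\<close>

lemma Gamma_poly_antiderivative:
  assumes D: "pw_D T \<omega> \<in> Gamma_poly T r" and w: "\<And>a x. x \<notin> cl a \<Longrightarrow> \<omega> a x = 0" "\<And>a. \<omega> a differentiable_on cl a"
  shows "\<omega> \<in> Gamma_poly T (Suc r)"
  unfolding Gamma_poly_def closure_top
proof (intro CollectI allI conjI impI)
  fix a
  obtain p where p: "p = 0 \<or> degree p < r" "\<forall>x\<in>cl a. pw_D T \<omega> a x = poly p x"
    using D unfolding Gamma_poly_def closure_top by blast
  have "\<exists>v. pderiv v = p \<and> degree v \<le> r"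
  proof (cases "p = 0")
    case True
    then show ?thesis by (intro exI[of _ 0]) simp
  next
    case False
    then have "Suc (degree p) \<le> r" using p(1) by simp
    then show ?thesis using poly_antiderivative[of p] order_trans by blast
  qed
  then obtain v where v: "pderiv v = p" "degree v \<le> r" by blast
  have "\<exists>c. \<forall>x\<in>cl a. \<omega> a x - poly v x = c"
  proof (rule has_field_derivative_zero_constant)
    fix x assume x: "x \<in> cl a"
    have "((\<lambda>x. \<omega> a x - poly v x) has_real_derivative (pw_D T \<omega> a x - poly (pderiv v) x)) (at x within cl a)"
      unfolding pw_D_eq by (intro DERIV_diff deriv_on_works[OF cl_less w(2) x] DERIV_subset[OF poly_DERIV subset_UNIV])
    then show "((\<lambda>x. \<omega> a x - poly v x) has_real_derivative 0) (at x within cl a)" using p(2) x v(1) by simp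
  qed simp
  then obtain c where "\<forall>x\<in>cl a. \<omega> a x - poly v x = c" by blast
  then have "\<forall>x\<in>cl a. \<omega> a x = poly (v + [:c:]) x" by (simp add: algebra_simps)
  moreover have "degree (v + [:c:]) < Suc r" using v(2) by (intro degree_add_less) auto
  ultimately show "\<exists>p. (p = 0 \<or> degree p < Suc r) \<and> (\<forall>x\<in>cl a. \<omega> a x = poly p x)" by blast
qed (rule w(1))

lemma Gamma_bd_poly: "\<omega> \<in> Gamma_bd T r \<Longrightarrow> \<omega> \<in> Gamma_poly T r"
  by (simp add: Gamma_bd_def)

lemma Gamma_bd_CBV: "\<omega> \<in> Gamma_bd T r \<Longrightarrow> \<omega> \<in> pw_CBV_bd T r"
  unfolding Gamma_bd_def pw_CBV_bd_def using Gamma_poly_CBV by simp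

section \<open>Solving the cohomological equation by induction on the regularity\<close>

text \<open>The form \<open>1 * _ + (-1) * _\<close> of the difference lets the lemmas on linear
  combinations apply as they stand. Linearity is stated on the function space only.\<close>

definition solves :: "nat \<Rightarrow> (('a \<Rightarrow> real \<Rightarrow> real) \<Rightarrow> real \<Rightarrow> real) \<Rightarrow> real \<Rightarrow> bool" where
  "solves r L K \<longleftrightarrow>
    (\<forall>\<phi>\<in>pw_CBV_bd T r. L \<phi> \<in> C_on (r - 1) J \<and> C_norm (r - 1) J (L \<phi>) \<le> K * pw_CBV_norm T r \<phi> \<and>
      (\<lambda>a x. 1 * \<phi> a x + (-1) * coboundary T (L \<phi>) a x) \<in> Gamma_bd T r) \<and>
    (\<forall>\<phi>\<in>pw_CBV_bd T r. \<forall>\<xi>\<in>pw_CBV_bd T r. \<forall>c e.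
      L (\<lambda>a x. c * \<phi> a x + e * \<xi> a x) = (\<lambda>x. c * L \<phi> x + e * L \<xi> x))"

lemma solves_Suc:
  assumes "solves (Suc k) L K"
  shows "\<exists>L' K'. solves (Suc (Suc k)) L' K'"
proof -
  \<comment> \<open>The value 0 outside the interval is required by the encoding of functions on a
    set.\<close>
  define L' where "L' \<phi> x = (if x \<in> J then integral {iet_left T..x} (L (pw_D T \<phi>)) else 0)" for \<phi> x
  \<comment> \<open>The length of the interval bounds the integral of the previous solution, and the
    summand 1 accounts for the norm of its derivatives; \<open>max K 0\<close> keeps the constant
    monotone in the norm.\<close>
  define K' where "K' = (iet_right T - iet_left T + 1) * max K 0"
  note S = assms[unfolded solves_def]
  let ?V = "pw_CBV_bd T (Suc (Suc k))"
  have main: "L' \<phi> \<in> C_on (Suc k) J \<and> C_norm (Suc k) J (L' \<phi>) \<le> K' * pw_CBV_norm T (Suc (Suc k)) \<phi> \<and>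
      (\<lambda>a x. 1 * \<phi> a x + (-1) * coboundary T (L' \<phi>) a x) \<in> Gamma_bd T (Suc (Suc k))" if V: "\<phi> \<in> ?V" for \<phi>
  proof -
    define u where "u = L (pw_D T \<phi>)"
    have u: "u \<in> C_on k J" "C_norm k J u \<le> K * pw_CBV_norm T (Suc k) (pw_D T \<phi>)"
      "(\<lambda>a x. 1 * pw_D T \<phi> a x + (-1) * coboundary T u a x) \<in> Gamma_bd T (Suc k)"
      using S pw_CBV_bd_D[OF V] unfolding u_def by auto
    have u_cont: "continuous_on J u" using C_on_continuous[OF J_less u(1), of 0] by simp
    have dL: "(L' \<phi> has_real_derivative u x) (at x within J)" if "x \<in> J" for x
      by (rule has_field_derivative_transform_within[OF integral_has_real_derivative[OF u_cont that] zero_less_one that])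
        (simp add: L'_def u_def)
    have L_diff: "L' \<phi> differentiable_on J"
      unfolding differentiable_on_def real_differentiable_def using dL by blast
    have L_D: "deriv_on J (L' \<phi>) = u"
    proof
      fix x show "deriv_on J (L' \<phi>) x = u x"
      proof (cases "x \<in> J")
        case False
        then have "u x = 0" using u(1) unfolding C_on_def by blast
        then show ?thesis unfolding deriv_on_def using False by (simp only: if_False)
      qed (rule deriv_on_eq[OF J_less _ dL])
    qed
    have L_C: "L' \<phi> \<in> C_on (Suc k) J" unfolding C_on_Suc[OF J_less] L_D using L_diff u(1) by (simp add: L'_def)
    have V': "\<phi> \<in> pw_CBV T (Suc (Suc k))" using V unfolding pw_CBV_bd_def by simp
    have "C_norm (Suc k) J (L' \<phi>) \<le> K' * pw_CBV_norm T (Suc (Suc k)) \<phi>"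
    proof -
      have "\<bar>L' \<phi> x\<bar> \<le> (iet_right T - iet_left T) * C_norm k J u" if x: "x \<in> J" for x
      proof -
        have "norm (integral {iet_left T..x} u) \<le> C_norm k J u * (x - iet_left T)"
        proof (rule integral_bound)
          show "iet_left T \<le> x" using x by simp
          show "continuous_on {iet_left T..x} u" by (rule continuous_on_subset[OF u_cont]) (use x in auto)
          show "norm (u t) \<le> C_norm k J u" if "t \<in> {iet_left T..x}" for t
            using C_norm_bound[OF J_less u(1), of 0 t] that x by simp
        qed
        also have "\<dots> \<le> C_norm k J u * (iet_right T - iet_left T)"
          by (rule mult_left_mono) (use x C_norm_nonneg[OF J_less u(1)] in auto)
        finally show ?thesis using x unfolding L'_def u_def by (simp add: mult.commute)
      qed
      then have "(SUP x\<in>J. \<bar>L' \<phi> x\<bar>) \<le> (iet_right T - iet_left T) * C_norm k J u"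
        using J_less by (intro cSUP_least) auto
      then have "C_norm (Suc k) J (L' \<phi>) \<le> (iet_right T - iet_left T + 1) * C_norm k J u"
        unfolding C_norm_Suc[OF J_less] L_D by (simp add: distrib_right)
      also have "\<dots> \<le> (iet_right T - iet_left T + 1) * (max K 0 * pw_CBV_norm T (Suc (Suc k)) \<phi>)"
      proof (rule mult_left_mono)
        have "C_norm k J u \<le> max K 0 * pw_CBV_norm T (Suc k) (pw_D T \<phi>)"
          by (rule order_trans[OF u(2)]) (rule mult_right_mono, simp, rule pw_norm_nonneg[OF pw_CBV_D[OF V']])
        also have "\<dots> \<le> max K 0 * pw_CBV_norm T (Suc (Suc k)) \<phi>" by (rule mult_left_mono[OF pw_norm_D[OF V']]) simp
        finally show "C_norm k J u \<le> max K 0 * pw_CBV_norm T (Suc (Suc k)) \<phi>" .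
      qed (use J_less in simp)
      finally show ?thesis unfolding K'_def by (simp only: mult.assoc)
    qed
    moreover have "(\<lambda>a x. 1 * \<phi> a x + (-1) * coboundary T (L' \<phi>) a x) \<in> Gamma_bd T (Suc (Suc k))" (is "?w \<in> _")
    proof -
      have C1: "\<phi> \<in> pw_C T (Suc 0)" "coboundary T (L' \<phi>) \<in> pw_C T (Suc 0)"
        by (rule pw_C_mono[OF pw_CBV_C[OF V']] pw_C_mono[OF cob_C[OF L_C]]; simp)+
      have wC: "?w \<in> pw_C T (Suc 0)" by (rule pw_C_lincomb[OF C1])
      have wD: "pw_D T ?w = (\<lambda>a x. 1 * pw_D T \<phi> a x + (-1) * coboundary T u a x)"
        using pw_D_lincomb[OF C1, of 1 1 "-1"] unfolding cob_D[OF L_diff, symmetric] L_D[symmetric] by simp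
      have "?w \<in> Gamma_poly T (Suc (Suc k))"
      proof (rule Gamma_poly_antiderivative)
        show "pw_D T ?w \<in> Gamma_poly T (Suc k)" unfolding wD using u(3) unfolding Gamma_bd_def by blast
      qed (use wC in \<open>auto simp: pw_C_Suc\<close>)
      moreover have "boundary_zero_upto T (Suc (Suc k)) ?w"
        unfolding boundary_zero_Suc[of "Suc k"] wD
      proof (intro conjI ballI)
        show "boundary_zero_upto T (Suc k) (\<lambda>a x. 1 * pw_D T \<phi> a x + (-1) * coboundary T u a x)"
          using u(3) unfolding Gamma_bd_def by blast
        fix C assume C: "C \<in> iet_cycles T"
        have "boundary T \<phi> C = 0" using V C unfolding pw_CBV_bd_def boundary_zero_Suc by blast
        then show "boundary T ?w C = 0" unfolding boundary_lincomb[of T 1 _ "-1"] using boundary_cob[OF T C] by simp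
      qed
      ultimately show ?thesis unfolding Gamma_bd_def by blast
    qed
    ultimately show ?thesis using L_C by blast
  qed
  have lin: "L' (\<lambda>a x. c * \<phi> a x + e * \<xi> a x) = (\<lambda>x. c * L' \<phi> x + e * L' \<xi> x)" if V: "\<phi> \<in> ?V" "\<xi> \<in> ?V" for \<phi> \<xi> c e
  proof
    fix x
    have "\<phi> \<in> pw_C T (Suc (Suc k))" "\<xi> \<in> pw_C T (Suc (Suc k))" using V unfolding pw_CBV_bd_def pw_CBV_def by auto
    from pw_D_lincomb[OF this, of 1 c e]
    have "pw_D T (\<lambda>a x. c * \<phi> a x + e * \<xi> a x) = (\<lambda>a x. c * pw_D T \<phi> a x + e * pw_D T \<xi> a x)" by simp
    moreover have "L (\<lambda>a x. c * pw_D T \<phi> a x + e * pw_D T \<xi> a x) = (\<lambda>x. c * L (pw_D T \<phi>) x + e * L (pw_D T \<xi>) x)"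
      using S pw_CBV_bd_D[OF V(1)] pw_CBV_bd_D[OF V(2)] by blast
    ultimately have LD: "L (pw_D T (\<lambda>a x. c * \<phi> a x + e * \<xi> a x)) = (\<lambda>x. c * L (pw_D T \<phi>) x + e * L (pw_D T \<xi>) x)" by simp
    have int: "L (pw_D T \<phi>) integrable_on {iet_left T..x}" if "\<phi> \<in> ?V" "x \<in> J" for \<phi> x
    proof (rule integrable_continuous_interval)
      have "L (pw_D T \<phi>) \<in> C_on k J" using S pw_CBV_bd_D[OF that(1)] by auto
      from C_on_continuous[OF J_less this, of 0] show "continuous_on {iet_left T..x} (L (pw_D T \<phi>))"
        using that(2) by (auto intro: continuous_on_subset)
    qed
    show "L' (\<lambda>a x. c * \<phi> a x + e * \<xi> a x) x = c * L' \<phi> x + e * L' \<xi> x"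
    proof (cases "x \<in> J")
      case True
      have "integral {iet_left T..x} (\<lambda>x. c * L (pw_D T \<phi>) x + e * L (pw_D T \<xi>) x)
        = integral {iet_left T..x} (\<lambda>x. c * L (pw_D T \<phi>) x) + integral {iet_left T..x} (\<lambda>x. e * L (pw_D T \<xi>) x)"
        by (intro Henstock_Kurzweil_Integration.integral_add integrable_on_mult_right int V True)
      then show ?thesis using True unfolding L'_def LD by simp
    next
      case False
      then show ?thesis unfolding L'_def by (simp only: if_False mult_zero_right add_0)
    qed
  qed
  have "solves (Suc (Suc k)) L' K'" unfolding solves_def using main lin by simp
  then show ?thesis by blast
qed

lemma Gamma_cob_subspace:
  assumes "f \<in> Gamma_cob T (Suc k)" "g \<in> Gamma_cob T (Suc k)"
  shows "(\<lambda>a x. c * f a x + e * g a x) \<in> Gamma_cob T (Suc k)"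
proof -
  obtain \<psi> \<rho> where fg: "f = coboundary T \<psi>" "g = coboundary T \<rho>" "\<psi> \<in> C_on k J" "\<rho> \<in> C_on k J"
    "f \<in> Gamma_poly T (Suc k)" "g \<in> Gamma_poly T (Suc k)"
    using assms unfolding Gamma_cob_def closure_int by auto
  have "(\<lambda>a x. c * f a x + e * g a x) = coboundary T (\<lambda>x. c * \<psi> x + e * \<rho> x)"
    unfolding fg(1,2) cob_lincomb ..
  moreover have "(\<lambda>x. c * \<psi> x + e * \<rho> x) \<in> C_on (Suc k - 1) J"
    using C_on_lincomb[OF J_less fg(3,4)] by simp
  ultimately show ?thesis
    unfolding Gamma_cob_def closure_int using Gamma_poly_lincomb[OF fg(5,6)] by blast
qed

text \<open>\<open>L0\<close> is the solution operator and \<open>L1\<close> maps a function to the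
  class of its remainder; linearity and boundedness of \<open>L1\<close> are those of the
  remainder.\<close>

lemma operators_exist:
  assumes "solves (Suc k) L K"
  shows "\<exists>(L1 :: ('a \<Rightarrow> real \<Rightarrow> real) \<Rightarrow> ('a \<Rightarrow> real \<Rightarrow> real) set)
           (L0 :: ('a \<Rightarrow> real \<Rightarrow> real) \<Rightarrow> real \<Rightarrow> real).
     bounded_linear_op (pw_CBV_bd T (Suc k)) pw_scale (pw_CBV_norm T (Suc k))
       (quot_space (Gamma_bd T (Suc k)) (Gamma_cob T (Suc k)))
       (quot_scale pw_scale (Gamma_cob T (Suc k)))
       (quot_norm (pw_CBV_norm T (Suc k))) L1 \<and>
     bounded_linear_op (pw_CBV_bd T (Suc k)) pw_scale (pw_CBV_norm T (Suc k))
       (C_on (Suc k - 1) (closure (iet_int T))) fun_scale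
       (C_norm (Suc k - 1) (closure (iet_int T))) L0 \<and>
     (\<forall>\<omega>\<in>Gamma_bd T (Suc k). L1 \<omega> = \<omega> +o Gamma_cob T (Suc k)) \<and>
     (\<forall>\<phi>\<in>pw_CBV_bd T (Suc k).
        \<phi> - coboundary T (L0 \<phi>) \<in> Gamma_bd T (Suc k) \<and>
        L1 \<phi> = (\<phi> - coboundary T (L0 \<phi>)) +o Gamma_cob T (Suc k))"
proof -
  let ?V = "pw_CBV_bd T (Suc k)" and ?G = "Gamma_cob T (Suc k)" and ?N = "pw_CBV_norm T (Suc k)"
  note S = assms[unfolded solves_def]
  have lc: "\<phi> + \<xi> = (\<lambda>a x. 1 * \<phi> a x + 1 * \<xi> a x)" "\<phi> - \<xi> = (\<lambda>a x. 1 * \<phi> a x + (-1) * \<xi> a x)"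
    "pw_scale c \<phi> = (\<lambda>a x. c * \<phi> a x + 0 * \<phi> a x)" for \<phi> \<xi> :: "'a \<Rightarrow> real \<Rightarrow> real" and c
    by (auto intro!: ext simp: pw_scale_def)
  define W where "W \<phi> = \<phi> - coboundary T (L \<phi>)" for \<phi>
  have W: "W \<phi> \<in> Gamma_bd T (Suc k)" if "\<phi> \<in> ?V" for \<phi> using S that unfolding W_def lc(2) by blast
  have L_add: "L (\<phi> + \<xi>) = L \<phi> + L \<xi>" if "\<phi> \<in> ?V" "\<xi> \<in> ?V" for \<phi> \<xi>
  proof -
    have "L (\<lambda>a x. 1 * \<phi> a x + 1 * \<xi> a x) = (\<lambda>x. 1 * L \<phi> x + 1 * L \<xi> x)" using S that by blast
    then show ?thesis unfolding lc(1) by (auto intro!: ext)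
  qed
  have L_scale: "L (pw_scale c \<phi>) = fun_scale c (L \<phi>)" if "\<phi> \<in> ?V" for c \<phi>
  proof -
    have "L (\<lambda>a x. c * \<phi> a x + 0 * \<phi> a x) = (\<lambda>x. c * L \<phi> x + 0 * L \<phi> x)" using S that by blast
    then show ?thesis unfolding lc(3) by (auto intro!: ext simp: fun_scale_def)
  qed
  have W_add: "W (\<phi> + \<xi>) = W \<phi> + W \<xi>" if "\<phi> \<in> ?V" "\<xi> \<in> ?V" for \<phi> \<xi>
    unfolding W_def L_add[OF that] by (intro ext) (simp add: coboundary_def)
  have W_scale: "W (pw_scale c \<phi>) = pw_scale c (W \<phi>)" if "\<phi> \<in> ?V" for c \<phi>
    unfolding W_def L_scale[OF that] by (intro ext) (simp add: coboundary_def fun_scale_def pw_scale_def algebra_simps)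
  have G_poly: "g \<in> Gamma_poly T (Suc k)" if "g \<in> ?G" for g using that unfolding Gamma_cob_def by blast
  have G0: "0 \<in> ?G"
  proof -
    have "(0 :: 'a \<Rightarrow> real \<Rightarrow> real) \<in> Gamma_poly T (Suc k)" unfolding Gamma_poly_def by (auto intro!: exI[of _ 0])
    moreover have "(\<lambda>x. 0) \<in> C_on k J"
    proof (induction k)
      case (Suc k)
      have "deriv_on J (\<lambda>x. 0) = (\<lambda>x. 0)"
      proof
        fix x show "deriv_on J (\<lambda>x. 0) x = 0"
        proof (cases "x \<in> J")
          case False
          then show ?thesis by (simp only: deriv_on_def if_False)
        qed (rule deriv_on_eq[OF J_less _ DERIV_const])
      qed
      then show ?case using Suc unfolding C_on_Suc[OF J_less] by simp
    qed (simp add: C_on_def)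
    moreover have "0 = coboundary T (\<lambda>x. 0)" by (intro ext) (simp add: coboundary_def)
    ultimately show ?thesis unfolding Gamma_cob_def closure_int by auto
  qed
  have G_add: "f + g \<in> ?G" if "f \<in> ?G" "g \<in> ?G" for f g
    unfolding lc(1) by (rule Gamma_cob_subspace[OF that])
  have G_diff: "f - g \<in> ?G" if "f \<in> ?G" "g \<in> ?G" for f g
    unfolding lc(2) by (rule Gamma_cob_subspace[OF that])
  have G_scale: "pw_scale c f \<in> ?G" if "f \<in> ?G" for f c
    unfolding lc(3) by (rule Gamma_cob_subspace[OF that that])
  have GG: "?G + ?G = ?G"
  proof
    show "?G + ?G \<subseteq> ?G" using G_add by (auto simp: set_plus_def)
    show "?G \<subseteq> ?G + ?G"
    proof
      fix g assume "g \<in> ?G"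
      from set_plus_intro[OF this G0] show "g \<in> ?G + ?G" by simp
    qed
  qed
  define L1 where "L1 \<phi> = W \<phi> +o ?G" for \<phi>
  have V_CBV: "\<phi> \<in> pw_CBV T (Suc k)" if "\<phi> \<in> ?V" for \<phi> using that unfolding pw_CBV_bd_def by simp
  \<comment> \<open>The remainder is a piecewise polynomial of degree at most k, so only derivatives
    of order up to k count, and these are controlled by the C^k norm of the solution.\<close>
  have W_norm: "?N (W \<phi>) \<le> (real (Suc (Suc k)) * (1 + 2 * K)) * ?N \<phi>" if V: "\<phi> \<in> ?V" for \<phi>
  proof -
    have LC: "L \<phi> \<in> C_on k J" "C_norm k J (L \<phi>) \<le> K * ?N \<phi>" using S V by auto
    have poly: "W \<phi> \<in> Gamma_poly T (Suc k)" by (rule Gamma_bd_poly[OF W[OF V]])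
    define M where "M = ?N \<phi> + 2 * C_norm k J (L \<phi>)"
    have M0: "0 \<le> M" unfolding M_def using pw_norm_nonneg[OF V_CBV[OF V]] C_norm_nonneg[OF J_less LC(1)] by simp
    have "\<bar>(pw_D T ^^ i) (W \<phi>) a x\<bar> \<le> M" if i: "i \<le> Suc k" and x: "x \<in> cl a" for i a x
    proof (cases "i = Suc k")
      case True
      then show ?thesis using M0 Gamma_poly_D_top[OF poly, of a] by simp
    next
      case False
      then have ik: "i \<le> k" using i by simp
      have C: "\<phi> \<in> pw_C T k" "coboundary T (L \<phi>) \<in> pw_C T k"
        using pw_C_mono[OF pw_CBV_C[OF V_CBV[OF V]], of k] cob_C[OF LC(1)] by auto
      have "(pw_D T ^^ i) (W \<phi>) a x = (pw_D T ^^ i) \<phi> a x - ((deriv_on J ^^ i) (L \<phi>) (x + iet_shift T a) - (deriv_on J ^^ i) (L \<phi>) x)"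
        using x unfolding W_def lc(2) pw_D_lincomb[OF C ik] cob_D_pow[OF LC(1) ik] by (simp add: coboundary_def closure_top)
      then show ?thesis
        using pw_norm_bound[OF V_CBV[OF V] i x] C_norm_bound[OF J_less LC(1) ik cl_J[OF x]]
          C_norm_bound[OF J_less LC(1) ik cl_shift_J[OF x]] unfolding M_def by linarith
    qed
    then have "pw_sup i (W \<phi>) \<le> M" if "i \<le> Suc k" for i using that by (intro pw_sup_least)
    then have "(\<Sum>i\<le>Suc k. pw_sup i (W \<phi>)) \<le> (\<Sum>i\<le>Suc k. M)" by (intro sum_mono) simp
    moreover have "total_variation ((pw_D T ^^ Suc k) (W \<phi>) a) (top_int T a) \<le> 0" for a
      unfolding Gamma_poly_D_top[OF poly] total_variation_def
    proof (rule cSup_least)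
      obtain y where "y \<in> top_int T a" using top_int_nonempty[of a] by blast
      from zero_in_variation_sums[OF this] show "variation_sums (\<lambda>x. 0) (top_int T a) \<noteq> {}" by blast
    qed (auto simp: variation_sums_def)
    then have "(\<Sum>a\<in>UNIV. total_variation ((pw_D T ^^ Suc k) (W \<phi>) a) (top_int T a)) \<le> 0" by (intro sum_nonpos)
    ultimately have "?N (W \<phi>) \<le> real (Suc (Suc k)) * M" unfolding pw_norm_eq by simp
    also have "\<dots> \<le> real (Suc (Suc k)) * ((1 + 2 * K) * ?N \<phi>)"
      by (rule mult_left_mono) (use LC(2) in \<open>simp_all add: M_def algebra_simps\<close>)
    finally show ?thesis by (simp only: mult.assoc)
  qed
  have op1: "bounded_linear_op ?V pw_scale ?N (quot_space (Gamma_bd T (Suc k)) ?G) (quot_scale pw_scale ?G) (quot_norm ?N) L1"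
    unfolding bounded_linear_op_def
  proof (intro conjI ballI allI funcsetI exI[of _ "real (Suc (Suc k)) * (1 + 2 * K)"])
    fix \<phi> assume V: "\<phi> \<in> ?V"
    show "L1 \<phi> \<in> quot_space (Gamma_bd T (Suc k)) ?G" unfolding L1_def quot_space_def using W[OF V] by blast
    show "L1 (pw_scale c \<phi>) = quot_scale pw_scale ?G c (L1 \<phi>)" for c
    proof (intro equalityI subsetI)
      fix f assume "f \<in> L1 (pw_scale c \<phi>)"
      then obtain g where g: "g \<in> ?G" "f = pw_scale c (W \<phi>) + g" unfolding L1_def W_scale[OF V] elt_set_plus_def by blast
      have "W \<phi> \<in> W \<phi> +o ?G" using set_plus_intro2[OF G0, of "W \<phi>"] by simp
      then show "f \<in> quot_scale pw_scale ?G c (L1 \<phi>)"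
        unfolding quot_scale_def L1_def g(2) by (intro set_plus_intro imageI g(1))
    next
      fix f assume "f \<in> quot_scale pw_scale ?G c (L1 \<phi>)"
      then obtain g g' where g: "g \<in> ?G" "g' \<in> ?G" "f = pw_scale c (W \<phi> + g) + g'"
        unfolding quot_scale_def L1_def elt_set_plus_def set_plus_def by blast
      have "f = pw_scale c (W \<phi>) + (pw_scale c g + g')" unfolding g(3) by (intro ext) (simp add: pw_scale_def algebra_simps)
      moreover have "pw_scale c g + g' \<in> ?G" by (intro G_add G_scale g)
      ultimately show "f \<in> L1 (pw_scale c \<phi>)" unfolding L1_def W_scale[OF V] using set_plus_intro2 by blast
    qed
    show "L1 (\<phi> + \<xi>) = L1 \<phi> + L1 \<xi>" if "\<xi> \<in> ?V" for \<xi>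
      unfolding L1_def W_add[OF V that] set_plus_rearrange GG ..
    have "quot_norm ?N (L1 \<phi>) \<le> ?N (W \<phi>)"
      unfolding quot_norm_def
    proof (rule cINF_lower)
      show "W \<phi> \<in> L1 \<phi>" using set_plus_intro2[OF G0, of "W \<phi>"] unfolding L1_def by simp
      \<comment> \<open>The norm is known to be nonnegative only inside the function space, so each
        member of the coset has to be recognised as a piecewise polynomial.\<close>
      show "bdd_below (?N ` L1 \<phi>)"
      proof (rule bdd_belowI)
        fix y assume "y \<in> ?N ` L1 \<phi>"
        then obtain f where f: "y = ?N f" "f \<in> W \<phi> +o ?G" unfolding L1_def by (rule imageE)
        from Gamma_poly_lincomb[OF Gamma_bd_poly[OF W[OF V]] G_poly[OF set_plus_imp_minus[OF f(2)]], of 1 1]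
        have "W \<phi> + (f - W \<phi>) \<in> Gamma_poly T (Suc k)" by (simp only: lc(1))
        then have "f \<in> Gamma_poly T (Suc k)" by simp
        then show "0 \<le> y" unfolding f(1) by (intro pw_norm_nonneg Gamma_poly_CBV)
      qed
    qed
    then show "quot_norm ?N (L1 \<phi>) \<le> real (Suc (Suc k)) * (1 + 2 * K) * ?N \<phi>" using W_norm[OF V] by linarith
  qed
  have op0: "bounded_linear_op ?V pw_scale ?N (C_on (Suc k - 1) (closure (iet_int T))) fun_scale
       (C_norm (Suc k - 1) (closure (iet_int T))) L"
    unfolding bounded_linear_op_def closure_int using S L_add L_scale by auto
  have "L1 \<omega> = \<omega> +o ?G" if w: "\<omega> \<in> Gamma_bd T (Suc k)" for \<omega>
  proof -
    have V: "\<omega> \<in> ?V" by (rule Gamma_bd_CBV[OF w])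
    from Gamma_poly_lincomb[OF Gamma_bd_poly[OF w] Gamma_bd_poly[OF W[OF V]], of 1 "-1"] have "\<omega> - W \<omega> \<in> Gamma_poly T (Suc k)" unfolding lc(2) .
    \<comment> \<open>For a piecewise polynomial the remainder differs from it by a coboundary that
      is itself piecewise polynomial, which is zero in the quotient.\<close>
    moreover have cob: "\<omega> - W \<omega> = coboundary T (L \<omega>)" unfolding W_def by simp
    moreover have "L \<omega> \<in> C_on k J" using S V by auto
    ultimately have g: "coboundary T (L \<omega>) \<in> ?G" unfolding Gamma_cob_def closure_int by auto
    have "f - W \<omega> \<in> ?G \<longleftrightarrow> f - \<omega> \<in> ?G" for f
    proof -
      have "(f - \<omega>) + coboundary T (L \<omega>) = f - W \<omega>" "(f - W \<omega>) - coboundary T (L \<omega>) = f - \<omega>"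
        unfolding W_def by (simp_all add: algebra_simps)
      then show ?thesis using G_add[OF _ g, of "f - \<omega>"] G_diff[OF _ g, of "f - W \<omega>"] by metis
    qed
    then show ?thesis unfolding L1_def set_minus_plus by blast
  qed
  then show ?thesis
    using op1 op0 W unfolding W_def[symmetric] L1_def[symmetric]
    by (intro exI[of _ L1] exI[of _ L] conjI ballI) (simp_all add: W_def[symmetric] L1_def[symmetric] del: One_nat_def)
qed

end

section \<open>The case of regularity one\<close>

text \<open>Links the function space to the estimates: the variation functions of the derivative on
  the intervals serve as \<open>g\<close>, and the boundary condition makes the total increment
  vanish.\<close>

lemma (in rauzy_path) cocycle_data_CBV:
  assumes V: "\<phi> \<in> pw_CBV_bd T 1"
  shows "\<exists>g. cocycle_data T \<phi> (pw_D T \<phi>) g \<and> tot g 0 \<le> pw_CBV_norm T 1 \<phi>"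
    and "tot \<phi> 0 = 0"
    and "x \<in> cI 0 b \<Longrightarrow> \<bar>\<phi> b x\<bar> \<le> pw_CBV_norm T 1 \<phi> \<and> \<bar>pw_D T \<phi> b x\<bar> \<le> pw_CBV_norm T 1 \<phi>"
proof -
  note T = good_iet[OF good0]
  have BV: "\<phi> \<in> pw_CBV T (Suc 0)" using V unfolding pw_CBV_bd_def by simp
  note C = pw_CBV_C[OF T BV]
  let ?f = "pw_D T \<phi>"
  have "\<exists>g. (\<forall>x y. tlft T a \<le> x \<longrightarrow> x \<le> y \<longrightarrow> y \<le> tlft T a + iet_len T a \<longrightarrow> \<bar>?f a y - ?f a x\<bar> \<le> g y - g x) \<and>
      g (tlft T a + iet_len T a) - g (tlft T a) \<le> total_variation (?f a) (top_int T a)" for a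
    unfolding top_int_eq[OF T]
  proof (rule variation_function[OF cl_less[OF T]])
    show "continuous_on {tlft T a..tlft T a + iet_len T a} (?f a)"
      using C unfolding pw_C_Suc[OF T] pw_C_iff[OF T] by (simp add: C_on_def pw_D_eq[OF T])
    show "bounded_variation_on (?f a) {tlft T a<..<tlft T a + iet_len T a}"
      using pw_CBV_variation[OF T BV, of a] by (simp add: top_int_eq[OF T])
  qed
  then obtain g where g: "\<And>a x y. tlft T a \<le> x \<Longrightarrow> x \<le> y \<Longrightarrow> y \<le> tlft T a + iet_len T a \<Longrightarrow> \<bar>?f a y - ?f a x\<bar> \<le> g a y - g a x"
      "\<And>a. g a (tlft T a + iet_len T a) - g a (tlft T a) \<le> total_variation (?f a) (top_int T a)"
    by metis
  have "cocycle_data T \<phi> ?f g"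
  proof (rule cocycle_data.intro[OF rauzy_path_axioms], rule cocycle_data_axioms.intro)
    show "(\<phi> a has_real_derivative ?f a x) (at x within cI 0 a)" if "x \<in> cI 0 a" for a x
      using pw_C_D_works[OF T C, of x a] that by (simp add: iter_0)
  qed (use g(1) in \<open>simp add: iter_0\<close>)
  moreover have "tot g 0 \<le> pw_CBV_norm T 1 \<phi>"
  proof -
    have "tot g 0 \<le> (\<Sum>a\<in>UNIV. total_variation (?f a) (top_int T a))"
      unfolding tot_def incr_def SB.simps(1) iter_0 by (rule sum_mono[OF g(2)])
    then show ?thesis using pw_norm_variation[OF T BV] by simp
  qed
  ultimately show "\<exists>g. cocycle_data T \<phi> ?f g \<and> tot g 0 \<le> pw_CBV_norm T 1 \<phi>" by blast
  have "boundary T \<phi> C = 0" if "C \<in> iet_cycles T" for C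
    using V that unfolding pw_CBV_bd_def boundary_zero_upto_def by simp
  from boundary_total[OF T this] show "tot \<phi> 0 = 0"
    unfolding tot_def incr_def SB.simps(1) iter_0 by simp
  show "\<bar>\<phi> b x\<bar> \<le> pw_CBV_norm T 1 \<phi> \<and> \<bar>?f b x\<bar> \<le> pw_CBV_norm T 1 \<phi>" if "x \<in> cI 0 b"
    using pw_norm_bound[OF T BV, of 0 x b] pw_norm_bound[OF T BV, of 1 x b] that by (simp add: iter_0)
qed

lemma (in dc_path) solves_1:
  assumes main: "(4 * real CARD('a) + real CARD('a) * (real CARD('a) - 1) / \<sigma>) * \<eta> < \<theta>"
  shows "\<exists>L K. solves T (Suc 0) L K"
proof -
  note T = good_iet[OF good0]
  let ?V = "pw_CBV_bd T 1" and ?N = "pw_CBV_norm T 1"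
  obtain C r where Cr: "0 < C" "\<And>k. 0 \<le> r k" "summable (\<lambda>k. Z k * r k)" "corrected C r"
    using corrected_exists[OF main] by blast
  have BV: "\<phi> \<in> pw_CBV T (Suc 0)" if "\<phi> \<in> ?V" for \<phi> using that unfolding pw_CBV_bd_def by simp
  have N0: "0 \<le> ?N \<phi>" if "\<phi> \<in> ?V" for \<phi> using pw_norm_nonneg[OF T BV[OF that]] by simp
  have ex: "\<exists>v. norm v \<le> C * ?N \<phi> \<and>
      (\<forall>k b x. x \<in> cI (nk k) b \<longrightarrow> \<bar>SB \<phi> (nk k) b x - (B 0 (nk k) *v v) $ b\<bar> \<le> C * ?N \<phi> * r k)" if V: "\<phi> \<in> ?V" for \<phi>
  \<comment> \<open>\<open>corrected\<close> asks for a positive bound. A function of norm 0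
    vanishes on all the closed intervals, and then v = 0 serves.\<close>
  proof (cases "?N \<phi> = 0")
    case True
    have "SB \<phi> n b x = 0" if x: "x \<in> cI n b" for n b x
    proof -
      have "SB \<phi> n b x = SB (\<lambda>a x. (0 :: real^'a) $ a) n b x"
        by (rule SB_cong[OF _ x]) (use cocycle_data_CBV(3)[OF V] True in fastforce)
      then show ?thesis unfolding SB_const by simp
    qed
    then show ?thesis using True by (intro exI[of _ 0]) simp
  next
    case False
    then have M: "0 < ?N \<phi>" using N0[OF V] by simp
    obtain g where g: "cocycle_data T \<phi> (pw_D T \<phi>) g" "tot g 0 \<le> ?N \<phi>" using cocycle_data_CBV(1)[OF V] by blast
    have "\<forall>b x. x \<in> cI 0 b \<longrightarrow> \<bar>\<phi> b x\<bar> \<le> ?N \<phi> \<and> \<bar>pw_D T \<phi> b x\<bar> \<le> ?N \<phi>"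
      by (intro allI impI cocycle_data_CBV(3)[OF V])
    then show ?thesis
      using Cr(4)[unfolded corrected_def, rule_format, OF g(1) M cocycle_data_CBV(2)[OF V] g(2)] by blast
  qed
  have Vlin: "(\<lambda>a x. c * \<phi> a x + e * \<xi> a x) \<in> ?V" if "\<phi> \<in> ?V" "\<xi> \<in> ?V" for \<phi> \<xi> c e
    by (rule pw_CBV_bd_lincomb[OF T that])
  obtain cor C' where C': "0 < C'"
    and cor_lin: "\<And>\<phi> \<xi> c e. \<phi> \<in> ?V \<Longrightarrow> \<xi> \<in> ?V \<Longrightarrow> cor (\<lambda>a x. c * \<phi> a x + e * \<xi> a x) = c *\<^sub>R cor \<phi> + e *\<^sub>R cor \<xi>"
    and cor: "\<And>\<phi> k b x. \<phi> \<in> ?V \<Longrightarrow> x \<in> cI (nk k) b \<Longrightarrow> \<bar>SB (\<lambda>a x. \<phi> a x - cor \<phi> $ a) (nk k) b x\<bar> \<le> C' * ?N \<phi> * r k"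
    using linear_correction[OF Cr(2) Cr(1) N0 ex Vlin] by blast
  define L where "L \<phi> = sol (\<lambda>a x. \<phi> a x - cor \<phi> $ a)" for \<phi>
  define K where "K = C' * (\<Sum>k. Z k * r k)"
  have SC: "summable_cocycle T (\<lambda>a x. \<phi> a x - cor \<phi> $ a) (\<lambda>k. C' * ?N \<phi> * r k)" if V: "\<phi> \<in> ?V" for \<phi>
  proof (rule summable_cocycle.intro[OF rauzy_path_axioms], rule summable_cocycle_axioms.intro)
    have "continuous_on (cI 0 a) (\<phi> a)" for a
      using pw_CBV_C[OF T BV[OF V]] unfolding pw_C_Suc[OF T] iter_0 by (intro differentiable_imp_continuous_on) blast
    then show "continuous_on (cI 0 a) (\<lambda>x. \<phi> a x - cor \<phi> $ a)" for a by (intro continuous_on_diff continuous_on_const)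
    have "summable (\<lambda>k. C' * ?N \<phi> * (Z k * r k))" by (rule summable_mult[OF Cr(3)])
    then show "summable (\<lambda>k. Z k * (C' * ?N \<phi> * r k))" by (simp only: mult_ac)
  qed (rule cor[OF V])
  note J = closure_int[OF T]
  have main: "L \<phi> \<in> C_on 0 {lt..rt 0} \<and> C_norm 0 {lt..rt 0} (L \<phi>) \<le> K * ?N \<phi> \<and>
      (\<lambda>a x. 1 * \<phi> a x + (-1) * coboundary T (L \<phi>) a x) \<in> Gamma_bd T (Suc 0)" if V: "\<phi> \<in> ?V" for \<phi>
  proof (intro conjI)
    show "L \<phi> \<in> C_on 0 {lt..rt 0}"
      unfolding C_on_def L_def using summable_cocycle.sol_continuous[OF SC[OF V]] lt_less_rt[of 0] by (auto simp: sol_def)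
    have "\<bar>L \<phi> x\<bar> \<le> K * ?N \<phi>" for x
    proof -
      have "\<bar>L \<phi> x\<bar> \<le> (\<Sum>k. Z k * (C' * ?N \<phi> * r k))"
        using summable_cocycle.sol_bound[OF SC[OF V], of x] unfolding summable_cocycle.rem_def[OF SC[OF V]] L_def by simp
      also have "\<dots> = (\<Sum>k. C' * ?N \<phi> * (Z k * r k))" by (simp only: mult_ac)
      also have "\<dots> = K * ?N \<phi>" unfolding suminf_mult[OF Cr(3)] K_def by (simp only: mult_ac)
      finally show ?thesis .
    qed
    then show "C_norm 0 {lt..rt 0} (L \<phi>) \<le> K * ?N \<phi>"
      unfolding C_norm_def using lt_less_rt[of 0] by (auto intro!: cSUP_least)
    let ?w = "\<lambda>a x. 1 * \<phi> a x + (-1) * coboundary T (L \<phi>) a x"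
    \<comment> \<open>What the coboundary leaves of \<phi> is the correction itself, constant on
      each interval and hence a polynomial of degree 0.\<close>
    have w_on: "?w a x = cor \<phi> $ a" if x: "x \<in> {tlft T a..tlft T a + iet_len T a}" for a x
      using summable_cocycle.sol_cocycle[OF SC[OF V], of x a] x
      by (simp add: coboundary_def closure_top[OF T] L_def iter_0)
    have w_off: "?w a x = 0" if x: "x \<notin> {tlft T a..tlft T a + iet_len T a}" for a x
    proof -
      have "\<phi> a x = 0" using pw_CBV_C[OF T BV[OF V]] x unfolding pw_C_Suc[OF T] by blast
      then show ?thesis using cob_off[OF T x] by simp
    qed
    have "?w \<in> Gamma_poly T (Suc 0)"
      unfolding Gamma_poly_def closure_top[OF T]
    proof (intro CollectI allI conjI impI)
      fix a show "\<exists>p. (p = 0 \<or> degree p < Suc 0) \<and> (\<forall>x\<in>{tlft T a..tlft T a + iet_len T a}. ?w a x = poly p x)"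
        using w_on by (intro exI[of _ "[:cor \<phi> $ a:]"]) simp
    qed (rule w_off)
    moreover have "boundary_zero_upto T (Suc 0) ?w"
      unfolding boundary_zero_Suc[OF T] boundary_lincomb[of T 1 _ "-1"]
    proof (intro conjI ballI)
      fix D assume D: "D \<in> iet_cycles T"
      have "boundary T \<phi> D = 0" using V D unfolding pw_CBV_bd_def boundary_zero_upto_def by simp
      then show "1 * boundary T \<phi> D + (-1) * boundary T (coboundary T (L \<phi>)) D = 0" using boundary_cob[OF T D] by simp
    qed (simp add: boundary_zero_upto_def)
    ultimately show "?w \<in> Gamma_bd T (Suc 0)" unfolding Gamma_bd_def by blast
  qed
  have lin: "L (\<lambda>a x. c * \<phi> a x + e * \<xi> a x) = (\<lambda>x. c * L \<phi> x + e * L \<xi> x)" if V: "\<phi> \<in> ?V" "\<xi> \<in> ?V" for \<phi> \<xi> c e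
  proof
    fix x
    have "(\<lambda>a x. c * \<phi> a x + e * \<xi> a x - cor (\<lambda>a x. c * \<phi> a x + e * \<xi> a x) $ a)
      = (\<lambda>a x. c * (\<phi> a x - cor \<phi> $ a) + e * (\<xi> a x - cor \<xi> $ a))"
      unfolding cor_lin[OF V] by (intro ext) (simp add: algebra_simps)
    then show "L (\<lambda>a x. c * \<phi> a x + e * \<xi> a x) x = c * L \<phi> x + e * L \<xi> x"
      unfolding L_def using sol_lincomb[OF SC[OF V(1)] SC[OF V(2)]] by simp
  qed
  have "solves T (Suc 0) L K"
    unfolding solves_def[OF T] using main lin by (simp add: iter_0)
  then show ?thesis by blast
qed

theorem theorem3p1:
  fixes T :: "'a::finite iet" and \<eta> \<theta> \<sigma> :: real and r :: nat
  assumes "2 \<le> CARD('a)"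
    and "is_iet T"
    and "iet_irreducible T"
    and "no_connections T"
    and "0 \<le> \<eta>" and "0 < \<theta>" and "0 < \<sigma>"
    and "in_DC \<eta> \<theta> \<sigma> T"
    and "(4 * real CARD('a) + real CARD('a) * (real CARD('a) - 1) / \<sigma>) * \<eta> < \<theta>"
    and "1 \<le> r"
  shows "\<exists>(L1 :: ('a \<Rightarrow> real \<Rightarrow> real) \<Rightarrow> ('a \<Rightarrow> real \<Rightarrow> real) set)
           (L0 :: ('a \<Rightarrow> real \<Rightarrow> real) \<Rightarrow> real \<Rightarrow> real).
     bounded_linear_op (pw_CBV_bd T r) pw_scale (pw_CBV_norm T r)
       (quot_space (Gamma_bd T r) (Gamma_cob T r))
       (quot_scale pw_scale (Gamma_cob T r))
       (quot_norm (pw_CBV_norm T r)) L1 \<and>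
     bounded_linear_op (pw_CBV_bd T r) pw_scale (pw_CBV_norm T r)
       (C_on (r - 1) (closure (iet_int T))) fun_scale
       (C_norm (r - 1) (closure (iet_int T))) L0 \<and>
     (\<forall>\<omega>\<in>Gamma_bd T r. L1 \<omega> = \<omega> +o Gamma_cob T r) \<and>
     (\<forall>\<phi>\<in>pw_CBV_bd T r.
        \<phi> - coboundary T (L0 \<phi>) \<in> Gamma_bd T r \<and>
        L1 \<phi> = (\<phi> - coboundary T (L0 \<phi>)) +o Gamma_cob T r)"
proof -
  have "no_common_initial (iet_top T) (iet_bot T)"
    using top_positions[OF assms(2)] bot_positions[OF assms(2)] assms(3)
    by (intro no_common_initialI) (auto simp: iet_irreducible_def)
  then have "rv_good T" using assms(1,2) no_connections_imp[OF assms(2,4)] by (simp add: rv_good_def)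
  then interpret dc_path T \<eta> \<theta> \<sigma> using assms(5-8) by unfold_locales
  obtain k where k: "r = Suc k" using assms(10) by (cases r) auto
  have "\<exists>L K. solves T (Suc k) L K"
  proof (induction k)
    case 0
    show ?case by (rule solves_1[OF assms(9)])
  next
    case (Suc k)
    then show ?case using solves_Suc[OF assms(2)] by blast
  qed
  then obtain L K where "solves T (Suc k) L K" by blast
  from operators_exist[OF assms(2) this] show ?thesis unfolding k .
qed

end
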